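(* Let $D\subset\mathbb{R}^d$ be a bounded domain satisfying conditions (D.1)–(D.3) of the context, with reflection-direction sets $\nu(x)$, $x\in\partial D$. Let $\sigma=(\sigma_{ij})\in C^1(\bar D;\mathbb{R}^d\otimes\mathbb{R}^m)$ have Lipschitz continuous derivative $\sigma'$, and let $b:\bar D\to\mathbb{R}^d$ be Lipschitz continuous. Let $W$ be an $m$-dimensional Brownian motion, $W^n$ its dyadic piecewise linear interpolation defined in the context, $x_0\in\bar D$, let $(X,L)$ be the solution of the reflected Stratonovich SDE and $(X^n,L^n)$ the solution of the reflected random ODE driven by $W^n$ (both defined in the context). Then for every $p>0$ and $T>0$, $$\lim_{n\to\infty}E\Big[\sup_{0\le t\le T}|X^n(t)-X(t)|^p\Big]=0.$$
   Context: For $x\in\partial D$, $\nu(x)\subset S^{d-1}$ is a nonempty set of reflecting directions, and the following hold. (D.1) There is $C_0\ge 0$ with $(x'-x)\cdot\nu+C_0|x-x'|^2\ge 0$ for all $x'\in D$, $x\in\partial D$, $\nu\in\nu(x)$. (D.2) There are $\phi\in C^2(\mathbb{R}^d;\mathbb{R})$ and $\alpha>0$ with $\nabla\phi(x)\cdot\nu\ge\alpha$ for all $x\in\partial D$, $\nu\in\nu(x)$. (D.3) There exist $N\ge1$, $\lambda>0$, $K>0$, $a_1,\dots,a_N\in S^{d-1}$ and $x_1,\dots,x_N\in\partial D$ such that $\partial D\subset\bigcup_{i=1}^N B(x_i,K)$ and, for each $i$, $x\in\partial D\cap B(x_i,2K)$ implies $\nu\cdot a_i\ge\lambda$ for all $\nu\in\nu(x)$.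 $W=(W_1,\dots,W_m)$ is an $m$-dimensional Brownian motion on a complete filtered probability space $(\Omega,\mathcal F,\mathcal F_t,P)$; any function $G$ on $[0,\infty)$ is extended by $G(s)=G(s\vee 0)$. For $n\in\mathbb N$ and $t\in[k2^{-n},(k+1)2^{-n})$, $k=0,1,2,\dots$, set $W^n(t)=W((k-1)2^{-n})+2^n(t-k2^{-n})\big(W(k2^{-n})-W((k-1)2^{-n})\big)$. Define $\sigma\sigma':\bar D\to\mathbb{R}^d$ by $(\sigma\sigma'(y))_i=\sum_{j=1}^m\sum_{k=1}^d\frac{\partial\sigma_{ij}(y)}{\partial y_k}\sigma_{kj}(y)$. A solution of the reflected SDE $dX=\sigma(X)\circ dW+b(X)dt+dL$, $X(0)=x_0$, is a pair $(X,L)$ of adapted continuous $\bar D\times\mathbb{R}^d$-valued processes such that $L$ has bounded variation on finite intervals, $X(t)=x_0+\int_0^t\sigma(X(s))dW(s)+\frac12\int_0^t\sigma\sigma'(X(s))ds+\int_0^tb(X(s))ds+L(t)$ a.s. for all $t\ge0$ (Itô integral), $|L|(t)=\int_0^tI_{\partial D}(X(s))\,d|L|(s)$ and $\frac{dL}{d|L|}(t)\in\nu(X(t))$, where $|L|(t)$ is the total variation of $L$ on $[0,t]$. The pair $(X^n,L^n)$ is the analogous solution (pathwise) of $\dot X^n(t)=\sigma(X^n(t))\dot W^n(t)+b(X^n(t))+\dot L^n(t)$, $X^n(0)=x_0$, $X^n(t)\in\bar D$, with $|L^n|(t)=\int_0^tI_{\partial D}(X^n(s))\,d|L^n|(s)$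 and $\frac{dL^n}{d|L^n|}(t)\in\nu(X^n(t))$. (Under these assumptions $X$ and $X^n$ exist and are unique.) *)

theory Defs
  imports "HOL-Analysis.Analysis" "HOL-Probability.Probability"
begin

definition complete_filtered_prob_space :: "'a measure \<Rightarrow> (real \<Rightarrow> 'a measure) \<Rightarrow> bool" where
  "complete_filtered_prob_space M F \<longleftrightarrow>
     prob_space M \<and> complete_measure M \<and> filtration (space M) F \<and>
     (\<forall>t. sets (F t) \<subseteq> sets M) \<and> null_sets M \<subseteq> sets (F 0)"

definition brownian_motion :: "'a measure \<Rightarrow> (real \<Rightarrow> 'a measure) \<Rightarrow> (real \<Rightarrow> 'a \<Rightarrow> real^'m) \<Rightarrow> bool" where
  "brownian_motion M F W \<longleftrightarrow>
     (\<forall>t. W t \<in> borel_measurable (F t)) \<and>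
     (AE \<omega> in M. W 0 \<omega> = 0 \<and> continuous_on {0..} (\<lambda>t. W t \<omega>)) \<and>
     (\<forall>s t. 0 \<le> s \<longrightarrow> s < t \<longrightarrow>
        prob_space.indep_set M (sets (F s))
           (sets (vimage_algebra (space M) (\<lambda>\<omega>. W t \<omega> - W s \<omega>) borel)) \<and>
        prob_space.indep_vars M (\<lambda>_. borel) (\<lambda>j \<omega>. (W t \<omega> - W s \<omega>) $ j) UNIV \<and>
        (\<forall>j. distributed M lborel (\<lambda>\<omega>. (W t \<omega> - W s \<omega>) $ j) (normal_density 0 (sqrt (t - s)))))"

text \<open>Functions on [0,\<infinity>) are extended by G(s) = G(max s 0).  For t in [k 2^-n, (k+1) 2^-n):
  W^n(t) = W((k-1)2^-n) + 2^n (t - k 2^-n) (W(k 2^-n) - W((k-1) 2^-n)).\<close>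

definition interp_W :: "(real \<Rightarrow> 'a \<Rightarrow> real^'m) \<Rightarrow> nat \<Rightarrow> real \<Rightarrow> 'a \<Rightarrow> real^'m" where
  "interp_W W n t \<omega> =
     (let k = real_of_int \<lfloor>max t 0 * 2 ^ n\<rfloor>;
          a = W (max 0 ((k - 1) / 2 ^ n)) \<omega>;
          c = W (max 0 (k / 2 ^ n)) \<omega>
      in a + (2 ^ n * (t - k / 2 ^ n)) *\<^sub>R (c - a))"

definition sigsig :: "(real^'d \<Rightarrow> real^'m^'d) \<Rightarrow> (real^'d \<Rightarrow> real^'d \<Rightarrow> real^'m^'d) \<Rightarrow> real^'d \<Rightarrow> real^'d" where
  "sigsig \<sigma> \<sigma>' y = (\<chi> i. \<Sum>j\<in>UNIV. \<Sum>k\<in>UNIV. (\<sigma>' y (axis k 1)) $ i $ j * \<sigma> y $ k $ j)"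

definition var_sums :: "(real \<Rightarrow> 'b::real_normed_vector) \<Rightarrow> real \<Rightarrow> real \<Rightarrow> real set" where
  "var_sums l a b = {(\<Sum>i<length ps - 1. norm (l (ps ! Suc i) - l (ps ! i))) | ps.
                        sorted ps \<and> set ps \<subseteq> {a..b}}"

definition bounded_variation_on :: "(real \<Rightarrow> 'b::real_normed_vector) \<Rightarrow> real \<Rightarrow> real \<Rightarrow> bool" where
  "bounded_variation_on l a b \<longleftrightarrow> bdd_above (var_sums l a b)"

definition total_variation :: "(real \<Rightarrow> 'b::real_normed_vector) \<Rightarrow> real \<Rightarrow> real \<Rightarrow> real" where
  "total_variation l a b = Sup (var_sums l a b)"

text \<open>|l|(t) = total variation of l on [0,t] (and 0 for t<0); d|l| is the Lebesgue-Stieltjes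
  measure of |l|.  The conditions say: l has bounded variation on finite intervals,
  l(t) = \<integral>_[0,t] \<gamma> d|l| where \<gamma> = dl/d|l| \<in> \<nu>(x(s)) d|l|-a.e., and
  |l|(t) = \<integral>_[0,t] 1_{\<partial>D}(x(s)) d|l|(s).\<close>

definition reflection_term ::
  "(real^'d) set \<Rightarrow> (real^'d \<Rightarrow> (real^'d) set) \<Rightarrow> (real \<Rightarrow> real^'d) \<Rightarrow> (real \<Rightarrow> real^'d) \<Rightarrow> bool" where
  "reflection_term D \<nu> x l \<longleftrightarrow>
     (\<forall>t\<ge>0. bounded_variation_on l 0 t) \<and>
     (let tv = (\<lambda>t. total_variation l 0 t) in
       \<exists>\<gamma>::real \<Rightarrow> real^'d. \<gamma> \<in> borel_measurable borel \<and>
          (AE s in interval_measure tv. 0 \<le> s \<longrightarrow> \<gamma> s \<in> \<nu> (x s)) \<and>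
          (\<forall>t\<ge>0. l t = (LINT s:{0..t}|interval_measure tv. \<gamma> s)) \<and>
          (\<forall>t\<ge>0. tv t = (LINT s:{0..t}|interval_measure tv. indicator (frontier D) (x s))))"

text \<open>For continuous adapted integrands the Ito integral is the limit in probability of the
  left-point Riemann sums along dyadic partitions.\<close>

definition ito_sum :: "(real \<Rightarrow> 'a \<Rightarrow> real^'m) \<Rightarrow> (real \<Rightarrow> 'a \<Rightarrow> real^'m^'d) \<Rightarrow> nat \<Rightarrow> real \<Rightarrow> 'a \<Rightarrow> real^'d" where
  "ito_sum W f n t \<omega> =
     (\<Sum>k<nat \<lceil>t * 2 ^ n\<rceil>. f (real k / 2 ^ n) \<omega> *v
        (W (min t (real (Suc k) / 2 ^ n)) \<omega> - W (real k / 2 ^ n) \<omega>))"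

definition is_ito_integral :: "'a measure \<Rightarrow> (real \<Rightarrow> 'a \<Rightarrow> real^'m) \<Rightarrow> (real \<Rightarrow> 'a \<Rightarrow> real^'m^'d) \<Rightarrow> (real \<Rightarrow> 'a \<Rightarrow> real^'d) \<Rightarrow> bool" where
  "is_ito_integral M W f I \<longleftrightarrow>
     (\<forall>t\<ge>0. I t \<in> borel_measurable M \<and>
        (\<forall>e>0. (\<lambda>n. measure M {\<omega>\<in>space M. e < norm (ito_sum W f n t \<omega> - I t \<omega>)}) \<longlonglongrightarrow> 0))"

definition reflected_sde_solution ::
  "'a measure \<Rightarrow> (real \<Rightarrow> 'a measure) \<Rightarrow> (real \<Rightarrow> 'a \<Rightarrow> real^'m) \<Rightarrow> (real^'d) set \<Rightarrow> (real^'d \<Rightarrow> (real^'d) set) \<Rightarrow>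
   (real^'d \<Rightarrow> real^'m^'d) \<Rightarrow> (real^'d \<Rightarrow> real^'d \<Rightarrow> real^'m^'d) \<Rightarrow> (real^'d \<Rightarrow> real^'d) \<Rightarrow> real^'d \<Rightarrow>
   (real \<Rightarrow> 'a \<Rightarrow> real^'d) \<Rightarrow> (real \<Rightarrow> 'a \<Rightarrow> real^'d) \<Rightarrow> bool" where
  "reflected_sde_solution M F W D \<nu> \<sigma> \<sigma>' b x0 X L \<longleftrightarrow>
     (\<forall>t. X t \<in> borel_measurable (F t) \<and> L t \<in> borel_measurable (F t)) \<and>
     (AE \<omega> in M. continuous_on {0..} (\<lambda>t. X t \<omega>) \<and> continuous_on {0..} (\<lambda>t. L t \<omega>) \<and>
        (\<forall>t\<ge>0. X t \<omega> \<in> closure D) \<and> reflection_term D \<nu> (\<lambda>t. X t \<omega>) (\<lambda>t. L t \<omega>)) \<and>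
     (\<exists>I. is_ito_integral M W (\<lambda>s \<omega>. \<sigma> (X s \<omega>)) I \<and>
        (\<forall>t\<ge>0. AE \<omega> in M. X t \<omega> = x0 + I t \<omega>
            + (1/2) *\<^sub>R integral {0..t} (\<lambda>s. sigsig \<sigma> \<sigma>' (X s \<omega>))
            + integral {0..t} (\<lambda>s. b (X s \<omega>)) + L t \<omega>))"

definition reflected_ode_solution ::
  "'a measure \<Rightarrow> (real \<Rightarrow> 'a measure) \<Rightarrow> (real \<Rightarrow> 'a \<Rightarrow> real^'m) \<Rightarrow> nat \<Rightarrow> (real^'d) set \<Rightarrow> (real^'d \<Rightarrow> (real^'d) set) \<Rightarrow>
   (real^'d \<Rightarrow> real^'m^'d) \<Rightarrow> (real^'d \<Rightarrow> real^'d) \<Rightarrow> real^'d \<Rightarrow>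
   (real \<Rightarrow> 'a \<Rightarrow> real^'d) \<Rightarrow> (real \<Rightarrow> 'a \<Rightarrow> real^'d) \<Rightarrow> bool" where
  "reflected_ode_solution M F W n D \<nu> \<sigma> b x0 Xpn Lpn \<longleftrightarrow>
     (\<forall>t. Xpn t \<in> borel_measurable (F t) \<and> Lpn t \<in> borel_measurable (F t)) \<and>
     (AE \<omega> in M. continuous_on {0..} (\<lambda>t. Xpn t \<omega>) \<and> continuous_on {0..} (\<lambda>t. Lpn t \<omega>) \<and>
        (\<forall>t\<ge>0. Xpn t \<omega> \<in> closure D) \<and> reflection_term D \<nu> (\<lambda>t. Xpn t \<omega>) (\<lambda>t. Lpn t \<omega>) \<and>
        (\<forall>t\<ge>0. Xpn t \<omega> = x0
            + integral {0..t} (\<lambda>s. \<sigma> (Xpn s \<omega>) *v vector_derivative (\<lambda>r. interp_W W n r \<omega>) (at s))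
            + integral {0..t} (\<lambda>s. b (Xpn s \<omega>)) + Lpn t \<omega>))"

end

theory Submission
  imports Defs
begin

text \<open>
  Write \<open>y\<^sub>k = X\<^sup>n(t\<^sub>k)\<close>, \<open>v\<^sub>k = X(t\<^sub>k)\<close> on the dyadic grid \<open>t\<^sub>k = k/2\<^sup>n\<close>. On
  \<open>[t\<^sub>k, t\<^sub>k\<^sub>+\<^sub>1]\<close> the path \<open>X\<^sup>n\<close> is driven by the Brownian increment \<open>w\<close> of the \<^emph>\<open>preceding\<close> interval, so
  up to drift and reflection its next value is \<open>U(y\<^sub>k, w) = y\<^sub>k + \<sigma>(y\<^sub>k) w + \<sigma>'(y\<^sub>k)(\<sigma>(y\<^sub>k) w) w / 2\<close>, which is
  already known at time \<open>t\<^sub>k\<close>. Compare it with an Euler approximation of \<open>v\<^sub>k\<close>: the difference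
  \<open>z\<^sub>k\<close> is adapted, and the increment of \<open>|z\<^sub>k|\<^sup>2\<close> is a mean-zero quadratic polynomial in the new
  Brownian increment (this is where the Stratonovich correction enters) plus a drift of order
  \<open>|z\<^sub>k|\<^sup>2\<close> plus reflection terms. By (D.1) the latter are at most a multiple of
  \<open>|z\<^sub>k|\<^sup>2\<close> times the variations of \<open>L\<close> and \<open>L\<^sup>n\<close>, up to a small error, and by (D.2) over a short step these
  variations are comparable to the norms of the increments of \<open>L\<close> and \<open>L\<^sup>n\<close>, which are adapted.
  The weight \<open>exp (- c \<Sum> (|\<Delta>L| + |\<Delta>L\<^sup>n|) - c t\<^sub>k)\<close> therefore absorbs drift and reflection, and the weighted
  squared distance is dominated by a martingale plus an error that vanishes in probability;
  stopping gives a maximal inequality for it. The total variations stay bounded in probability: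
  (D.2) bounds them by the remaining terms of the equation for \<open>\<phi>\<close> along the path. Condition (D.3) only serves to connect nearby points of
  \<open>D\<close> by short polygons, which yields Taylor's formula for \<open>\<sigma>\<close> on the closure of \<open>D\<close>. Since
  \<open>D\<close> is bounded, convergence in probability implies convergence of all moments.
\<close>

section \<open>Taylor's formula on the closure of the domain\<close>

text \<open>Comparing y_k with v_k themselves would fail: the noise that moves X on one interval
  moves X^n only on the next, so in each step the increments differ by a term of order 2^(-n/2) that
  does not shrink with the distance. Advancing X^n by the missing interval, from y_k to U(y_k, w),
  lets both paths receive the same new increment, with coefficients that are close when the paths
  are close. These coefficients must be known at t_k. But X^n(t_(k+1)) is given only as adapted at
  t_(k+1); hence \<open>\<sigma>\<close> there is replaced by its first-order expansion
  \<open>Shat\<close>, and the second-order term is evaluated at y_k. Total variations are suprema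
  over all partitions and are never shown measurable. Therefore the weight uses norms of increments,
  and statements in probability are phrased through events that cover the bad set; outside such an
  event the argument is pathwise. No rate is sought: each error of a step is a modulus of continuity
  times a quantity whose sum over the grid is bounded in probability.\<close>

lemma move_along_cone_stays_in_domain:
  fixes D :: "'a::euclidean_space set"
  assumes "open D" "C0 \<ge> 0"
    and D1: "\<forall>x'\<in>D. \<forall>x\<in>frontier D. \<forall>v\<in>\<nu> x. (x' - x) \<bullet> v + C0 * (norm (x - x'))^2 \<ge> 0"
    and nu: "\<forall>x\<in>frontier D. \<nu> x \<noteq> {} \<and> (\<forall>v\<in>\<nu> x. norm v = 1)"
    and cone: "\<forall>x\<in>frontier D \<inter> ball c R. \<forall>v\<in>\<nu> x. v \<bullet> a \<ge> lam"
    and lam: "lam > 0" and a: "norm a = 1" and u: "norm (u - a) \<le> lam / 2"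
    and y: "y \<in> D" and s: "s \<ge> 0" "C0 * s * (1 + lam / 2)^2 < lam / 2"
    and ball: "\<And>r. 0 \<le> r \<Longrightarrow> r \<le> s \<Longrightarrow> y + r *\<^sub>R u \<in> ball c R"
  shows "y + s *\<^sub>R u \<in> D"
proof (rule ccontr)
  assume nin: "y + s *\<^sub>R u \<notin> D"
  let ?S = "closed_segment y (y + s *\<^sub>R u)"
  have "?S \<inter> frontier D \<noteq> {}"
    by (rule connected_Int_frontier) (use y nin in auto)
  then obtain z where z: "z \<in> ?S" "z \<in> frontier D" by blast
  then obtain t where t: "0 \<le> t" "t \<le> 1" "z = (1 - t) *\<^sub>R y + t *\<^sub>R (y + s *\<^sub>R u)"
    by (auto simp: in_segment)
  define r where "r = t * s"
  have zr: "z = y + r *\<^sub>R u" using t(3) by (simp add: r_def algebra_simps)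
  have r: "0 \<le> r" "r \<le> s" using t s by (auto simp: r_def intro: mult_left_le_one_le)
  obtain v where v: "v \<in> \<nu> z" using nu z by blast
  have va: "v \<bullet> a \<ge> lam" using cone v z ball[OF r] zr by blast
  have nv: "norm v = 1" using nu v z by blast
  have "\<bar>v \<bullet> (u - a)\<bar> \<le> lam / 2"
    using Cauchy_Schwarz_ineq2[of v "u - a"] nv u by simp
  then have "v \<bullet> u - v \<bullet> a \<ge> - (lam / 2)" by (simp only: inner_diff_right abs_le_iff) linarith
  then have uv: "u \<bullet> v \<ge> lam / 2" using va by (simp add: inner_commute[of u])
  have nu1: "norm u \<le> 1 + lam / 2" using norm_triangle_ineq[of a "u - a"] a u by simp
  \<comment> \<open>(D.1) at the crossing point \<open>z\<close> is tested against the starting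
    point \<open>y\<close> itself. It bounds \<open>r * (u \<bullet> v)\<close> by a term quadratic
    in \<open>r\<close>, while the cone condition keeps \<open>u \<bullet> v\<close> at least
    \<open>lam / 2\<close>; for a short move the two are incompatible, so the boundary is never
    met.\<close>
  have "(y - z) \<bullet> v + C0 * (norm (z - y))^2 \<ge> 0" using D1 y z v by blast
  then have ineq: "r * (u \<bullet> v) \<le> C0 * r^2 * (norm u)^2"
    by (simp add: zr power_mult_distrib)
  show False
  proof (cases "r = 0")
    case True
    then show False using z zr y \<open>open D\<close> frontier_disjoint_eq by auto
  next
    case False
    then have rp: "r > 0" using r by simp
    have "r * (u \<bullet> v) \<le> r * (C0 * r * (norm u)^2)" using ineq by (simp add: power2_eq_square mult_ac)
    then have "u \<bullet> v \<le> C0 * r * (norm u)^2" using rp by (rule mult_left_le_imp_le)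
    also have "\<dots> \<le> C0 * s * (1 + lam / 2)^2"
      using r nu1 \<open>C0 \<ge> 0\<close> s by (intro mult_mono power_mono) auto
    finally show False using uv s by linarith
  qed
qed


text \<open>The straight segment between two points near the boundary may leave \<open>D\<close>.
  Both points are first pushed along a common direction \<open>a i\<close> by a multiple of their
  distance; every point of the shifted segment is then reached from \<open>y\<close> by one move in
  a direction close to \<open>a i\<close>, so the cone lemma applies to it.\<close>

lemma short_chain_in_domain:
  fixes D :: "'a::euclidean_space set"
  assumes "open D" "C0 \<ge> 0"
    and D1: "\<forall>x'\<in>D. \<forall>x\<in>frontier D. \<forall>v\<in>\<nu> x. (x' - x) \<bullet> v + C0 * (norm (x - x'))^2 \<ge> 0"
    and nu: "\<forall>x\<in>frontier D. \<nu> x \<noteq> {} \<and> (\<forall>v\<in>\<nu> x. norm v = 1)"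
    and lam: "lam > 0" and K: "K > 0"
    and a: "\<forall>i<N. norm (a i) = 1"
    and cover: "frontier D \<subseteq> (\<Union>i<N. ball (xs i) K)"
    and cone: "\<forall>i<N. \<forall>x\<in>frontier D \<inter> ball (xs i) (2 * K). \<forall>v\<in>\<nu> x. v \<bullet> a i \<ge> lam"
  obtains \<rho> C where "\<rho> > 0" "C \<ge> 1"
    "\<And>y z. y \<in> D \<Longrightarrow> z \<in> D \<Longrightarrow> dist y z < \<rho> \<Longrightarrow>
       \<exists>y' z'. closed_segment y y' \<subseteq> D \<and> closed_segment y' z' \<subseteq> D \<and> closed_segment z' z \<subseteq> D \<and>
             dist y y' \<le> C * dist y z \<and> dist y' z' \<le> C * dist y z \<and> dist z' z \<le> C * dist y z"
proof -
  \<comment> \<open>The first bound keeps the quadratic term of the cone lemma at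
    \<open>lam / 4\<close>, half of what is allowed, with \<open>C0 + 1\<close> in place of
    \<open>C0\<close> to avoid a zero divisor. The second keeps a move within distance
    \<open>K / 4\<close>, hence inside the ball of radius \<open>2 * K\<close>.\<close>
  define s0 where "s0 = min (lam / (4 * (C0 + 1) * (1 + lam / 2)^2)) (K / (4 * (1 + lam / 2)))"
  have s0: "s0 > 0" using lam K \<open>C0 \<ge> 0\<close> by (auto simp: s0_def)
  have s0a: "C0 * s * (1 + lam / 2)^2 < lam / 2" if "0 \<le> s" "s \<le> s0" for s
  proof -
    have p: "(1 + lam / 2)^2 > 0" using lam by (simp add: power2_eq_square add_pos_pos)
    have "C0 * s * (1 + lam / 2)^2 \<le> (C0 + 1) * s * (1 + lam / 2)^2"
      using that lam p by (intro mult_right_mono) auto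
    also have "\<dots> \<le> (C0 + 1) * (lam / (4 * (C0 + 1) * (1 + lam / 2)^2)) * (1 + lam / 2)^2"
      using that \<open>C0 \<ge> 0\<close> p by (intro mult_right_mono mult_left_mono) (auto simp: s0_def)
    also have "\<dots> = lam / 4"
    proof -
      have "c * (lam / (4 * c * d)) * d = lam / 4" if "c > 0" "d > 0" for c d :: real
        using that by simp
      from this[OF _ p, of "C0 + 1"] show ?thesis using \<open>C0 \<ge> 0\<close> by linarith
    qed
    finally show ?thesis using lam by linarith
  qed
  have s0b: "s * (1 + lam / 2) \<le> K / 4" if "s \<le> s0" for s
  proof -
    have "s \<le> K / (4 * (1 + lam / 2))" using that by (simp add: s0_def)
    then show ?thesis using lam by (simp add: field_simps)
  qed
  define \<rho> where "\<rho> = min (K / 4) (lam * s0 / 2)"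
  define C where "C = max 1 (2 / lam)"
  have rho: "\<rho> > 0" using K lam s0 by (simp add: \<rho>_def)
  have "\<exists>y' z'. closed_segment y y' \<subseteq> D \<and> closed_segment y' z' \<subseteq> D \<and> closed_segment z' z \<subseteq> D \<and>
             dist y y' \<le> C * dist y z \<and> dist y' z' \<le> C * dist y z \<and> dist z' z \<le> C * dist y z"
    if y: "y \<in> D" and z: "z \<in> D" and d: "dist y z < \<rho>" for y z
  proof (cases "\<exists>p\<in>frontier D. dist y p < K / 4")
    case False
    have "ball y (K / 4) \<subseteq> D"
    proof (rule ccontr)
      assume "\<not> ball y (K / 4) \<subseteq> D"
      then have "ball y (K / 4) \<inter> frontier D \<noteq> {}"
      proof (intro connected_Int_frontier)
        show "ball y (K / 4) \<inter> D \<noteq> {}" using K y by (metis IntI centre_in_ball empty_iff zero_less_divide_iff zero_less_numeral)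
        show "ball y (K / 4) - D \<noteq> {}" using \<open>\<not> ball y (K / 4) \<subseteq> D\<close> by auto
      qed simp
      then show False using False by auto
    qed
    moreover have "closed_segment y z \<subseteq> ball y (K / 4)"
      using d K by (intro closed_segment_subset) (auto simp: \<rho>_def)
    ultimately have "closed_segment y z \<subseteq> D" by blast
    then show ?thesis using y z lam C_def by (intro exI[of _ y] exI[of _ z]) (auto simp: max_def mult_le_cancel_right1)
  next
    case True
    then obtain p where p: "p \<in> frontier D" "dist y p < K / 4" by blast
    then obtain i where i: "i < N" "dist (xs i) p < K" using cover by auto
    define A where "A = a i"
    have A: "norm A = 1" using a i A_def by blast
    have coneA: "\<forall>x\<in>frontier D \<inter> ball (xs i) (2 * K). \<forall>v\<in>\<nu> x. v \<bullet> A \<ge> lam"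
      using cone i A_def by blast
    define \<delta> where "\<delta> = dist y z"
    \<comment> \<open>With this shift the direction from \<open>y\<close> to a point of the shifted
      segment deviates from \<open>A\<close> by at most \<open>\<delta> / \<tau> = lam / 2\<close>
      when \<open>\<delta> > 0\<close>, the largest deviation that the cone lemma permits.\<close>
    define \<tau> where "\<tau> = 2 * \<delta> / lam"
    have tau: "0 \<le> \<tau>" "\<tau> \<le> s0" using d lam by (auto simp: \<tau>_def \<delta>_def \<rho>_def field_simps)
    have dy: "dist (xs i) y < 5 * K / 4" using p i dist_triangle[of "xs i" y p] by (simp add: dist_commute)
    have dz: "dist (xs i) z < 3 * K / 2" using dy d dist_triangle[of "xs i" z y] by (simp add: \<rho>_def)
    have move: "q + s *\<^sub>R u \<in> D" if q: "q \<in> D" "dist (xs i) q < 3 * K / 2" and s: "0 \<le> s" "s \<le> \<tau>"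
      and u: "norm (u - A) \<le> lam / 2" for q s u
    proof (rule move_along_cone_stays_in_domain[OF assms(1,2) D1 nu coneA lam A u q(1) s(1)])
      show "C0 * s * (1 + lam / 2)^2 < lam / 2" using s tau by (intro s0a) auto
      fix r assume r: "0 \<le> r" "r \<le> s"
      have "norm u \<le> 1 + lam / 2" using norm_triangle_ineq[of A "u - A"] A u by simp
      then have "r * norm u \<le> s0 * (1 + lam / 2)" using r s tau by (intro mult_mono) auto
      then have "dist q (q + r *\<^sub>R u) \<le> K / 4" using s0b[of s0] r by (simp add: dist_norm)
      then have "dist (xs i) (q + r *\<^sub>R u) < 2 * K"
        using dist_triangle[of "xs i" "q + r *\<^sub>R u" q] q K by linarith
      then show "q + r *\<^sub>R u \<in> ball (xs i) (2 * K)" by simp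
    qed
    have seg: "closed_segment q (q + \<tau> *\<^sub>R A) \<subseteq> D" if "q \<in> D" "dist (xs i) q < 3 * K / 2" for q
    proof
      fix x assume "x \<in> closed_segment q (q + \<tau> *\<^sub>R A)"
      then obtain t where t: "0 \<le> t" "t \<le> 1" "x = (1 - t) *\<^sub>R q + t *\<^sub>R (q + \<tau> *\<^sub>R A)"
        by (auto simp: in_segment)
      have "x = q + (t * \<tau>) *\<^sub>R A" using t(3) by (simp add: algebra_simps)
      then show "x \<in> D" using move[OF that, of "t * \<tau>" A] t tau lam
        by (simp add: mult_left_le_one_le)
    qed
    have mid: "closed_segment (y + \<tau> *\<^sub>R A) (z + \<tau> *\<^sub>R A) \<subseteq> D"
    proof (cases "\<delta> = 0")
      case True
      then have "y = z" by (simp add: \<delta>_def)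
      then show ?thesis using seg[of y] y dy K by auto
    next
      case False
      then have tp: "\<tau> > 0" "\<delta> > 0" using lam by (auto simp: \<tau>_def \<delta>_def)
      show ?thesis
      proof
        fix x assume "x \<in> closed_segment (y + \<tau> *\<^sub>R A) (z + \<tau> *\<^sub>R A)"
        then obtain t where t: "0 \<le> t" "t \<le> 1" "x = (1 - t) *\<^sub>R (y + \<tau> *\<^sub>R A) + t *\<^sub>R (z + \<tau> *\<^sub>R A)"
          by (auto simp: in_segment)
        define u where "u = A + (t / \<tau>) *\<^sub>R (z - y)"
        have x: "x = y + \<tau> *\<^sub>R u" using tp by (simp add: u_def t(3) algebra_simps)
        have "norm (u - A) = t * \<delta> / \<tau>" using t tp by (simp add: u_def \<delta>_def dist_norm norm_minus_commute)
        also have "\<dots> = t * lam / 2" using tp lam by (simp add: \<tau>_def)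
        also have "\<dots> \<le> lam / 2" using t lam by (simp add: mult_left_le_one_le)
        finally have "norm (u - A) \<le> lam / 2" .
        then show "x \<in> D" unfolding x using move[of y \<tau> u] y dy K tau by simp
      qed
    qed
    have c: "2 / lam * \<delta> \<le> C * \<delta>" "1 * \<delta> \<le> C * \<delta>"
      by (intro mult_right_mono; simp add: C_def \<delta>_def)+
    then have "\<tau> \<le> C * \<delta>" by (simp add: \<tau>_def)
    then show ?thesis
      using seg[OF y] seg[OF z] mid dy dz tau c A K
      by (intro exI[of _ "y + \<tau> *\<^sub>R A"] exI[of _ "z + \<tau> *\<^sub>R A"])
         (auto simp: \<delta>_def dist_norm closed_segment_commute)
  qed
  moreover have "C \<ge> 1" by (simp add: C_def)
  ultimately show ?thesis using that rho by blast
qed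

text \<open>Subtracting \<open>\<sigma>' y\<close> from \<open>\<sigma>\<close> leaves a derivative
  of size \<open>B\<close> times the distance from \<open>y\<close>, so the mean value inequality
  along the three segments of a chain gives a quadratic remainder although \<open>D\<close> need not
  be convex. Limits extend the estimate from \<open>D\<close> to its closure. Points at distance at
  least \<open>\<rho>\<close> require only boundedness.\<close>

lemma C1_taylor_on_closure:
  fixes D :: "'a::euclidean_space set" and \<sigma> :: "'a \<Rightarrow> 'b::real_normed_vector"
  assumes "open D" "bounded D" and rho: "\<rho> > 0" and C: "C \<ge> 1"
    and chain: "\<And>y z. y \<in> D \<Longrightarrow> z \<in> D \<Longrightarrow> dist y z < \<rho> \<Longrightarrow>
       \<exists>y' z'. closed_segment y y' \<subseteq> D \<and> closed_segment y' z' \<subseteq> D \<and> closed_segment z' z \<subseteq> D \<and>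
             dist y y' \<le> C * dist y z \<and> dist y' z' \<le> C * dist y z \<and> dist z' z \<le> C * dist y z"
    and der: "\<forall>x\<in>closure D. (\<sigma> has_derivative \<sigma>' x) (at x within closure D)"
    and B: "B \<ge> 0" "\<And>x y. x \<in> closure D \<Longrightarrow> y \<in> closure D \<Longrightarrow> onorm (\<lambda>h. \<sigma>' x h - \<sigma>' y h) \<le> B * dist x y"
  shows "\<exists>E\<ge>0. \<forall>x\<in>closure D. \<forall>y\<in>closure D. norm (\<sigma> y - \<sigma> x - \<sigma>' x (y - x)) \<le> E * (norm (y - x))^2"
proof -
  have bl: "bounded_linear (\<sigma>' x)" if "x \<in> closure D" for x
    using der that has_derivative_bounded_linear by blast
  have lip: "norm (\<sigma>' x h - \<sigma>' y h) \<le> B * dist x y * norm h" if "x \<in> closure D" "y \<in> closure D" for x y h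
  proof -
    have "norm (\<sigma>' x h - \<sigma>' y h) \<le> onorm (\<lambda>h. \<sigma>' x h - \<sigma>' y h) * norm h"
      using bl that by (intro onorm bounded_linear_sub) auto
    also have "\<dots> \<le> B * dist x y * norm h" using B(2)[OF that] by (intro mult_right_mono) auto
    finally show ?thesis .
  qed
  have DC: "D \<subseteq> closure D" by (rule closure_subset)
  \<comment> \<open>Each of the three segments has length at most \<open>C * dist y z\<close> and
    stays within \<open>3 * C * dist y z\<close> of \<open>y\<close>; hence three times
    \<open>B * (3 * C) * C\<close>.\<close>
  define E1 where "E1 = 9 * B * C^2"
  have E1: "E1 \<ge> 0" using B C by (simp add: E1_def)
  have near: "norm (\<sigma> z - \<sigma> y - \<sigma>' y (z - y)) \<le> E1 * (norm (z - y))^2"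
    if y: "y \<in> D" and z: "z \<in> D" and d: "dist y z < \<rho>" for y z
  proof -
    obtain y' z' where c: "closed_segment y y' \<subseteq> D" "closed_segment y' z' \<subseteq> D" "closed_segment z' z \<subseteq> D"
      "dist y y' \<le> C * dist y z" "dist y' z' \<le> C * dist y z" "dist z' z \<le> C * dist y z"
      using chain[OF y z d] by blast
    define f where "f = (\<lambda>p. \<sigma> p - \<sigma>' y p)"
    have fd: "(f has_derivative (\<lambda>h. \<sigma>' p h - \<sigma>' y h)) (at p within S)" if "S \<subseteq> D" "p \<in> S" for p S
      unfolding f_def using der that DC y bl
      by (intro has_derivative_diff bounded_linear_imp_has_derivative)
         (blast intro: has_derivative_subset)+
    have seg: "norm (f q - f p) \<le> (B * (3 * C * dist y z)) * (C * dist y z)"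
      if S: "closed_segment p q \<subseteq> D" and pq: "dist p q \<le> C * dist y z"
        and b: "dist y p \<le> 2 * C * dist y z" "dist y q \<le> 3 * C * dist y z" for p q
    proof -
      have "norm (f q - f p) \<le> (B * (3 * C * dist y z)) * norm (q - p)"
      proof (rule differentiable_bound[of "closed_segment p q"])
        fix x assume x: "x \<in> closed_segment p q"
        show "(f has_derivative (\<lambda>h. \<sigma>' x h - \<sigma>' y h)) (at x within closed_segment p q)"
          by (rule fd[OF S x])
        have "closed_segment p q \<subseteq> cball y (3 * C * dist y z)"
          using b C by (intro closed_segment_subset)
             (auto intro: order_trans[OF b(1)] mult_right_mono)
        then have "dist x y \<le> 3 * C * dist y z" using x by (auto simp: dist_commute)
        moreover have "onorm (\<lambda>h. \<sigma>' x h - \<sigma>' y h) \<le> B * dist x y"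
          using x S y DC by (intro B) auto
        ultimately show "onorm (\<lambda>h. \<sigma>' x h - \<sigma>' y h) \<le> B * (3 * C * dist y z)"
          using B(1) by (meson mult_left_mono order_trans)
      qed auto
      also have "\<dots> \<le> (B * (3 * C * dist y z)) * (C * dist y z)"
        using pq B C by (intro mult_left_mono) (auto simp: dist_norm norm_minus_commute)
      finally show ?thesis .
    qed
    have p1: "0 \<le> C * dist y z" using C by simp
    have b1: "dist y z' \<le> 2 * C * dist y z" using c(4,5) dist_triangle[of y z' y'] by linarith
    have b2: "dist y z \<le> 3 * C * dist y z" using b1 c(6) dist_triangle[of y z z'] by linarith
    have "norm (f z - f y) \<le> norm (f z - f z') + norm (f z' - f y') + norm (f y' - f y)"
      using norm_triangle_ineq[of "f z - f z'" "f z' - f y"] norm_triangle_ineq[of "f z' - f y'" "f y' - f y"]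
      by simp
    also have "\<dots> \<le> 3 * ((B * (3 * C * dist y z)) * (C * dist y z))"
      using seg[OF c(3)] seg[OF c(2)] seg[OF c(1)] c b1 b2 p1 by (simp add: mult.assoc)
    also have "\<dots> = E1 * (norm (z - y))^2"
      by (simp add: E1_def dist_norm norm_minus_commute power2_eq_square)
    finally have "norm (f z - f y) \<le> E1 * (norm (z - y))^2" .
    moreover have "f z - f y = \<sigma> z - \<sigma> y - \<sigma>' y (z - y)"
      using linear_diff[OF bounded_linear.linear[OF bl]] y DC by (auto simp: f_def)
    ultimately show ?thesis by simp
  qed
  have cont: "continuous_on (closure D) \<sigma>"
    using der has_derivative_continuous_on by blast
  have nearcl: "norm (\<sigma> z - \<sigma> y - \<sigma>' y (z - y)) \<le> E1 * (norm (z - y))^2"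
    if y: "y \<in> closure D" and z: "z \<in> closure D" and d: "dist y z < \<rho>" for y z
  proof -
    obtain u where u: "\<And>n. u n \<in> D" "u \<longlonglongrightarrow> y" using y closure_sequential by metis
    obtain v where v: "\<And>n. v n \<in> D" "v \<longlonglongrightarrow> z" using z closure_sequential by metis
    have su: "(\<lambda>n. \<sigma> (u n)) \<longlonglongrightarrow> \<sigma> y" and sv: "(\<lambda>n. \<sigma> (v n)) \<longlonglongrightarrow> \<sigma> z"
      using cont[unfolded continuous_on_sequentially comp_def] u v y z DC by (meson subset_iff)+
    have uv: "(\<lambda>n. v n - u n) \<longlonglongrightarrow> z - y" by (intro tendsto_intros u v)
    have s0: "(\<lambda>n. \<sigma>' y (v n - u n)) \<longlonglongrightarrow> \<sigma>' y (z - y)"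
      by (rule bounded_linear.tendsto[OF bl[OF y] uv])
    have "(\<lambda>n. \<sigma>' (u n) (v n - u n) - \<sigma>' y (v n - u n)) \<longlonglongrightarrow> 0"
    proof (rule Lim_null_comparison)
      show "\<forall>\<^sub>F n in sequentially. norm (\<sigma>' (u n) (v n - u n) - \<sigma>' y (v n - u n)) \<le> B * dist (u n) y * norm (v n - u n)"
        using lip[OF _ y] u(1) DC by (intro always_eventually allI) blast
      have "(\<lambda>n. B * dist (u n) y * norm (v n - u n)) \<longlonglongrightarrow> B * dist y y * norm (z - y)"
        by (intro tendsto_intros u uv)
      then show "(\<lambda>n. B * dist (u n) y * norm (v n - u n)) \<longlonglongrightarrow> 0" by simp
    qed
    from tendsto_add[OF this s0] have s': "(\<lambda>n. \<sigma>' (u n) (v n - u n)) \<longlonglongrightarrow> \<sigma>' y (z - y)" by simp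
    have "(\<lambda>n. dist (u n) (v n)) \<longlonglongrightarrow> dist y z" by (intro tendsto_intros u v)
    then have "\<forall>\<^sub>F n in sequentially. dist (u n) (v n) < \<rho>" using d by (rule order_tendstoD)
    then have ev: "\<forall>\<^sub>F n in sequentially. norm (\<sigma> (v n) - \<sigma> (u n) - \<sigma>' (u n) (v n - u n)) \<le> E1 * (norm (v n - u n))^2"
      by eventually_elim (use near u v in auto)
    show ?thesis
      by (rule tendsto_le[OF _ _ _ ev])
         (auto intro!: tendsto_intros su sv s' uv)
  qed
  obtain S where S: "\<And>x. x \<in> closure D \<Longrightarrow> norm (\<sigma> x) \<le> S" 
  proof -
    have "compact (\<sigma> ` closure D)" using cont assms(2) by (intro compact_continuous_image) (auto simp: compact_closure)
    then have "bounded (\<sigma> ` closure D)" by (rule compact_imp_bounded)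
    then show ?thesis using that by (auto simp: bounded_iff)
  qed
  obtain R where R: "\<And>x. x \<in> closure D \<Longrightarrow> norm x \<le> R"
    using bounded_closure[OF assms(2)] by (auto simp: bounded_iff)
  show ?thesis
  proof (cases "D = {}")
    case True then show ?thesis by auto
  next
    case False
    then obtain p where p: "p \<in> closure D" using DC by auto
    have R0: "R \<ge> 0" using R[OF p] norm_ge_zero order_trans by blast
    have S0: "S \<ge> 0" using S[OF p] norm_ge_zero order_trans by blast
    define Q where "Q = onorm (\<sigma>' p) + B * (2 * R)"
    have Q: "norm (\<sigma>' x h) \<le> Q * norm h" if x: "x \<in> closure D" for x h
    proof -
      have "norm (\<sigma>' x h) \<le> norm (\<sigma>' p h) + norm (\<sigma>' x h - \<sigma>' p h)"
        by (metis norm_triangle_sub)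
      also have "\<dots> \<le> onorm (\<sigma>' p) * norm h + B * dist x p * norm h"
        using onorm[OF bl[OF p]] lip[OF x p] by (intro add_mono)
      also have "\<dots> \<le> onorm (\<sigma>' p) * norm h + B * (2 * R) * norm h"
        using B(1) R[OF x] R[OF p] norm_triangle_ineq4[of x p]
        by (intro add_left_mono mult_right_mono mult_left_mono) (auto simp: dist_norm)
      finally show ?thesis by (simp add: Q_def algebra_simps)
    qed
    have Q0: "Q \<ge> 0" using onorm_pos_le[OF bl[OF p]] B R0 by (simp add: Q_def)
    define E where "E = E1 + (2 * S + Q * (2 * R)) / \<rho>^2"
    have "norm (\<sigma> y - \<sigma> x - \<sigma>' x (y - x)) \<le> E * (norm (y - x))^2" if x: "x \<in> closure D" and y: "y \<in> closure D" for x y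
    proof (cases "dist x y < \<rho>")
      case True
      have "norm (\<sigma> y - \<sigma> x - \<sigma>' x (y - x)) \<le> E1 * (norm (y - x))^2" by (rule nearcl[OF x y True])
      also have "\<dots> \<le> E * (norm (y - x))^2"
        using S0 Q0 R0 by (intro mult_right_mono) (auto simp: E_def)
      finally show ?thesis .
    next
      case False
      have "norm (\<sigma> y - \<sigma> x - \<sigma>' x (y - x)) \<le> norm (\<sigma> y) + norm (\<sigma> x) + norm (\<sigma>' x (y - x))"
        by (smt (verit) norm_triangle_ineq4)
      also have "\<dots> \<le> S + S + Q * (2 * R)"
        using S[OF x] S[OF y] R[OF x] R[OF y] norm_triangle_ineq4[of y x] Q0
        by (intro add_mono order_trans[OF Q[OF x]] mult_left_mono) auto
      also have "\<dots> = (2 * S + Q * (2 * R)) / \<rho>^2 * \<rho>^2" using rho by simp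
      also have "\<dots> \<le> (2 * S + Q * (2 * R)) / \<rho>^2 * (norm (y - x))^2"
        using False rho S0 Q0 R0 by (intro mult_left_mono power_mono) (auto simp: dist_norm norm_minus_commute)
      also have "\<dots> \<le> E * (norm (y - x))^2"
        using E1 by (intro mult_right_mono) (auto simp: E_def)
      finally show ?thesis .
    qed
    moreover have "E \<ge> 0" using E1 S0 Q0 R0 by (simp add: E_def)
    ultimately show ?thesis by blast
  qed
qed

section \<open>Total variation and the reflection term\<close>

text \<open>The variation sums are indexed by positions in a list; the recursive form opens
  concatenation and insertion of partition points to induction.\<close>

fun path_length :: "('b \<Rightarrow> 'a::real_normed_vector) \<Rightarrow> 'b list \<Rightarrow> real" where
  "path_length l [] = 0"
| "path_length l [x] = 0"
| "path_length l (x # y # zs) = norm (l y - l x) + path_length l (y # zs)"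

lemma path_length_eq_sum:
  "path_length l ps = (\<Sum>i<length ps - 1. norm (l (ps ! Suc i) - l (ps ! i)))"
  by (induction l ps rule: path_length.induct) (simp_all add: sum.lessThan_Suc_shift del: sum.lessThan_Suc)

lemma var_sums_eq: "var_sums l a b = path_length l ` {ps. sorted ps \<and> set ps \<subseteq> {a..b}}"
  unfolding var_sums_def path_length_eq_sum by blast

lemma path_length_append: "path_length l (xs @ [a]) + path_length l (a # ys) = path_length l (xs @ a # ys)"
proof (induction xs)
  case (Cons x xs)
  then show ?case by (cases xs) auto
qed simp

lemma path_length_nonneg: "path_length l ps \<ge> 0"
  by (simp add: path_length_eq_sum sum_nonneg)

lemma path_length_Cons_le: "path_length l ys \<le> path_length l (a # ys)"
  by (cases ys) auto

lemma path_length_snoc_le: "path_length l xs \<le> path_length l (xs @ [a])"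
proof (induction xs)
  case (Cons x xs)
  then show ?case by (cases xs) auto
qed simp

lemma path_length_insert_le: "path_length l (xs @ ys) \<le> path_length l (xs @ [a]) + path_length l (a # ys)"
proof (induction xs)
  case (Cons x xs)
  show ?case
  proof (cases xs)
    case Nil
    show ?thesis
    proof (cases ys)
      case (Cons y zs)
      then show ?thesis using Nil norm_triangle_ineq[of "l y - l a" "l a - l x"] by auto
    qed (use Nil path_length_nonneg in auto)
  qed (use Cons in auto)
qed (simp add: path_length_Cons_le)

context
  fixes l :: "real \<Rightarrow> 'b::real_normed_vector"
  assumes bv: "\<And>t. t \<ge> 0 \<Longrightarrow> bounded_variation_on l 0 t"
begin

lemma path_length_le_total_variation:
  assumes "sorted ps" "set ps \<subseteq> {0..t}"
  shows "path_length l ps \<le> total_variation l 0 t"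
proof (cases "t \<ge> 0")
  case True
  then have "bdd_above (path_length l ` {ps. sorted ps \<and> set ps \<subseteq> {0..t}})"
    using bv[OF True] by (simp add: bounded_variation_on_def var_sums_eq)
  then show ?thesis unfolding total_variation_def var_sums_eq
    by (intro cSup_upper) (use assms in blast)
next
  case False
  then have "{ps. sorted ps \<and> set ps \<subseteq> {0..t}} = {[]}" by auto
  then have "total_variation l 0 t = 0" by (simp add: total_variation_def var_sums_eq)
  moreover have "ps = []" using False assms by (cases ps) auto
  ultimately show ?thesis by simp
qed

lemma total_variation_leI:
  assumes "\<And>ps. sorted ps \<Longrightarrow> set ps \<subseteq> {0..t} \<Longrightarrow> path_length l ps \<le> c"
  shows "total_variation l 0 t \<le> c"
  unfolding total_variation_def var_sums_eq
proof (rule cSup_least)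
  have "[] \<in> {ps. sorted ps \<and> set ps \<subseteq> {0..t}}" by simp
  then show "path_length l ` {ps. sorted ps \<and> set ps \<subseteq> {0..t}} \<noteq> {}" by blast
qed (use assms in auto)

lemma total_variation_nonpos: "t \<le> 0 \<Longrightarrow> total_variation l 0 t = 0"
proof (rule antisym)
  assume t: "t \<le> 0"
  show "total_variation l 0 t \<le> 0"
  proof (rule total_variation_leI)
    fix ps assume ps: "sorted ps" "set ps \<subseteq> {0..t}"
    then have "\<forall>p\<in>set ps. p = 0" using t by auto
    then have "path_length l ps = 0" by (induction l ps rule: path_length.induct) auto
    then show "path_length l ps \<le> 0" by simp
  qed
  show "0 \<le> total_variation l 0 t" using path_length_le_total_variation[of "[]" t] by simp
qed

lemma total_variation_add_path_length_le:
  assumes "0 \<le> s" "sorted (s # qs)" "set qs \<subseteq> {s..t}" "s \<le> t"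
  shows "total_variation l 0 s + path_length l (s # qs) \<le> total_variation l 0 t"
proof -
  have "total_variation l 0 s \<le> total_variation l 0 t - path_length l (s # qs)"
  proof (rule total_variation_leI)
    fix ps assume ps: "sorted ps" "set ps \<subseteq> {0..s}"
    have "path_length l ps + path_length l (s # qs) \<le> path_length l (ps @ s # qs)"
      using path_length_snoc_le[of l ps s] path_length_append[of l ps s qs] by linarith
    also have "\<dots> \<le> total_variation l 0 t"
    proof (rule path_length_le_total_variation)
      have 1: "0 \<le> p \<and> p \<le> s" if "p \<in> set ps" for p using ps(2) that by auto
      have 2: "s \<le> p \<and> p \<le> t" if "p \<in> set qs" for p using assms(3) that by auto
      have "p \<le> q" if "p \<in> set ps" "q \<in> set qs" for p q using 1[OF that(1)] 2[OF that(2)] by linarith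
      then show "sorted (ps @ s # qs)" using ps(1) assms(2) 1 by (auto simp: sorted_append)
      have "0 \<le> p \<and> p \<le> t" if "p \<in> set (ps @ s # qs)" for p
        using that 1[of p] 2[of p] assms(1,4) by auto
      then show "set (ps @ s # qs) \<subseteq> {0..t}" by auto
    qed
    finally show "path_length l ps \<le> total_variation l 0 t - path_length l (s # qs)" by simp
  qed
  then show ?thesis by simp
qed

lemma total_variation_mono: "s \<le> t \<Longrightarrow> total_variation l 0 s \<le> total_variation l 0 t"
  by (rule total_variation_leI, rule path_length_le_total_variation) auto

lemma norm_diff_le_total_variation:
  assumes "0 \<le> s" "s \<le> t"
  shows "norm (l t - l s) \<le> total_variation l 0 t - total_variation l 0 s"
  using total_variation_add_path_length_le[of s "[t]" t] assms by simp

text \<open>Take a partition of \<open>{0..a+1}\<close> within \<open>e / 2\<close> of the supremum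
  and insert \<open>a\<close> and a point \<open>r\<close> just after it. The part of the sum
  between \<open>a\<close> and \<open>r\<close> is then the single norm
  \<open>norm (l r - l a)\<close>, which is small by continuity, so the variation gains less than
  \<open>e\<close> there. Right continuity is what lets \<open>interval_measure\<close> assign to
  \<open>{a<..b}\<close> the increment of the variation.\<close>

lemma total_variation_right_continuous:
  assumes cont: "continuous_on {0..} l"
  shows "continuous (at_right a) (total_variation l 0)"
proof (cases "a < 0")
  case True
  have "((\<lambda>_. 0) \<longlongrightarrow> total_variation l 0 a) (at_right a)"
    using True by (simp add: total_variation_nonpos)
  moreover have "\<forall>\<^sub>F t in at_right a. 0 = total_variation l 0 t"
    using True by (intro eventually_at_rightI[of a 0]) (auto simp: total_variation_nonpos)
  ultimately show ?thesis unfolding continuous_within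
    by (rule Lim_transform_eventually)
next
  case False
  then have a: "a \<ge> 0" by simp
  show ?thesis unfolding continuous_within
  proof (rule tendstoI)
    fix e :: real assume e: "e > 0"
    have "\<exists>ps. sorted ps \<and> set ps \<subseteq> {0..a+1} \<and> path_length l ps > total_variation l 0 (a + 1) - e / 2"
    proof (rule ccontr)
      assume "\<not> ?thesis"
      then have "total_variation l 0 (a + 1) \<le> total_variation l 0 (a + 1) - e / 2"
        by (intro total_variation_leI) (meson not_less)
      then show False using e by simp
    qed
    then obtain ps where ps: "sorted ps" "set ps \<subseteq> {0..a+1}" "path_length l ps > total_variation l 0 (a + 1) - e / 2"
      by blast
    have "(l \<longlongrightarrow> l a) (at a within {0..})" using cont a by (auto simp: continuous_on_def)
    then have "(l \<longlongrightarrow> l a) (at_right a)" by (rule tendsto_within_subset) (use a in auto)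
    then have "\<forall>\<^sub>F r in at_right a. dist (l r) (l a) < e / 2" using e by (intro tendstoD) auto
    moreover have "\<forall>\<^sub>F r in at_right a. \<forall>p\<in>set ps. a < p \<longrightarrow> r \<le> p"
    proof (intro eventually_ball_finite ballI)
      fix p
      show "\<forall>\<^sub>F r in at_right a. a < p \<longrightarrow> r \<le> p"
      proof (cases "a < p")
        case True
        then show ?thesis by (intro eventually_at_rightI[of a p]) auto
      qed simp
    qed simp
    moreover have "\<forall>\<^sub>F r in at_right a. a < r \<and> r < a + 1" by (intro eventually_at_rightI[of a "a+1"]) auto
    ultimately show "\<forall>\<^sub>F r in at_right a. dist (total_variation l 0 r) (total_variation l 0 a) < e"
    proof eventually_elim
      case (elim r)
      define p1 where "p1 = filter (\<lambda>p. p \<le> a) ps"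
      define p2 where "p2 = filter (\<lambda>p. \<not> p \<le> a) ps"
      have split: "ps = p1 @ p2" using ps(1) unfolding p1_def p2_def
      proof (induction ps)
        case (Cons x xs)
        show ?case
        proof (cases "x \<le> a")
          case False
          then have "filter (\<lambda>p. p \<le> a) xs = []" "filter (\<lambda>p. \<not> p \<le> a) xs = xs"
            using Cons.prems by (auto simp: filter_empty_conv intro!: filter_True)
          then show ?thesis using False by simp
        qed (use Cons in auto)
      qed simp
      have s2: "sorted p2" "sorted p1" using ps(1) by (auto simp: p1_def p2_def sorted_wrt_filter)
      have "path_length l ps \<le> path_length l (p1 @ [a]) + path_length l (a # p2)"
        unfolding split by (rule path_length_insert_le)
      also have "path_length l (a # p2) \<le> path_length l ([a] @ [r]) + path_length l (r # p2)"
        using path_length_insert_le[of l "[a]" p2 r] by simp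
      finally have 1: "path_length l ps \<le> path_length l (p1 @ [a]) + norm (l r - l a) + path_length l (r # p2)" by simp
      have 2: "path_length l (p1 @ [a]) \<le> total_variation l 0 a"
        using s2 ps(2) a by (intro path_length_le_total_variation) (auto simp: p1_def sorted_append)
      have 3: "total_variation l 0 r + path_length l (r # p2) \<le> total_variation l 0 (a + 1)"
        using elim a s2 ps(2) by (intro total_variation_add_path_length_le) (auto simp: p2_def)
      have "total_variation l 0 r < total_variation l 0 a + e"
        using 1 2 3 ps(3) elim by (auto simp: dist_norm)
      moreover have "total_variation l 0 a \<le> total_variation l 0 r" using elim by (intro total_variation_mono) auto
      ultimately show ?case by (simp add: dist_real_def)
    qed
  qed
qed

end

text \<open>The measure of the total variation sits on the times at which the path is at the
  boundary, where the density is a reflecting direction; a pointwise lower bound for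
  \<open>u\<close> against such directions can be integrated. Apart from the value at time 0, this
  is all that is later used of the integral representation.\<close>

lemma reflection_term_inner_ge:
  fixes x l :: "real \<Rightarrow> real^'d"
  assumes refl: "reflection_term D \<nu> x l"
    and cl: "continuous_on {0..} l" and cx: "continuous_on {0..} x"
    and nu: "\<forall>x\<in>frontier D. \<nu> x \<noteq> {} \<and> (\<forall>v\<in>\<nu> x. norm v = 1)"
    and st: "0 \<le> s" "s \<le> t"
    and u: "\<And>r v. s \<le> r \<Longrightarrow> r \<le> t \<Longrightarrow> x r \<in> frontier D \<Longrightarrow> v \<in> \<nu> (x r) \<Longrightarrow> \<beta> \<le> u \<bullet> v"
  shows "\<beta> * (total_variation l 0 t - total_variation l 0 s) \<le> u \<bullet> (l t - l s)"
proof -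
  define tv where "tv = total_variation l 0"
  define \<mu> where "\<mu> = interval_measure tv"
  have bv: "\<And>t. t \<ge> 0 \<Longrightarrow> bounded_variation_on l 0 t" using refl by (auto simp: reflection_term_def)
  have "\<exists>\<gamma>::real \<Rightarrow> real^'d. \<gamma> \<in> borel_measurable borel \<and> (AE s in \<mu>. 0 \<le> s \<longrightarrow> \<gamma> s \<in> \<nu> (x s)) \<and>
      (\<forall>t\<ge>0. l t = (LINT s:{0..t}|\<mu>. \<gamma> s)) \<and>
      (\<forall>t\<ge>0. tv t = (LINT s:{0..t}|\<mu>. indicator (frontier D) (x s)))"
    using refl unfolding reflection_term_def Let_def \<mu>_def tv_def by (rule conjunct2)
  then obtain \<gamma> where g: "\<gamma> \<in> borel_measurable borel" "AE s in \<mu>. 0 \<le> s \<longrightarrow> \<gamma> s \<in> \<nu> (x s)"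
    "\<And>t. t \<ge> 0 \<Longrightarrow> l t = (LINT s:{0..t}|\<mu>. \<gamma> s)"
    "\<And>t. t \<ge> 0 \<Longrightarrow> tv t = (LINT s:{0..t}|\<mu>. indicator (frontier D) (x s))"
    by (elim exE conjE) (rule that, auto)
  have sets_mu[measurable_cong]: "sets \<mu> = sets borel" by (simp add: \<mu>_def)
  have mono: "\<And>a b. a \<le> b \<Longrightarrow> tv a \<le> tv b" unfolding tv_def by (rule total_variation_mono[OF bv])
  have rc: "\<And>a. continuous (at_right a) tv" unfolding tv_def by (rule total_variation_right_continuous[OF bv cl])
  have em: "emeasure \<mu> {a<..b} = ennreal (tv b - tv a)" if "a \<le> b" for a b
    unfolding \<mu>_def by (rule emeasure_interval_measure_Ioc[OF that mono rc])
  have t0: "0 \<le> t" using st by simp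
  define A where "A = {r\<in>{0..t}. x r \<in> frontier D}"
  have "closed ({0..t} \<inter> x -` frontier D)"
    by (rule continuous_closed_preimage) (auto intro: continuous_on_subset[OF cx])
  moreover have "{0..t} \<inter> x -` frontier D = A" by (auto simp: A_def)
  ultimately have "closed A" by simp
  then have A[measurable]: "A \<in> sets \<mu>" by (simp add: sets_mu)
  have fin: "emeasure \<mu> {0..t} < \<infinity>"
  proof -
    have "emeasure \<mu> {0..t} \<le> emeasure \<mu> {-1<..t}" by (intro emeasure_mono) (auto simp: sets_mu)
    then show ?thesis using em[of "-1" t] t0 by (auto simp: le_less_trans)
  qed
  have "tv t = (LINT r|\<mu>. indicator A r)"
    unfolding g(4)[OF t0] set_lebesgue_integral_def
    by (rule Bochner_Integration.integral_cong) (auto simp: A_def indicator_def)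
  also have "\<dots> = measure \<mu> A" by (simp add: \<mu>_def)
  finally have mA: "measure \<mu> A = tv t" by simp
  \<comment> \<open>The variation vanishes on the negative axis, so \<open>{0..t}\<close> has mass
    at most \<open>tv t\<close>, and \<open>A\<close> already carries that much. What lies outside
    \<open>A\<close> is therefore null.\<close>
  have "measure \<mu> {0..t} \<le> measure \<mu> {-1<..t}"
    using em[of "-1" t] t0 by (intro measure_mono_fmeasurable) (auto simp: fmeasurable_def sets_mu)
  also have "\<dots> = tv t" using em[of "-1" t] t0 mono[of "-1" t]
    by (simp add: measure_def tv_def total_variation_nonpos[OF bv])
  finally have m0: "measure \<mu> {0..t} \<le> tv t" .
  have "measure \<mu> ({0..t} - A) = measure \<mu> {0..t} - measure \<mu> A"
    by (rule measure_Diff) (use fin A in \<open>auto simp: A_def sets_mu\<close>)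
  then have "measure \<mu> ({0..t} - A) = 0" using m0 mA measure_nonneg[of \<mu> "{0..t} - A"] by linarith
  moreover have "emeasure \<mu> ({0..t} - A) < \<infinity>"
    by (rule le_less_trans[OF emeasure_mono fin]) (auto simp: sets_mu)
  ultimately have "emeasure \<mu> ({0..t} - A) = 0" by (simp add: emeasure_eq_ennreal_measure less_top)
  then have "{0..t} - A \<in> null_sets \<mu>" by (auto simp: null_sets_def)
  then have "AE r in \<mu>. r \<notin> {0..t} - A" by (rule AE_not_in)
  with g(2) have ae: "AE r in \<mu>. 0 \<le> r \<and> r \<le> t \<longrightarrow> x r \<in> frontier D \<and> \<gamma> r \<in> \<nu> (x r)"
    by eventually_elim (auto simp: A_def)
  have int: "set_integrable \<mu> {0..t} \<gamma>"
    unfolding set_integrable_def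
  proof (rule Bochner_Integration.integrable_bound[of _ "indicator {0..t} :: real \<Rightarrow> real"])
    show "integrable \<mu> (indicator {0..t} :: real \<Rightarrow> real)" using fin by (auto simp: sets_mu)
    show "AE r in \<mu>. norm (indicat_real {0..t} r *\<^sub>R \<gamma> r) \<le> norm (indicat_real {0..t} r)"
      using ae by eventually_elim (use nu in \<open>auto simp: indicator_def\<close>)
    show "(\<lambda>r. indicat_real {0..t} r *\<^sub>R \<gamma> r) \<in> borel_measurable \<mu>"
      using g(1) by measurable
  qed
  have un: "{0..t} = {0..s} \<union> {s<..t}" using st by auto
  have int2: "set_integrable \<mu> {s<..t} \<gamma>" and int1: "set_integrable \<mu> {0..s} \<gamma>"
    by (rule set_integrable_subset[OF int]; use st in \<open>auto simp: sets_mu\<close>)+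
  have "l t = l s + (LINT r:{s<..t}|\<mu>. \<gamma> r)"
    unfolding g(3)[OF t0] g(3)[OF st(1)] un by (rule set_integral_Un[OF _ int1 int2]) auto
  then have "u \<bullet> (l t - l s) = u \<bullet> (LINT r|\<mu>. indicator {s<..t} r *\<^sub>R \<gamma> r)"
    by (simp add: set_lebesgue_integral_def)
  also have "\<dots> = (LINT r|\<mu>. u \<bullet> (indicator {s<..t} r *\<^sub>R \<gamma> r))"
    using int2 by (subst integral_inner_right) (auto simp: set_integrable_def)
  also have "\<dots> \<ge> (LINT r|\<mu>. \<beta> * indicator {s<..t} r)"
  proof (rule integral_mono_AE)
    show "integrable \<mu> (\<lambda>r. \<beta> * indicator {s<..t} r)"
      using em[OF st(2)] by (auto simp: sets_mu)
    show "integrable \<mu> (\<lambda>r. u \<bullet> (indicat_real {s<..t} r *\<^sub>R \<gamma> r))"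
      using int2 by (intro integrable_inner_right) (auto simp: set_integrable_def)
    show "AE r in \<mu>. \<beta> * indicat_real {s<..t} r \<le> u \<bullet> (indicat_real {s<..t} r *\<^sub>R \<gamma> r)"
      using ae
    proof eventually_elim
      case (elim r)
      then show ?case using u[of r "\<gamma> r"] st by (auto simp: indicator_def)
    qed
  qed
  also have "(LINT r|\<mu>. \<beta> * indicator {s<..t} r) = \<beta> * (tv t - tv s)"
    using em[OF st(2)] mono[OF st(2)] by (simp add: measure_def sets_mu \<mu>_def)
  finally show ?thesis by (simp add: tv_def)
qed

text \<open>A one-sided chain rule for a path made of a Lipschitz part \<open>v\<close> and a
  reflection part \<open>l\<close>. On a fine partition the gradient is frozen at each left end
  point, because \<open>R\<close> tests with constant vectors; this error vanishes with the mesh.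
  Only the further replacement of the gradient by its value at time \<open>a\<close> leaves a trace,
  \<open>\<Gamma> * K * (b - a)\<close>.\<close>

lemma reflected_path_C1_bound:
  fixes x l v :: "real \<Rightarrow> 'a::euclidean_space"
  assumes ab: "a \<le> b" and cx: "continuous_on {a..b} x"
    and V: "\<And>s t. a \<le> s \<Longrightarrow> s \<le> t \<Longrightarrow> t \<le> b \<Longrightarrow> norm (l t - l s) \<le> V t - V s"
    and R: "\<And>s t u \<gamma>. a \<le> s \<Longrightarrow> s \<le> t \<Longrightarrow> t \<le> b \<Longrightarrow>
       (\<And>r w. s \<le> r \<Longrightarrow> r \<le> t \<Longrightarrow> x r \<in> frontier D \<Longrightarrow> w \<in> \<nu> (x r) \<Longrightarrow> \<gamma> \<le> u \<bullet> w) \<Longrightarrow>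
       \<gamma> * (V t - V s) \<le> u \<bullet> (l t - l s)"
    and nu: "\<And>y w. y \<in> frontier D \<Longrightarrow> w \<in> \<nu> y \<Longrightarrow> norm w = 1"
    and xv: "\<And>s t. a \<le> s \<Longrightarrow> s \<le> t \<Longrightarrow> t \<le> b \<Longrightarrow> x t - x s = (v t - v s) + (l t - l s)"
    and vK: "\<And>s t. a \<le> s \<Longrightarrow> s \<le> t \<Longrightarrow> t \<le> b \<Longrightarrow> norm (v t - v s) \<le> K * (t - s)"
    and F: "\<And>y. (F has_derivative (\<lambda>h. g y \<bullet> h)) (at y)" and g: "continuous_on UNIV g"
    and gb: "\<And>y w. y \<in> frontier D \<Longrightarrow> w \<in> \<nu> y \<Longrightarrow> g y \<bullet> w \<le> - \<beta>"
    and G: "\<And>r. a \<le> r \<Longrightarrow> r \<le> b \<Longrightarrow> norm (g (x r) - g (x a)) \<le> \<Gamma>"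
  shows "F (x b) - F (x a) \<le> g (x a) \<bullet> (v b - v a) + \<Gamma> * K * (b - a) - \<beta> * (V b - V a)"
proof (rule field_le_epsilon)
  fix e0 :: real assume e0: "e0 > 0"
  have G0: "\<Gamma> \<ge> 0" using G[of a] ab by simp
  \<comment> \<open>The total coefficient of \<open>e\<close> after summation over the partition:
    one \<open>K * (b - a)\<close> and one variation from the mean value error, a second variation
    from freezing the gradient in \<open>R\<close>. The added 1 allows division.\<close>
  define Z where "Z = K * (b - a) + 2 * (V b - V a) + 1"
  have Kn: "0 \<le> K * (b - a)" using vK[of a b] ab norm_ge_zero[of "v b - v a"] by linarith
  have Vn: "0 \<le> V b - V a" using V[of a b] ab norm_ge_zero[of "l b - l a"] by linarith
  have Z: "Z > 0" using Kn Vn by (simp add: Z_def)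
  define e where "e = e0 / Z"
  have e: "e > 0" using e0 Z by (simp add: e_def)
  have "bounded (x ` {a..b})" using cx by (intro compact_imp_bounded compact_continuous_image) auto
  then obtain Q where Q: "\<And>r. a \<le> r \<Longrightarrow> r \<le> b \<Longrightarrow> x r \<in> cball 0 Q"
    unfolding bounded_iff by (metis atLeastAtMost_iff imageI mem_cball_0)
  have "uniformly_continuous_on (cball 0 Q) g"
    by (rule compact_uniformly_continuous) (auto intro: continuous_on_subset[OF g])
  then obtain d where d: "d > 0" "\<And>p q. p \<in> cball 0 Q \<Longrightarrow> q \<in> cball 0 Q \<Longrightarrow> dist q p < d \<Longrightarrow> dist (g q) (g p) < e"
    using e unfolding uniformly_continuous_on_def by metis
  have "uniformly_continuous_on {a..b} x" using cx by (intro compact_uniformly_continuous) auto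
  then obtain c where c: "c > 0" "\<And>p q. p \<in> {a..b} \<Longrightarrow> q \<in> {a..b} \<Longrightarrow> dist q p < c \<Longrightarrow> dist (x q) (x p) < d"
    using d(1) unfolding uniformly_continuous_on_def by metis
  obtain N :: nat where N: "(b - a) / c < real N" "N > 0"
  proof -
    obtain N :: nat where N: "(b - a) / c < real N" using reals_Archimedean2 by blast
    moreover have "0 \<le> (b - a) / c" using ab c(1) by simp
    ultimately have "N > 0" by (cases N) auto
    with N show ?thesis using that by blast
  qed
  have Nc: "(b - a) / real N < c" using N c(1) by (simp add: field_simps)
  define r where "r = (\<lambda>i::nat. a + real i * ((b - a) / real N))"
  have r0: "r 0 = a" and rN: "r N = b" using N by (simp_all add: r_def)
  have rS: "r i \<le> r (Suc i)" "r (Suc i) - r i = (b - a) / real N" for i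
    using ab by (simp_all add: r_def algebra_simps add_divide_distrib diff_divide_distrib divide_right_mono)
  have rab: "a \<le> r i" "r i \<le> b" if "i \<le> N" for i
  proof -
    show "a \<le> r i" using ab by (simp add: r_def)
    have "real i * ((b - a) / real N) \<le> real N * ((b - a) / real N)" using that ab by (intro mult_right_mono) auto
    then show "r i \<le> b" using N by (simp add: r_def)
  qed
  have step: "F (x t) - F (x s) \<le> g (x a) \<bullet> (v t - v s) + (\<Gamma> + e) * (K * (t - s)) + (2 * e - \<beta>) * (V t - V s)"
    if s: "a \<le> s" "s \<le> t" "t \<le> b" "t - s < c" for s t
  proof -
    have osc: "dist (x q) (x s) < d" if "s \<le> q" "q \<le> t" for q
      using c(2)[of s q] that s by (auto simp: dist_real_def)
    have gosc: "norm (g q - g (x s)) \<le> e" if "q \<in> closed_segment (x s) (x t)" for q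
    proof -
      have "closed_segment (x s) (x t) \<subseteq> cball 0 Q \<inter> ball (x s) d"
        using Q[of s] Q[of t] s osc[of t] d(1) by (intro closed_segment_subset) (auto simp: dist_commute convex_Int)
      then have "q \<in> cball 0 Q" "dist q (x s) < d" using that by (auto simp: dist_commute)
      then show ?thesis using d(2)[of "x s" q] Q[of s] s by (auto simp: dist_norm less_imp_le)
    qed
    define f where "f = (\<lambda>q. F q - g (x s) \<bullet> q)"
    have "norm (f (x t) - f (x s)) \<le> e * norm (x t - x s)"
    proof (rule differentiable_bound[of "closed_segment (x s) (x t)"])
      fix q assume q: "q \<in> closed_segment (x s) (x t)"
      show "(f has_derivative (\<lambda>h. g q \<bullet> h - g (x s) \<bullet> h)) (at q within closed_segment (x s) (x t))"
        unfolding f_def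
        by (rule has_derivative_diff[OF has_derivative_at_withinI[OF F]]) (auto intro!: derivative_eq_intros)
      show "onorm (\<lambda>h. g q \<bullet> h - g (x s) \<bullet> h) \<le> e"
      proof (rule onorm_bound)
        fix h
        have "\<bar>(g q - g (x s)) \<bullet> h\<bar> \<le> norm (g q - g (x s)) * norm h" by (rule Cauchy_Schwarz_ineq2)
        also have "\<dots> \<le> e * norm h" using gosc[OF q] by (intro mult_right_mono) auto
        finally show "norm (g q \<bullet> h - g (x s) \<bullet> h) \<le> e * norm h" by (simp add: inner_diff_left)
      qed (use e in auto)
    qed auto
    also have "\<dots> \<le> e * (K * (t - s) + (V t - V s))"
      using V[of s t] vK[of s t] xv[of s t] s e norm_triangle_ineq[of "v t - v s" "l t - l s"]
      by (intro mult_left_mono) auto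
    finally have 1: "F (x t) - F (x s) \<le> g (x s) \<bullet> (x t - x s) + e * (K * (t - s) + (V t - V s))"
      by (simp add: f_def inner_diff_right)
    have "(g (x s) - g (x a)) \<bullet> (v t - v s) \<le> norm (g (x s) - g (x a)) * norm (v t - v s)"
      by (rule norm_cauchy_schwarz)
    also have "\<dots> \<le> \<Gamma> * (K * (t - s))" using G[of s] vK[of s t] s G0 by (intro mult_mono) auto
    finally have 2: "g (x s) \<bullet> (v t - v s) \<le> g (x a) \<bullet> (v t - v s) + \<Gamma> * (K * (t - s))"
      by (simp add: inner_diff_left)
    have "(\<beta> - e) * (V t - V s) \<le> (- g (x s)) \<bullet> (l t - l s)"
    proof (rule R)
      fix q w assume q: "s \<le> q" "q \<le> t" and w: "x q \<in> frontier D" "w \<in> \<nu> (x q)"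
      have "\<bar>(g (x q) - g (x s)) \<bullet> w\<bar> \<le> norm (g (x q) - g (x s)) * norm w" by (rule Cauchy_Schwarz_ineq2)
      also have "\<dots> \<le> e"
        using nu[OF w] d(2)[of "x s" "x q"] Q[of s] Q[of q] osc[OF q] q s
        by (simp add: dist_norm)
      finally show "\<beta> - e \<le> - g (x s) \<bullet> w" using gb[OF w] by (simp add: inner_diff_left abs_le_iff)
    qed (use s in auto)
    then have "g (x s) \<bullet> (l t - l s) \<le> (e - \<beta>) * (V t - V s)" by (simp add: algebra_simps)
    moreover have "g (x s) \<bullet> (x t - x s) = g (x s) \<bullet> (v t - v s) + g (x s) \<bullet> (l t - l s)"
      using xv[of s t] s by (simp add: inner_add_right)
    ultimately show ?thesis using 1 2 by (simp add: algebra_simps)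
  qed
  have ind: "F (x (r i)) - F (x a) \<le> g (x a) \<bullet> (v (r i) - v a) + (\<Gamma> + e) * (K * (r i - a)) + (2 * e - \<beta>) * (V (r i) - V a)"
    if "i \<le> N" for i
    using that
  proof (induction i)
    case (Suc i)
    have "F (x (r (Suc i))) - F (x (r i)) \<le> g (x a) \<bullet> (v (r (Suc i)) - v (r i)) + (\<Gamma> + e) * (K * (r (Suc i) - r i))
            + (2 * e - \<beta>) * (V (r (Suc i)) - V (r i))"
      using Suc.prems rab[of i] rab[of "Suc i"] rS[of i] Nc by (intro step) auto
    with Suc show ?case by (simp add: algebra_simps inner_diff_right)
  qed (simp add: r0)
  have "F (x b) - F (x a) \<le> g (x a) \<bullet> (v b - v a) + (\<Gamma> + e) * (K * (b - a)) + (2 * e - \<beta>) * (V b - V a)"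
    using ind[of N] rN by simp
  also have "\<dots> \<le> g (x a) \<bullet> (v b - v a) + \<Gamma> * K * (b - a) - \<beta> * (V b - V a) + e * Z"
    using e by (simp add: Z_def algebra_simps)
  also have "e * Z = e0" using Z by (simp add: e_def)
  finally show "F (x b) - F (x a) \<le> g (x a) \<bullet> (v b - v a) + \<Gamma> * K * (b - a) - \<beta> * (V b - V a) + e0" .
qed

section \<open>Events of probability close to one\<close>

context prob_space
begin

text \<open>The exceptional set is only required to be covered by an event of small probability.
  Thus \<open>P\<close> may speak of suprema over all times, of continuity or of total
  variations.\<close>

definition whp :: "(nat \<Rightarrow> 'a \<Rightarrow> bool) \<Rightarrow> bool" where
  "whp P \<longleftrightarrow> (\<forall>\<epsilon>>0. \<forall>\<^sub>F n in sequentially. \<exists>A\<in>events. prob A \<le> \<epsilon> \<and> (\<forall>\<omega>\<in>space M - A. P n \<omega>))"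

definition bounded_whp :: "(nat \<Rightarrow> 'a \<Rightarrow> real) \<Rightarrow> bool" where
  "bounded_whp Z \<longleftrightarrow> (\<forall>\<epsilon>>0. \<exists>R. \<forall>\<^sub>F n in sequentially. \<exists>A\<in>events. prob A \<le> \<epsilon> \<and> (\<forall>\<omega>\<in>space M - A. Z n \<omega> \<le> R))"

lemma whpD:
  "whp P \<Longrightarrow> \<epsilon> > 0 \<Longrightarrow>
    \<forall>\<^sub>F n in sequentially. \<exists>A\<in>events. prob A \<le> \<epsilon> \<and> (\<forall>\<omega>\<in>space M - A. P n \<omega>)"
  by (simp add: whp_def)

lemma bounded_whpE:
  assumes "bounded_whp Z" "\<epsilon> > 0"
  obtains R where "\<forall>\<^sub>F n in sequentially. \<exists>A\<in>events. prob A \<le> \<epsilon> \<and> (\<forall>\<omega>\<in>space M - A. Z n \<omega> \<le> R)"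
  using assms unfolding bounded_whp_def by blast

lemma whp_conj:
  assumes "whp P" "whp Q" shows "whp (\<lambda>n \<omega>. P n \<omega> \<and> Q n \<omega>)"
  unfolding whp_def
proof (intro allI impI)
  fix e :: real assume e: "e > 0"
  have "\<forall>\<^sub>F n in sequentially. \<exists>A\<in>events. prob A \<le> e / 2 \<and> (\<forall>\<omega>\<in>space M - A. P n \<omega>)"
       "\<forall>\<^sub>F n in sequentially. \<exists>A\<in>events. prob A \<le> e / 2 \<and> (\<forall>\<omega>\<in>space M - A. Q n \<omega>)"
    using whpD[OF assms(1), of "e / 2"] whpD[OF assms(2), of "e / 2"] e by simp_all
  then show "\<forall>\<^sub>F n in sequentially. \<exists>A\<in>events. prob A \<le> e \<and> (\<forall>\<omega>\<in>space M - A. P n \<omega> \<and> Q n \<omega>)"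
  proof eventually_elim
    case (elim n)
    then obtain A B where AB: "A \<in> events" "B \<in> events" "prob A \<le> e / 2" "prob B \<le> e / 2"
      "\<forall>\<omega>\<in>space M - A. P n \<omega>" "\<forall>\<omega>\<in>space M - B. Q n \<omega>" by blast
    then have "prob (A \<union> B) \<le> e" using measure_Un_le[of A M B] by simp
    then show ?case using AB by (intro bexI[of _ "A \<union> B"]) auto
  qed
qed

lemma whp_mono:
  assumes "whp P" "\<And>n \<omega>. \<omega> \<in> space M \<Longrightarrow> P n \<omega> \<Longrightarrow> Q n \<omega>" shows "whp Q"
  unfolding whp_def
proof (intro allI impI)
  fix e :: real assume e: "e > 0"
  with assms(1) have "\<forall>\<^sub>F n in sequentially. \<exists>A\<in>events. prob A \<le> e \<and> (\<forall>\<omega>\<in>space M - A. P n \<omega>)"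
    unfolding whp_def by blast
  then show "\<forall>\<^sub>F n in sequentially. \<exists>A\<in>events. prob A \<le> e \<and> (\<forall>\<omega>\<in>space M - A. Q n \<omega>)"
    by eventually_elim (use assms(2) in blast)
qed

lemma whp_AE:
  assumes "\<And>n. AE \<omega> in M. P n \<omega>" shows "whp P"
  unfolding whp_def
proof (intro allI impI always_eventually)
  fix e :: real and n assume e: "e > 0"
  from assms[of n] obtain N where "{\<omega>\<in>space M. \<not> P n \<omega>} \<subseteq> N" "emeasure M N = 0" "N \<in> events"
    by (rule AE_E)
  then show "\<exists>A\<in>events. prob A \<le> e \<and> (\<forall>\<omega>\<in>space M - A. P n \<omega>)"
    using e by (intro bexI[of _ N]) (auto simp: measure_def)
qed

lemma whp_eventually:
  assumes "\<forall>\<^sub>F n in sequentially. P n" shows "whp (\<lambda>n \<omega>. P n)"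
  unfolding whp_def
proof (intro allI impI)
  fix e :: real assume e: "e > 0"
  show "\<forall>\<^sub>F n in sequentially. \<exists>A\<in>events. prob A \<le> e \<and> (\<forall>\<omega>\<in>space M - A. P n)"
    using assms by eventually_elim (use e in \<open>auto intro!: bexI[of _ "{}"]\<close>)
qed

lemma whp_incseq:
  assumes E: "\<And>n. E n \<in> events" "incseq E" and ae: "AE \<omega> in M. \<exists>n. \<omega> \<in> E n"
  shows "whp (\<lambda>n \<omega>. \<omega> \<in> E n)"
  unfolding whp_def
proof (intro allI impI)
  fix e :: real assume e: "e > 0"
  have "(\<lambda>n. prob (E n)) \<longlonglongrightarrow> prob (\<Union>n. E n)"
    using E by (intro finite_Lim_measure_incseq) auto
  moreover have "prob (\<Union>n. E n) = 1" using E ae by (subst prob_eq_1) auto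
  ultimately have "\<forall>\<^sub>F n in sequentially. prob (E n) > 1 - e"
    using e by (intro order_tendstoD) auto
  then show "\<forall>\<^sub>F n in sequentially. \<exists>A\<in>events. prob A \<le> e \<and> (\<forall>\<omega>\<in>space M - A. \<omega> \<in> E n)"
  proof eventually_elim
    case (elim n)
    then show ?case using E by (intro bexI[of _ "space M - E n"]) (auto simp: prob_compl)
  qed
qed

text \<open>Localization: a claim may be proved under an arbitrary fixed bound \<open>R\<close> for
  a quantity that is bounded in probability, and the constants chosen in that proof may depend on
  \<open>R\<close>.\<close>

lemma whp_if_bounded:
  assumes "bounded_whp Z" "\<And>R. whp (\<lambda>n \<omega>. Z n \<omega> \<le> R \<longrightarrow> P n \<omega>)" shows "whp P"
  unfolding whp_def
proof (intro allI impI)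
  fix e :: real assume e: "e > 0"
  obtain R where "\<forall>\<^sub>F n in sequentially. \<exists>A\<in>events. prob A \<le> e / 2 \<and> (\<forall>\<omega>\<in>space M - A. Z n \<omega> \<le> R)"
    using bounded_whpE[OF assms(1), of "e / 2"] e by auto
  moreover have "\<forall>\<^sub>F n in sequentially. \<exists>A\<in>events. prob A \<le> e / 2 \<and> (\<forall>\<omega>\<in>space M - A. Z n \<omega> \<le> R \<longrightarrow> P n \<omega>)"
    using whpD[OF assms(2), of "e / 2" R] e by simp
  ultimately show "\<forall>\<^sub>F n in sequentially. \<exists>A\<in>events. prob A \<le> e \<and> (\<forall>\<omega>\<in>space M - A. P n \<omega>)"
  proof eventually_elim
    case (elim n)
    then obtain A B where AB: "A \<in> events" "B \<in> events" "prob A \<le> e / 2" "prob B \<le> e / 2"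
      "\<forall>\<omega>\<in>space M - A. Z n \<omega> \<le> R" "\<forall>\<omega>\<in>space M - B. Z n \<omega> \<le> R \<longrightarrow> P n \<omega>" by blast
    then have "prob (A \<union> B) \<le> e" using measure_Un_le[of A M B] by simp
    then show ?case using AB by (intro bexI[of _ "A \<union> B"]) auto
  qed
qed

lemma bounded_whp_whp:
  assumes "bounded_whp Z" "whp (\<lambda>n \<omega>. Y n \<omega> \<le> f (Z n \<omega>))" "mono f" shows "bounded_whp Y"
  unfolding bounded_whp_def
proof (intro allI impI)
  fix e :: real assume e: "e > 0"
  obtain R where "\<forall>\<^sub>F n in sequentially. \<exists>A\<in>events. prob A \<le> e / 2 \<and> (\<forall>\<omega>\<in>space M - A. Z n \<omega> \<le> R)"
    using bounded_whpE[OF assms(1), of "e / 2"] e by auto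
  moreover have "\<forall>\<^sub>F n in sequentially. \<exists>A\<in>events. prob A \<le> e / 2 \<and> (\<forall>\<omega>\<in>space M - A. Y n \<omega> \<le> f (Z n \<omega>))"
    using whpD[OF assms(2), of "e / 2"] e by simp
  ultimately have "\<forall>\<^sub>F n in sequentially. \<exists>A\<in>events. prob A \<le> e \<and> (\<forall>\<omega>\<in>space M - A. Y n \<omega> \<le> f R)"
  proof eventually_elim
    case (elim n)
    then obtain A B where AB: "A \<in> events" "B \<in> events" "prob A \<le> e / 2" "prob B \<le> e / 2"
      "\<forall>\<omega>\<in>space M - A. Z n \<omega> \<le> R" "\<forall>\<omega>\<in>space M - B. Y n \<omega> \<le> f (Z n \<omega>)" by blast
    then have "prob (A \<union> B) \<le> e" using measure_Un_le[of A M B] by simp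
    moreover have "Y n \<omega> \<le> f R" if "\<omega> \<in> space M - (A \<union> B)" for \<omega>
      using AB(5,6) that monoD[OF assms(3), of "Z n \<omega>" R] order_trans[of "Y n \<omega>" "f (Z n \<omega>)" "f R"] by auto
    ultimately show ?case using AB by (intro bexI[of _ "A \<union> B"]) auto
  qed
  then show "\<exists>R. \<forall>\<^sub>F n in sequentially. \<exists>A\<in>events. prob A \<le> e \<and> (\<forall>\<omega>\<in>space M - A. Y n \<omega> \<le> R)" by blast
qed

lemma bounded_whp_expectation:
  assumes "\<And>n. integrable M (Z n)" "\<And>n \<omega>. \<omega> \<in> space M \<Longrightarrow> 0 \<le> Z n \<omega>" "\<And>n. expectation (Z n) \<le> c"
  shows "bounded_whp Z"
  unfolding bounded_whp_def
proof (intro allI impI)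
  fix e :: real assume e: "e > 0"
  define R where "R = (\<bar>c\<bar> + 1) / e"
  have R: "R > 0" using e by (simp add: R_def add_pos_nonneg)
  have "\<exists>A\<in>events. prob A \<le> e \<and> (\<forall>\<omega>\<in>space M - A. Z n \<omega> \<le> R)" for n
  proof (rule bexI[of _ "{\<omega>\<in>space M. R \<le> Z n \<omega>}"])
    have "prob {\<omega>\<in>space M. R \<le> Z n \<omega>} \<le> expectation (Z n) / R"
      using assms R by (intro integral_Markov_inequality_measure[where A = "{}", OF assms(1)]) auto
    also have "\<dots> \<le> (\<bar>c\<bar> + 1) / R" using assms(3)[of n] R by (intro divide_right_mono) auto
    also have "\<dots> = e" using R e by (simp add: R_def)
    finally show "prob {\<omega>\<in>space M. R \<le> Z n \<omega>} \<le> e \<and> (\<forall>\<omega>\<in>space M - {\<omega>\<in>space M. R \<le> Z n \<omega>}. Z n \<omega> \<le> R)"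
      by auto
    show "{\<omega>\<in>space M. R \<le> Z n \<omega>} \<in> events" using assms(1)[of n] by measurable
  qed
  then show "\<exists>R. \<forall>\<^sub>F n in sequentially. \<exists>A\<in>events. prob A \<le> e \<and> (\<forall>\<omega>\<in>space M - A. Z n \<omega> \<le> R)"
    by (intro exI[of _ R] always_eventually allI)
qed

text \<open>Restricted to rational times the condition is measurable, and by uniform continuity of
  almost every path the resulting events increase to a set of full measure. Continuity then carries
  the bound over to real times.\<close>

lemma whp_modulus_of_continuity:
  fixes Z :: "real \<Rightarrow> 'a \<Rightarrow> 'b::euclidean_space"
  assumes [measurable]: "\<And>t. Z t \<in> borel_measurable M"
    and cont: "AE \<omega> in M. continuous_on {0..} (\<lambda>t. Z t \<omega>)" and e: "e > 0"
  shows "whp (\<lambda>n \<omega>. \<forall>s t. 0 \<le> s \<longrightarrow> s \<le> T \<longrightarrow> 0 \<le> t \<longrightarrow> t \<le> T \<longrightarrow> \<bar>s - t\<bar> \<le> 1 / 2^n \<longrightarrow> norm (Z s \<omega> - Z t \<omega>) \<le> e)"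
proof -
  define S where "S = \<rat> \<inter> {0..T+1}"
  have cS: "countable S" unfolding S_def by (intro countable_Int1 countable_rat)
  \<comment> \<open>Twice the target distance, together with times up to \<open>T + 1\<close>,
    leaves room for approximating real times by rational times from the right.\<close>
  define E where "E = (\<lambda>n::nat. {\<omega>\<in>space M. \<forall>s\<in>S. \<forall>t\<in>S. \<bar>s - t\<bar> < 2 / 2^n \<longrightarrow> norm (Z s \<omega> - Z t \<omega>) \<le> e})"
  have meas: "E n \<in> events" for n
    unfolding E_def using cS by measurable
  have inc: "incseq E"
  proof (rule incseq_SucI)
    fix n
    have "(2::real) / 2 ^ Suc n \<le> 2 / 2^n" by (intro divide_left_mono) auto
    then show "E n \<le> E (Suc n)" unfolding E_def by fastforce
  qed
  have ae: "AE \<omega> in M. \<exists>n. \<omega> \<in> E n"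
    using cont AE_space
  proof eventually_elim
    case (elim \<omega>)
    have "uniformly_continuous_on {0..T+1} (\<lambda>t. Z t \<omega>)"
      by (intro compact_uniformly_continuous continuous_on_subset[OF elim(1)]) auto
    then obtain d where d: "d > 0" "\<And>p q. p \<in> {0..T+1} \<Longrightarrow> q \<in> {0..T+1} \<Longrightarrow> dist q p < d \<Longrightarrow> dist (Z q \<omega>) (Z p \<omega>) < e"
      using e unfolding uniformly_continuous_on_def by metis
    obtain n where n: "2 / d < 2 ^ n" using real_arch_pow[of 2 "2 / d"] by auto
    then have "2 / 2 ^ n < d" using d(1) by (simp add: field_simps)
    then have "\<omega> \<in> E n" using elim(2) d(2) unfolding E_def S_def
      by (fastforce simp: dist_norm intro: less_imp_le)
    then show ?case by blast
  qed
  have "whp (\<lambda>n \<omega>. \<omega> \<in> E n \<and> continuous_on {0..} (\<lambda>t. Z t \<omega>))"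
    by (intro whp_conj whp_incseq[OF meas inc ae] whp_AE cont)
  then show ?thesis
  proof (rule whp_mono, intro allI impI)
    fix n \<omega> s t
    assume w: "\<omega> \<in> E n \<and> continuous_on {0..} (\<lambda>t. Z t \<omega>)"
      and st: "0 \<le> s" "s \<le> T" "0 \<le> t" "t \<le> T" "\<bar>s - t\<bar> \<le> 1 / 2^n"
    have approx: "\<exists>u. (\<forall>i. u i \<in> S) \<and> u \<longlonglongrightarrow> r" if "0 \<le> r" "r \<le> T" for r
    proof -
      have "\<exists>q\<in>\<rat>. r < q \<and> q < r + 1 / real (Suc i)" for i by (rule Rats_dense_in_real) simp
      then obtain u where u: "\<And>i. u i \<in> \<rat> \<and> r < u i \<and> u i < r + 1 / real (Suc i)" by metis
      have "(\<lambda>i. r + 1 / real (Suc i)) \<longlonglongrightarrow> r + 0"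
        by (intro tendsto_intros LIMSEQ_Suc[OF lim_1_over_n])
      then have "u \<longlonglongrightarrow> r"
        using u by (intro tendsto_sandwich[of "\<lambda>_. r" u sequentially "\<lambda>i. r + 1 / real (Suc i)" r]) (auto simp: less_imp_le)
      moreover have "u i \<in> S" for i
      proof -
        have "1 / real (Suc i) \<le> 1" by simp
        then have "u i \<le> T + 1" using u[of i] that by linarith
        then show ?thesis using u[of i] that unfolding S_def by (auto intro: less_imp_le)
      qed
      ultimately show ?thesis by blast
    qed
    obtain u v where u: "\<And>i. u i \<in> S" "u \<longlonglongrightarrow> s" and v: "\<And>i. v i \<in> S" "v \<longlonglongrightarrow> t"
      using approx[of s] approx[of t] st by blast
    have lim: "(\<lambda>i. Z (a i) \<omega>) \<longlonglongrightarrow> Z r \<omega>" if "\<And>i. a i \<in> S" "a \<longlonglongrightarrow> r" "0 \<le> r" for a r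
      using w[THEN conjunct2, unfolded continuous_on_sequentially comp_def] that unfolding S_def by auto
    have "(\<lambda>i. \<bar>u i - v i\<bar>) \<longlonglongrightarrow> \<bar>s - t\<bar>" by (intro tendsto_intros u v)
    moreover have "\<bar>s - t\<bar> < 2 / 2 ^ n" using st(5) by (rule le_less_trans) (simp add: field_simps)
    ultimately have "\<forall>\<^sub>F i in sequentially. \<bar>u i - v i\<bar> < 2 / 2 ^ n" by (rule order_tendstoD)
    then have "\<forall>\<^sub>F i in sequentially. norm (Z (u i) \<omega> - Z (v i) \<omega>) \<le> e"
      by eventually_elim (use w u v in \<open>auto simp: E_def\<close>)
    then show "norm (Z s \<omega> - Z t \<omega>) \<le> e"
      by (intro tendsto_upperbound[OF _ _ sequentially_bot]) (auto intro!: tendsto_intros lim u v st)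
  qed
qed

lemma expectation_tends_to_zero_if_whp:
  fixes f :: "nat \<Rightarrow> 'a \<Rightarrow> real"
  assumes "\<And>\<eta>. \<eta> > 0 \<Longrightarrow> whp (\<lambda>n \<omega>. f n \<omega> \<le> \<eta>)"
    and "\<And>n. AE \<omega> in M. 0 \<le> f n \<omega> \<and> f n \<omega> \<le> B" and p: "p > 0"
  shows "(\<lambda>n. \<integral>\<^sup>+ \<omega>. ennreal (f n \<omega> powr p) \<partial>M) \<longlonglongrightarrow> 0"
proof (rule tendsto_zero_ennreal)
  fix r :: real assume r: "r > 0"
  \<comment> \<open>Outside the exceptional event the integrand is at most
    \<open>\<eta> powr p = r / 3\<close>; the event itself contributes at most
    \<open>B' * \<epsilon> = r / 3\<close>.\<close>
  define \<eta> where "\<eta> = (r / 3) powr (1 / p)"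
  have eta: "\<eta> > 0" "\<eta> powr p = r / 3" using r p by (auto simp: \<eta>_def powr_powr)
  define B' where "B' = (max B 1) powr p"
  have B': "B' > 0" by (simp add: B'_def)
  define \<epsilon> where "\<epsilon> = r / (3 * B')"
  have eps: "\<epsilon> > 0" using r B' by (simp add: \<epsilon>_def)
  have "\<forall>\<^sub>F n in sequentially. \<exists>A\<in>events. prob A \<le> \<epsilon> \<and> (\<forall>\<omega>\<in>space M - A. f n \<omega> \<le> \<eta>)"
    using assms(1)[OF eta(1)] eps unfolding whp_def by blast
  then show "\<forall>\<^sub>F n in sequentially. (\<integral>\<^sup>+ \<omega>. ennreal (f n \<omega> powr p) \<partial>M) < ennreal r"
  proof eventually_elim
    case (elim n)
    then obtain A where A[measurable]: "A \<in> events" and pA: "prob A \<le> \<epsilon>" and f: "\<forall>\<omega>\<in>space M - A. f n \<omega> \<le> \<eta>" by blast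
    have "(\<integral>\<^sup>+ \<omega>. ennreal (f n \<omega> powr p) \<partial>M) \<le> (\<integral>\<^sup>+ \<omega>. ennreal (\<eta> powr p) + ennreal B' * indicator A \<omega> \<partial>M)"
    proof (rule nn_integral_mono_AE)
      show "AE \<omega> in M. ennreal (f n \<omega> powr p) \<le> ennreal (\<eta> powr p) + ennreal B' * indicator A \<omega>"
        using assms(2)[of n] AE_space
      proof eventually_elim
        case (elim \<omega>)
        show ?case
        proof (cases "\<omega> \<in> A")
          case True
          have "f n \<omega> powr p \<le> B'" unfolding B'_def using elim p by (intro powr_mono2) auto
          then have "ennreal (f n \<omega> powr p) \<le> ennreal B'" by (rule ennreal_leI)
          then show ?thesis using True by (simp add: add_increasing)
        next
          case False
          have "f n \<omega> powr p \<le> \<eta> powr p" using elim p f False by (intro powr_mono2) auto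
          then show ?thesis using False by (simp add: ennreal_leI)
        qed
      qed
    qed
    also have "\<dots> = ennreal (\<eta> powr p) + ennreal B' * ennreal (prob A)"
      by (subst nn_integral_add) (auto simp: nn_integral_cmult emeasure_eq_measure prob_space)
    also have "\<dots> = ennreal (\<eta> powr p + B' * prob A)"
      using B' by (simp add: ennreal_plus ennreal_mult)
    also have "\<dots> \<le> ennreal (r / 3 + B' * \<epsilon>)"
      using pA B' eta(2) by (intro ennreal_leI add_mono mult_left_mono) auto
    also have "\<dots> < ennreal r" using B' r by (intro ennreal_lessI) (auto simp: \<epsilon>_def field_simps)
    finally show ?case .
  qed
qed

end

section \<open>Increments of Brownian motion\<close>

lemma norm_power2_vec: "(norm (x::real^'n))\<^sup>2 = (\<Sum>i\<in>UNIV. (x $ i)\<^sup>2)"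
  unfolding power2_norm_eq_inner inner_vec_def by (simp add: power2_eq_square)

lemma vec_nth_borel [measurable]: "(\<lambda>x::real^'n. x $ i) \<in> borel_measurable borel"
  by (intro borel_measurable_continuous_onI continuous_intros)

locale filtered_brownian_motion =
  fixes M :: "'a measure" and F :: "real \<Rightarrow> 'a measure" and W :: "real \<Rightarrow> 'a \<Rightarrow> real^'m"
  assumes complete_filtered: "complete_filtered_prob_space M F" and brownian: "brownian_motion M F W"
begin

sublocale prob_space M
  using complete_filtered by (simp add: complete_filtered_prob_space_def)

lemma space_F [simp]: "space (F t) = space M"
  using complete_filtered by (simp add: complete_filtered_prob_space_def filtration.space_F)

lemma sets_F_subset: "sets (F t) \<subseteq> sets M"
  using complete_filtered by (simp add: complete_filtered_prob_space_def)

lemma sets_F_mono: "s \<le> t \<Longrightarrow> sets (F s) \<subseteq> sets (F t)"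
  using complete_filtered by (auto simp: complete_filtered_prob_space_def dest: filtration.sets_F_mono)

lemma measurable_F_M: "f \<in> measurable (F t) N \<Longrightarrow> f \<in> measurable M N"
  using sets_F_subset[of t] by (auto simp: measurable_def)

lemma measurable_F_mono: "f \<in> measurable (F s) N \<Longrightarrow> s \<le> t \<Longrightarrow> f \<in> measurable (F t) N"
  using sets_F_mono[of s t] by (auto simp: measurable_def)

lemma W_measurable_F: "W t \<in> borel_measurable (F t)"
  using brownian by (simp add: brownian_motion_def)

lemma W_measurable [measurable]: "W t \<in> borel_measurable M"
  by (rule measurable_F_M[OF W_measurable_F])

text \<open>Independence of \<open>F s\<close> and the increment passes to the sigma-algebras
  generated by \<open>f\<close> and by \<open>g\<close> of the increment, and independent integrable
  factors have multiplicative expectation. It is through this rule alone that independence from the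
  past enters.\<close>

lemma
  fixes g :: "real^'m \<Rightarrow> real"
  assumes st: "0 \<le> s" "s < t" and f: "f \<in> borel_measurable (F s)" "integrable M f"
    and g[measurable]: "g \<in> borel_measurable borel" and ig: "integrable M (\<lambda>\<omega>. g (W t \<omega> - W s \<omega>))"
  shows integrable_mult_increment: "integrable M (\<lambda>\<omega>. f \<omega> * g (W t \<omega> - W s \<omega>))"
    and expectation_mult_increment:
      "expectation (\<lambda>\<omega>. f \<omega> * g (W t \<omega> - W s \<omega>)) = expectation f * expectation (\<lambda>\<omega>. g (W t \<omega> - W s \<omega>))"
proof -
  let ?d = "\<lambda>\<omega>. W t \<omega> - W s \<omega>"
  let ?V = "vimage_algebra (space M) ?d borel"
  have ind: "indep_set (sets (F s)) (sets ?V)"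
    using brownian st by (simp add: brownian_motion_def)
  have dV: "?d \<in> measurable ?V borel" by (rule measurable_vimage_algebra1) auto
  then have gV: "(\<lambda>\<omega>. g (?d \<omega>)) \<in> borel_measurable ?V" by measurable
  have 1: "sigma_sets (space M) {f -` A \<inter> space M |A. A \<in> sets borel} \<subseteq> sets (F s)"
    using sets.sigma_sets_subset[of "{f -` A \<inter> space M |A. A \<in> sets borel}" "F s"] measurable_sets[OF f(1)] by auto
  have 2: "sigma_sets (space M) {(\<lambda>\<omega>. g (?d \<omega>)) -` A \<inter> space M |A. A \<in> sets borel} \<subseteq> sets ?V"
    using sets.sigma_sets_subset[of "{(\<lambda>\<omega>. g (?d \<omega>)) -` A \<inter> space M |A. A \<in> sets borel}" ?V] measurable_sets[OF gV]
    by auto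
  have "indep_var borel f borel (\<lambda>\<omega>. g (?d \<omega>))"
    unfolding indep_var_eq
  proof (intro conjI)
    show "random_variable borel f" by (rule measurable_F_M[OF f(1)])
    show "indep_set (sigma_sets (space M) {f -` A \<inter> space M |A. A \<in> sets borel})
        (sigma_sets (space M) {(\<lambda>\<omega>. g (?d \<omega>)) -` A \<inter> space M |A. A \<in> sets borel})"
      using ind unfolding indep_set_def
      by (rule indep_sets_mono_sets) (use 1 2 in \<open>auto split: bool.split\<close>)
  qed measurable
  then show "integrable M (\<lambda>\<omega>. f \<omega> * g (?d \<omega>))"
    "expectation (\<lambda>\<omega>. f \<omega> * g (?d \<omega>)) = expectation f * expectation (\<lambda>\<omega>. g (?d \<omega>))"
    using f(2) ig by (auto intro!: indep_var_integrable indep_var_lebesgue_integral)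
qed

context
  fixes s t :: real
  assumes s0: "0 \<le> s" and st: "s < t"
begin

lemma distributed_increment:
  "distributed M lborel (\<lambda>\<omega>. (W t \<omega> - W s \<omega>) $ j) (normal_density 0 (sqrt (t - s)))"
  using brownian s0 st by (simp add: brownian_motion_def)

lemma integrable_increment_power: "integrable M (\<lambda>\<omega>. ((W t \<omega> - W s \<omega>) $ j) ^ k)"
  using distributed_integrable[OF distributed_increment[of j], of "\<lambda>x. x ^ k"]
    integrable_normal_moment[of "sqrt (t - s)" 0 k] st by simp

lemma expectation_increment: "expectation (\<lambda>\<omega>. (W t \<omega> - W s \<omega>) $ j) = 0"
  using distributed_integral[OF distributed_increment[of j], of "\<lambda>x. x"]
    integral_normal_moment_odd[of "sqrt (t - s)" 0 0] st by simp

lemma expectation_increment_power2: "expectation (\<lambda>\<omega>. ((W t \<omega> - W s \<omega>) $ j)\<^sup>2) = t - s"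
  using distributed_integral[OF distributed_increment[of j], of "\<lambda>x. x\<^sup>2"]
    integral_normal_moment_even[of "sqrt (t - s)" 0 1] st by simp

lemma expectation_increment_power4: "expectation (\<lambda>\<omega>. ((W t \<omega> - W s \<omega>) $ j) ^ 4) = 3 * (t - s)\<^sup>2"
  using distributed_integral[OF distributed_increment[of j], of "\<lambda>x. x ^ 4"]
    integral_normal_moment_even[of "sqrt (t - s)" 0 2] st
  by (simp add: fact_numeral field_simps power2_eq_square)

lemma
  shows integrable_increment_prod: "integrable M (\<lambda>\<omega>. (W t \<omega> - W s \<omega>) $ i * (W t \<omega> - W s \<omega>) $ j)"
    and expectation_increment_prod:
      "expectation (\<lambda>\<omega>. (W t \<omega> - W s \<omega>) $ i * (W t \<omega> - W s \<omega>) $ j) = (if i = j then t - s else 0)"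
proof -
  let ?D = "\<lambda>j \<omega>. (W t \<omega> - W s \<omega>) $ j"
  have i1: "integrable M (?D j)" for j using integrable_increment_power[of j 1] by simp
  have "integrable M (\<lambda>\<omega>. ?D i \<omega> * ?D j \<omega>) \<and> expectation (\<lambda>\<omega>. ?D i \<omega> * ?D j \<omega>) = (if i = j then t - s else 0)"
  proof (cases "i = j")
    case True
    then show ?thesis using integrable_increment_power[of j 2] expectation_increment_power2[of j]
      by (simp add: power2_eq_square)
  next
    case False
    have "indep_vars (\<lambda>_. borel) ?D UNIV" using brownian s0 st by (simp add: brownian_motion_def)
    then have "indep_vars (\<lambda>_. borel) ?D (insert i {j})" by (rule indep_vars_subset) simp
    then have "indep_var borel (?D i) borel (\<lambda>\<omega>. \<Sum>j\<in>{j}. ?D j \<omega>)"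
      using False by (intro indep_vars_sum) auto
    then have iv: "indep_var borel (?D i) borel (?D j)" by simp
    show ?thesis using indep_var_integrable[OF iv i1 i1] indep_var_lebesgue_integral[OF iv i1 i1] False
      expectation_increment by simp
  qed
  then show "integrable M (\<lambda>\<omega>. ?D i \<omega> * ?D j \<omega>)" "expectation (\<lambda>\<omega>. ?D i \<omega> * ?D j \<omega>) = (if i = j then t - s else 0)"
    by auto
qed

lemma
  shows integrable_increment_norm2: "integrable M (\<lambda>\<omega>. (norm (W t \<omega> - W s \<omega>))\<^sup>2)"
    and expectation_increment_norm2: "expectation (\<lambda>\<omega>. (norm (W t \<omega> - W s \<omega>))\<^sup>2) = real CARD('m) * (t - s)"
  using expectation_increment_power2 integrable_increment_power[of _ 2]
  by (auto simp: norm_power2_vec)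

text \<open>Cauchy-Schwarz reduces the fourth power to the coordinates. The quadratic order in
  \<open>t - s\<close> matters: summed over a grid it still tends to 0, which later controls the
  largest increment.\<close>

lemma
  shows integrable_increment_norm4: "integrable M (\<lambda>\<omega>. (norm (W t \<omega> - W s \<omega>))^4)"
    and expectation_increment_norm4: "expectation (\<lambda>\<omega>. (norm (W t \<omega> - W s \<omega>))^4) \<le> 3 * (real CARD('m))\<^sup>2 * (t - s)\<^sup>2"
proof -
  let ?D = "\<lambda>\<omega>. W t \<omega> - W s \<omega>"
  have le: "(norm (?D \<omega>))^4 \<le> real CARD('m) * (\<Sum>i\<in>UNIV. (?D \<omega> $ i)^4)" for \<omega>
  proof -
    have "(norm (?D \<omega>))^4 = (\<Sum>i\<in>UNIV. (?D \<omega> $ i)\<^sup>2)\<^sup>2"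
      unfolding norm_power2_vec[symmetric] by simp
    also have "\<dots> = (\<Sum>i\<in>UNIV. 1 * (?D \<omega> $ i)\<^sup>2)\<^sup>2" by simp
    also have "\<dots> \<le> (\<Sum>i\<in>(UNIV::'m set). 1\<^sup>2) * (\<Sum>i\<in>UNIV. ((?D \<omega> $ i)\<^sup>2)\<^sup>2)"
      by (rule Cauchy_Schwarz_ineq_sum)
    finally show ?thesis by simp
  qed
  have int: "integrable M (\<lambda>\<omega>. real CARD('m) * (\<Sum>i\<in>UNIV. (?D \<omega> $ i)^4))"
    using integrable_increment_power[of _ 4] by auto
  show i4: "integrable M (\<lambda>\<omega>. (norm (?D \<omega>))^4)"
    by (rule Bochner_Integration.integrable_bound[OF int]) (use le in \<open>auto simp: sum_nonneg\<close>)
  have "expectation (\<lambda>\<omega>. (norm (?D \<omega>))^4) \<le> expectation (\<lambda>\<omega>. real CARD('m) * (\<Sum>i\<in>UNIV. (?D \<omega> $ i)^4))"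
    by (rule integral_mono[OF i4 int le])
  also have "\<dots> = 3 * (real CARD('m))\<^sup>2 * (t - s)\<^sup>2"
    using integrable_increment_power[of _ 4] expectation_increment_power4
    by (simp add: power2_eq_square)
  finally show "expectation (\<lambda>\<omega>. (norm (?D \<omega>))^4) \<le> 3 * (real CARD('m))\<^sup>2 * (t - s)\<^sup>2" .
qed

text \<open>Coefficients known at time \<open>s\<close> factor out of the expectation. Products of
  two coordinates of the increment have mean \<open>t - s\<close> on the diagonal and 0 off it, so
  the subtracted diagonal centers the quadratic part.\<close>

lemma
  assumes u: "\<And>i. u i \<in> borel_measurable (F s)" "\<And>i \<omega>. \<omega> \<in> space M \<Longrightarrow> \<bar>u i \<omega>\<bar> \<le> C"
    and A: "\<And>i j. A i j \<in> borel_measurable (F s)" "\<And>i j \<omega>. \<omega> \<in> space M \<Longrightarrow> \<bar>A i j \<omega>\<bar> \<le> C"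
  shows integrable_quadratic_increment: "integrable M (\<lambda>\<omega>. (\<Sum>i\<in>UNIV. u i \<omega> * (W t \<omega> - W s \<omega>) $ i) +
      (\<Sum>i\<in>UNIV. \<Sum>j\<in>UNIV. A i j \<omega> * ((W t \<omega> - W s \<omega>) $ i * (W t \<omega> - W s \<omega>) $ j - (if i = j then t - s else 0))))"
    and expectation_quadratic_increment: "expectation (\<lambda>\<omega>. (\<Sum>i\<in>UNIV. u i \<omega> * (W t \<omega> - W s \<omega>) $ i) +
      (\<Sum>i\<in>UNIV. \<Sum>j\<in>UNIV. A i j \<omega> * ((W t \<omega> - W s \<omega>) $ i * (W t \<omega> - W s \<omega>) $ j - (if i = j then t - s else 0)))) = 0"
proof -
  let ?D = "\<lambda>\<omega>. W t \<omega> - W s \<omega>"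
  have iu: "integrable M (u i)" for i
    by (rule integrable_const_bound[of _ C]) (use u measurable_F_M[OF u(1)] in auto)
  have iA: "integrable M (A i j)" for i j
    by (rule integrable_const_bound[of _ C]) (use A measurable_F_M[OF A(1)] in auto)
  have 1: "integrable M (\<lambda>\<omega>. u i \<omega> * ?D \<omega> $ i)" "expectation (\<lambda>\<omega>. u i \<omega> * ?D \<omega> $ i) = 0" for i
    using integrable_mult_increment[OF s0 st u(1) iu, of "\<lambda>x. x $ i"] integrable_increment_power[of i 1]
      expectation_mult_increment[OF s0 st u(1) iu, of "\<lambda>x. x $ i"] expectation_increment[of i] by auto
  have i0: "integrable M (\<lambda>\<omega>. ?D \<omega> $ i * ?D \<omega> $ j - (if i = j then t - s else 0))" for i j
    using integrable_increment_prod[of i j] by (intro Bochner_Integration.integrable_diff) auto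
  have e0: "expectation (\<lambda>\<omega>. ?D \<omega> $ i * ?D \<omega> $ j - (if i = j then t - s else 0)) = 0" for i j
    using integrable_increment_prod[of i j] expectation_increment_prod[of i j]
    by (subst Bochner_Integration.integral_diff) (auto simp: prob_space)
  have 2: "integrable M (\<lambda>\<omega>. A i j \<omega> * (?D \<omega> $ i * ?D \<omega> $ j - (if i = j then t - s else 0)))"
      "expectation (\<lambda>\<omega>. A i j \<omega> * (?D \<omega> $ i * ?D \<omega> $ j - (if i = j then t - s else 0))) = 0" for i j
  proof -
    let ?g = "\<lambda>x::real^'m. x $ i * x $ j - (if i = j then t - s else 0)"
    have g: "?g \<in> borel_measurable borel" by simp
    show "integrable M (\<lambda>\<omega>. A i j \<omega> * (?D \<omega> $ i * ?D \<omega> $ j - (if i = j then t - s else 0)))"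
      using integrable_mult_increment[OF s0 st A(1) iA g, of i j] i0[of i j] by simp
    show "expectation (\<lambda>\<omega>. A i j \<omega> * (?D \<omega> $ i * ?D \<omega> $ j - (if i = j then t - s else 0))) = 0"
      using expectation_mult_increment[OF s0 st A(1) iA g, of i j] i0[of i j] e0[of i j] by simp
  qed
  show "integrable M (\<lambda>\<omega>. (\<Sum>i\<in>UNIV. u i \<omega> * ?D \<omega> $ i) +
      (\<Sum>i\<in>UNIV. \<Sum>j\<in>UNIV. A i j \<omega> * (?D \<omega> $ i * ?D \<omega> $ j - (if i = j then t - s else 0))))"
    by (intro Bochner_Integration.integrable_add Bochner_Integration.integrable_sum 1 2)
  have "expectation (\<lambda>\<omega>. (\<Sum>i\<in>UNIV. u i \<omega> * ?D \<omega> $ i) +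
      (\<Sum>i\<in>UNIV. \<Sum>j\<in>UNIV. A i j \<omega> * (?D \<omega> $ i * ?D \<omega> $ j - (if i = j then t - s else 0))))
     = (\<Sum>i\<in>UNIV. expectation (\<lambda>\<omega>. u i \<omega> * ?D \<omega> $ i)) +
      (\<Sum>i\<in>UNIV. \<Sum>j\<in>UNIV. expectation (\<lambda>\<omega>. A i j \<omega> * (?D \<omega> $ i * ?D \<omega> $ j - (if i = j then t - s else 0))))"
    using 1 2 by (subst Bochner_Integration.integral_add
        Bochner_Integration.integral_sum | intro Bochner_Integration.integrable_sum | simp)+
  also have "\<dots> = 0" by (simp only: 1(2) 2(2)) simp
  finally show "expectation (\<lambda>\<omega>. (\<Sum>i\<in>UNIV. u i \<omega> * ?D \<omega> $ i) +
      (\<Sum>i\<in>UNIV. \<Sum>j\<in>UNIV. A i j \<omega> * (?D \<omega> $ i * ?D \<omega> $ j - (if i = j then t - s else 0)))) = 0" .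
qed

end

definition dW :: "nat \<Rightarrow> nat \<Rightarrow> 'a \<Rightarrow> real^'m" where
  "dW n k \<omega> = W (real (Suc k) / 2 ^ n) \<omega> - W (real k / 2 ^ n) \<omega>"

lemma grid_step: "(0::real) \<le> real k / 2 ^ n" "real k / 2 ^ n < real (Suc k) / 2 ^ n"
    "real (Suc k) / 2 ^ n - real k / 2 ^ n = 1 / 2 ^ n" "j \<le> k \<Longrightarrow> real j / 2 ^ n \<le> real k / 2 ^ n"
  by (auto simp: divide_strict_right_mono divide_right_mono add_divide_distrib)

lemma dW_measurable_F: "dW n k \<in> borel_measurable (F (real (Suc k) / 2 ^ n))"
proof -
  have "W (real k / 2 ^ n) \<in> borel_measurable (F (real (Suc k) / 2 ^ n))"
    by (rule measurable_F_mono[OF W_measurable_F]) (rule less_imp_le[OF grid_step(2)])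
  then show ?thesis unfolding dW_def using W_measurable_F by (intro borel_measurable_diff) auto
qed

lemma dW_measurable [measurable]: "dW n k \<in> borel_measurable M"
  by (rule measurable_F_M[OF dW_measurable_F])

lemma dW_measurable_F': "k < j \<Longrightarrow> dW n k \<in> borel_measurable (F (real j / 2 ^ n))"
  by (rule measurable_F_mono[OF dW_measurable_F]) (rule grid_step, simp)

lemma dW_norm2: "integrable M (\<lambda>\<omega>. (norm (dW n k \<omega>))\<^sup>2)"
    "expectation (\<lambda>\<omega>. (norm (dW n k \<omega>))\<^sup>2) = real CARD('m) / 2 ^ n"
  using integrable_increment_norm2[OF grid_step(1,2)[of k n]] expectation_increment_norm2[OF grid_step(1,2)[of k n]]
  unfolding dW_def[symmetric] grid_step(3) by auto

lemma dW_norm4: "integrable M (\<lambda>\<omega>. (norm (dW n k \<omega>))^4)"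
    "expectation (\<lambda>\<omega>. (norm (dW n k \<omega>))^4) \<le> 3 * (real CARD('m))\<^sup>2 * (1 / 2 ^ n)\<^sup>2"
  using integrable_increment_norm4[OF grid_step(1,2)[of k n]] expectation_increment_norm4[OF grid_step(1,2)[of k n]]
  unfolding dW_def[symmetric] grid_step(3) by auto

lemma sum_increments_measurable_F:
  assumes "\<And>j. \<xi> j \<in> borel_measurable (F (real j / 2 ^ n))"
  shows "(\<lambda>\<omega>. \<Sum>j<N. \<xi> j \<omega> \<bullet> dW n j \<omega>) \<in> borel_measurable (F (real N / 2 ^ n))"
proof (intro borel_measurable_sum borel_measurable_inner)
  fix j assume "j \<in> {..<N}"
  then show "\<xi> j \<in> borel_measurable (F (real N / 2 ^ n))" "dW n j \<in> borel_measurable (F (real N / 2 ^ n))"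
    by (auto intro!: measurable_F_mono[OF assms] grid_step(4) dW_measurable_F')
qed

text \<open>A discrete Ito isometry. The cross term vanishes because the partial sum and the next
  integrand are both known at the left end of the next interval, whose increment has mean 0.\<close>

lemma
  assumes xi: "\<And>j. \<xi> j \<in> borel_measurable (F (real j / 2 ^ n))"
    and C: "\<And>j \<omega>. \<omega> \<in> space M \<Longrightarrow> norm (\<xi> j \<omega>) \<le> C"
  shows square_integrable_sum_increments: "integrable M (\<lambda>\<omega>. (\<Sum>j<N. \<xi> j \<omega> \<bullet> dW n j \<omega>)\<^sup>2)"
    and isometry_sum_increments: "expectation (\<lambda>\<omega>. (\<Sum>j<N. \<xi> j \<omega> \<bullet> dW n j \<omega>)\<^sup>2) =
      (\<Sum>j<N. expectation (\<lambda>\<omega>. (norm (\<xi> j \<omega>))\<^sup>2) / 2 ^ n)"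
proof -
  have "integrable M (\<lambda>\<omega>. (\<Sum>j<N. \<xi> j \<omega> \<bullet> dW n j \<omega>)\<^sup>2) \<and>
    expectation (\<lambda>\<omega>. (\<Sum>j<N. \<xi> j \<omega> \<bullet> dW n j \<omega>)\<^sup>2) = (\<Sum>j<N. expectation (\<lambda>\<omega>. (norm (\<xi> j \<omega>))\<^sup>2) / 2 ^ n)"
  proof (induction N)
    case (Suc N)
    let ?S = "\<lambda>\<omega>. \<Sum>j<N. \<xi> j \<omega> \<bullet> dW n j \<omega>"
    let ?s = "real N / 2 ^ n" and ?t = "real (Suc N) / 2 ^ n"
    note g = grid_step(1,2)[of N n]
    have SF: "?S \<in> borel_measurable (F ?s)" by (rule sum_increments_measurable_F[OF xi])
    have SM[measurable]: "?S \<in> borel_measurable M" by (rule measurable_F_M[OF SF])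
    have xiF: "(\<lambda>\<omega>. \<xi> N \<omega> $ i) \<in> borel_measurable (F ?s)" for i
      by (rule measurable_compose[OF xi vec_nth_borel])
    have xiM[measurable]: "\<xi> N \<in> borel_measurable M" by (rule measurable_F_M[OF xi])
    have xib: "\<bar>\<xi> N \<omega> $ i\<bar> \<le> C" if "\<omega> \<in> space M" for i \<omega>
      using C[OF that, of N] component_le_norm_cart[of "\<xi> N \<omega>" i] by linarith
    have iS: "integrable M ?S" using Suc square_integrable_imp_integrable[OF SM] by blast
    have iSx: "integrable M (\<lambda>\<omega>. ?S \<omega> * \<xi> N \<omega> $ i)" for i
    proof (rule Bochner_Integration.integrable_bound[OF integrable_mult_right[OF iS, of C]])
      show "AE \<omega> in M. norm (?S \<omega> * \<xi> N \<omega> $ i) \<le> norm (C * ?S \<omega>)"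
      proof (rule AE_I2)
        fix \<omega> assume w: "\<omega> \<in> space M"
        then show "norm (?S \<omega> * \<xi> N \<omega> $ i) \<le> norm (C * ?S \<omega>)"
          using mult_right_mono[OF xib[OF w, of i], of "\<bar>?S \<omega>\<bar>"] order_trans[OF abs_ge_zero xib[OF w, of i]]
          by (simp add: abs_mult mult.commute)
      qed
    qed measurable
    have c: "integrable M (\<lambda>\<omega>. ?S \<omega> * \<xi> N \<omega> $ i * dW n N \<omega> $ i)" "expectation (\<lambda>\<omega>. ?S \<omega> * \<xi> N \<omega> $ i * dW n N \<omega> $ i) = 0" for i
      using integrable_mult_increment[OF g borel_measurable_times[OF SF xiF] iSx, of "\<lambda>x. x $ i" i]
        expectation_mult_increment[OF g borel_measurable_times[OF SF xiF] iSx, of "\<lambda>x. x $ i" i]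
        integrable_increment_power[OF g, of i 1] expectation_increment[OF g, of i] by (auto simp: dW_def)
    have ixx: "integrable M (\<lambda>\<omega>. \<xi> N \<omega> $ i * \<xi> N \<omega> $ j)" for i j
    proof (rule integrable_const_bound[of _ "C * C"])
      show "AE \<omega> in M. norm (\<xi> N \<omega> $ i * \<xi> N \<omega> $ j) \<le> C * C"
      proof (rule AE_I2)
        fix \<omega> assume w: "\<omega> \<in> space M"
        have "0 \<le> C" using xib[OF w, of i] by linarith
        then show "norm (\<xi> N \<omega> $ i * \<xi> N \<omega> $ j) \<le> C * C"
          unfolding real_norm_def abs_mult by (intro mult_mono xib[OF w]) auto
      qed
    qed measurable
    have q: "integrable M (\<lambda>\<omega>. \<xi> N \<omega> $ i * \<xi> N \<omega> $ j * (dW n N \<omega> $ i * dW n N \<omega> $ j))"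
      "expectation (\<lambda>\<omega>. \<xi> N \<omega> $ i * \<xi> N \<omega> $ j * (dW n N \<omega> $ i * dW n N \<omega> $ j)) =
        (if i = j then expectation (\<lambda>\<omega>. (\<xi> N \<omega> $ i)\<^sup>2) / 2 ^ n else 0)" for i j
      using integrable_mult_increment[OF g borel_measurable_times[OF xiF xiF] ixx, of "\<lambda>x. x $ i * x $ j" i j]
        expectation_mult_increment[OF g borel_measurable_times[OF xiF xiF] ixx, of "\<lambda>x. x $ i * x $ j" i j]
        integrable_increment_prod[OF g, of i j] expectation_increment_prod[OF g, of i j] grid_step(3)[of N n]
      by (auto simp: dW_def power2_eq_square)
    have eq: "(\<Sum>j<Suc N. \<xi> j \<omega> \<bullet> dW n j \<omega>)\<^sup>2 = (?S \<omega>)\<^sup>2 + 2 * (\<Sum>i\<in>UNIV. ?S \<omega> * \<xi> N \<omega> $ i * dW n N \<omega> $ i) +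
       (\<Sum>i\<in>UNIV. \<Sum>j\<in>UNIV. \<xi> N \<omega> $ i * \<xi> N \<omega> $ j * (dW n N \<omega> $ i * dW n N \<omega> $ j))" for \<omega>
    proof -
      have "(\<Sum>i\<in>UNIV. ?S \<omega> * \<xi> N \<omega> $ i * dW n N \<omega> $ i) = ?S \<omega> * (\<xi> N \<omega> \<bullet> dW n N \<omega>)"
        by (simp add: inner_vec_def sum_distrib_left mult.assoc)
      moreover have "(\<Sum>i\<in>UNIV. \<Sum>j\<in>UNIV. \<xi> N \<omega> $ i * \<xi> N \<omega> $ j * (dW n N \<omega> $ i * dW n N \<omega> $ j)) = (\<xi> N \<omega> \<bullet> dW n N \<omega>)\<^sup>2"
        by (simp add: inner_vec_def power2_eq_square sum_product mult_ac)
      ultimately show ?thesis by (simp add: power2_eq_square algebra_simps)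
    qed
    have int: "integrable M (\<lambda>\<omega>. (?S \<omega>)\<^sup>2)"
      "integrable M (\<lambda>\<omega>. 2 * (\<Sum>i\<in>UNIV. ?S \<omega> * \<xi> N \<omega> $ i * dW n N \<omega> $ i))"
      "integrable M (\<lambda>\<omega>. \<Sum>i\<in>UNIV. \<Sum>j\<in>UNIV. \<xi> N \<omega> $ i * \<xi> N \<omega> $ j * (dW n N \<omega> $ i * dW n N \<omega> $ j))"
      using Suc by (auto intro!: Bochner_Integration.integrable_sum integrable_mult_right c q)
    have "expectation (\<lambda>\<omega>. (\<Sum>j<Suc N. \<xi> j \<omega> \<bullet> dW n j \<omega>)\<^sup>2) = expectation (\<lambda>\<omega>. (?S \<omega>)\<^sup>2)
       + expectation (\<lambda>\<omega>. 2 * (\<Sum>i\<in>UNIV. ?S \<omega> * \<xi> N \<omega> $ i * dW n N \<omega> $ i))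
       + expectation (\<lambda>\<omega>. \<Sum>i\<in>UNIV. \<Sum>j\<in>UNIV. \<xi> N \<omega> $ i * \<xi> N \<omega> $ j * (dW n N \<omega> $ i * dW n N \<omega> $ j))"
      unfolding eq using int by simp
    also have "expectation (\<lambda>\<omega>. 2 * (\<Sum>i\<in>UNIV. ?S \<omega> * \<xi> N \<omega> $ i * dW n N \<omega> $ i)) = 0"
      using c by (simp add: Bochner_Integration.integral_sum)
    also have "expectation (\<lambda>\<omega>. \<Sum>i\<in>UNIV. \<Sum>j\<in>UNIV. \<xi> N \<omega> $ i * \<xi> N \<omega> $ j * (dW n N \<omega> $ i * dW n N \<omega> $ j))
      = (\<Sum>i\<in>UNIV. \<Sum>j\<in>UNIV. if i = j then expectation (\<lambda>\<omega>. (\<xi> N \<omega> $ i)\<^sup>2) / 2 ^ n else 0)"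
      by (subst Bochner_Integration.integral_sum, intro Bochner_Integration.integrable_sum q,
          subst Bochner_Integration.integral_sum, rule q, simp only: q(2))
    also have "\<dots> = (\<Sum>i\<in>UNIV. expectation (\<lambda>\<omega>. (\<xi> N \<omega> $ i)\<^sup>2)) / 2 ^ n"
      by (simp add: sum_divide_distrib)
    also have "(\<Sum>i\<in>UNIV. expectation (\<lambda>\<omega>. (\<xi> N \<omega> $ i)\<^sup>2)) = expectation (\<lambda>\<omega>. (norm (\<xi> N \<omega>))\<^sup>2)"
      unfolding norm_power2_vec using ixx
      by (subst Bochner_Integration.integral_sum) (auto simp: power2_eq_square)
    finally have "expectation (\<lambda>\<omega>. (\<Sum>j<Suc N. \<xi> j \<omega> \<bullet> dW n j \<omega>)\<^sup>2) =
       (\<Sum>j<Suc N. expectation (\<lambda>\<omega>. (norm (\<xi> j \<omega>))\<^sup>2) / 2 ^ n)" using Suc by simp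
    moreover have "integrable M (\<lambda>\<omega>. (\<Sum>j<Suc N. \<xi> j \<omega> \<bullet> dW n j \<omega>)\<^sup>2)"
      unfolding eq using int by (intro Bochner_Integration.integrable_add)
    ultimately show ?case by blast
  qed simp
  then show "integrable M (\<lambda>\<omega>. (\<Sum>j<N. \<xi> j \<omega> \<bullet> dW n j \<omega>)\<^sup>2)"
    "expectation (\<lambda>\<omega>. (\<Sum>j<N. \<xi> j \<omega> \<bullet> dW n j \<omega>)\<^sup>2) = (\<Sum>j<N. expectation (\<lambda>\<omega>. (norm (\<xi> j \<omega>))\<^sup>2) / 2 ^ n)" by auto
qed

end

section \<open>Stopping and maximal inequalities\<close>

lemma first_failure_index:
  fixes P :: "nat \<Rightarrow> bool"
  assumes "\<And>i j. i \<le> j \<Longrightarrow> P j \<Longrightarrow> P i"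
  obtains \<tau> where "\<tau> \<le> N" "\<And>j. j < N \<Longrightarrow> P j \<longleftrightarrow> j < \<tau>"
proof (cases "\<exists>j<N. \<not> P j")
  case True
  define \<tau> where "\<tau> = (LEAST j. \<not> P j)"
  have "\<not> P \<tau>" unfolding \<tau>_def using True by (metis LeastI)
  moreover have "P j" if "j < \<tau>" for j using not_less_Least[of j "\<lambda>j. \<not> P j"] that by (auto simp: \<tau>_def)
  moreover have "\<tau> \<le> N" using True not_less_Least unfolding \<tau>_def by (metis Least_le less_imp_le order_trans)
  ultimately show ?thesis using assms by (intro that[of \<tau>]) (auto simp: not_less intro: leI)
next
  case False
  then show ?thesis by (intro that[of N]) auto
qed

lemma sum_if_initial:
  fixes m :: "nat \<Rightarrow> 'b::comm_monoid_add"
  assumes "\<tau> \<le> N" shows "(\<Sum>j<N. if j < \<tau> then m j else 0) = (\<Sum>j<\<tau>. m j)"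
proof -
  have "{..<N} \<inter> {j. j < \<tau>} = {..<\<tau>}" using assms by auto
  then show ?thesis by (simp add: sum.If_cases)
qed

context filtered_brownian_motion
begin

text \<open>Setting the integrand to 0 after the first excess over \<open>e\<close> keeps it adapted
  and freezes the sum at the excessive value. The final value of the stopped sum thus records
  whether any partial sum was too large, and Chebyshev's inequality with the isometry applies to
  this one variable.\<close>

lemma maximal_inequality_sum_increments:
  assumes xi: "\<And>j. \<xi> j \<in> borel_measurable (F (real j / 2 ^ n))"
    and C: "\<And>j \<omega>. \<omega> \<in> space M \<Longrightarrow> norm (\<xi> j \<omega>) \<le> C" and e: "e > 0"
  shows "\<exists>A\<in>events. prob A \<le> (\<Sum>j<N. expectation (\<lambda>\<omega>. (norm (\<xi> j \<omega>))\<^sup>2) / 2 ^ n) / e\<^sup>2 \<and>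
    (\<forall>\<omega>\<in>space M - A. \<forall>k\<le>N. \<bar>\<Sum>j<k. \<xi> j \<omega> \<bullet> dW n j \<omega>\<bar> \<le> e)"
proof -
  let ?S = "\<lambda>k \<omega>. \<Sum>j<k. \<xi> j \<omega> \<bullet> dW n j \<omega>"
  define B where "B = (\<lambda>j. {\<omega>\<in>space M. \<forall>i\<le>j. \<bar>?S i \<omega>\<bar> \<le> e})"
  define \<zeta> where "\<zeta> = (\<lambda>j \<omega>. if \<omega> \<in> B j then \<xi> j \<omega> else 0)"
  have BF: "B j \<in> sets (F (real j / 2 ^ n))" for j
  proof -
    have S: "?S i \<in> borel_measurable (F (real j / 2 ^ n))" if "i \<le> j" for i
      by (rule measurable_F_mono[OF sum_increments_measurable_F[OF xi]]) (rule grid_step(4)[OF that])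
    have "B j = (\<Inter>i\<in>{..j}. {\<omega>\<in>space (F (real j / 2 ^ n)). \<bar>?S i \<omega>\<bar> \<le> e})" unfolding B_def by auto
    also have "\<dots> \<in> sets (F (real j / 2 ^ n))"
      using S by (intro sets.finite_INT borel_measurable_le borel_measurable_abs) auto
    finally show ?thesis .
  qed
  have zF: "\<zeta> j \<in> borel_measurable (F (real j / 2 ^ n))" for j
    unfolding \<zeta>_def 
    by (rule measurable_If_set[OF xi]) (simp, subst sets.Int_space_eq2[OF BF], rule BF)
  have zC: "norm (\<zeta> j \<omega>) \<le> \<bar>C\<bar>" if "\<omega> \<in> space M" for j \<omega>
    using C[OF that, of j] by (auto simp: \<zeta>_def)
  let ?Z = "\<lambda>\<omega>. \<Sum>j<N. \<zeta> j \<omega> \<bullet> dW n j \<omega>"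
  have int: "integrable M (\<lambda>\<omega>. (?Z \<omega>)\<^sup>2)" by (rule square_integrable_sum_increments[OF zF zC])
  have ZM[measurable]: "?Z \<in> borel_measurable M" by (rule measurable_F_M[OF sum_increments_measurable_F[OF zF]])
  define A where "A = {\<omega>\<in>space M. e\<^sup>2 \<le> (?Z \<omega>)\<^sup>2 \<and> e < \<bar>?Z \<omega>\<bar>}"
  have A: "A \<in> events" unfolding A_def by measurable
  have "prob A \<le> prob {\<omega>\<in>space M. e\<^sup>2 \<le> (?Z \<omega>)\<^sup>2}"
    by (rule finite_measure_mono) (auto simp: A_def)
  also have "\<dots> \<le> expectation (\<lambda>\<omega>. (?Z \<omega>)\<^sup>2) / e\<^sup>2"
    using e by (intro integral_Markov_inequality_measure[where A = "{}", OF int]) auto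
  also have "expectation (\<lambda>\<omega>. (?Z \<omega>)\<^sup>2) = (\<Sum>j<N. expectation (\<lambda>\<omega>. (norm (\<zeta> j \<omega>))\<^sup>2) / 2 ^ n)"
    by (rule isometry_sum_increments[OF zF zC])
  also have "\<dots> / e\<^sup>2 \<le> (\<Sum>j<N. expectation (\<lambda>\<omega>. (norm (\<xi> j \<omega>))\<^sup>2) / 2 ^ n) / e\<^sup>2"
  proof (intro divide_right_mono sum_mono integral_mono)
    fix j
    have i: "integrable M (\<lambda>\<omega>. (norm (f \<omega>))\<^sup>2)" if "f \<in> borel_measurable M" "\<And>\<omega>. \<omega> \<in> space M \<Longrightarrow> norm (f \<omega>) \<le> \<bar>C\<bar>"
      for f :: "'a \<Rightarrow> real^'m"
      by (rule integrable_const_bound[of _ "\<bar>C\<bar>\<^sup>2"]) (use that power_mono[of "norm (f _)" "\<bar>C\<bar>" 2] in auto)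
    show "integrable M (\<lambda>\<omega>. (norm (\<zeta> j \<omega>))\<^sup>2)" by (rule i[OF measurable_F_M[OF zF] zC])
    show "integrable M (\<lambda>\<omega>. (norm (\<xi> j \<omega>))\<^sup>2)"
    proof (rule i[OF measurable_F_M[OF xi]])
      fix \<omega> assume "\<omega> \<in> space M"
      from C[OF this, of j] show "norm (\<xi> j \<omega>) \<le> \<bar>C\<bar>" by linarith
    qed
    show "(norm (\<zeta> j \<omega>))\<^sup>2 \<le> (norm (\<xi> j \<omega>))\<^sup>2" for \<omega> by (auto simp: \<zeta>_def)
  qed auto
  finally have pA: "prob A \<le> (\<Sum>j<N. expectation (\<lambda>\<omega>. (norm (\<xi> j \<omega>))\<^sup>2) / 2 ^ n) / e\<^sup>2" .
  have "\<bar>?S k \<omega>\<bar> \<le> e" if w: "\<omega> \<in> space M - A" and k: "k \<le> N" for k \<omega>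
  proof (rule ccontr)
    assume bad: "\<not> \<bar>?S k \<omega>\<bar> \<le> e"
    obtain \<tau> where t: "\<tau> \<le> N" "\<And>j. j < N \<Longrightarrow> \<omega> \<in> B j \<longleftrightarrow> j < \<tau>"
      by (rule first_failure_index[of "\<lambda>j. \<omega> \<in> B j" N]) (auto simp: B_def)
    have Z: "?Z \<omega> = ?S \<tau> \<omega>"
    proof -
      have "?Z \<omega> = (\<Sum>j<N. if j < \<tau> then \<xi> j \<omega> \<bullet> dW n j \<omega> else 0)"
        using t(2) by (intro sum.cong) (auto simp: \<zeta>_def)
      then show ?thesis using sum_if_initial[OF t(1)] by simp
    qed
    have "e < \<bar>?S \<tau> \<omega>\<bar>"
    proof (cases "\<tau> = N")
      case True
      have "\<omega> \<notin> B k" using bad by (auto simp: B_def)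
      then have "\<not> k < N" using t(2)[of k] True by blast
      then show ?thesis using k bad True by simp
    next
      case False
      then have tN: "\<tau> < N" using t(1) by simp
      then have "\<omega> \<notin> B \<tau>" using t(2) by blast
      then obtain i where i: "i \<le> \<tau>" "\<not> \<bar>?S i \<omega>\<bar> \<le> e" using w by (auto simp: B_def)
      have "\<not> i < \<tau>" using t(2)[of i] tN i by (auto simp: B_def)
      then show ?thesis using i by simp
    qed
    then have "e < \<bar>?Z \<omega>\<bar>" using Z by simp
    moreover from this have "e\<^sup>2 \<le> (?Z \<omega>)\<^sup>2" using e by (metis abs_le_square_iff abs_of_pos less_imp_le)
    ultimately show False using w by (auto simp: A_def)
  qed
  then show ?thesis using A pA by blast
qed

text \<open>The sum is stopped as soon as \<open>Err\<close> exceeds \<open>e\<close> or the sum reaches \<open>\<eta>\<close>. Until then it is at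
  least \<open>- e\<close> because \<open>H\<close> is nonnegative, and its last step is at most \<open>Z\<close> in absolute value; mean zero then bounds
  the probability of reaching \<open>\<eta>\<close>.\<close>

lemma stopped_domination:
  fixes m Err H :: "nat \<Rightarrow> 'a \<Rightarrow> real"
  assumes ErrF: "\<And>k. Err k \<in> borel_measurable (F (real k / 2 ^ n))"
    and mF: "\<And>j. m j \<in> borel_measurable (F (real (Suc j) / 2 ^ n))" and im: "\<And>j. integrable M (m j)"
    and m0: "\<And>j B. B \<in> sets (F (real j / 2 ^ n)) \<Longrightarrow> expectation (\<lambda>\<omega>. indicator B \<omega> * m j \<omega>) = 0"
    and Z: "integrable M Z" "\<And>\<omega>. \<omega> \<in> space M \<Longrightarrow> 0 \<le> Z \<omega>" "\<And>j \<omega>. j < N \<Longrightarrow> \<omega> \<in> space M \<Longrightarrow> \<bar>m j \<omega>\<bar> \<le> Z \<omega>"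
    and Err_mono: "\<And>i j \<omega>. i \<le> j \<Longrightarrow> Err i \<omega> \<le> Err j \<omega>"
    and H0: "\<And>k \<omega>. 0 \<le> H k \<omega>" and H: "\<And>k \<omega>. H k \<omega> \<le> Err k \<omega> + (\<Sum>j<k. m j \<omega>)"
    and e: "0 \<le> e" and \<eta>: "0 < \<eta>"
  shows "\<exists>A\<in>events. prob A \<le> (e + expectation Z) / \<eta> \<and>
    (\<forall>\<omega>\<in>space M - A. Err N \<omega> \<le> e \<longrightarrow> (\<forall>k\<le>N. H k \<omega> < \<eta> + e))"
proof -
  let ?S = "\<lambda>k \<omega>. \<Sum>j<k. m j \<omega>"
  define B where "B = (\<lambda>j. {\<omega>\<in>space M. \<forall>i\<le>j. Err i \<omega> \<le> e \<and> ?S i \<omega> < \<eta>})"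
  have BF: "B j \<in> sets (F (real j / 2 ^ n))" for j
  proof -
    have S: "?S i \<in> borel_measurable (F (real j / 2 ^ n))" if "i \<le> j" for i
      using that by (intro borel_measurable_sum measurable_F_mono[OF mF] grid_step(4)) auto
    have E: "Err i \<in> borel_measurable (F (real j / 2 ^ n))" if "i \<le> j" for i
      by (rule measurable_F_mono[OF ErrF grid_step(4)[OF that]])
    have "B j = (\<Inter>i\<in>{..j}. {\<omega>\<in>space (F (real j / 2 ^ n)). Err i \<omega> \<le> e} \<inter> {\<omega>\<in>space (F (real j / 2 ^ n)). ?S i \<omega> < \<eta>})"
      unfolding B_def by auto
    also have "\<dots> \<in> sets (F (real j / 2 ^ n))"
      using S E by (intro sets.finite_INT sets.Int borel_measurable_le borel_measurable_less) auto
    finally show ?thesis .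
  qed
  have BM[measurable]: "B j \<in> events" for j using BF sets_F_subset by blast
  define Y where "Y = (\<lambda>\<omega>. \<Sum>j<N. indicator (B j) \<omega> * m j \<omega>)"
  have iBm: "integrable M (\<lambda>\<omega>. indicator (B j) \<omega> * m j \<omega>)" for j
    using integrable_mult_indicator[OF BM im, of j j] by simp
  have iY: "integrable M Y" unfolding Y_def by (intro Bochner_Integration.integrable_sum iBm)
  have EY: "expectation Y = 0"
    unfolding Y_def using m0[OF BF] iBm by (subst Bochner_Integration.integral_sum) auto
  have stop: "\<exists>\<tau>\<le>N. Y \<omega> = ?S \<tau> \<omega> \<and> (\<forall>j<N. \<omega> \<in> B j \<longleftrightarrow> j < \<tau>)" for \<omega>
  proof -
    obtain \<tau> where t: "\<tau> \<le> N" "\<And>j. j < N \<Longrightarrow> \<omega> \<in> B j \<longleftrightarrow> j < \<tau>"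
      by (rule first_failure_index[of "\<lambda>j. \<omega> \<in> B j" N]) (auto simp: B_def)
    have "Y \<omega> = (\<Sum>j<N. if j < \<tau> then m j \<omega> else 0)"
      unfolding Y_def using t(2) by (intro sum.cong) (auto simp: indicator_def)
    then have "Y \<omega> = ?S \<tau> \<omega>" using sum_if_initial[OF t(1), of "\<lambda>j. m j \<omega>"] by simp
    then show ?thesis using t by blast
  qed
  have low: "- (e + Z \<omega>) \<le> Y \<omega>" if w: "\<omega> \<in> space M" for \<omega>
  proof -
    obtain \<tau> where t: "\<tau> \<le> N" "Y \<omega> = ?S \<tau> \<omega>" "\<And>j. j < N \<Longrightarrow> \<omega> \<in> B j \<longleftrightarrow> j < \<tau>" using stop by blast
    show ?thesis
    proof (cases \<tau>)
      case 0
      then show ?thesis using t Z(2)[OF w] e by simp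
    next
      case (Suc i)
      then have "\<omega> \<in> B i" using t by auto
      then have "Err i \<omega> \<le> e" by (auto simp: B_def)
      then have "- e \<le> ?S i \<omega>" using H[of i \<omega>] H0[of i \<omega>] by linarith
      moreover have "\<bar>m i \<omega>\<bar> \<le> Z \<omega>" using Suc t(1) w by (intro Z(3)) auto
      ultimately show ?thesis using t(2) Suc by simp
    qed
  qed
  define A where "A = {\<omega>\<in>space M. \<eta> \<le> Y \<omega>}"
  have A[measurable]: "A \<in> events" unfolding A_def using iY by measurable
  \<comment> \<open>Markov's inequality for \<open>Y + e + Z\<close>, which is nonnegative by
    \<open>low\<close> and at least \<open>\<eta>\<close> on \<open>A\<close>; the mean of
    \<open>Y\<close> being 0, only \<open>e\<close> and the mean of \<open>Z\<close> remain.\<close>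
  have "\<eta> * prob A = expectation (\<lambda>\<omega>. \<eta> * indicator A \<omega>)" by simp
  also have "\<dots> \<le> expectation (\<lambda>\<omega>. Y \<omega> + (e + Z \<omega>))"
  proof (rule integral_mono)
    fix \<omega> assume w: "\<omega> \<in> space M"
    show "\<eta> * indicat_real A \<omega> \<le> Y \<omega> + (e + Z \<omega>)"
      using low[OF w] Z(2)[OF w] e by (auto simp: A_def indicator_def)
  next
    show "integrable M (\<lambda>\<omega>. \<eta> * indicat_real A \<omega>)"
      by (intro integrable_mult_right integrable_real_indicator) (auto simp: emeasure_eq_measure)
  qed (use iY Z in auto)
  also have "\<dots> = e + expectation Z" using iY Z EY by (simp add: prob_space)
  finally have pA: "prob A \<le> (e + expectation Z) / \<eta>" using \<eta> by (simp add: field_simps)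
  have "H k \<omega> < \<eta> + e" if w: "\<omega> \<in> space M - A" and E: "Err N \<omega> \<le> e" and k: "k \<le> N" for k \<omega>
  proof (rule ccontr)
    assume "\<not> H k \<omega> < \<eta> + e"
    then have Sk: "\<eta> \<le> ?S k \<omega>" using H[of k \<omega>] E Err_mono[OF k, of \<omega>] by linarith
    obtain \<tau> where t: "\<tau> \<le> N" "Y \<omega> = ?S \<tau> \<omega>" "\<And>j. j < N \<Longrightarrow> \<omega> \<in> B j \<longleftrightarrow> j < \<tau>" using stop by blast
    have "\<eta> \<le> ?S \<tau> \<omega>"
    proof (cases "\<tau> = N")
      case True
      have "\<omega> \<notin> B k" using Sk by (auto simp: B_def not_less intro!: exI[of _ k])
      then have "\<not> k < N" using t(3)[of k] True by blast
      then show ?thesis using k Sk True by simp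
    next
      case False
      then have tN: "\<tau> < N" using t(1) by simp
      then have "\<omega> \<notin> B \<tau>" using t(3) by blast
      then obtain i where i: "i \<le> \<tau>" "\<not> (Err i \<omega> \<le> e \<and> ?S i \<omega> < \<eta>)" using w by (auto simp: B_def)
      have "\<not> i < \<tau>" using t(3)[of i] tN i by (auto simp: B_def)
      moreover have "Err i \<omega> \<le> e" using Err_mono[of i N \<omega>] E i tN by linarith
      ultimately show ?thesis using i by auto
    qed
    then show False using w t(2) by (auto simp: A_def)
  qed
  then show ?thesis using A pA by blast
qed

end

section \<open>Reflected paths over a short step\<close>

lemma norm_matrix_vector_le:
  fixes A :: "real^'m^'d"
  shows "norm (A *v x) \<le> norm A * norm x"
proof -
  have "(norm (A *v x))\<^sup>2 = (\<Sum>i\<in>UNIV. (A $ i \<bullet> x)\<^sup>2)"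
    by (simp add: norm_power2_vec matrix_vector_mult_def inner_vec_def)
  also have "\<dots> \<le> (\<Sum>i\<in>UNIV. (norm (A $ i))\<^sup>2 * (norm x)\<^sup>2)"
  proof (rule sum_mono)
    fix i
    show "(A $ i \<bullet> x)\<^sup>2 \<le> (norm (A $ i))\<^sup>2 * (norm x)\<^sup>2"
      using Cauchy_Schwarz_ineq[of "A $ i" x] by (simp add: power2_norm_eq_inner)
  qed
  also have "\<dots> = (norm A * norm x)\<^sup>2"
    by (simp add: sum_distrib_right[symmetric] power_mult_distrib norm_vec_def L2_set_def sum_nonneg)
  finally show ?thesis by (rule power2_le_imp_le) simp
qed

lemma exp_minus_le_quadratic: "exp (- a) \<le> 1 - a + a\<^sup>2" if "a \<ge> 0" for a :: real
proof -
  have "1 + a \<le> exp a" by (rule exp_ge_add_one_self)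
  then have "exp (- a) \<le> 1 / (1 + a)" using that by (simp add: exp_minus field_simps)
  also have "\<dots> \<le> 1 - a + a\<^sup>2"
  proof -
    have "(1 - a + a\<^sup>2) * (1 + a) = 1 + a ^ 3" by (simp add: algebra_simps power2_eq_square power3_eq_cube)
    then have "1 \<le> (1 - a + a\<^sup>2) * (1 + a)" using that by simp
    then show ?thesis using that by (simp add: divide_le_eq)
  qed
  finally show ?thesis .
qed

text \<open>One constant \<open>\<Lambda>\<close> serves as bound, Lipschitz constant and diameter,
  so that few constants have to be followed later. (D.1) is stated for \<open>x'\<close> in the
  closure, since both solutions may sit on the boundary. Of the second derivative of
  \<open>\<phi>\<close> only the Lipschitz property of the gradient is retained.\<close>

locale coefficients =
  fixes D :: "(real^'d) set" and \<nu> :: "real^'d \<Rightarrow> (real^'d) set"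
    and \<phi> :: "real^'d \<Rightarrow> real" and g :: "real^'d \<Rightarrow> real^'d" and \<alpha> \<Lambda> :: real
    and \<sigma> :: "real^'d \<Rightarrow> real^'m^'d" and \<sigma>' :: "real^'d \<Rightarrow> real^'d \<Rightarrow> real^'m^'d" and b :: "real^'d \<Rightarrow> real^'d"
  assumes \<Lambda>: "\<Lambda> \<ge> 1" and \<alpha>: "\<alpha> > 0"
    and nu: "\<forall>x\<in>frontier D. \<nu> x \<noteq> {} \<and> (\<forall>v\<in>\<nu> x. norm v = 1)"
    and D1: "\<And>x x' v. x' \<in> closure D \<Longrightarrow> x \<in> frontier D \<Longrightarrow> v \<in> \<nu> x \<Longrightarrow> (x - x') \<bullet> v \<le> \<Lambda> * (norm (x - x'))\<^sup>2"
    and phi_deriv: "\<And>x. (\<phi> has_derivative (\<lambda>h. g x \<bullet> h)) (at x)" and g_cont: "continuous_on UNIV g"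
    and phi_lip: "\<And>x y. x \<in> closure D \<Longrightarrow> y \<in> closure D \<Longrightarrow> \<bar>\<phi> x - \<phi> y\<bar> \<le> \<Lambda> * norm (x - y)"
    and phi_bound: "\<And>x. x \<in> closure D \<Longrightarrow> \<bar>\<phi> x\<bar> \<le> \<Lambda>"
    and g_bound: "\<And>x. x \<in> closure D \<Longrightarrow> norm (g x) \<le> \<Lambda>"
    and g_lip: "\<And>x y. x \<in> closure D \<Longrightarrow> y \<in> closure D \<Longrightarrow> norm (g x - g y) \<le> \<Lambda> * norm (x - y)"
    and g_nu: "\<And>x v. x \<in> frontier D \<Longrightarrow> v \<in> \<nu> x \<Longrightarrow> \<alpha> \<le> g x \<bullet> v"
    and diam: "\<And>x y. x \<in> closure D \<Longrightarrow> y \<in> closure D \<Longrightarrow> norm (x - y) \<le> \<Lambda>"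
    and sigma_bound: "\<And>x. x \<in> closure D \<Longrightarrow> norm (\<sigma> x) \<le> \<Lambda>"
    and sigma_lip: "\<And>x y. x \<in> closure D \<Longrightarrow> y \<in> closure D \<Longrightarrow> norm (\<sigma> x - \<sigma> y) \<le> \<Lambda> * norm (x - y)"
    and sigma_taylor: "\<And>x y. x \<in> closure D \<Longrightarrow> y \<in> closure D \<Longrightarrow> norm (\<sigma> y - \<sigma> x - \<sigma>' x (y - x)) \<le> \<Lambda> * (norm (y - x))\<^sup>2"
    and sigma'_linear: "\<And>x. x \<in> closure D \<Longrightarrow> linear (\<sigma>' x)"
    and sigma'_bound: "\<And>x h. x \<in> closure D \<Longrightarrow> norm (\<sigma>' x h) \<le> \<Lambda> * norm h"
    and sigma'_lip: "\<And>x y h. x \<in> closure D \<Longrightarrow> y \<in> closure D \<Longrightarrow> norm (\<sigma>' x h - \<sigma>' y h) \<le> \<Lambda> * norm (x - y) * norm h"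
    and b_bound: "\<And>x. x \<in> closure D \<Longrightarrow> norm (b x) \<le> \<Lambda>"
    and b_lip: "\<And>x y. x \<in> closure D \<Longrightarrow> y \<in> closure D \<Longrightarrow> norm (b x - b y) \<le> \<Lambda> * norm (x - y)"
begin

text \<open>\<open>Uhat y w\<close> is the second-order expansion of the endpoint of the unreflected driftless flow, and
  \<open>Shat y w\<close> the first-order expansion of \<open>\<sigma>\<close> there.\<close>

definition Q :: "real^'d \<Rightarrow> real^'m \<Rightarrow> real^'d" where
  "Q y w = (1/2) *\<^sub>R ((\<sigma>' y (\<sigma> y *v w)) *v w)"

text \<open>The drift of the equation in Ito form.\<close>

definition B :: "real^'d \<Rightarrow> real^'d" where
  "B y = (1/2) *\<^sub>R sigsig \<sigma> \<sigma>' y + b y"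

definition Uhat :: "real^'d \<Rightarrow> real^'m \<Rightarrow> real^'d" where
  "Uhat y w = y + \<sigma> y *v w + Q y w"

definition Shat :: "real^'d \<Rightarrow> real^'m \<Rightarrow> real^'m^'d" where
  "Shat y w = \<sigma> y + \<sigma>' y (\<sigma> y *v w)"

lemma sigma_mult_bound: "x \<in> closure D \<Longrightarrow> norm (\<sigma> x *v w) \<le> \<Lambda> * norm w"
  by (rule order_trans[OF norm_matrix_vector_le mult_right_mono[OF sigma_bound]]) auto

lemma Q_bound: "y \<in> closure D \<Longrightarrow> norm (Q y w) \<le> \<Lambda>\<^sup>2 * (norm w)\<^sup>2"
proof -
  assume y: "y \<in> closure D"
  have "norm ((\<sigma>' y (\<sigma> y *v w)) *v w) \<le> norm (\<sigma>' y (\<sigma> y *v w)) * norm w" by (rule norm_matrix_vector_le)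
  also have "\<dots> \<le> (\<Lambda> * (\<Lambda> * norm w)) * norm w"
    using \<Lambda> by (intro mult_right_mono order_trans[OF sigma'_bound[OF y]] mult_left_mono sigma_mult_bound[OF y]) auto
  finally have "norm ((\<sigma>' y (\<sigma> y *v w)) *v w) \<le> \<Lambda>\<^sup>2 * (norm w)\<^sup>2" by (simp add: power2_eq_square mult_ac)
  moreover have "norm (Q y w) = norm ((\<sigma>' y (\<sigma> y *v w)) *v w) / 2" by (simp add: Q_def)
  ultimately show ?thesis using norm_ge_zero[of "(\<sigma>' y (\<sigma> y *v w)) *v w"] by linarith
qed

text \<open>By this choice \<open>c\<phi> * \<alpha> = 2 * \<Lambda>\<close>, so that (D.2) in the
  weight compensates the worst case of (D.1) for the squared distance. \<open>C1\<close> bounds the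
  gradient of the weighted squared distance relative to the distance, and \<open>C2\<close> adds the
  cost of removing the weight.\<close>

definition c\<phi> :: real where "c\<phi> = 2 * \<Lambda> / \<alpha>"
definition C1 :: real where "C1 = exp (c\<phi> * \<Lambda>) * (2 + c\<phi> * \<Lambda> * \<Lambda>)"
definition C2 :: real where "C2 = exp (c\<phi> * \<Lambda>) * C1"

lemma consts_nonneg: "c\<phi> \<ge> 0" "C1 \<ge> 0" "C2 \<ge> 0"
  using \<Lambda> \<alpha> by (auto simp: c\<phi>_def C1_def C2_def)

text \<open>A deterministic setting: \<open>V\<close> stands for the total variation of
  \<open>l\<close>, and \<open>R\<close> has the form of \<open>reflection_term_inner_ge\<close>, so
  that no measure appears in the pathwise estimates.\<close>

context
  fixes x l v :: "real \<Rightarrow> real^'d" and V :: "real \<Rightarrow> real" and p q :: real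
  assumes pq: "p \<le> q" and cx: "continuous_on {p..q} x" and xD: "\<And>r. p \<le> r \<Longrightarrow> r \<le> q \<Longrightarrow> x r \<in> closure D"
    and V: "\<And>s t. p \<le> s \<Longrightarrow> s \<le> t \<Longrightarrow> t \<le> q \<Longrightarrow> norm (l t - l s) \<le> V t - V s"
    and R: "\<And>s t u \<gamma>. p \<le> s \<Longrightarrow> s \<le> t \<Longrightarrow> t \<le> q \<Longrightarrow>
       (\<And>r w. s \<le> r \<Longrightarrow> r \<le> t \<Longrightarrow> x r \<in> frontier D \<Longrightarrow> w \<in> \<nu> (x r) \<Longrightarrow> \<gamma> \<le> u \<bullet> w) \<Longrightarrow>
       \<gamma> * (V t - V s) \<le> u \<bullet> (l t - l s)"
begin

text \<open>Over a short step all reflecting directions met have a component of nearly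
  \<open>\<alpha>\<close> along the single vector \<open>g (x p)\<close>. Pushes therefore cannot
  cancel, and the variation is comparable to the norm of the net push. This justifies norms of
  increments in the weight.\<close>

lemma reflection_lower_bound:
  assumes o: "\<And>r. p \<le> r \<Longrightarrow> r \<le> q \<Longrightarrow> norm (x r - x p) \<le> o'"
  shows "(\<alpha> - \<Lambda> * o') * (V q - V p) \<le> \<Lambda> * norm (l q - l p)"
proof -
  have "(\<alpha> - \<Lambda> * o') * (V q - V p) \<le> g (x p) \<bullet> (l q - l p)"
  proof (rule R)
    fix r w assume r: "p \<le> r" "r \<le> q" and w: "x r \<in> frontier D" "w \<in> \<nu> (x r)"
    have "(g (x r) - g (x p)) \<bullet> w \<le> norm (g (x r) - g (x p)) * norm w" by (rule norm_cauchy_schwarz)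
    also have "\<dots> \<le> \<Lambda> * o'"
    proof -
      have "norm w = 1" using nu w by blast
      moreover have "norm (g (x r) - g (x p)) \<le> \<Lambda> * norm (x r - x p)" using xD r pq by (intro g_lip) auto
      moreover have "\<Lambda> * norm (x r - x p) \<le> \<Lambda> * o'" using o[OF r] \<Lambda> by (intro mult_left_mono) auto
      ultimately show ?thesis by simp
    qed
    finally show "\<alpha> - \<Lambda> * o' \<le> g (x p) \<bullet> w" using g_nu[OF w] by (simp add: inner_diff_left)
  qed (use pq in auto)
  also have "\<dots> \<le> norm (g (x p)) * norm (l q - l p)" by (rule norm_cauchy_schwarz)
  also have "\<dots> \<le> \<Lambda> * norm (l q - l p)" using xD[of p] pq by (intro mult_right_mono g_bound) auto
  finally show ?thesis .
qed

text \<open>(D.1) compares \<open>u\<close> with the boundary points \<open>x r\<close>, not with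
  \<open>x p\<close>. Passing from one to the other costs \<open>o'\<close> in the linear term and
  at most \<open>3 * \<Lambda>^2 * o'\<close> in the quadratic one, as all distances are at most
  \<open>\<Lambda>\<close>.\<close>

lemma reflection_pair_bound:
  assumes o: "\<And>r. p \<le> r \<Longrightarrow> r \<le> q \<Longrightarrow> norm (x r - x p) \<le> o'" and o1: "o' \<le> \<Lambda>" and u: "u \<in> closure D"
  shows "(x p - u) \<bullet> (l q - l p) \<le> (\<Lambda> * (norm (x p - u))\<^sup>2 + (1 + 3 * \<Lambda>\<^sup>2) * o') * (V q - V p)"
proof -
  let ?c = "\<Lambda> * (norm (x p - u))\<^sup>2 + (1 + 3 * \<Lambda>\<^sup>2) * o'"
  have o0: "0 \<le> o'" using o[of p] pq by simp
  have "(- ?c) * (V q - V p) \<le> (- (x p - u)) \<bullet> (l q - l p)"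
  proof (rule R)
    fix r w assume r: "p \<le> r" "r \<le> q" and w: "x r \<in> frontier D" "w \<in> \<nu> (x r)"
    have nw: "norm w = 1" using nu w by blast
    have "(x p - x r) \<bullet> w \<le> norm (x p - x r) * norm w" by (rule norm_cauchy_schwarz)
    then have 1: "(x p - x r) \<bullet> w \<le> o'" using o[OF r] nw by (simp add: norm_minus_commute)
    have n0: "norm (x p - u) \<le> \<Lambda>" using xD[of p] pq u by (intro diam) auto
    have "norm (x r - u) \<le> norm (x p - u) + o'"
      using norm_triangle_ineq[of "x p - u" "x r - x p"] o[OF r] by simp
    then have "(norm (x r - u))\<^sup>2 \<le> (norm (x p - u) + o')\<^sup>2" by (intro power_mono) auto
    also have "\<dots> = (norm (x p - u))\<^sup>2 + 2 * norm (x p - u) * o' + o' * o'" by (simp add: power2_eq_square algebra_simps)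
    also have "\<dots> \<le> (norm (x p - u))\<^sup>2 + 2 * \<Lambda> * o' + \<Lambda> * o'"
      using n0 o0 o1 by (intro add_mono mult_right_mono mult_left_mono) auto
    finally have "\<Lambda> * (norm (x r - u))\<^sup>2 \<le> \<Lambda> * ((norm (x p - u))\<^sup>2 + 2 * \<Lambda> * o' + \<Lambda> * o')"
      using \<Lambda> by (intro mult_left_mono) auto
    then have "(x r - u) \<bullet> w \<le> \<Lambda> * (norm (x p - u))\<^sup>2 + 3 * \<Lambda>\<^sup>2 * o'"
      using D1[OF u w] by (simp add: power2_eq_square algebra_simps)
    with 1 show "- ?c \<le> - (x p - u) \<bullet> w" by (simp add: inner_diff_left algebra_simps)
  qed (use pq in auto)
  then show ?thesis by (simp add: inner_diff_left algebra_simps)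
qed

context
  fixes K :: real
  assumes xv: "\<And>s t. p \<le> s \<Longrightarrow> s \<le> t \<Longrightarrow> t \<le> q \<Longrightarrow> x t - x s = (v t - v s) + (l t - l s)"
    and vK: "\<And>s t. p \<le> s \<Longrightarrow> s \<le> t \<Longrightarrow> t \<le> q \<Longrightarrow> norm (v t - v s) \<le> K * (t - s)"
begin

text \<open>The factor \<open>exp (- c \<phi>)\<close> makes the normal derivative of the squared distance to the
  starting point nonpositive, so that the reflection cannot increase it.\<close>

lemma reflected_oscillation_bound:
  assumes r: "p \<le> r" "r \<le> q"
  shows "norm (x r - x p) \<le> C2 * (K * (q - p))"
proof -
  define a where "a = x p"
  have aD: "a \<in> closure D" using xD[of p] pq by (simp add: a_def)
  define f where "f = (\<lambda>y. exp (- c\<phi> * \<phi> y) * (norm (y - a))\<^sup>2)"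
  define G where "G = (\<lambda>y. exp (- c\<phi> * \<phi> y) *\<^sub>R (2 *\<^sub>R (y - a) - (c\<phi> * (norm (y - a))\<^sup>2) *\<^sub>R g y))"
  have fd: "(f has_derivative (\<lambda>h. G y \<bullet> h)) (at y)" for y
    unfolding f_def G_def power2_norm_eq_inner
    by (auto intro!: derivative_eq_intros phi_deriv simp: algebra_simps inner_commute)
  have phi_cont: "continuous_on UNIV \<phi>"
    using phi_deriv by (intro has_derivative_continuous_on) blast
  have Gc: "continuous_on UNIV G"
    unfolding G_def by (intro continuous_intros g_cont phi_cont)
  have Gnu: "G y \<bullet> w \<le> - 0" if w: "y \<in> frontier D" "w \<in> \<nu> y" for y w
  proof -
    have "2 * ((y - a) \<bullet> w) \<le> 2 * (\<Lambda> * (norm (y - a))\<^sup>2)" using D1[OF aD w] by simp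
    also have "\<dots> = c\<phi> * (norm (y - a))\<^sup>2 * \<alpha>" using \<alpha> by (simp add: c\<phi>_def)
    also have "\<dots> \<le> c\<phi> * (norm (y - a))\<^sup>2 * (g y \<bullet> w)" using g_nu[OF w] consts_nonneg by (intro mult_left_mono) auto
    finally have "2 * ((y - a) \<bullet> w) - c\<phi> * (norm (y - a))\<^sup>2 * (g y \<bullet> w) \<le> 0" by simp
    moreover have "G y \<bullet> w = exp (- c\<phi> * \<phi> y) * (2 * ((y - a) \<bullet> w) - c\<phi> * (norm (y - a))\<^sup>2 * (g y \<bullet> w))"
      by (simp add: G_def inner_diff_left)
    ultimately show ?thesis by (simp add: mult_nonneg_nonpos)
  qed
  have Gb: "norm (G y) \<le> C1 * norm (y - a)" if y: "y \<in> closure D" for y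
  proof -
    have "- (c\<phi> * \<phi> y) \<le> c\<phi> * \<Lambda>"
    proof -
      have "c\<phi> * (- \<phi> y) \<le> c\<phi> * \<Lambda>" using phi_bound[OF y] consts_nonneg by (intro mult_left_mono) auto
      then show ?thesis by simp
    qed
    then have e: "exp (- c\<phi> * \<phi> y) \<le> exp (c\<phi> * \<Lambda>)" by simp
    have n: "(norm (y - a))\<^sup>2 * norm (g y) \<le> norm (y - a) * \<Lambda> * \<Lambda>"
      unfolding power2_eq_square using diam[OF y aD] g_bound[OF y] \<Lambda> by (intro mult_mono) auto
    have "norm (2 *\<^sub>R (y - a) - (c\<phi> * (norm (y - a))\<^sup>2) *\<^sub>R g y) \<le> 2 * norm (y - a) + c\<phi> * ((norm (y - a))\<^sup>2 * norm (g y))"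
      using consts_nonneg norm_triangle_ineq4[of "2 *\<^sub>R (y - a)" "(c\<phi> * (norm (y - a))\<^sup>2) *\<^sub>R g y"]
      by (simp add: mult_ac)
    also have "\<dots> \<le> 2 * norm (y - a) + c\<phi> * (norm (y - a) * \<Lambda> * \<Lambda>)"
      using n consts_nonneg by (intro add_left_mono mult_left_mono) auto
    finally have m: "norm (2 *\<^sub>R (y - a) - (c\<phi> * (norm (y - a))\<^sup>2) *\<^sub>R g y) \<le> (2 + c\<phi> * \<Lambda> * \<Lambda>) * norm (y - a)"
      by (simp add: algebra_simps)
    have "norm (G y) = exp (- c\<phi> * \<phi> y) * norm (2 *\<^sub>R (y - a) - (c\<phi> * (norm (y - a))\<^sup>2) *\<^sub>R g y)"
      by (simp add: G_def)
    also have "\<dots> \<le> exp (c\<phi> * \<Lambda>) * ((2 + c\<phi> * \<Lambda> * \<Lambda>) * norm (y - a))"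
      using e m by (intro mult_mono) auto
    finally show ?thesis by (simp add: C1_def mult_ac)
  qed
  \<comment> \<open>At the time of largest distance \<open>m\<close> the path inequality bounds
    \<open>f\<close>, which is of order \<open>m^2\<close>, by a multiple of
    \<open>m * K * (q - p)\<close>; cancelling one factor \<open>m\<close> gives the linear
    bound.\<close>
  obtain s where s: "s \<in> {p..q}" "\<And>r. r \<in> {p..q} \<Longrightarrow> norm (x r - a) \<le> norm (x s - a)"
  proof -
    have "\<exists>s\<in>{p..q}. \<forall>r\<in>{p..q}. norm (x r - a) \<le> norm (x s - a)"
      using pq by (intro continuous_attains_sup continuous_intros cx) auto
    then show ?thesis using that by blast
  qed
  define m where "m = norm (x s - a)"
  have m0: "m \<ge> 0" by (simp add: m_def)
  have Kq: "0 \<le> K * (q - p)" using vK[of p q] pq norm_ge_zero[of "v q - v p"] by linarith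
  have "f (x s) - f (x p) \<le> G (x p) \<bullet> (v s - v p) + (C1 * m) * K * (s - p) - 0 * (V s - V p)"
  proof (rule reflected_path_C1_bound[where D = D and \<nu> = \<nu> and l = l])
    show "continuous_on {p..s} x" using s by (intro continuous_on_subset[OF cx]) auto
    fix r assume "p \<le> r" "r \<le> s"
    then have r: "r \<in> {p..q}" using s by auto
    have "norm (G (x r) - G (x p)) = norm (G (x r))" by (simp add: G_def a_def)
    also have "\<dots> \<le> C1 * norm (x r - a)" using r xD by (intro Gb) auto
    also have "\<dots> \<le> C1 * m" unfolding m_def using s(2)[OF r] consts_nonneg by (intro mult_left_mono) auto
    finally show "norm (G (x r) - G (x p)) \<le> C1 * m" .
  qed (use s V R xv vK fd Gc Gnu nu in auto)
  then have "f (x s) \<le> C1 * m * (K * (s - p))" by (simp add: f_def G_def a_def)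
  also have "\<dots> \<le> C1 * m * (K * (q - p))"
  proof (cases "q = p")
    case False
    then have "K \<ge> 0" using Kq pq by (simp add: zero_le_mult_iff)
    then show ?thesis using s m0 consts_nonneg by (intro mult_left_mono) auto
  qed (use s in auto)
  finally have 1: "f (x s) \<le> C1 * m * (K * (q - p))" .
  have "c\<phi> * \<phi> (x s) \<le> c\<phi> * \<Lambda>" using phi_bound[of "x s"] xD[of s] s consts_nonneg by (intro mult_left_mono) auto
  then have "exp (- (c\<phi> * \<Lambda>)) * m\<^sup>2 \<le> f (x s)" unfolding f_def m_def by (intro mult_right_mono) auto
  with 1 have "exp (c\<phi> * \<Lambda>) * (exp (- (c\<phi> * \<Lambda>)) * m\<^sup>2) \<le> exp (c\<phi> * \<Lambda>) * (C1 * m * (K * (q - p)))"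
    by (intro mult_left_mono) auto
  moreover have "exp (c\<phi> * \<Lambda>) * (exp (- (c\<phi> * \<Lambda>)) * m\<^sup>2) = m\<^sup>2"
    by (simp add: mult.assoc[symmetric] exp_add[symmetric])
  ultimately have "m\<^sup>2 \<le> exp (c\<phi> * \<Lambda>) * (C1 * m * (K * (q - p)))" by simp
  then have "m * m \<le> m * (C2 * (K * (q - p)))"
    by (simp add: C2_def power2_eq_square mult_ac)
  then have "m \<le> C2 * (K * (q - p))"
    using m0 Kq consts_nonneg by (cases "m = 0") auto
  then show ?thesis using s(2)[of r] r by (simp add: m_def a_def)
qed

text \<open>The path inequality for \<open>- \<phi>\<close>, whose gradient has inner product at
  most \<open>- \<alpha>\<close> with the reflecting directions. The oscillation of the path, hence
  of the gradient, is linear in \<open>K * (q - p)\<close>, which makes the error quadratic and so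
  comparable to the quadratic variation of the driving noise.\<close>

lemma reflected_variation_bound:
  "\<alpha> * (V q - V p) \<le> \<phi> (x q) - \<phi> (x p) - g (x p) \<bullet> (v q - v p) + \<Lambda> * C2 * (K * (q - p))\<^sup>2"
proof -
  have "(- \<phi> (x q)) - (- \<phi> (x p)) \<le> (- g (x p)) \<bullet> (v q - v p) + (\<Lambda> * (C2 * (K * (q - p)))) * K * (q - p) - \<alpha> * (V q - V p)"
  proof (rule reflected_path_C1_bound[where D = D and \<nu> = \<nu> and l = l and F = "\<lambda>y. - \<phi> y" and g = "\<lambda>y. - g y"])
    show "((\<lambda>y. - \<phi> y) has_derivative (\<lambda>h. - g y \<bullet> h)) (at y)" for y
      using has_derivative_minus[OF phi_deriv[of y]] by simp
    show "continuous_on UNIV (\<lambda>y. - g y)" by (intro continuous_intros g_cont)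
    fix r assume r: "p \<le> r" "r \<le> q"
    have "norm (g (x r) - g (x p)) \<le> \<Lambda> * norm (x r - x p)" using xD r pq by (intro g_lip) auto
    also have "\<dots> \<le> \<Lambda> * (C2 * (K * (q - p)))"
      using reflected_oscillation_bound[OF r] \<Lambda> by (intro mult_left_mono) auto
    finally show "norm (- g (x r) - - g (x p)) \<le> \<Lambda> * (C2 * (K * (q - p)))" by (simp add: norm_minus_commute)
  qed (use pq cx V R xv vK g_nu nu in auto)
  then show ?thesis by (simp add: power2_eq_square algebra_simps)
qed

end

end

lemma sigma'_product_diff:
  assumes x: "x \<in> closure D" and y: "y \<in> closure D"
  shows "norm ((\<sigma>' x (\<sigma> x *v w)) *v u - (\<sigma>' y (\<sigma> y *v w)) *v u) \<le> 2 * \<Lambda>\<^sup>2 * norm (x - y) * norm w * norm u"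
proof -
  have lin: "\<sigma>' y (\<sigma> x *v w) - \<sigma>' y (\<sigma> y *v w) = \<sigma>' y ((\<sigma> x - \<sigma> y) *v w)"
    using linear_diff[OF sigma'_linear[OF y]] by (simp add: matrix_vector_mult_diff_rdistrib)
  have 1: "norm (\<sigma>' x (\<sigma> x *v w) - \<sigma>' y (\<sigma> x *v w)) \<le> \<Lambda> * norm (x - y) * (\<Lambda> * norm w)"
    using \<Lambda> by (intro order_trans[OF sigma'_lip[OF x y]] mult_left_mono sigma_mult_bound[OF x]) auto
  have "norm ((\<sigma> x - \<sigma> y) *v w) \<le> (\<Lambda> * norm (x - y)) * norm w"
    by (rule order_trans[OF norm_matrix_vector_le mult_right_mono[OF sigma_lip[OF x y]]]) auto
  then have 2: "norm (\<sigma>' y (\<sigma> x *v w) - \<sigma>' y (\<sigma> y *v w)) \<le> \<Lambda> * ((\<Lambda> * norm (x - y)) * norm w)"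
    unfolding lin using \<Lambda> by (intro order_trans[OF sigma'_bound[OF y]] mult_left_mono) auto
  have "norm (\<sigma>' x (\<sigma> x *v w) - \<sigma>' y (\<sigma> y *v w)) \<le> 2 * \<Lambda>\<^sup>2 * norm (x - y) * norm w"
    using norm_triangle_ineq[of "\<sigma>' x (\<sigma> x *v w) - \<sigma>' y (\<sigma> x *v w)" "\<sigma>' y (\<sigma> x *v w) - \<sigma>' y (\<sigma> y *v w)"] 1 2
    by (simp add: power2_eq_square algebra_simps)
  then have "norm (\<sigma>' x (\<sigma> x *v w) - \<sigma>' y (\<sigma> y *v w)) * norm u \<le> 2 * \<Lambda>\<^sup>2 * norm (x - y) * norm w * norm u"
    by (rule mult_right_mono) auto
  moreover have "(\<sigma>' x (\<sigma> x *v w)) *v u - (\<sigma>' y (\<sigma> y *v w)) *v u = (\<sigma>' x (\<sigma> x *v w) - \<sigma>' y (\<sigma> y *v w)) *v u"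
    by (simp add: matrix_vector_mult_diff_rdistrib)
  ultimately show ?thesis using norm_matrix_vector_le[of "\<sigma>' x (\<sigma> x *v w) - \<sigma>' y (\<sigma> y *v w)" u] by simp
qed

text \<open>With one term per noise direction, half of \<open>sigsig\<close> is visibly the mean of
  \<open>Q y w\<close> for a standard normal \<open>w\<close>.\<close>

lemma sigsig_eq:
  assumes "y \<in> closure D"
  shows "sigsig \<sigma> \<sigma>' y = (\<Sum>j\<in>UNIV. (\<sigma>' y (\<sigma> y *v axis j 1)) *v axis j 1)"
proof -
  have "\<sigma> y *v axis j 1 = (\<Sum>k\<in>UNIV. (\<sigma> y $ k $ j) *\<^sub>R axis k 1)" for j
    by (simp add: vec_eq_iff matrix_vector_mult_def axis_def if_distrib cong: if_cong)
  then have "\<sigma>' y (\<sigma> y *v axis j 1) = (\<Sum>k\<in>UNIV. (\<sigma> y $ k $ j) *\<^sub>R \<sigma>' y (axis k 1))" for j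
    using sigma'_linear[OF assms] by (simp add: linear_sum linear_cmul)
  then show ?thesis
    by (simp add: vec_eq_iff sigsig_def matrix_vector_mult_def axis_def if_distrib mult.commute cong: if_cong)
qed

definition CB :: real where "CB = real CARD('m) * \<Lambda>\<^sup>2 + \<Lambda>"

lemma B_lip: "x \<in> closure D \<Longrightarrow> y \<in> closure D \<Longrightarrow> norm (B x - B y) \<le> CB * norm (x - y)"
proof -
  assume x: "x \<in> closure D" and y: "y \<in> closure D"
  have "norm (sigsig \<sigma> \<sigma>' x - sigsig \<sigma> \<sigma>' y) \<le> (\<Sum>j\<in>(UNIV::'m set). 2 * \<Lambda>\<^sup>2 * norm (x - y))"
    unfolding sigsig_eq[OF x] sigsig_eq[OF y] sum_subtractf[symmetric]
    by (rule sum_norm_le) (use sigma'_product_diff[OF x y, of "axis _ 1" "axis _ 1"] in simp)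
  then have "norm ((1/2) *\<^sub>R (sigsig \<sigma> \<sigma>' x - sigsig \<sigma> \<sigma>' y)) \<le> real CARD('m) * \<Lambda>\<^sup>2 * norm (x - y)" by simp
  moreover have eq: "B x - B y = (1/2) *\<^sub>R (sigsig \<sigma> \<sigma>' x - sigsig \<sigma> \<sigma>' y) + (b x - b y)"
    by (simp add: B_def algebra_simps)
  ultimately show ?thesis using b_lip[OF x y]
    norm_triangle_ineq[of "(1/2) *\<^sub>R (sigsig \<sigma> \<sigma>' x - sigsig \<sigma> \<sigma>' y)" "b x - b y"]
    unfolding eq CB_def distrib_right by linarith
qed

lemma B_bound: "y \<in> closure D \<Longrightarrow> norm (B y) \<le> CB"
proof -
  assume y: "y \<in> closure D"
  have "norm ((\<sigma>' y (\<sigma> y *v axis j 1)) *v axis j (1::real)) \<le> 2 * \<Lambda>\<^sup>2" for j :: 'm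
    using Q_bound[OF y, of "axis j 1"] by (simp add: Q_def)
  then have "norm (sigsig \<sigma> \<sigma>' y) \<le> (\<Sum>j\<in>(UNIV::'m set). 2 * \<Lambda>\<^sup>2)"
    unfolding sigsig_eq[OF y] by (intro sum_norm_le) auto
  then have "norm ((1/2) *\<^sub>R sigsig \<sigma> \<sigma>' y) \<le> real CARD('m) * \<Lambda>\<^sup>2" by simp
  then show ?thesis using b_bound[OF y] norm_triangle_ineq[of "(1/2) *\<^sub>R sigsig \<sigma> \<sigma>' y" "b y"]
    by (simp add: B_def CB_def)
qed

lemma CB_pos: "CB \<ge> 1" using \<Lambda> by (simp add: CB_def add_increasing)

section \<open>The reflected equation on one interval, driven at constant velocity\<close>

context
  fixes x l :: "real \<Rightarrow> real^'d" and V :: "real \<Rightarrow> real" and p h :: real and w :: "real^'m"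
  assumes h: "0 < h" and cx: "continuous_on {p..p+h} x" and xD: "\<And>r. p \<le> r \<Longrightarrow> r \<le> p + h \<Longrightarrow> x r \<in> closure D"
    and V: "\<And>s t. p \<le> s \<Longrightarrow> s \<le> t \<Longrightarrow> t \<le> p + h \<Longrightarrow> norm (l t - l s) \<le> V t - V s"
    and R: "\<And>s t u \<gamma>. p \<le> s \<Longrightarrow> s \<le> t \<Longrightarrow> t \<le> p + h \<Longrightarrow>
       (\<And>r w. s \<le> r \<Longrightarrow> r \<le> t \<Longrightarrow> x r \<in> frontier D \<Longrightarrow> w \<in> \<nu> (x r) \<Longrightarrow> \<gamma> \<le> u \<bullet> w) \<Longrightarrow>
       \<gamma> * (V t - V s) \<le> u \<bullet> (l t - l s)"
    and xi: "\<And>t. p \<le> t \<Longrightarrow> t \<le> p + h \<Longrightarrow>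
       x t - x p = integral {p..t} (\<lambda>r. \<sigma> (x r) *v ((1 / h) *\<^sub>R w) + b (x r)) + (l t - l p)"
begin

abbreviation (input) vel where "vel \<equiv> \<lambda>r. \<sigma> (x r) *v ((1 / h) *\<^sub>R w) + b (x r)"
abbreviation (input) drv where "drv \<equiv> \<lambda>t. integral {p..t} vel"

lemma vel_continuous: "continuous_on {p..p+h} vel"
proof -
  have L: "\<Lambda>-lipschitz_on (closure D) \<sigma>" "\<Lambda>-lipschitz_on (closure D) b"
    using sigma_lip b_lip \<Lambda> by (auto intro!: lipschitz_onI simp: dist_norm)
  have xc: "x ` {p..p+h} \<subseteq> closure D" using xD by auto
  have 1: "continuous_on {p..p+h} (\<lambda>r. \<sigma> (x r))" "continuous_on {p..p+h} (\<lambda>r. b (x r))"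
    using continuous_on_compose2[OF lipschitz_on_continuous_on[OF L(1)] cx xc]
      continuous_on_compose2[OF lipschitz_on_continuous_on[OF L(2)] cx xc] by auto
  show ?thesis unfolding matrix_vector_mult_def
    by (intro continuous_intros 1)
qed

lemma vel_bound: "p \<le> r \<Longrightarrow> r \<le> p + h \<Longrightarrow> norm (vel r) \<le> \<Lambda> * (norm w / h + 1)"
proof -
  assume r: "p \<le> r" "r \<le> p + h"
  have "norm (\<sigma> (x r) *v ((1 / h) *\<^sub>R w)) \<le> \<Lambda> * (norm w / h)"
    using sigma_mult_bound[OF xD[OF r], of "(1 / h) *\<^sub>R w"] h by simp
  then show ?thesis using b_bound[OF xD[OF r]] norm_triangle_ineq[of "\<sigma> (x r) *v ((1 / h) *\<^sub>R w)" "b (x r)"]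
    by (simp add: algebra_simps)
qed

lemma drv_diff:
  assumes "p \<le> s" "s \<le> t" "t \<le> p + h"
  shows "drv t - drv s = integral {s..t} vel"
proof -
  have "vel integrable_on {p..t}"
    using assms by (intro integrable_continuous_interval continuous_on_subset[OF vel_continuous]) auto
  from Henstock_Kurzweil_Integration.integral_combine[OF assms(1,2) this]
  have "drv s + integral {s..t} vel = drv t" .
  then show ?thesis by (simp only: algebra_simps)
qed

lemma drv_lip:
  assumes "p \<le> s" "s \<le> t" "t \<le> p + h"
  shows "norm (drv t - drv s) \<le> \<Lambda> * (norm w / h + 1) * (t - s)"
  unfolding drv_diff[OF assms]
  by (rule integral_bound) (use assms in \<open>auto intro!: continuous_on_subset[OF vel_continuous] vel_bound\<close>)

lemma x_diff:
  assumes "p \<le> s" "s \<le> t" "t \<le> p + h"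
  shows "x t - x s = (drv t - drv s) + (l t - l s)"
proof -
  have gen: "A - C = (P - R) + (S - T)" if "A - a = P + (S - c)" "C - a = R + (T - c)" for A C P R S T a c :: "real^'d"
  proof -
    have "A - C = (A - a) - (C - a)" by simp
    also have "\<dots> = (P - R) + (S - T)" unfolding that by simp
    finally show ?thesis .
  qed
  show ?thesis by (rule gen[OF xi xi]) (use assms in auto)
qed

lemma Kh: "\<Lambda> * (norm w / h + 1) * (p + h - p) = \<Lambda> * (norm w + h)"
  using h by (simp add: field_simps)

lemma ode_step_oscillation:
  assumes "p \<le> r" "r \<le> p + h"
  shows "norm (x r - x p) \<le> C2 * (\<Lambda> * (norm w + h))"
proof -
  have ph: "p \<le> p + h" using h by simp
  have "norm (x r - x p) \<le> C2 * (\<Lambda> * (norm w / h + 1) * (p + h - p))"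
    by (rule reflected_oscillation_bound[of p "p + h" x l V drv "\<Lambda> * (norm w / h + 1)" r])
       (fact ph cx xD V R x_diff drv_lip assms)+
  then show ?thesis by (simp only: Kh)
qed

lemma ode_step_variation:
  "\<alpha> * (V (p + h) - V p) \<le> \<phi> (x (p + h)) - \<phi> (x p) - g (x p) \<bullet> (x (p + h) - x p - (l (p + h) - l p))
     + \<Lambda> * C2 * (\<Lambda> * (norm w + h))\<^sup>2"
proof -
  have ph: "p \<le> p + h" using h by simp
  have "drv (p + h) - drv p = x (p + h) - x p - (l (p + h) - l p)"
    using x_diff[of p "p + h"] h by (simp only: algebra_simps)
  moreover have "\<alpha> * (V (p + h) - V p) \<le> \<phi> (x (p + h)) - \<phi> (x p) - g (x p) \<bullet> (drv (p + h) - drv p)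
     + \<Lambda> * C2 * (\<Lambda> * (norm w / h + 1) * (p + h - p))\<^sup>2"
    by (rule reflected_variation_bound[of p "p + h" x l V drv "\<Lambda> * (norm w / h + 1)"])
       (fact ph cx xD V R x_diff drv_lip)+
  ultimately show ?thesis by (simp only: Kh)
qed

lemma ode_step_first_order:
  assumes t: "p \<le> t" "t \<le> p + h"
  shows "norm (x t - x p - (l t - l p) - ((t - p) / h) *\<^sub>R (\<sigma> (x p) *v w)) \<le>
    \<Lambda> * (C2 * (\<Lambda> * (norm w + h))) * norm w + \<Lambda> * h"
proof -
  let ?o = "C2 * (\<Lambda> * (norm w + h))"
  have pD: "x p \<in> closure D" using xD[of p] h by simp
  have o0: "0 \<le> ?o" using consts_nonneg \<Lambda> h by simp
  let ?f = "\<lambda>r. (\<sigma> (x r) - \<sigma> (x p)) *v ((1 / h) *\<^sub>R w) + b (x r)"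
  have ci: "vel integrable_on {p..t}"
    using t by (intro integrable_continuous_interval continuous_on_subset[OF vel_continuous]) auto
  have "integral {p..t} ?f = integral {p..t} (\<lambda>r. vel r - \<sigma> (x p) *v ((1 / h) *\<^sub>R w))"
    by (intro integral_cong) (simp add: matrix_vector_mult_diff_rdistrib)
  also have "\<dots> = drv t - (t - p) *\<^sub>R (\<sigma> (x p) *v ((1 / h) *\<^sub>R w))"
    using t ci by (subst integral_diff) auto
  also have "\<dots> = x t - x p - (l t - l p) - ((t - p) / h) *\<^sub>R (\<sigma> (x p) *v w)"
    using xi[OF t] by (simp add: matrix_vector_mult_scaleR)
  finally have eq: "x t - x p - (l t - l p) - ((t - p) / h) *\<^sub>R (\<sigma> (x p) *v w) = integral {p..t} ?f" by simp
  have fc: "continuous_on {p..t} ?f"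
  proof -
    have "continuous_on {p..t} (\<lambda>r. vel r - \<sigma> (x p) *v ((1 / h) *\<^sub>R w))"
      using t by (intro continuous_intros continuous_on_subset[OF vel_continuous]) auto
    then show ?thesis by (simp add: matrix_vector_mult_diff_rdistrib algebra_simps)
  qed
  have "norm (?f r) \<le> \<Lambda> * ?o * (norm w / h) + \<Lambda>" if r: "r \<in> {p..t}" for r
  proof -
    have rD: "x r \<in> closure D" and ro: "norm (x r - x p) \<le> ?o"
      using r t xD ode_step_oscillation by auto
    have "norm ((\<sigma> (x r) - \<sigma> (x p)) *v ((1 / h) *\<^sub>R w)) \<le> norm (\<sigma> (x r) - \<sigma> (x p)) * norm ((1 / h) *\<^sub>R w)"
      by (rule norm_matrix_vector_le)
    also have "\<dots> \<le> (\<Lambda> * ?o) * (norm w / h)"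
      using h \<Lambda> ro by (intro mult_mono order_trans[OF sigma_lip[OF rD pD]] mult_left_mono) (auto intro!: mult_nonneg_nonneg[OF _ o0])
    finally show ?thesis using b_bound[OF rD] norm_triangle_ineq[of "(\<sigma> (x r) - \<sigma> (x p)) *v ((1 / h) *\<^sub>R w)" "b (x r)"]
      by simp
  qed
  then have "norm (integral {p..t} ?f) \<le> (\<Lambda> * ?o * (norm w / h) + \<Lambda>) * (t - p)"
    using t fc by (intro integral_bound) auto
  also have "\<dots> \<le> (\<Lambda> * ?o * (norm w / h) + \<Lambda>) * h"
    using t \<Lambda> h by (intro mult_left_mono add_nonneg_nonneg mult_nonneg_nonneg[OF mult_nonneg_nonneg[OF _ o0]]) auto
  also have "\<dots> = \<Lambda> * ?o * norm w + \<Lambda> * h" using h by (simp add: field_simps)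
  finally show ?thesis unfolding eq .
qed

text \<open>The first-order description of the path, inserted into Taylor's formula, shows
  \<open>\<sigma> (x r)\<close> to be affine in time up to a small error. The variation enters
  because reflection may displace the path inside the interval; it carries a factor
  \<open>norm w\<close>, which makes it small against the variation itself.\<close>

lemma ode_step_second_order:
  "norm (x (p + h) - x p - (l (p + h) - l p) - \<sigma> (x p) *v w - Q (x p) w - h *\<^sub>R b (x p)) \<le>
    (\<Lambda> * (C2 * (\<Lambda> * (norm w + h)))\<^sup>2 +
     \<Lambda> * (\<Lambda> * (C2 * (\<Lambda> * (norm w + h))) * norm w + \<Lambda> * h + (V (p + h) - V p))) * norm w
    + \<Lambda> * (C2 * (\<Lambda> * (norm w + h))) * h"
proof -
  let ?o = "C2 * (\<Lambda> * (norm w + h))"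
  let ?l = "V (p + h) - V p"
  have pD: "x p \<in> closure D" using xD[of p] h by simp
  define A where "A = \<sigma>' (x p) (\<sigma> (x p) *v w)"
  let ?E = "\<lambda>r. vel r - (\<sigma> (x p) *v ((1 / h) *\<^sub>R w) + b (x p)) - ((r - p) / h) *\<^sub>R (A *v ((1 / h) *\<^sub>R w))"
  \<comment> \<open>The integral of \<open>(r - p) / h\<close> over the interval is
    \<open>h / 2\<close>, the origin of the factor 1/2 in \<open>Q\<close>.\<close>
  have lin: "((\<lambda>r. ((r - p) / h) *\<^sub>R (A *v ((1 / h) *\<^sub>R w))) has_integral (h / 2) *\<^sub>R (A *v ((1 / h) *\<^sub>R w))) {p..p+h}"
  proof -
    have "((\<lambda>r. (r - p) / h) has_integral ((p + h - p)\<^sup>2 / (2 * h) - (p - p)\<^sup>2 / (2 * h))) {p..p+h}"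
      using h by (intro fundamental_theorem_of_calculus)
         (auto intro!: derivative_eq_intros simp: has_real_derivative_iff_has_vector_derivative[symmetric] field_simps)
    then have "((\<lambda>r. (r - p) / h) has_integral (h / 2)) {p..p+h}" using h by (simp add: power2_eq_square)
    then show ?thesis by (rule has_integral_scaleR_left)
  qed
  have vi: "(vel has_integral drv (p + h)) {p..p+h}"
    by (intro integrable_integral integrable_continuous_interval vel_continuous)
  have ci: "((\<lambda>r. \<sigma> (x p) *v ((1 / h) *\<^sub>R w) + b (x p)) has_integral (h *\<^sub>R (\<sigma> (x p) *v ((1 / h) *\<^sub>R w) + b (x p)))) {p..p+h}"
    using has_integral_const_real[of "\<sigma> (x p) *v ((1 / h) *\<^sub>R w) + b (x p)" p "p + h"] h by simp
  have "(?E has_integral (drv (p + h) - h *\<^sub>R (\<sigma> (x p) *v ((1 / h) *\<^sub>R w) + b (x p)) - (h / 2) *\<^sub>R (A *v ((1 / h) *\<^sub>R w)))) {p..p+h}"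
    by (intro has_integral_diff vi ci lin)
  then have "integral {p..p+h} ?E = drv (p + h) - h *\<^sub>R (\<sigma> (x p) *v ((1 / h) *\<^sub>R w) + b (x p)) - (h / 2) *\<^sub>R (A *v ((1 / h) *\<^sub>R w))"
    by (rule integral_unique)
  also have "\<dots> = x (p + h) - x p - (l (p + h) - l p) - \<sigma> (x p) *v w - Q (x p) w - h *\<^sub>R b (x p)"
    using xi[of "p + h"] h by (simp add: matrix_vector_mult_scaleR Q_def A_def algebra_simps)
  finally have eq: "x (p + h) - x p - (l (p + h) - l p) - \<sigma> (x p) *v w - Q (x p) w - h *\<^sub>R b (x p) = integral {p..p+h} ?E" by simp
  have Ec: "continuous_on {p..p+h} ?E"
    using h by (intro continuous_intros vel_continuous) auto
  let ?d = "\<Lambda> * ?o * norm w + \<Lambda> * h + ?l"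
  have Eb: "norm (?E r) \<le> (\<Lambda> * ?o\<^sup>2 + \<Lambda> * ?d) * (norm w / h) + \<Lambda> * ?o" if r: "r \<in> {p..p+h}" for r
  proof -
    have rD: "x r \<in> closure D" and ro: "norm (x r - x p) \<le> ?o"
      using r xD ode_step_oscillation by auto
    define c where "c = (r - p) / h"
    let ?S = "\<sigma> (x r) - \<sigma> (x p) - c *\<^sub>R A"
    have "?S = (\<sigma> (x r) - \<sigma> (x p) - \<sigma>' (x p) (x r - x p)) + \<sigma>' (x p) (x r - x p - c *\<^sub>R (\<sigma> (x p) *v w))"
      using linear_diff[OF sigma'_linear[OF pD]] linear_cmul[OF sigma'_linear[OF pD]] by (simp add: A_def)
    then have "norm ?S \<le> norm (\<sigma> (x r) - \<sigma> (x p) - \<sigma>' (x p) (x r - x p)) + norm (\<sigma>' (x p) (x r - x p - c *\<^sub>R (\<sigma> (x p) *v w)))"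
      using norm_triangle_ineq by metis
    also have "\<dots> \<le> \<Lambda> * ?o\<^sup>2 + \<Lambda> * ?d"
    proof (rule add_mono)
      show "norm (\<sigma> (x r) - \<sigma> (x p) - \<sigma>' (x p) (x r - x p)) \<le> \<Lambda> * ?o\<^sup>2"
        using ro \<Lambda> by (intro order_trans[OF sigma_taylor[OF pD rD]] mult_left_mono power_mono) auto
      have "norm (l r - l p) \<le> ?l"
      proof -
        have "norm (l r - l p) \<le> V r - V p" "norm (l (p + h) - l r) \<le> V (p + h) - V r" using V r by auto
        then show ?thesis using norm_ge_zero[of "l (p + h) - l r"] by linarith
      qed
      moreover have "norm (x r - x p - (l r - l p) - c *\<^sub>R (\<sigma> (x p) *v w)) \<le> \<Lambda> * ?o * norm w + \<Lambda> * h"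
        unfolding c_def using r by (intro ode_step_first_order) auto
      moreover have "norm (x r - x p - c *\<^sub>R (\<sigma> (x p) *v w)) \<le> ?d" if "norm (l r - l p) \<le> ?l"
        "norm (x r - x p - (l r - l p) - c *\<^sub>R (\<sigma> (x p) *v w)) \<le> \<Lambda> * ?o * norm w + \<Lambda> * h"
      proof -
        have "x r - x p - c *\<^sub>R (\<sigma> (x p) *v w) = (x r - x p - (l r - l p) - c *\<^sub>R (\<sigma> (x p) *v w)) + (l r - l p)"
          by simp
        then have "norm (x r - x p - c *\<^sub>R (\<sigma> (x p) *v w)) \<le>
            norm (x r - x p - (l r - l p) - c *\<^sub>R (\<sigma> (x p) *v w)) + norm (l r - l p)"
          using norm_triangle_ineq by metis
        then show ?thesis using that by linarith
      qed
      ultimately have "norm (x r - x p - c *\<^sub>R (\<sigma> (x p) *v w)) \<le> ?d" by blast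
      then show "norm (\<sigma>' (x p) (x r - x p - c *\<^sub>R (\<sigma> (x p) *v w))) \<le> \<Lambda> * ?d"
        using \<Lambda> by (intro order_trans[OF sigma'_bound[OF pD]] mult_left_mono) auto
    qed
    finally have S: "norm ?S \<le> \<Lambda> * ?o\<^sup>2 + \<Lambda> * ?d" .
    have Eq: "?E r = ?S *v ((1 / h) *\<^sub>R w) + (b (x r) - b (x p))"
      by (simp add: c_def matrix_vector_mult_diff_rdistrib scaleR_matrix_vector_assoc)
    have "norm (?S *v ((1 / h) *\<^sub>R w)) \<le> (\<Lambda> * ?o\<^sup>2 + \<Lambda> * ?d) * (norm w / h)"
    proof -
      have "norm (?S *v ((1 / h) *\<^sub>R w)) \<le> norm ?S * norm ((1 / h) *\<^sub>R w)" by (rule norm_matrix_vector_le)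
      also have "\<dots> = norm ?S * (norm w / h)" using h by simp
      also have "\<dots> \<le> (\<Lambda> * ?o\<^sup>2 + \<Lambda> * ?d) * (norm w / h)" using S h by (intro mult_right_mono) auto
      finally show ?thesis .
    qed
    moreover have "norm (b (x r) - b (x p)) \<le> \<Lambda> * ?o"
      using ro \<Lambda> by (intro order_trans[OF b_lip[OF rD pD]] mult_left_mono) auto
    ultimately show ?thesis unfolding Eq
      using norm_triangle_ineq[of "?S *v ((1 / h) *\<^sub>R w)" "b (x r) - b (x p)"] by linarith
  qed
  have "norm (integral {p..p+h} ?E) \<le> ((\<Lambda> * ?o\<^sup>2 + \<Lambda> * ?d) * (norm w / h) + \<Lambda> * ?o) * (p + h - p)"
    using h Ec Eb by (intro integral_bound) auto
  also have "\<dots> = (\<Lambda> * ?o\<^sup>2 + \<Lambda> * ?d) * norm w + \<Lambda> * ?o * h" using h by (simp add: field_simps)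
  finally show ?thesis unfolding eq .
qed

end

section \<open>One step of the weighted squared distance\<close>

text \<open>Here \<open>w0\<close> is the increment already contained in the comparison point and
  \<open>w1\<close> the new one; \<open>ln\<close> and \<open>lm\<close> bound the two reflection
  increments, as the variations over the step do. The bracket subtracted on the left is the centered
  part. What remains proportional to \<open>(norm z)^2\<close> comes from drift, from the variance
  of the noise difference and from reflection, and the exponent is large enough to cancel it. All
  other terms contain the common modulus \<open>\<theta>\<close> as a factor.\<close>

lemma one_step_estimate:
  fixes C :: real
  assumes C1: "1 \<le> C" and CL: "\<Lambda> \<le> C" and CB: "CB \<le> C"
  obtains G where "0 \<le> G"
    "\<And>y v y1 w0 w1 h xh dl dm ln lm \<theta> z z1 P.
      \<lbrakk>y \<in> closure D; v \<in> closure D; y1 \<in> closure D; \<theta> \<le> 1; norm w0 \<le> \<theta>; norm w1 \<le> \<theta>; 0 \<le> h; h \<le> \<theta>;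
       norm (v - xh) \<le> \<theta>; norm dl \<le> ln; norm dm \<le> lm; ln \<le> C * \<theta>; lm \<le> C * \<theta>;
       norm (y1 - Uhat y w0 - h *\<^sub>R b y - dl) \<le> C * ((norm w0 + h)^3 + h * (norm w0 + h) + (norm w0 + h) * ln);
       norm (y1 - y - \<sigma> y *v w0) \<le> C * ((norm w0 + h)\<^sup>2 + h + ln);
       norm (y1 - y) \<le> C * (norm w0 + h);
       (y - v) \<bullet> dl \<le> (C * (norm (y - v))\<^sup>2 + C * \<theta>) * ln;
       (v - y) \<bullet> dm \<le> (C * (norm (y - v))\<^sup>2 + C * \<theta>) * lm;
       ln / C - C * \<theta> * ln \<le> norm dl; lm / C - C * \<theta> * lm \<le> norm dm;
       z = Uhat y w0 - xh; z1 = Uhat y1 w1 - (xh + \<sigma> v *v w1 + h *\<^sub>R B v + dm); P = Shat y w0 - \<sigma> v\<rbrakk> \<Longrightarrow>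
      exp (- (2 * C\<^sup>2 * (norm dl + norm dm) + 4 * C\<^sup>2 * h)) * (norm z1)\<^sup>2 - (norm z)\<^sup>2
        - (2 * (z \<bullet> (P *v w1 + Q y w1 - (h / 2) *\<^sub>R sigsig \<sigma> \<sigma>' y)) + (norm (P *v w1))\<^sup>2 - h * (norm P)\<^sup>2)
      \<le> G * (\<theta> * ((norm w0)\<^sup>2 + (norm w1)\<^sup>2 + h + ln + lm))"
proof -
  have C0: "0 \<le> C" using C1 by simp
  have CC: "C \<le> C\<^sup>2" using C1 by (simp add: power2_eq_square)
  \<comment> \<open>Roles of the constants, with \<open>e\<close> as defined below: \<open>k\<close>
    bounds the remainder \<open>r'\<close>, \<open>kg\<close> the correction \<open>gd\<close>,
    \<open>ke\<close> the ratio of \<open>e\<close> to \<open>\<theta>\<close>, \<open>kd\<close>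
    the whole increment of \<open>z\<close>, \<open>k0\<close> the gap between \<open>z\<close> and
    \<open>y - v\<close>, \<open>kz\<close> the norm of \<open>z\<close>, \<open>k5\<close> the loss
    in replacing \<open>(norm (y - v))^2\<close> by \<open>(norm z)^2\<close>, \<open>kq\<close> and
    \<open>kq1\<close> the change and the size of \<open>(norm z1)^2\<close>, and \<open>ka\<close>
    the exponent.\<close>
  define k where "k = 8 * C + (2 * C^3 + 3 * C\<^sup>2) + 2 * C^3"
  define kg where "kg = C\<^sup>2 + 2 * C + 1 + k"
  define ke where "ke = 3 + 2 * C"
  define kd where "kd = 2 * C\<^sup>2 + kg * ke"
  define k0 where "k0 = C + C\<^sup>2 + 1"
  define kz where "kz = C + k0"
  define k5 where "k5 = 2 * kz * k0 + k0\<^sup>2"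
  define kq where "kq = 2 * kz * kd + kd\<^sup>2"
  define kq1 where "kq1 = kz\<^sup>2 + kq"
  define ka where "ka = 4 * C\<^sup>2"
  have nn: "0 \<le> k" "0 \<le> kg" "0 \<le> ke" "0 \<le> kd" "0 \<le> k0" "0 \<le> kz" "0 \<le> k5" "0 \<le> kq" "0 \<le> kq1" "0 \<le> ka"
    using C0 by (auto simp: k_def kg_def ke_def kd_def k0_def kz_def k5_def kq_def kq1_def ka_def)
  define G where "G = 2 * C * kz * k0 + (2 * C\<^sup>2 * k5 + 2 * C^4) + 2 * kz * k + 4 * C\<^sup>2 * kg + kg * ke * kg
     + (2 * C * k5 + 2 * C + 2 * k0) + ka * kq + ka * ka * ke * kq1 + 2 * C^3 * kz\<^sup>2"
  have main: "exp (- (2 * C\<^sup>2 * (norm dl + norm dm) + 4 * C\<^sup>2 * h)) * (norm z1)\<^sup>2 - (norm z)\<^sup>2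
        - (2 * (z \<bullet> (P *v w1 + Q y w1 - (h / 2) *\<^sub>R sigsig \<sigma> \<sigma>' y)) + (norm (P *v w1))\<^sup>2 - h * (norm P)\<^sup>2)
      \<le> G * (\<theta> * ((norm w0)\<^sup>2 + (norm w1)\<^sup>2 + h + ln + lm))"
    if y: "y \<in> closure D" and v: "v \<in> closure D" and y1: "y1 \<in> closure D"
      and t1: "\<theta> \<le> 1" and w0: "norm w0 \<le> \<theta>" and w1: "norm w1 \<le> \<theta>" and h0: "0 \<le> h" and h: "h \<le> \<theta>"
      and xh: "norm (v - xh) \<le> \<theta>" and dl: "norm dl \<le> ln" and dm: "norm dm \<le> lm" and ln: "ln \<le> C * \<theta>" and lm: "lm \<le> C * \<theta>"
      and e1: "norm (y1 - Uhat y w0 - h *\<^sub>R b y - dl) \<le> C * ((norm w0 + h)^3 + h * (norm w0 + h) + (norm w0 + h) * ln)"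
      and e2: "norm (y1 - y - \<sigma> y *v w0) \<le> C * ((norm w0 + h)\<^sup>2 + h + ln)"
      and e3: "norm (y1 - y) \<le> C * (norm w0 + h)"
      and rl: "(y - v) \<bullet> dl \<le> (C * (norm (y - v))\<^sup>2 + C * \<theta>) * ln"
      and rm: "(v - y) \<bullet> dm \<le> (C * (norm (y - v))\<^sup>2 + C * \<theta>) * lm"
      and ll: "ln / C - C * \<theta> * ln \<le> norm dl" and lml: "lm / C - C * \<theta> * lm \<le> norm dm"
      and z: "z = Uhat y w0 - xh" and z1: "z1 = Uhat y1 w1 - (xh + \<sigma> v *v w1 + h *\<^sub>R B v + dm)" and P: "P = Shat y w0 - \<sigma> v"
    for y v y1 w0 w1 h xh dl dm ln lm \<theta> z z1 P
  proof -
    \<comment> \<open>\<open>e\<close> gathers the quantities whose sum over all steps will be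
      bounded in probability. An error is negligible once it is a constant times
      \<open>\<theta> * e\<close>.\<close>
    define e where "e = (norm w0)\<^sup>2 + (norm w1)\<^sup>2 + h + ln + lm"
    define \<kappa> where "\<kappa> = norm w0 + h"
    have t0: "0 \<le> \<theta>" using h0 h by simp
    have ln0: "0 \<le> ln" "0 \<le> lm" using dl dm norm_ge_zero order_trans by blast+
    have el: "(norm w0)\<^sup>2 \<le> e" "(norm w1)\<^sup>2 \<le> e" "h \<le> e" "ln \<le> e" "lm \<le> e" "ln + lm \<le> e" "0 \<le> e"
        "(norm w0)\<^sup>2 + h \<le> e" "(norm w0)\<^sup>2 + h + ln \<le> e"
      using h0 ln0 by (auto simp: e_def)
    have tt: "\<theta>\<^sup>2 \<le> \<theta>" using t0 t1 by (simp add: power2_eq_square mult_left_le)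
    have sq: "a\<^sup>2 \<le> \<theta>" if "0 \<le> a" "a \<le> \<theta>" for a
      using power_mono[OF that(2,1), of 2] tt by linarith
    have ee: "e \<le> ke * \<theta>"
      using sq[of "norm w0"] sq[of "norm w1"] w0 w1 h ln lm by (simp add: e_def ke_def algebra_simps)
    have k2: "\<kappa> \<le> 2 * \<theta>" "0 \<le> \<kappa>" using w0 h h0 by (auto simp: \<kappa>_def)
    have hh: "h\<^sup>2 \<le> h" using h0 h t1 by (simp add: power2_eq_square mult_left_le)
    have kk: "\<kappa>\<^sup>2 \<le> 2 * (norm w0)\<^sup>2 + 2 * h"
    proof -
      have "\<kappa>\<^sup>2 \<le> 2 * (norm w0)\<^sup>2 + 2 * h\<^sup>2"
        using zero_le_power2[of "norm w0 - h"] by (simp add: \<kappa>_def power2_eq_square algebra_simps)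
      then show ?thesis using hh by simp
    qed
    have kk2: "\<kappa>\<^sup>2 \<le> 2 * e" using kk el(8) by linarith
    define r where "r = y1 - Uhat y w0 - h *\<^sub>R b y - dl"
    have r: "norm r \<le> 8 * C * (\<theta> * e)"
    proof -
      have "\<kappa>^3 = \<kappa> * \<kappa>\<^sup>2" by (simp add: power3_eq_cube power2_eq_square)
      also have "\<dots> \<le> (2 * \<theta>) * (2 * e)" using k2 kk2 by (intro mult_mono) auto
      finally have 1: "\<kappa>^3 \<le> 4 * (\<theta> * e)" by simp
      have "h * \<kappa> \<le> e * (2 * \<theta>)" using k2 el h0 by (intro mult_mono) auto
      then have 2: "h * \<kappa> \<le> 2 * (\<theta> * e)" by (simp add: mult_ac)
      have "\<kappa> * ln \<le> (2 * \<theta>) * e" using k2 el ln0 by (intro mult_mono) auto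
      then have 3: "\<kappa> * ln \<le> 2 * (\<theta> * e)" by simp
      have "norm r \<le> C * (\<kappa>^3 + h * \<kappa> + \<kappa> * ln)" using e1 by (simp add: r_def \<kappa>_def)
      also have "\<dots> \<le> C * (8 * (\<theta> * e))" using 1 2 3 C0 by (intro mult_left_mono) auto
      finally show ?thesis by simp
    qed
    define r2 where "r2 = (\<sigma> y1 - Shat y w0) *v w1"
    have r2: "norm r2 \<le> (2 * C^3 + 3 * C\<^sup>2) * (\<theta> * e)"
    proof -
      have n1: "norm (y1 - y) \<le> C * \<kappa>" using e3 by (simp add: \<kappa>_def)
      have "norm (\<sigma> y1 - \<sigma> y - \<sigma>' y (y1 - y)) \<le> \<Lambda> * (norm (y1 - y))\<^sup>2" by (rule sigma_taylor[OF y y1])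
      also have "\<dots> \<le> C * (C * \<kappa>)\<^sup>2" using CL n1 \<Lambda> C0 by (intro mult_mono power_mono) auto
      also have "\<dots> = C^3 * \<kappa>\<^sup>2" by (simp add: power2_eq_square power3_eq_cube)
      also have "\<dots> \<le> C^3 * (2 * e)" using kk2 C0 by (intro mult_left_mono) auto
      finally have 1: "norm (\<sigma> y1 - \<sigma> y - \<sigma>' y (y1 - y)) \<le> 2 * C^3 * e" by simp
      have "\<kappa>\<^sup>2 + h + ln \<le> 3 * e" using kk el(3,8,9) by linarith
      then have "norm (y1 - y - \<sigma> y *v w0) \<le> C * (3 * e)"
        using e2 C0 by (intro order_trans[OF e2] mult_left_mono) (auto simp: \<kappa>_def)
      then have "norm (\<sigma>' y (y1 - y - \<sigma> y *v w0)) \<le> C * (C * (3 * e))"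
        using CL \<Lambda> C0 by (intro order_trans[OF sigma'_bound[OF y]] mult_mono) auto
      then have 2: "norm (\<sigma>' y (y1 - y - \<sigma> y *v w0)) \<le> 3 * C\<^sup>2 * e" by (simp add: power2_eq_square)
      have "\<sigma> y1 - Shat y w0 = (\<sigma> y1 - \<sigma> y - \<sigma>' y (y1 - y)) + \<sigma>' y (y1 - y - \<sigma> y *v w0)"
        using linear_diff[OF sigma'_linear[OF y]] by (simp add: Shat_def)
      then have "norm (\<sigma> y1 - Shat y w0) \<le> norm (\<sigma> y1 - \<sigma> y - \<sigma>' y (y1 - y)) + norm (\<sigma>' y (y1 - y - \<sigma> y *v w0))"
        using norm_triangle_ineq by metis
      then have "norm (\<sigma> y1 - Shat y w0) \<le> (2 * C^3 + 3 * C\<^sup>2) * e" using 1 2 by (simp add: algebra_simps)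
      then have "norm (\<sigma> y1 - Shat y w0) * norm w1 \<le> ((2 * C^3 + 3 * C\<^sup>2) * e) * \<theta>"
        using w1 C0 el by (intro mult_mono) auto
      then show ?thesis unfolding r2_def using norm_matrix_vector_le[of "\<sigma> y1 - Shat y w0" w1] by (simp add: mult_ac)
    qed
    define r3 where "r3 = Q y1 w1 - Q y w1"
    have r3: "norm r3 \<le> 2 * C^3 * (\<theta> * e)"
    proof -
      have "r3 = (1/2) *\<^sub>R ((\<sigma>' y1 (\<sigma> y1 *v w1)) *v w1 - (\<sigma>' y (\<sigma> y *v w1)) *v w1)"
        by (simp add: r3_def Q_def scaleR_diff_right)
      then have "norm r3 \<le> \<Lambda>\<^sup>2 * norm (y1 - y) * (norm w1 * norm w1)"
        using sigma'_product_diff[OF y1 y, of w1 w1] by simp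
      also have "\<dots> \<le> C\<^sup>2 * (C * (2 * \<theta>)) * e"
        using CL \<Lambda> C0 e3 k2 el by (intro mult_mono power_mono order_trans[OF e3] mult_left_mono)
          (auto simp: \<kappa>_def power2_eq_square)
      finally show ?thesis by (simp add: power2_eq_square power3_eq_cube mult_ac)
    qed
    define r' where "r' = r + r2 + r3"
    have r': "norm r' \<le> k * (\<theta> * e)"
      using r r2 r3 norm_triangle_ineq[of "r + r2" r3] norm_triangle_ineq[of r r2]
      unfolding r'_def k_def by (simp add: algebra_simps)
    \<comment> \<open>Everything in \<open>z1 - z\<close> except the leading noise
      \<open>P *v w1\<close>. It is of order \<open>e\<close>, while the leading noise is only of
      order \<open>\<theta>\<close>; their product is therefore negligible, and so is the square of
      \<open>gd\<close>.\<close>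
    define gd where "gd = Q y w1 + h *\<^sub>R (b y - B v) + (dl - dm) + r'"
    have Dz: "z1 = z + (P *v w1 + gd)"
      unfolding z z1 P gd_def r'_def r_def r2_def r3_def Uhat_def
      by (simp add: matrix_vector_mult_diff_rdistrib algebra_simps)
    have nyv: "norm (y - v) \<le> C" using diam[OF y v] CL by simp
    have Pn: "norm P \<le> C * norm (y - v) + C\<^sup>2 * \<theta>"
    proof -
      have "P = (\<sigma> y - \<sigma> v) + \<sigma>' y (\<sigma> y *v w0)" by (simp add: P Shat_def)
      moreover have "norm (\<sigma> y - \<sigma> v) \<le> C * norm (y - v)"
        using CL by (intro order_trans[OF sigma_lip[OF y v]] mult_right_mono) auto
      moreover have "norm (\<sigma>' y (\<sigma> y *v w0)) \<le> C * (C * \<theta>)"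
        using CL \<Lambda> C0 w0
        by (intro order_trans[OF sigma'_bound[OF y]] mult_mono order_trans[OF sigma_mult_bound[OF y]]) auto
      ultimately show ?thesis using norm_triangle_ineq[of "\<sigma> y - \<sigma> v" "\<sigma>' y (\<sigma> y *v w0)"]
        by (simp add: power2_eq_square)
    qed
    have Pn2: "norm P \<le> 2 * C\<^sup>2"
    proof -
      have "C * norm (y - v) \<le> C * C" using nyv C0 by (intro mult_left_mono) auto
      moreover have "C\<^sup>2 * \<theta> \<le> C\<^sup>2 * 1" using t1 by (intro mult_left_mono) auto
      ultimately show ?thesis using Pn by (simp add: power2_eq_square)
    qed
    have Pw: "norm (P *v w1) \<le> 2 * C\<^sup>2 * \<theta>"
      using Pn2 w1 C0 by (intro order_trans[OF norm_matrix_vector_le] mult_mono) auto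
    have gd: "norm gd \<le> kg * e"
    proof -
      have "norm (Q y w1) \<le> C\<^sup>2 * e"
        using CL \<Lambda> el by (intro order_trans[OF Q_bound[OF y]] mult_mono power_mono) auto
      moreover have "norm (h *\<^sub>R (b y - B v)) \<le> 2 * C * e"
      proof -
        have "norm (b y - B v) \<le> 2 * C" using b_bound[OF y] B_bound[OF v] CL CB norm_triangle_ineq4[of "b y" "B v"] by linarith
        then have "h * norm (b y - B v) \<le> e * (2 * C)" using el h0 by (intro mult_mono) auto
        then show ?thesis using h0 by (simp add: mult_ac)
      qed
      moreover have "norm (dl - dm) \<le> e" using dl dm el norm_triangle_ineq4[of dl dm] by linarith
      moreover have "norm r' \<le> k * e"
      proof -
        have "k * (\<theta> * e) \<le> k * (1 * e)" using t1 el nn by (intro mult_left_mono mult_right_mono) auto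
        then show ?thesis using r' by simp
      qed
      ultimately show ?thesis
        using norm_triangle_ineq[of "Q y w1 + h *\<^sub>R (b y - B v) + (dl - dm)" r']
          norm_triangle_ineq[of "Q y w1 + h *\<^sub>R (b y - B v)" "dl - dm"] norm_triangle_ineq[of "Q y w1" "h *\<^sub>R (b y - B v)"]
        unfolding gd_def kg_def by (simp add: algebra_simps)
    qed
    have gdt: "norm gd \<le> kg * ke * \<theta>"
      using gd mult_left_mono[OF ee nn(2)] by (simp add: mult.assoc)
    have zd: "norm (z - (y - v)) \<le> k0 * \<theta>"
    proof -
      have eq: "z - (y - v) = \<sigma> y *v w0 + Q y w0 + (v - xh)" by (simp add: z Uhat_def)
      have "norm (\<sigma> y *v w0) \<le> C * \<theta>"
        using CL \<Lambda> w0 C0 by (intro order_trans[OF sigma_mult_bound[OF y]] mult_mono) auto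
      moreover have "norm (Q y w0) \<le> C\<^sup>2 * \<theta>"
        using CL \<Lambda> w0 sq[of "norm w0"] by (intro order_trans[OF Q_bound[OF y]] mult_mono power_mono) auto
      ultimately show ?thesis using xh norm_triangle_ineq[of "\<sigma> y *v w0 + Q y w0" "v - xh"] norm_triangle_ineq[of "\<sigma> y *v w0" "Q y w0"]
        unfolding eq k0_def distrib_right by linarith
    qed
    have zn: "norm z \<le> kz"
    proof -
      have "k0 * \<theta> \<le> k0 * 1" using t1 nn by (intro mult_left_mono) auto
      then show ?thesis using zd nyv norm_triangle_ineq[of "z - (y - v)" "y - v"] by (simp add: kz_def)
    qed
    have yz: "norm (y - v) \<le> norm z + k0 * \<theta>"
      using zd norm_triangle_ineq4[of z "z - (y - v)"] by simp
    have yz2: "(norm (y - v))\<^sup>2 \<le> (norm z)\<^sup>2 + k5 * \<theta>"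
    proof -
      have "(norm (y - v))\<^sup>2 \<le> (norm z + k0 * \<theta>)\<^sup>2" using yz by (intro power_mono) auto
      also have "\<dots> = (norm z)\<^sup>2 + 2 * norm z * k0 * \<theta> + k0\<^sup>2 * \<theta>\<^sup>2" by (simp add: power2_eq_square algebra_simps)
      also have "\<dots> \<le> (norm z)\<^sup>2 + 2 * kz * k0 * \<theta> + k0\<^sup>2 * \<theta>"
        using zn tt nn t0 by (intro add_mono mult_right_mono mult_left_mono) auto
      finally show ?thesis by (simp add: k5_def algebra_simps)
    qed
    \<comment> \<open>\<open>T1\<close> to \<open>T9\<close> treat the terms of
      \<open>expand\<close> and of the exponential. Multiples of \<open>(norm z)^2\<close> are kept
      explicit, to be set against the exponent; the rest goes into
      \<open>\<theta> * e\<close>.\<close>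
    have T1: "2 * h * (z \<bullet> (B y - B v)) \<le> 2 * C * h * (norm z)\<^sup>2 + 2 * C * kz * k0 * (\<theta> * e)"
    proof -
      have "z \<bullet> (B y - B v) \<le> norm z * norm (B y - B v)" by (rule norm_cauchy_schwarz)
      also have "\<dots> \<le> norm z * (C * (norm z + k0 * \<theta>))"
        using CB yz C0 CB_pos by (intro mult_left_mono order_trans[OF B_lip[OF y v]] mult_mono) auto
      also have "\<dots> = C * (norm z)\<^sup>2 + norm z * (C * (k0 * \<theta>))" by (simp add: power2_eq_square algebra_simps)
      also have "\<dots> \<le> C * (norm z)\<^sup>2 + kz * (C * (k0 * \<theta>))"
        using zn C0 nn t0 by (intro add_left_mono mult_right_mono) auto
      finally have "2 * h * (z \<bullet> (B y - B v)) \<le> 2 * h * (C * (norm z)\<^sup>2 + kz * (C * (k0 * \<theta>)))"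
        using h0 by (intro mult_left_mono) auto
      also have "\<dots> = 2 * C * h * (norm z)\<^sup>2 + (2 * C * kz * k0 * \<theta>) * h" by (simp add: algebra_simps)
      also have "\<dots> \<le> 2 * C * h * (norm z)\<^sup>2 + (2 * C * kz * k0 * \<theta>) * e"
        using el C0 nn t0 by (intro add_left_mono mult_left_mono) auto
      finally show ?thesis by (simp add: mult_ac)
    qed
    have T2: "h * (norm P)\<^sup>2 \<le> 2 * C\<^sup>2 * h * (norm z)\<^sup>2 + (2 * C\<^sup>2 * k5 + 2 * C^4) * (\<theta> * e)"
    proof -
      have "(norm P)\<^sup>2 \<le> (C * norm (y - v) + C\<^sup>2 * \<theta>)\<^sup>2" using Pn by (intro power_mono) auto
      also have "\<dots> \<le> 2 * (C * norm (y - v))\<^sup>2 + 2 * (C\<^sup>2 * \<theta>)\<^sup>2"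
        using zero_le_power2[of "C * norm (y - v) - C\<^sup>2 * \<theta>"] by (simp add: power2_eq_square algebra_simps)
      also have "\<dots> = 2 * C\<^sup>2 * (norm (y - v))\<^sup>2 + 2 * C^4 * \<theta>\<^sup>2" by (simp add: power_mult_distrib)
      also have "\<dots> \<le> 2 * C\<^sup>2 * ((norm z)\<^sup>2 + k5 * \<theta>) + 2 * C^4 * \<theta>"
        using yz2 tt C0 by (intro add_mono mult_left_mono) auto
      finally have "h * (norm P)\<^sup>2 \<le> h * (2 * C\<^sup>2 * ((norm z)\<^sup>2 + k5 * \<theta>) + 2 * C^4 * \<theta>)" using h0 by (intro mult_left_mono) auto
      also have "\<dots> = 2 * C\<^sup>2 * h * (norm z)\<^sup>2 + ((2 * C\<^sup>2 * k5 + 2 * C^4) * \<theta>) * h" by (simp add: algebra_simps)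
      also have "\<dots> \<le> 2 * C\<^sup>2 * h * (norm z)\<^sup>2 + ((2 * C\<^sup>2 * k5 + 2 * C^4) * \<theta>) * e"
        using el C0 nn t0 by (intro add_left_mono mult_left_mono) auto
      finally show ?thesis by (simp add: mult_ac)
    qed
    have T3: "2 * (z \<bullet> r') \<le> 2 * kz * k * (\<theta> * e)"
    proof -
      have "z \<bullet> r' \<le> norm z * norm r'" by (rule norm_cauchy_schwarz)
      also have "\<dots> \<le> kz * (k * (\<theta> * e))" using zn r' nn by (intro mult_mono) auto
      finally show ?thesis by (simp add: mult_ac)
    qed
    have T4: "2 * ((P *v w1) \<bullet> gd) \<le> 4 * C\<^sup>2 * kg * (\<theta> * e)"
    proof -
      have "(P *v w1) \<bullet> gd \<le> norm (P *v w1) * norm gd" by (rule norm_cauchy_schwarz)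
      also have "\<dots> \<le> (2 * C\<^sup>2 * \<theta>) * (kg * e)" using Pw gd t0 by (intro mult_mono) auto
      finally show ?thesis by (simp add: mult_ac)
    qed
    have T5: "(norm gd)\<^sup>2 \<le> kg * ke * kg * (\<theta> * e)"
    proof -
      have "norm gd * norm gd \<le> (kg * ke * \<theta>) * (kg * e)" using gd gdt nn t0 by (intro mult_mono) auto
      then show ?thesis by (simp add: power2_eq_square mult_ac)
    qed
    \<comment> \<open>The hypotheses \<open>rl\<close> and \<open>rm\<close>, which encode (D.1),
      concern \<open>y - v\<close>; replacing it by \<open>z\<close> costs at most
      \<open>k0 * \<theta>\<close> against each reflection increment.\<close>
    have T6: "2 * (z \<bullet> (dl - dm)) \<le> 2 * C * (ln + lm) * (norm z)\<^sup>2 + (2 * C * k5 + 2 * C + 2 * k0) * (\<theta> * e)"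
    proof -
      have one: "q \<bullet> d \<le> C * (norm z)\<^sup>2 * ll + (C * k5 + C + k0) * \<theta> * ll"
        if a: "(q - q') \<bullet> d \<le> (C * (norm (y - v))\<^sup>2 + C * \<theta>) * ll" and b: "norm q' \<le> k0 * \<theta>" and c: "norm d \<le> ll" "0 \<le> ll"
        for q q' d :: "real^'d" and ll
      proof -
        have "q' \<bullet> d \<le> norm q' * norm d" by (rule norm_cauchy_schwarz)
        also have "\<dots> \<le> (k0 * \<theta>) * ll" using b c nn t0 by (intro mult_mono) auto
        finally have "q \<bullet> d \<le> (C * (norm (y - v))\<^sup>2 + C * \<theta>) * ll + k0 * \<theta> * ll" using a by (simp add: inner_diff_left)
        also have "\<dots> \<le> (C * ((norm z)\<^sup>2 + k5 * \<theta>) + C * \<theta>) * ll + k0 * \<theta> * ll"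
          using yz2 C0 c by (intro add_right_mono mult_right_mono mult_left_mono) auto
        finally show ?thesis by (simp add: algebra_simps)
      qed
      have "z \<bullet> dl \<le> C * (norm z)\<^sup>2 * ln + (C * k5 + C + k0) * \<theta> * ln"
        by (rule one[of z "z - (y - v)"]) (use rl zd dl ln0 in auto)
      moreover have "(- z) \<bullet> dm \<le> C * (norm z)\<^sup>2 * lm + (C * k5 + C + k0) * \<theta> * lm"
        by (rule one[of "- z" "- (z - (y - v))"]) (use rm zd dm ln0 in \<open>auto simp: norm_minus_commute\<close>)
      ultimately have "2 * (z \<bullet> (dl - dm)) \<le> 2 * C * (ln + lm) * (norm z)\<^sup>2 + ((2 * C * k5 + 2 * C + 2 * k0) * \<theta>) * (ln + lm)"
        by (simp add: inner_diff_right algebra_simps)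
      also have "\<dots> \<le> 2 * C * (ln + lm) * (norm z)\<^sup>2 + ((2 * C * k5 + 2 * C + 2 * k0) * \<theta>) * e"
        using el C0 nn t0 by (intro add_left_mono mult_left_mono) auto
      finally show ?thesis by (simp add: mult_ac)
    qed
    define a where "a = 2 * C\<^sup>2 * (norm dl + norm dm) + 4 * C\<^sup>2 * h"
    have a0: "0 \<le> a" using h0 by (simp add: a_def)
    have ae: "a \<le> ka * e"
    proof -
      have "2 * C\<^sup>2 * (norm dl + norm dm) \<le> 4 * C\<^sup>2 * (ln + lm)"
        using dl dm by (intro mult_mono) auto
      then have "a \<le> 4 * C\<^sup>2 * (ln + lm + h)" by (simp add: a_def algebra_simps)
      also have "\<dots> \<le> 4 * C\<^sup>2 * e" by (intro mult_left_mono) (auto simp: e_def)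
      finally show ?thesis by (simp add: ka_def)
    qed
    have at: "a \<le> ka * ke * \<theta>" using ae mult_left_mono[OF ee nn(10)] by (simp add: mult.assoc)
    have zz1: "\<bar>(norm z1)\<^sup>2 - (norm z)\<^sup>2\<bar> \<le> kq * \<theta>"
    proof -
      let ?u = "P *v w1 + gd"
      have u: "norm ?u \<le> kd * \<theta>"
        using Pw gdt norm_triangle_ineq[of "P *v w1" gd] by (simp add: kd_def algebra_simps)
      have "(norm z1)\<^sup>2 - (norm z)\<^sup>2 = 2 * (z \<bullet> ?u) + (norm ?u)\<^sup>2"
        unfolding Dz power2_norm_eq_inner by (simp add: inner_add_left inner_add_right inner_commute)
      moreover have "\<bar>z \<bullet> ?u\<bar> \<le> kz * (kd * \<theta>)"
        using zn u nn t0 by (intro order_trans[OF Cauchy_Schwarz_ineq2] mult_mono) auto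
      moreover have "(norm ?u)\<^sup>2 \<le> kd\<^sup>2 * \<theta>"
      proof -
        have "(norm ?u)\<^sup>2 \<le> (kd * \<theta>)\<^sup>2" using u by (intro power_mono) auto
        also have "\<dots> \<le> kd\<^sup>2 * \<theta>" using tt by (simp add: power_mult_distrib mult_left_mono)
        finally show ?thesis .
      qed
      moreover have "0 \<le> (norm ?u)\<^sup>2" by simp
      moreover have "kq * \<theta> = 2 * (kz * (kd * \<theta>)) + kd\<^sup>2 * \<theta>" by (simp add: kq_def algebra_simps)
      moreover have "\<bar>A\<bar> \<le> K" if "A = 2 * X + Y" "\<bar>X\<bar> \<le> X'" "Y \<le> Y'" "0 \<le> Y" "K = 2 * X' + Y'" for A X Y X' Y' K :: real
        using that by linarith
      ultimately show ?thesis by blast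
    qed
    have z1b: "(norm z1)\<^sup>2 \<le> kq1"
    proof -
      have "kq * \<theta> \<le> kq * 1" using t1 nn by (intro mult_left_mono) auto
      moreover have "(norm z)\<^sup>2 \<le> kz\<^sup>2" using zn by (intro power_mono) auto
      ultimately show ?thesis using zz1 by (simp add: kq1_def abs_le_iff)
    qed
    \<comment> \<open>The exponential multiplies \<open>(norm z1)^2\<close>, but the terms to be
      cancelled contain \<open>(norm z)^2\<close>. The exchange costs \<open>a\<close> times a
      change of order \<open>\<theta>\<close>, and the quadratic remainder of the exponential is of
      order \<open>a^2\<close>; both are multiples of \<open>\<theta> * e\<close>.\<close>
    have T7: "(exp (- a) - 1) * (norm z1)\<^sup>2 \<le> - a * (norm z)\<^sup>2 + ka * kq * (\<theta> * e) + ka * ka * ke * kq1 * (\<theta> * e)"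
    proof -
      have "(exp (- a) - 1) * (norm z1)\<^sup>2 \<le> (- a + a\<^sup>2) * (norm z1)\<^sup>2"
        using exp_minus_le_quadratic[OF a0] by (intro mult_right_mono) auto
      also have "\<dots> = - a * (norm z)\<^sup>2 + a * ((norm z)\<^sup>2 - (norm z1)\<^sup>2) + a\<^sup>2 * (norm z1)\<^sup>2" by (simp add: algebra_simps)
      also have "\<dots> \<le> - a * (norm z)\<^sup>2 + (ka * e) * (kq * \<theta>) + ((ka * e) * (ka * ke * \<theta>)) * kq1"
      proof (intro add_mono)
        have "a * ((norm z)\<^sup>2 - (norm z1)\<^sup>2) \<le> a * (kq * \<theta>)" using zz1 a0 by (intro mult_left_mono) (auto simp: abs_le_iff)
        also have "\<dots> \<le> (ka * e) * (kq * \<theta>)" using ae nn t0 by (intro mult_right_mono) auto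
        finally show "a * ((norm z)\<^sup>2 - (norm z1)\<^sup>2) \<le> (ka * e) * (kq * \<theta>)" .
        have "a\<^sup>2 \<le> (ka * e) * (ka * ke * \<theta>)" unfolding power2_eq_square using ae at a0 nn el by (intro mult_mono) auto
        then show "a\<^sup>2 * (norm z1)\<^sup>2 \<le> ((ka * e) * (ka * ke * \<theta>)) * kq1" using z1b nn el t0 by (intro mult_mono) auto
      qed simp
      finally show ?thesis by (simp add: mult_ac)
    qed
    \<comment> \<open>The origin of \<open>2 * C^2\<close> in the exponent: an increment is at least
      its variation divided by \<open>C\<close>, up to a small error, so that the
      \<open>2 * C * (ln + lm)\<close> demanded by \<open>T6\<close> is still available. The part
      \<open>4 * C^2 * h\<close> is left for drift and variance in \<open>T1\<close> and
      \<open>T2\<close>.\<close>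
    have T8: "2 * C * (ln + lm) * (norm z)\<^sup>2 + 4 * C\<^sup>2 * h * (norm z)\<^sup>2 - 2 * C^3 * kz\<^sup>2 * (\<theta> * e) \<le> a * (norm z)\<^sup>2"
    proof -
      have cp: "C > 0" using C1 by simp
      have "(ln + lm) / C - C * \<theta> * (ln + lm) \<le> norm dl + norm dm" using ll lml by (simp add: add_divide_distrib algebra_simps)
      then have "2 * C\<^sup>2 * ((ln + lm) / C - C * \<theta> * (ln + lm)) \<le> 2 * C\<^sup>2 * (norm dl + norm dm)" by (intro mult_left_mono) auto
      then have "2 * C * (ln + lm) - 2 * C^3 * \<theta> * (ln + lm) + 4 * C\<^sup>2 * h \<le> a"
      proof -
        have "2 * C\<^sup>2 * ((ln + lm) / C - C * \<theta> * (ln + lm)) = 2 * C * (ln + lm) - 2 * C^3 * \<theta> * (ln + lm)"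
          using cp by (simp add: field_simps power2_eq_square power3_eq_cube)
        then show ?thesis
          using \<open>2 * C\<^sup>2 * ((ln + lm) / C - C * \<theta> * (ln + lm)) \<le> 2 * C\<^sup>2 * (norm dl + norm dm)\<close>
          by (simp add: a_def)
      qed
      then have "(2 * C * (ln + lm) - 2 * C^3 * \<theta> * (ln + lm) + 4 * C\<^sup>2 * h) * (norm z)\<^sup>2 \<le> a * (norm z)\<^sup>2"
        by (intro mult_right_mono) auto
      moreover have "(2 * C^3 * \<theta> * (ln + lm)) * (norm z)\<^sup>2 \<le> (2 * C^3 * \<theta> * e) * kz\<^sup>2"
        using zn C0 el t0 ln0 by (intro mult_mono power_mono mult_left_mono) auto
      ultimately show ?thesis by (simp add: algebra_simps)
    qed
    have T9: "2 * C * h * (norm z)\<^sup>2 + 2 * C\<^sup>2 * h * (norm z)\<^sup>2 \<le> 4 * C\<^sup>2 * h * (norm z)\<^sup>2"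
    proof -
      have "C * (h * (norm z)\<^sup>2) \<le> C\<^sup>2 * (h * (norm z)\<^sup>2)" using CC h0 by (intro mult_right_mono) auto
      then show ?thesis by (simp add: algebra_simps)
    qed
    \<comment> \<open>Centering \<open>Q y w1\<close> releases \<open>h / 2\<close> times
      \<open>sigsig\<close> at \<open>y\<close>, which joins \<open>b y\<close> to form the Ito
      drift \<open>B y\<close>. Only \<open>B y - B v\<close> is left, and it is controlled by
      Lipschitz continuity.\<close>
    have expand: "(norm z1)\<^sup>2 - (norm z)\<^sup>2
        - (2 * (z \<bullet> (P *v w1 + Q y w1 - (h / 2) *\<^sub>R sigsig \<sigma> \<sigma>' y)) + (norm (P *v w1))\<^sup>2 - h * (norm P)\<^sup>2)
      = 2 * h * (z \<bullet> (B y - B v)) + 2 * (z \<bullet> (dl - dm)) + 2 * (z \<bullet> r') + 2 * ((P *v w1) \<bullet> gd) + (norm gd)\<^sup>2 + h * (norm P)\<^sup>2"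
    proof -
      have "(norm z1)\<^sup>2 = (norm z)\<^sup>2 + 2 * (z \<bullet> (P *v w1)) + 2 * (z \<bullet> gd) + (norm (P *v w1))\<^sup>2 + 2 * ((P *v w1) \<bullet> gd) + (norm gd)\<^sup>2"
        unfolding Dz power2_norm_eq_inner by (simp add: inner_add_left inner_add_right inner_commute)
      moreover have "z \<bullet> gd = z \<bullet> Q y w1 + h * (z \<bullet> (b y - B v)) + z \<bullet> (dl - dm) + z \<bullet> r'"
        by (simp add: gd_def inner_add_right)
      moreover have "h * (z \<bullet> (B y - B v)) = h * (z \<bullet> (b y - B v)) + z \<bullet> ((h / 2) *\<^sub>R sigsig \<sigma> \<sigma>' y)"
        by (simp add: B_def inner_add_right inner_diff_right algebra_simps)
      moreover have "z \<bullet> (P *v w1 + Q y w1 - (h / 2) *\<^sub>R sigsig \<sigma> \<sigma>' y) = z \<bullet> (P *v w1) + z \<bullet> Q y w1 - z \<bullet> ((h / 2) *\<^sub>R sigsig \<sigma> \<sigma>' y)"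
        by (simp add: inner_add_right inner_diff_right)
      ultimately show ?thesis by linarith
    qed
    have "exp (- a) * (norm z1)\<^sup>2 = (norm z1)\<^sup>2 + (exp (- a) - 1) * (norm z1)\<^sup>2" by (simp add: algebra_simps)
    then have "exp (- a) * (norm z1)\<^sup>2 - (norm z)\<^sup>2
        - (2 * (z \<bullet> (P *v w1 + Q y w1 - (h / 2) *\<^sub>R sigsig \<sigma> \<sigma>' y)) + (norm (P *v w1))\<^sup>2 - h * (norm P)\<^sup>2)
      \<le> 2 * C * kz * k0 * (\<theta> * e) + (2 * C\<^sup>2 * k5 + 2 * C^4) * (\<theta> * e) + 2 * kz * k * (\<theta> * e) + 4 * C\<^sup>2 * kg * (\<theta> * e)
        + kg * ke * kg * (\<theta> * e) + (2 * C * k5 + 2 * C + 2 * k0) * (\<theta> * e) + ka * kq * (\<theta> * e) + ka * ka * ke * kq1 * (\<theta> * e)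
        + 2 * C^3 * kz\<^sup>2 * (\<theta> * e)"
      using expand T1 T2 T3 T4 T5 T6 T7 T8 T9 by linarith
    also have "\<dots> = G * (\<theta> * e)" unfolding G_def by (simp only: distrib_right)
    finally show ?thesis by (simp add: a_def e_def)
  qed
  moreover have "0 \<le> G" unfolding G_def using nn C0 by (intro add_nonneg_nonneg mult_nonneg_nonneg) auto
  ultimately show ?thesis by (intro that[of G]) blast+
qed

end

section \<open>The two reflected equations on the dyadic grid\<close>

text \<open>The integral over \<open>{0..0}\<close> would count an atom at 0. There is none: the
  variation is 0 at all nonpositive times and right continuous, so \<open>{-1<..0}\<close> has mass
  0.\<close>

lemma reflection_term_zero:
  fixes x l :: "real \<Rightarrow> real^'d"
  assumes refl: "reflection_term D \<nu> x l" and cl: "continuous_on {0..} l"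
  shows "l 0 = 0"
proof -
  define tv where "tv = total_variation l 0"
  define \<mu> where "\<mu> = interval_measure tv"
  have bv: "\<And>t. t \<ge> 0 \<Longrightarrow> bounded_variation_on l 0 t" using refl by (auto simp: reflection_term_def)
  have "\<exists>\<gamma>::real \<Rightarrow> real^'d. \<gamma> \<in> borel_measurable borel \<and> (AE s in \<mu>. 0 \<le> s \<longrightarrow> \<gamma> s \<in> \<nu> (x s)) \<and>
      (\<forall>t\<ge>0. l t = (LINT s:{0..t}|\<mu>. \<gamma> s)) \<and>
      (\<forall>t\<ge>0. tv t = (LINT s:{0..t}|\<mu>. indicator (frontier D) (x s)))"
    using refl unfolding reflection_term_def Let_def \<mu>_def tv_def by (rule conjunct2)
  then obtain \<gamma> where g: "\<And>t. t \<ge> 0 \<Longrightarrow> l t = (LINT s:{0..t}|\<mu>. \<gamma> s)" by blast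
  have mono: "\<And>a b. a \<le> b \<Longrightarrow> tv a \<le> tv b" unfolding tv_def by (rule total_variation_mono[OF bv])
  have rc: "\<And>a. continuous (at_right a) tv" unfolding tv_def by (rule total_variation_right_continuous[OF bv cl])
  have "emeasure \<mu> {0} \<le> emeasure \<mu> {-1<..0}" by (intro emeasure_mono) (auto simp: \<mu>_def)
  also have "\<dots> = ennreal (tv 0 - tv (-1))"
    unfolding \<mu>_def by (rule emeasure_interval_measure_Ioc[OF _ mono rc]) auto
  also have "\<dots> = 0" by (simp add: tv_def total_variation_nonpos[OF bv])
  finally have "{0} \<in> null_sets \<mu>" by (auto simp: null_sets_def \<mu>_def)
  then have "AE s in \<mu>. s \<notin> {0}" by (rule AE_not_in)
  then have "(LINT s|\<mu>. indicator {0..0} s *\<^sub>R \<gamma> s) = 0"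
    by (intro integral_eq_zero_AE) (auto elim!: eventually_mono)
  then show ?thesis using g[of 0] by (simp add: set_lebesgue_integral_def)
qed

lemma interp_W_derivative:
  assumes s: "real k / 2 ^ n < s" "s < real (Suc k) / 2 ^ n"
  shows "vector_derivative (\<lambda>r. interp_W W n r \<omega>) (at s) =
    (2 ^ n) *\<^sub>R (W (real k / 2 ^ n) \<omega> - W (max 0 ((real k - 1) / 2 ^ n)) \<omega>)"
proof -
  let ?a = "W (max 0 ((real k - 1) / 2 ^ n)) \<omega>" and ?c = "W (real k / 2 ^ n) \<omega>"
  let ?f = "\<lambda>r. ?a + (2 ^ n * (r - real k / 2 ^ n)) *\<^sub>R (?c - ?a)"
  let ?S = "{real k / 2 ^ n <..< real (Suc k) / 2 ^ n}"
  have eq: "interp_W W n r \<omega> = ?f r" if r: "r \<in> ?S" for r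
  proof -
    have r0: "0 \<le> r" using r by (auto intro: order_trans[of 0 "real k / 2 ^ n"] less_imp_le)
    have "real k < r * 2 ^ n" "r * 2 ^ n < real k + 1" using r by (auto simp: field_simps)
    then have "\<lfloor>r * 2 ^ n\<rfloor> = int k" by (simp add: floor_eq_iff)
    then show ?thesis using r0 by (simp add: interp_W_def Let_def max_def)
  qed
  have "(?f has_vector_derivative (2 ^ n) *\<^sub>R (?c - ?a)) (at s)"
    by (auto intro!: derivative_eq_intros)
  then have "((\<lambda>r. interp_W W n r \<omega>) has_vector_derivative (2 ^ n) *\<^sub>R (?c - ?a)) (at s)"
    by (rule has_vector_derivative_transform_within_open[of _ _ _ ?S]) (use s eq in auto)
  then show ?thesis by (rule vector_derivative_at)
qed

locale wong_zakai =
  filtered_brownian_motion M F W + coefficients D \<nu> \<phi> g \<alpha> \<Lambda> \<sigma> \<sigma>' b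
  for M :: "'a measure" and F :: "real \<Rightarrow> 'a measure" and W :: "real \<Rightarrow> 'a \<Rightarrow> real^'m"
    and D :: "(real^'d) set" and \<nu> \<phi> g \<alpha> \<Lambda> and \<sigma> :: "real^'d \<Rightarrow> real^'m^'d" and \<sigma>' b +
  fixes x0 :: "real^'d" and X L :: "real \<Rightarrow> 'a \<Rightarrow> real^'d" and Xn Ln :: "nat \<Rightarrow> real \<Rightarrow> 'a \<Rightarrow> real^'d"
  assumes x0: "x0 \<in> closure D"
    and sol: "reflected_sde_solution M F W D \<nu> \<sigma> \<sigma>' b x0 X L"
    and sol_n: "\<And>n. reflected_ode_solution M F W n D \<nu> \<sigma> b x0 (Xn n) (Ln n)"
begin

text \<open>The increment that drives \<open>X\<^sup>n\<close> on the \<open>k\<close>-th interval; it is zero on the first one because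
  \<open>W\<close> is extended constantly to negative times.\<close>

definition w' :: "nat \<Rightarrow> nat \<Rightarrow> 'a \<Rightarrow> real^'m" where
  "w' n k \<omega> = (if k = 0 then 0 else dW n (k - 1) \<omega>)"

definition rpath :: "(real \<Rightarrow> real^'d) \<Rightarrow> (real \<Rightarrow> real^'d) \<Rightarrow> bool" where
  "rpath x l \<longleftrightarrow> continuous_on {0..} x \<and> continuous_on {0..} l \<and> (\<forall>t\<ge>0. x t \<in> closure D) \<and> reflection_term D \<nu> x l"

abbreviation tv :: "(real \<Rightarrow> real^'d) \<Rightarrow> real \<Rightarrow> real" where "tv l \<equiv> total_variation l 0"

lemma rpath_V:
  assumes "rpath x l" "0 \<le> s" "s \<le> t" shows "norm (l t - l s) \<le> tv l t - tv l s"
proof -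
  have bv: "\<And>t. t \<ge> 0 \<Longrightarrow> bounded_variation_on l 0 t" using assms by (auto simp: rpath_def reflection_term_def)
  show ?thesis by (rule norm_diff_le_total_variation[OF bv assms(2,3)])
qed

lemma rpath_tv0: "rpath x l \<Longrightarrow> tv l 0 = 0"
  by (rule total_variation_nonpos) (auto simp: rpath_def reflection_term_def)

lemma rpath_l0: "rpath x l \<Longrightarrow> l 0 = 0"
  by (rule reflection_term_zero) (auto simp: rpath_def)

lemma rpath_R:
  assumes "rpath x l" "0 \<le> s" "s \<le> t"
    "\<And>r w. s \<le> r \<Longrightarrow> r \<le> t \<Longrightarrow> x r \<in> frontier D \<Longrightarrow> w \<in> \<nu> (x r) \<Longrightarrow> \<gamma> \<le> u \<bullet> w"
  shows "\<gamma> * (tv l t - tv l s) \<le> u \<bullet> (l t - l s)"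
  by (rule reflection_term_inner_ge[OF _ _ _ nu assms(2,3)]) (use assms in \<open>auto simp: rpath_def\<close>)

lemma rpath_lower:
  assumes rp: "rpath x l" and pq: "0 \<le> p" "p \<le> q" and o: "\<And>r. p \<le> r \<Longrightarrow> r \<le> q \<Longrightarrow> norm (x r - x p) \<le> o'"
  shows "(\<alpha> - \<Lambda> * o') * (tv l q - tv l p) \<le> \<Lambda> * norm (l q - l p)"
proof (rule reflection_lower_bound[where x = x])
  show "continuous_on {p..q} x" using rp pq by (auto simp: rpath_def intro: continuous_on_subset)
  show "x r \<in> closure D" if "p \<le> r" "r \<le> q" for r using rp pq that by (auto simp: rpath_def)
  show "norm (l t - l s) \<le> tv l t - tv l s" if "p \<le> s" "s \<le> t" "t \<le> q" for s t using that pq by (intro rpath_V[OF rp]) auto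
  fix s t u \<gamma> assume a: "p \<le> s" "s \<le> t" "t \<le> q"
    "\<And>r w. s \<le> r \<Longrightarrow> r \<le> t \<Longrightarrow> x r \<in> frontier D \<Longrightarrow> w \<in> \<nu> (x r) \<Longrightarrow> \<gamma> \<le> u \<bullet> w"
  have "0 \<le> s" using a pq by simp
  then show "\<gamma> * (tv l t - tv l s) \<le> u \<bullet> (l t - l s)" by (rule rpath_R[OF rp _ a(2)]) (rule a(4))
qed (use pq o in auto)

lemma rpath_pair:
  assumes rp: "rpath x l" and pq: "0 \<le> p" "p \<le> q" and o: "\<And>r. p \<le> r \<Longrightarrow> r \<le> q \<Longrightarrow> norm (x r - x p) \<le> o'"
    and o1: "o' \<le> \<Lambda>" and u: "u \<in> closure D"
  shows "(x p - u) \<bullet> (l q - l p) \<le> (\<Lambda> * (norm (x p - u))\<^sup>2 + (1 + 3 * \<Lambda>\<^sup>2) * o') * (tv l q - tv l p)"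
proof (rule reflection_pair_bound[where x = x])
  show "continuous_on {p..q} x" using rp pq by (auto simp: rpath_def intro: continuous_on_subset)
  show "x r \<in> closure D" if "p \<le> r" "r \<le> q" for r using rp pq that by (auto simp: rpath_def)
  show "norm (l t - l s) \<le> tv l t - tv l s" if "p \<le> s" "s \<le> t" "t \<le> q" for s t using that pq by (intro rpath_V[OF rp]) auto
  fix s t u \<gamma> assume a: "p \<le> s" "s \<le> t" "t \<le> q"
    "\<And>r w. s \<le> r \<Longrightarrow> r \<le> t \<Longrightarrow> x r \<in> frontier D \<Longrightarrow> w \<in> \<nu> (x r) \<Longrightarrow> \<gamma> \<le> u \<bullet> w"
  have "0 \<le> s" using a pq by simp
  then show "\<gamma> * (tv l t - tv l s) \<le> u \<bullet> (l t - l s)" by (rule rpath_R[OF rp _ a(2)]) (rule a(4))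
qed (use pq o o1 u in auto)

definition ode_path :: "nat \<Rightarrow> 'a \<Rightarrow> bool" where
  "ode_path n \<omega> \<longleftrightarrow> rpath (\<lambda>t. Xn n t \<omega>) (\<lambda>t. Ln n t \<omega>) \<and>
    (\<forall>t\<ge>0. Xn n t \<omega> = x0
       + integral {0..t} (\<lambda>s. \<sigma> (Xn n s \<omega>) *v vector_derivative (\<lambda>r. interp_W W n r \<omega>) (at s))
       + integral {0..t} (\<lambda>s. b (Xn n s \<omega>)) + Ln n t \<omega>)"

lemma AE_ode_path: "AE \<omega> in M. ode_path n \<omega>"
  using sol_n[of n] by (auto simp: reflected_ode_solution_def ode_path_def rpath_def elim!: eventually_mono)

lemma AE_rpath: "AE \<omega> in M. rpath (\<lambda>t. X t \<omega>) (\<lambda>t. L t \<omega>)"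
  using sol by (auto simp: reflected_sde_solution_def rpath_def elim!: eventually_mono)

lemma closure_continuous_compose:
  assumes "\<And>x y. x \<in> closure D \<Longrightarrow> y \<in> closure D \<Longrightarrow> norm (f x - f y) \<le> c * norm (x - y)"
    "continuous_on A x" "x ` A \<subseteq> closure D" "0 \<le> c"
  shows "continuous_on A (\<lambda>r. f (x r))"
proof -
  have "c-lipschitz_on (closure D) f" using assms(1,4) by (auto intro!: lipschitz_onI simp: dist_norm)
  from continuous_on_compose2[OF lipschitz_on_continuous_on[OF this] assms(2,3)] show ?thesis .
qed

lemma ode_path_step:
  assumes op: "ode_path n \<omega>" and t: "real k / 2 ^ n \<le> t" "t \<le> real k / 2 ^ n + 1 / 2 ^ n"
  shows "Xn n t \<omega> - Xn n (real k / 2 ^ n) \<omega> =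
    integral {real k / 2 ^ n..t} (\<lambda>r. \<sigma> (Xn n r \<omega>) *v ((1 / (1 / 2 ^ n)) *\<^sub>R w' n k \<omega>) + b (Xn n r \<omega>))
     + (Ln n t \<omega> - Ln n (real k / 2 ^ n) \<omega>)"
proof -
  define x where "x = (\<lambda>t. Xn n t \<omega>)"
  define f where "f = (\<lambda>s. \<sigma> (x s) *v vector_derivative (\<lambda>r. interp_W W n r \<omega>) (at s))"
  define f2 where "f2 = (\<lambda>k s. \<sigma> (x s) *v ((2 ^ n) *\<^sub>R w' n k \<omega>))"
  have xc: "continuous_on {0..} x" and xD: "\<And>t. 0 \<le> t \<Longrightarrow> x t \<in> closure D"
    using op by (auto simp: ode_path_def rpath_def x_def)
  have f2c: "continuous_on {p..q} (f2 k)" if "0 \<le> p" for p q k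
  proof -
    have "continuous_on {p..q} (\<lambda>r. \<sigma> (x r))"
      using that xD \<Lambda> by (intro closure_continuous_compose[of \<sigma> \<Lambda>] sigma_lip continuous_on_subset[OF xc]) auto
    then show ?thesis unfolding f2_def matrix_vector_mult_def by (intro continuous_intros)
  qed
  have bc: "continuous_on {p..q} (\<lambda>r. b (x r))" if "0 \<le> p" for p q
    using that xD \<Lambda> by (intro closure_continuous_compose[of b \<Lambda>] b_lip continuous_on_subset[OF xc]) auto
  have eq: "f s = f2 k s" if "real k / 2 ^ n < s" "s < real (Suc k) / 2 ^ n" for s k
  proof -
    have "W (real k / 2 ^ n) \<omega> - W (max 0 ((real k - 1) / 2 ^ n)) \<omega> = w' n k \<omega>"
    proof (cases k)
      case 0
      have "max 0 ((real k - 1) / 2 ^ n) = 0" by (intro max_absorb1) (simp add: 0)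
      then show ?thesis using 0 by (simp add: w'_def)
    next
      case (Suc j)
      then show ?thesis by (simp add: w'_def dW_def)
    qed
    then show ?thesis unfolding f_def f2_def interp_W_derivative[OF that] by simp
  qed
  \<comment> \<open>At grid points the interpolation may have a kink, where nothing is claimed about
    \<open>vector_derivative\<close>. The integrand is identified only inside the intervals, the end
    points are removed as a negligible set, and integrability on the whole past is then assembled
    interval by interval.\<close>
  have step: "f integrable_on {real k / 2 ^ n..t}" "integral {real k / 2 ^ n..t} f = integral {real k / 2 ^ n..t} (f2 k)"
    if t: "real k / 2 ^ n \<le> t" "t \<le> real (Suc k) / 2 ^ n" for t k
  proof -
    have sp: "f s = f2 k s" if "s \<in> {real k / 2 ^ n..t} - {real k / 2 ^ n, t}" for s
      using that t by (intro eq) auto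
    have i: "f2 k integrable_on {real k / 2 ^ n..t}" by (intro integrable_continuous_interval f2c) simp
    show "f integrable_on {real k / 2 ^ n..t}"
      by (rule integrable_spike_finite[of "{real k / 2 ^ n, t}", OF _ _ i]) (use sp in auto)
    show "integral {real k / 2 ^ n..t} f = integral {real k / 2 ^ n..t} (f2 k)"
      by (rule integral_spike[of "{real k / 2 ^ n, t}"]) (use sp in auto)
  qed
  have fint: "f integrable_on {0..real k / 2 ^ n}" for k
  proof (induction k)
    case (Suc k)
    show ?case
      by (rule Henstock_Kurzweil_Integration.integrable_combine[OF _ _ Suc step(1)])
         (auto simp: divide_right_mono)
  qed (use integrable_on_refl[of f 0] in simp)
  have t': "t \<le> real (Suc k) / 2 ^ n" using t(2) by (simp add: add_divide_distrib)
  have k0: "0 \<le> real k / 2 ^ n" by simp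
  have fi: "integral {0..t} f = integral {0..real k / 2 ^ n} f + integral {real k / 2 ^ n..t} (f2 k)"
    using Henstock_Kurzweil_Integration.integral_combine[OF k0 t(1)
        Henstock_Kurzweil_Integration.integrable_combine[OF k0 t(1) fint step(1)[OF t(1) t']]]
      step(2)[OF t(1) t'] by simp
  have bi: "integral {0..t} (\<lambda>r. b (x r)) = integral {0..real k / 2 ^ n} (\<lambda>r. b (x r)) + integral {real k / 2 ^ n..t} (\<lambda>r. b (x r))"
    using Henstock_Kurzweil_Integration.integral_combine[OF k0 t(1), of "\<lambda>r. b (x r)"]
      integrable_continuous_interval[OF bc[of 0 t]] by simp
  have e: "x t = x0 + integral {0..t} f + integral {0..t} (\<lambda>r. b (x r)) + Ln n t \<omega>" if "0 \<le> t" for t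
    using op that by (auto simp: ode_path_def x_def f_def)
  have "integral {real k / 2 ^ n..t} (\<lambda>r. f2 k r + b (x r)) = integral {real k / 2 ^ n..t} (f2 k) + integral {real k / 2 ^ n..t} (\<lambda>r. b (x r))"
    by (intro Henstock_Kurzweil_Integration.integral_add integrable_continuous_interval f2c bc) auto
  then have "x t - x (real k / 2 ^ n) = integral {real k / 2 ^ n..t} (\<lambda>r. f2 k r + b (x r)) + (Ln n t \<omega> - Ln n (real k / 2 ^ n) \<omega>)"
    using e[of t] e[OF k0] t fi bi order_trans[OF k0 t(1)] by simp
  then show ?thesis by (simp add: x_def f2_def)
qed

section \<open>Measurability and adaptedness\<close>

lemma w'_measurable_F: "w' n k \<in> borel_measurable (F (real k / 2 ^ n))"
proof (cases k)
  case 0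
  then have "w' n k = (\<lambda>_. 0)" by (auto simp: w'_def)
  then show ?thesis by simp
next
  case (Suc j)
  then have "w' n k = dW n j" by (auto simp: w'_def)
  then show ?thesis using dW_measurable_F[of n j] Suc by simp
qed

text \<open>The solutions lie in the closure of \<open>D\<close> only almost surely; mapping the exceptional values to
  \<open>x0\<close> makes the compositions with the coefficients measurable and the bounds hold everywhere.\<close>

definition proj :: "real^'d \<Rightarrow> real^'d" where
  "proj y = (if y \<in> closure D then y else x0)"

lemma proj_closure [simp]: "proj y \<in> closure D"
  by (simp add: proj_def x0)

lemma measurable_compose_proj:
  fixes f :: "real^'d \<Rightarrow> 'c::euclidean_space"
  assumes "\<And>x y. x \<in> closure D \<Longrightarrow> y \<in> closure D \<Longrightarrow> norm (f x - f y) \<le> c * norm (x - y)" "0 \<le> c"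
    and "Y \<in> borel_measurable N"
  shows "(\<lambda>\<omega>. f (proj (Y \<omega>))) \<in> borel_measurable N"
proof -
  have "c-lipschitz_on (closure D) f" using assms(1,2) by (auto intro!: lipschitz_onI simp: dist_norm)
  then have "continuous_on (closure D) f" by (rule lipschitz_on_continuous_on)
  then have 1: "(\<lambda>y. indicator (closure D) y *\<^sub>R f y) \<in> borel_measurable borel"
    by (intro borel_measurable_continuous_on_indicator) auto
  have 2: "(\<lambda>y. indicator (- closure D) y *\<^sub>R f x0) \<in> borel_measurable borel" by measurable
  have "(\<lambda>y. f (proj y)) = (\<lambda>y. indicator (closure D) y *\<^sub>R f y + indicator (- closure D) y *\<^sub>R f x0)"
    by (auto simp: fun_eq_iff proj_def)
  then have "(\<lambda>y. f (proj y)) \<in> borel_measurable borel" using 1 2 by simp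
  then show ?thesis using measurable_compose[OF assms(3)] by blast
qed

lemma matrix_vector_mult_measurable:
  fixes A :: "'c \<Rightarrow> real^'k^'l"
  assumes "A \<in> borel_measurable N" "u \<in> borel_measurable N"
  shows "(\<lambda>\<omega>. A \<omega> *v u \<omega>) \<in> borel_measurable N"
proof (rule borel_measurable_continuous_Pair[OF assms])
  show "continuous_on UNIV (\<lambda>p::(real^'k^'l) \<times> (real^'k). fst p *v snd p)"
    unfolding matrix_vector_mult_def by (intro continuous_intros)
qed

lemma
  assumes Y: "Y \<in> borel_measurable N" and u: "u \<in> borel_measurable N"
  shows proj_measurable: "(\<lambda>\<omega>. proj (Y \<omega>)) \<in> borel_measurable N"
    and sigma_measurable: "(\<lambda>\<omega>. \<sigma> (proj (Y \<omega>))) \<in> borel_measurable N"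
    and B_measurable: "(\<lambda>\<omega>. B (proj (Y \<omega>))) \<in> borel_measurable N"
    and g_measurable: "(\<lambda>\<omega>. g (proj (Y \<omega>))) \<in> borel_measurable N"
    and sigma'_measurable: "h \<in> borel_measurable N \<Longrightarrow> (\<lambda>\<omega>. \<sigma>' (proj (Y \<omega>)) (h \<omega>)) \<in> borel_measurable N"
    and Shat_measurable: "(\<lambda>\<omega>. Shat (proj (Y \<omega>)) (u \<omega>)) \<in> borel_measurable N"
    and Uhat_measurable: "(\<lambda>\<omega>. Uhat (proj (Y \<omega>)) (u \<omega>)) \<in> borel_measurable N"
proof -
  show p: "(\<lambda>\<omega>. proj (Y \<omega>)) \<in> borel_measurable N"
    by (rule measurable_compose_proj[of "\<lambda>x. x" 1, OF _ _ Y]) auto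
  show s: "(\<lambda>\<omega>. \<sigma> (proj (Y \<omega>))) \<in> borel_measurable N"
    by (rule measurable_compose_proj[OF sigma_lip _ Y]) (use \<Lambda> in auto)
  show "(\<lambda>\<omega>. B (proj (Y \<omega>))) \<in> borel_measurable N"
    by (rule measurable_compose_proj[OF B_lip _ Y]) (use CB_pos in auto)
  show "(\<lambda>\<omega>. g (proj (Y \<omega>))) \<in> borel_measurable N"
    by (rule measurable_compose_proj[OF g_lip _ Y]) (use \<Lambda> in auto)
  \<comment> \<open>Lipschitz continuity of \<open>\<sigma>'\<close> yields measurability for a
    fixed direction; linearity reduces the random direction \<open>h\<close> to the coordinate
    axes.\<close>
  have s': "(\<lambda>\<omega>. \<sigma>' (proj (Y \<omega>)) (h \<omega>)) \<in> borel_measurable N" if h: "h \<in> borel_measurable N" for h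
  proof -
    have 1: "(\<lambda>\<omega>. \<sigma>' (proj (Y \<omega>)) (axis k 1)) \<in> borel_measurable N" for k
      by (rule measurable_compose_proj[of "\<lambda>y. \<sigma>' y (axis k 1)", OF _ _ Y]) (use sigma'_lip[of _ _ "axis k 1"] \<Lambda> in auto)
    have eq: "\<sigma>' (proj y) u = (\<Sum>k\<in>UNIV. (u $ k) *\<^sub>R \<sigma>' (proj y) (axis k 1))" for y u
    proof -
      have "u = (\<Sum>k\<in>UNIV. (u $ k) *\<^sub>R axis k 1)"
        by (simp add: vec_eq_iff axis_def if_distrib cong: if_cong)
      then have "\<sigma>' (proj y) u = \<sigma>' (proj y) (\<Sum>k\<in>UNIV. (u $ k) *\<^sub>R axis k 1)" by simp
      then show ?thesis using sigma'_linear[OF proj_closure, of y] by (simp add: linear_sum linear_cmul)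
    qed
    have fe: "(\<lambda>\<omega>. \<sigma>' (proj (Y \<omega>)) (h \<omega>)) = (\<lambda>\<omega>. \<Sum>k\<in>UNIV. (h \<omega> $ k) *\<^sub>R \<sigma>' (proj (Y \<omega>)) (axis k 1))"
      by (rule ext) (rule eq)
    show ?thesis by (subst fe)
      (intro borel_measurable_sum borel_measurable_scaleR 1 measurable_compose[OF h vec_nth_borel])
  qed
  then show "h \<in> borel_measurable N \<Longrightarrow> (\<lambda>\<omega>. \<sigma>' (proj (Y \<omega>)) (h \<omega>)) \<in> borel_measurable N" .
  have su: "(\<lambda>\<omega>. \<sigma> (proj (Y \<omega>)) *v u \<omega>) \<in> borel_measurable N" by (rule matrix_vector_mult_measurable[OF s u])
  show "(\<lambda>\<omega>. Shat (proj (Y \<omega>)) (u \<omega>)) \<in> borel_measurable N"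
    unfolding Shat_def by (intro borel_measurable_add s s' su)
  show "(\<lambda>\<omega>. Uhat (proj (Y \<omega>)) (u \<omega>)) \<in> borel_measurable N"
    unfolding Uhat_def Q_def
    by (intro borel_measurable_add borel_measurable_scaleR p su borel_measurable_const matrix_vector_mult_measurable s' u)
qed

lemma XL_measurable_F: "X t \<in> borel_measurable (F t)" "L t \<in> borel_measurable (F t)"
    "Xn n t \<in> borel_measurable (F t)" "Ln n t \<in> borel_measurable (F t)"
  using sol sol_n[of n] by (auto simp: reflected_sde_solution_def reflected_ode_solution_def)

lemma XL_measurable: "X t \<in> borel_measurable M" "L t \<in> borel_measurable M"
  using XL_measurable_F measurable_F_M by blast+

definition yk :: "nat \<Rightarrow> nat \<Rightarrow> 'a \<Rightarrow> real^'d" where "yk n k \<omega> = proj (Xn n (real k / 2 ^ n) \<omega>)"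
definition vk :: "nat \<Rightarrow> nat \<Rightarrow> 'a \<Rightarrow> real^'d" where "vk n k \<omega> = proj (X (real k / 2 ^ n) \<omega>)"

lemma vk_eq: "rpath (\<lambda>t. X t \<omega>) (\<lambda>t. L t \<omega>) \<Longrightarrow> vk n k \<omega> = X (real k / 2 ^ n) \<omega>"
  by (simp add: vk_def proj_def rpath_def)

lemma yk_eq: "ode_path n \<omega> \<Longrightarrow> yk n k \<omega> = Xn n (real k / 2 ^ n) \<omega>"
proof -
  assume "ode_path n \<omega>"
  then have "rpath (\<lambda>t. Xn n t \<omega>) (\<lambda>t. Ln n t \<omega>)" by (simp only: ode_path_def)
  then show ?thesis by (simp add: yk_def proj_def rpath_def)
qed

lemma vk_closure [simp]: "vk n k \<omega> \<in> closure D" and yk_closure [simp]: "yk n k \<omega> \<in> closure D"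
  by (simp_all add: vk_def yk_def)

lemma sigma_vk_measurable_F: "(\<lambda>\<omega>. \<sigma> (vk n k \<omega>)) \<in> borel_measurable (F (real k / 2 ^ n))"
  unfolding vk_def by (rule sigma_measurable[OF XL_measurable_F(1) borel_measurable_const[of 0]])

section \<open>Left-point sums and the Ito integral\<close>

definition S :: "nat \<Rightarrow> nat \<Rightarrow> 'a \<Rightarrow> real^'d" where
  "S n k \<omega> = (\<Sum>j<k. \<sigma> (vk n j \<omega>) *v dW n j \<omega>)"

lemma sum_dW_refine:
  "(\<Sum>i = j * 2 ^ d..<j * 2 ^ d + 2 ^ d. dW (n + d) i \<omega>) = dW n j \<omega>"
proof -
  have "(\<Sum>i = j * 2 ^ d..<j * 2 ^ d + 2 ^ d. dW (n + d) i \<omega>)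
    = W (real (j * 2 ^ d + 2 ^ d) / 2 ^ (n + d)) \<omega> - W (real (j * 2 ^ d) / 2 ^ (n + d)) \<omega>"
    unfolding dW_def by (rule sum_Suc_diff'[of _ _ "\<lambda>i. W (real i / 2 ^ (n + d)) \<omega>"]) simp
  also have "real (j * 2 ^ d + 2 ^ d) / 2 ^ (n + d) = real (Suc j) / 2 ^ n"
    by (simp add: power_add field_simps)
  also have "real (j * 2 ^ d) / 2 ^ (n + d) = real j / 2 ^ n" by (simp add: power_add)
  finally show ?thesis by (simp add: dW_def)
qed

text \<open>The coarse sum becomes a sum over the fine grid with coefficients constant on blocks.
  The difference of two levels is then a single sum against the fine increments, to which the
  maximal inequality applies.\<close>

lemma S_refine: "S n k \<omega> = (\<Sum>i<k * 2 ^ d. \<sigma> (vk n (i div 2 ^ d) \<omega>) *v dW (n + d) i \<omega>)"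
proof -
  have "(\<Sum>i = j * 2 ^ d..<j * 2 ^ d + 2 ^ d. \<sigma> (vk n (i div 2 ^ d) \<omega>) *v dW (n + d) i \<omega>) = \<sigma> (vk n j \<omega>) *v dW n j \<omega>" for j
  proof -
    have "i div 2 ^ d = j" if "i \<in> {j * 2 ^ d..<j * 2 ^ d + 2 ^ d}" for i
      using that by (intro div_nat_eqI) (auto simp: algebra_simps)
    then have "(\<Sum>i = j * 2 ^ d..<j * 2 ^ d + 2 ^ d. \<sigma> (vk n (i div 2 ^ d) \<omega>) *v dW (n + d) i \<omega>)
      = (\<Sum>i = j * 2 ^ d..<j * 2 ^ d + 2 ^ d. \<sigma> (vk n j \<omega>) *v dW (n + d) i \<omega>)" by (intro sum.cong) auto
    also have "\<dots> = \<sigma> (vk n j \<omega>) *v (\<Sum>i = j * 2 ^ d..<j * 2 ^ d + 2 ^ d. dW (n + d) i \<omega>)"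
      by (rule linear_sum[OF matrix_vector_mul_linear, symmetric])
    finally show ?thesis by (simp add: sum_dW_refine)
  qed
  then show ?thesis unfolding S_def sum.nat_group[symmetric] by simp
qed

lemma ito_sum_eq_S:
  assumes "rpath (\<lambda>t. X t \<omega>) (\<lambda>t. L t \<omega>)"
  shows "ito_sum W (\<lambda>s \<omega>. \<sigma> (X s \<omega>)) (n + d) (real k / 2 ^ n) \<omega> = S (n + d) (k * 2 ^ d) \<omega>"
proof -
  have "real k / 2 ^ n * 2 ^ (n + d) = real (k * 2 ^ d)" by (simp add: power_add)
  then have c: "nat \<lceil>real k / 2 ^ n * 2 ^ (n + d)\<rceil> = k * 2 ^ d" by (simp only: ceiling_of_nat nat_int)
  have "min (real k / 2 ^ n) (real (Suc j) / 2 ^ (n + d)) = real (Suc j) / 2 ^ (n + d)" if "j < k * 2 ^ d" for j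
  proof (rule min_absorb2)
    have "real (Suc j) \<le> real (k * 2 ^ d)" using that by (simp only: of_nat_le_iff)
    then have "real (Suc j) / 2 ^ (n + d) \<le> real (k * 2 ^ d) / 2 ^ (n + d)" by (rule divide_right_mono) simp
    also have "\<dots> = real k / 2 ^ n" by (simp add: power_add)
    finally show "real (Suc j) / 2 ^ (n + d) \<le> real k / 2 ^ n" .
  qed
  then show ?thesis unfolding ito_sum_def S_def c
    by (intro sum.cong) (auto simp: vk_eq[OF assms] dW_def)
qed

lemma S_measurable: "S n k \<in> borel_measurable M"
  unfolding S_def
  by (intro borel_measurable_sum matrix_vector_mult_measurable dW_measurable measurable_F_M[OF sigma_vk_measurable_F])

lemma whp_osc:
  assumes "e > 0"
  shows "whp (\<lambda>n \<omega>. \<forall>s t. 0 \<le> s \<longrightarrow> s \<le> T \<longrightarrow> 0 \<le> t \<longrightarrow> t \<le> T \<longrightarrow> \<bar>s - t\<bar> \<le> 1 / 2^n \<longrightarrow> norm (X s \<omega> - X t \<omega>) \<le> e)"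
    "whp (\<lambda>n \<omega>. \<forall>s t. 0 \<le> s \<longrightarrow> s \<le> T \<longrightarrow> 0 \<le> t \<longrightarrow> t \<le> T \<longrightarrow> \<bar>s - t\<bar> \<le> 1 / 2^n \<longrightarrow> norm (L s \<omega> - L t \<omega>) \<le> e)"
    "whp (\<lambda>n \<omega>. \<forall>s t. 0 \<le> s \<longrightarrow> s \<le> T \<longrightarrow> 0 \<le> t \<longrightarrow> t \<le> T \<longrightarrow> \<bar>s - t\<bar> \<le> 1 / 2^n \<longrightarrow> norm (W s \<omega> - W t \<omega>) \<le> e)"
proof -
  have "AE \<omega> in M. continuous_on {0..} (\<lambda>t. X t \<omega>)" "AE \<omega> in M. continuous_on {0..} (\<lambda>t. L t \<omega>)"
    using AE_rpath by (auto simp: rpath_def elim!: eventually_mono)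
  moreover have "AE \<omega> in M. continuous_on {0..} (\<lambda>t. W t \<omega>)"
    using brownian by (auto simp: brownian_motion_def elim!: eventually_mono)
  ultimately have c: "AE \<omega> in M. continuous_on {0..} (\<lambda>t. X t \<omega>)" "AE \<omega> in M. continuous_on {0..} (\<lambda>t. L t \<omega>)"
      "AE \<omega> in M. continuous_on {0..} (\<lambda>t. W t \<omega>)" by blast+
  show "whp (\<lambda>n \<omega>. \<forall>s t. 0 \<le> s \<longrightarrow> s \<le> T \<longrightarrow> 0 \<le> t \<longrightarrow> t \<le> T \<longrightarrow> \<bar>s - t\<bar> \<le> 1 / 2^n \<longrightarrow> norm (X s \<omega> - X t \<omega>) \<le> e)"
    by (rule whp_modulus_of_continuity[OF XL_measurable(1) c(1) assms])
  show "whp (\<lambda>n \<omega>. \<forall>s t. 0 \<le> s \<longrightarrow> s \<le> T \<longrightarrow> 0 \<le> t \<longrightarrow> t \<le> T \<longrightarrow> \<bar>s - t\<bar> \<le> 1 / 2^n \<longrightarrow> norm (L s \<omega> - L t \<omega>) \<le> e)"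
    by (rule whp_modulus_of_continuity[OF XL_measurable(2) c(2) assms])
  show "whp (\<lambda>n \<omega>. \<forall>s t. 0 \<le> s \<longrightarrow> s \<le> T \<longrightarrow> 0 \<le> t \<longrightarrow> t \<le> T \<longrightarrow> \<bar>s - t\<bar> \<le> 1 / 2^n \<longrightarrow> norm (W s \<omega> - W t \<omega>) \<le> e)"
    by (rule whp_modulus_of_continuity[OF W_measurable c(3) assms])
qed

text \<open>Off the event \<open>A\<close> the coefficients at the two levels differ by at most
  \<open>\<Lambda> * \<delta>\<close>, and everywhere by at most \<open>\<Lambda>^2\<close>; the
  isometry turns this into the stated bound. The bound does not involve \<open>d\<close>, so the
  fine level may later be taken as high as desired. Rows are treated singly, since the maximal
  inequality is scalar.\<close>

lemma S_refine_maximal: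
  assumes osc: "A \<in> events" "prob A \<le> \<epsilon>1"
      "\<And>\<omega> s t. \<omega> \<in> space M - A \<Longrightarrow> 0 \<le> s \<Longrightarrow> s \<le> real TT \<Longrightarrow> 0 \<le> t \<Longrightarrow> t \<le> real TT \<Longrightarrow> \<bar>s - t\<bar> \<le> 1 / 2^n \<Longrightarrow> norm (X s \<omega> - X t \<omega>) \<le> \<delta>"
    and \<delta>: "0 \<le> \<delta>" and e: "e > 0"
  shows "\<exists>A'\<in>events. prob A' \<le> real TT * (\<Lambda>\<^sup>2 * (\<delta>\<^sup>2 + \<Lambda>\<^sup>2 * \<epsilon>1)) / e\<^sup>2 \<and>
    (\<forall>\<omega>\<in>space M - A'. \<forall>k\<le>TT * 2 ^ n. \<bar>(S (n + d) (k * 2 ^ d) \<omega> - S n k \<omega>) $ i\<bar> \<le> e)"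
proof -
  define m where "m = n + d"
  define \<xi> where "\<xi> = (\<lambda>j \<omega>. (\<sigma> (vk m j \<omega>) - \<sigma> (vk n (j div 2 ^ d) \<omega>)) $ i)"
  have grid: "real (j div 2 ^ d) / 2 ^ n \<le> real j / 2 ^ m" "real j / 2 ^ m - real (j div 2 ^ d) / 2 ^ n \<le> 1 / 2 ^ n" for j
  proof -
    have e: "real (j div 2 ^ d) / 2 ^ n = real (j div 2 ^ d * 2 ^ d) / 2 ^ m" by (simp add: m_def power_add)
    have "j div 2 ^ d * 2 ^ d \<le> j" by simp
    then show "real (j div 2 ^ d) / 2 ^ n \<le> real j / 2 ^ m" unfolding e by (intro divide_right_mono) (simp_all only: of_nat_le_iff, simp)
    have "j = j div 2 ^ d * 2 ^ d + j mod 2 ^ d" by (rule div_mult_mod_eq[symmetric])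
    moreover have "j mod 2 ^ d < 2 ^ d" by simp
    ultimately have "j \<le> j div 2 ^ d * 2 ^ d + 2 ^ d" by linarith
    then have "real j \<le> real (j div 2 ^ d * 2 ^ d + 2 ^ d)" by (simp only: of_nat_le_iff)
    then have "real j / 2 ^ m \<le> real (j div 2 ^ d * 2 ^ d + 2 ^ d) / 2 ^ m" by (rule divide_right_mono) simp
    also have "\<dots> = real (j div 2 ^ d * 2 ^ d) / 2 ^ m + 1 / 2 ^ n" by (simp add: m_def power_add field_simps)
    finally show "real j / 2 ^ m - real (j div 2 ^ d) / 2 ^ n \<le> 1 / 2 ^ n" unfolding e by simp
  qed
  have row: "(\<lambda>A::real^'m^'d. A $ i) \<in> borel_measurable borel"
    by (intro borel_measurable_continuous_onI continuous_intros)
  have xiF: "\<xi> j \<in> borel_measurable (F (real j / 2 ^ m))" for j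
    unfolding \<xi>_def
    by (intro measurable_compose[OF _ row] borel_measurable_diff sigma_vk_measurable_F
        measurable_F_mono[OF sigma_vk_measurable_F grid(1)])
  have xin: "norm (\<xi> j \<omega>) \<le> \<Lambda> * norm (vk m j \<omega> - vk n (j div 2 ^ d) \<omega>)" for j \<omega>
    unfolding \<xi>_def by (rule order_trans[OF Finite_Cartesian_Product.norm_nth_le sigma_lip]) auto
  have xib: "norm (\<xi> j \<omega>) \<le> \<Lambda> * \<Lambda>" for j \<omega>
    using \<Lambda> by (intro order_trans[OF xin] mult_left_mono diam) auto
  obtain A' where A': "A' \<in> events" "prob A' \<le> (\<Sum>j<TT * 2 ^ m. expectation (\<lambda>\<omega>. (norm (\<xi> j \<omega>))\<^sup>2) / 2 ^ m) / e\<^sup>2"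
    "\<And>\<omega> k. \<omega> \<in> space M - A' \<Longrightarrow> k \<le> TT * 2 ^ m \<Longrightarrow> \<bar>\<Sum>j<k. \<xi> j \<omega> \<bullet> dW m j \<omega>\<bar> \<le> e"
    using maximal_inequality_sum_increments[OF xiF xib e, of "TT * 2 ^ m"] by blast
  have exp: "expectation (\<lambda>\<omega>. (norm (\<xi> j \<omega>))\<^sup>2) \<le> \<Lambda>\<^sup>2 * (\<delta>\<^sup>2 + \<Lambda>\<^sup>2 * \<epsilon>1)" if j: "j < TT * 2 ^ m" for j
  proof -
    have tj: "real j / 2 ^ m \<le> real TT" "real (j div 2 ^ d) / 2 ^ n \<le> real TT"
    proof -
      have "real j \<le> real (TT * 2 ^ m)" using j by (simp only: of_nat_le_iff)
      then show "real j / 2 ^ m \<le> real TT" by (simp add: divide_le_eq)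
      then show "real (j div 2 ^ d) / 2 ^ n \<le> real TT" using grid(1)[of j] by linarith
    qed
    have "expectation (\<lambda>\<omega>. (norm (\<xi> j \<omega>))\<^sup>2) \<le> expectation (\<lambda>\<omega>. \<Lambda>\<^sup>2 * (\<delta>\<^sup>2 + \<Lambda>\<^sup>2 * indicator A \<omega>))"
    proof (rule integral_mono_AE)
      have [measurable]: "\<xi> j \<in> borel_measurable M" by (rule measurable_F_M[OF xiF])
      show "integrable M (\<lambda>\<omega>. (norm (\<xi> j \<omega>))\<^sup>2)"
        by (rule integrable_const_bound[of _ "(\<Lambda> * \<Lambda>)\<^sup>2"]) (use power_mono[OF xib, of j _ 2] in auto)
      show "integrable M (\<lambda>\<omega>. \<Lambda>\<^sup>2 * (\<delta>\<^sup>2 + \<Lambda>\<^sup>2 * indicator A \<omega>))"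
        using osc(1) by (intro integrable_mult_right Bochner_Integration.integrable_add integrable_const integrable_real_indicator)
          (auto simp: emeasure_eq_measure)
      show "AE \<omega> in M. (norm (\<xi> j \<omega>))\<^sup>2 \<le> \<Lambda>\<^sup>2 * (\<delta>\<^sup>2 + \<Lambda>\<^sup>2 * indicator A \<omega>)"
        using AE_rpath AE_space
      proof eventually_elim
        case (elim \<omega>)
        have "(norm (\<xi> j \<omega>))\<^sup>2 \<le> \<Lambda>\<^sup>2 * (norm (vk m j \<omega> - vk n (j div 2 ^ d) \<omega>))\<^sup>2"
          using power_mono[OF xin, of j \<omega> 2] by (simp add: power_mult_distrib)
        also have "\<dots> \<le> \<Lambda>\<^sup>2 * (\<delta>\<^sup>2 + \<Lambda>\<^sup>2 * indicator A \<omega>)"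
        proof (intro mult_left_mono)
          show "(norm (vk m j \<omega> - vk n (j div 2 ^ d) \<omega>))\<^sup>2 \<le> \<delta>\<^sup>2 + \<Lambda>\<^sup>2 * indicator A \<omega>"
          proof (cases "\<omega> \<in> A")
            case True
            have "(norm (vk m j \<omega> - vk n (j div 2 ^ d) \<omega>))\<^sup>2 \<le> \<Lambda>\<^sup>2" by (intro power_mono diam) auto
            then show ?thesis using True by (simp add: add_increasing)
          next
            case False
            have "norm (vk m j \<omega> - vk n (j div 2 ^ d) \<omega>) \<le> \<delta>"
              unfolding vk_eq[OF elim(1)]
              using osc(3)[of \<omega> "real j / 2 ^ m" "real (j div 2 ^ d) / 2 ^ n"] elim(2) False tj grid[of j] by auto
            then show ?thesis using False \<delta> by (simp add: power_mono)
          qed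
        qed simp
        finally show ?case .
      qed
    qed
    also have "\<dots> = \<Lambda>\<^sup>2 * (\<delta>\<^sup>2 + \<Lambda>\<^sup>2 * prob A)"
      using osc(1) by (simp add: prob_space emeasure_eq_measure)
    also have "\<dots> \<le> \<Lambda>\<^sup>2 * (\<delta>\<^sup>2 + \<Lambda>\<^sup>2 * \<epsilon>1)" using osc(2) by (intro mult_left_mono add_left_mono) auto
    finally show ?thesis .
  qed
  have "(\<Sum>j<TT * 2 ^ m. expectation (\<lambda>\<omega>. (norm (\<xi> j \<omega>))\<^sup>2) / 2 ^ m) \<le> (\<Sum>j<TT * 2 ^ m. (\<Lambda>\<^sup>2 * (\<delta>\<^sup>2 + \<Lambda>\<^sup>2 * \<epsilon>1)) / 2 ^ m)"
    using exp by (intro sum_mono divide_right_mono) auto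
  also have "\<dots> = real TT * (\<Lambda>\<^sup>2 * (\<delta>\<^sup>2 + \<Lambda>\<^sup>2 * \<epsilon>1))" by simp
  finally have "prob A' \<le> real TT * (\<Lambda>\<^sup>2 * (\<delta>\<^sup>2 + \<Lambda>\<^sup>2 * \<epsilon>1)) / e\<^sup>2"
    using A'(2) divide_right_mono[of _ _ "e\<^sup>2"] by (meson order_trans zero_le_power2)
  moreover have "\<bar>(S (n + d) (k * 2 ^ d) \<omega> - S n k \<omega>) $ i\<bar> \<le> e" if w: "\<omega> \<in> space M - A'" and k: "k \<le> TT * 2 ^ n" for \<omega> k
  proof -
    have "S (n + d) (k * 2 ^ d) \<omega> - S n k \<omega> = (\<Sum>j<k * 2 ^ d. (\<sigma> (vk m j \<omega>) - \<sigma> (vk n (j div 2 ^ d) \<omega>)) *v dW m j \<omega>)"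
      unfolding S_refine[of n k \<omega> d] by (simp add: S_def m_def sum_subtractf matrix_vector_mult_diff_rdistrib)
    then have "(S (n + d) (k * 2 ^ d) \<omega> - S n k \<omega>) $ i = (\<Sum>j<k * 2 ^ d. \<xi> j \<omega> \<bullet> dW m j \<omega>)"
      by (simp add: \<xi>_def matrix_vector_mult_def inner_vec_def)
    moreover have "k * 2 ^ d \<le> TT * 2 ^ m" using k by (simp add: m_def power_add)
    ultimately show ?thesis using A'(3)[OF w] by simp
  qed
  ultimately show ?thesis using A'(1) by blast
qed

lemma ito_integral_S:
  assumes I: "is_ito_integral M W (\<lambda>s \<omega>. \<sigma> (X s \<omega>)) I" and e: "e > 0"
  shows "(\<lambda>d. prob {\<omega>\<in>space M. e < norm (S (n + d) (k * 2 ^ d) \<omega> - I (real k / 2 ^ n) \<omega>)}) \<longlonglongrightarrow> 0"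
    "I (real k / 2 ^ n) \<in> borel_measurable M"
proof -
  let ?t = "real k / 2 ^ n"
  \<comment> \<open>\<open>ito_sum\<close> uses \<open>X\<close> itself and \<open>S\<close> its
    projection to the closure. The two agree almost everywhere, and by completeness the event formed
    with \<open>ito_sum\<close> is measurable as well.\<close>
  interpret complete_measure M using complete_filtered by (simp add: complete_filtered_prob_space_def)
  have t0: "0 \<le> ?t" by simp
  show IM: "I ?t \<in> borel_measurable M" using I t0 by (auto simp: is_ito_integral_def)
  have lim: "(\<lambda>m. prob {\<omega>\<in>space M. e < norm (ito_sum W (\<lambda>s \<omega>. \<sigma> (X s \<omega>)) m ?t \<omega> - I ?t \<omega>)}) \<longlonglongrightarrow> 0"
    using I t0 e by (auto simp: is_ito_integral_def)
  have eq: "prob {\<omega>\<in>space M. e < norm (ito_sum W (\<lambda>s \<omega>. \<sigma> (X s \<omega>)) (n + d) ?t \<omega> - I ?t \<omega>)}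
    = prob {\<omega>\<in>space M. e < norm (S (n + d) (k * 2 ^ d) \<omega> - I ?t \<omega>)}" (is "prob ?A = prob ?B") for d
  proof -
    have B: "?B \<in> events" using S_measurable IM by measurable
    have ae: "AE \<omega> in M. \<omega> \<in> ?B \<longleftrightarrow> \<omega> \<in> ?A"
      using AE_rpath by eventually_elim (simp add: ito_sum_eq_S)
    have A: "?A \<in> events" by (rule in_sets_AE[OF ae B]) auto
    show ?thesis by (rule finite_measure_eq_AE[OF _ A B]) (use ae in \<open>auto elim!: eventually_mono\<close>)
  qed
  have "(\<lambda>d. prob {\<omega>\<in>space M. e < norm (ito_sum W (\<lambda>s \<omega>. \<sigma> (X s \<omega>)) (d + n) ?t \<omega> - I ?t \<omega>)}) \<longlonglongrightarrow> 0"
    by (rule LIMSEQ_ignore_initial_segment[OF lim])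
  then show "(\<lambda>d. prob {\<omega>\<in>space M. e < norm (S (n + d) (k * 2 ^ d) \<omega> - I ?t \<omega>)}) \<longlonglongrightarrow> 0"
    by (simp only: eq add.commute[of _ n])
qed

text \<open>The definition of the Ito integral gives convergence in probability at single times
  only. For fixed \<open>n\<close> there are finitely many grid times, so a level
  \<open>n + d\<close> can be found that is close to \<open>I\<close> at all of them with high
  probability; the maximal inequality, uniform in \<open>d\<close>, leads back to level
  \<open>n\<close>.\<close>

lemma whp_ito_sums_close:
  assumes I: "is_ito_integral M W (\<lambda>s \<omega>. \<sigma> (X s \<omega>)) I" and e: "e > 0"
  shows "whp (\<lambda>n \<omega>. \<forall>k\<le>TT * 2 ^ n. norm (S n k \<omega> - I (real k / 2 ^ n) \<omega>) \<le> e)"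
  unfolding whp_def
proof (intro allI impI)
  fix \<epsilon> :: real assume eps: "\<epsilon> > 0"
  define dd where "dd = real CARD('d)"
  have dd: "dd \<ge> 1" unfolding dd_def by (simp add: Suc_leI)
  \<comment> \<open>One share for each of the \<open>dd\<close> coordinates of the difference of
    levels, and one for the distance between the fine level and \<open>I\<close>.\<close>
  define e1 where "e1 = e / (dd + 1)"
  have e1: "e1 > 0" using e dd by (simp add: e1_def)
  define c where "c = dd * real (Suc TT) * \<Lambda>\<^sup>2 * (1 + \<Lambda>\<^sup>2) / e1\<^sup>2"
  have c: "c > 0" using dd \<Lambda> e1 by (auto simp: c_def intro!: divide_pos_pos mult_pos_pos add_pos_nonneg)
  define \<delta> where "\<delta> = min 1 (\<epsilon> / (2 * c))"
  have \<delta>: "\<delta> > 0" "\<delta> \<le> 1" "c * \<delta> \<le> \<epsilon> / 2" using eps c by (auto simp: \<delta>_def min_def field_simps)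
  have "\<forall>\<^sub>F n in sequentially. \<exists>A\<in>events. prob A \<le> \<delta> \<and> (\<forall>\<omega>\<in>space M - A. \<forall>s t. 0 \<le> s \<longrightarrow> s \<le> real TT \<longrightarrow> 0 \<le> t \<longrightarrow> t \<le> real TT \<longrightarrow> \<bar>s - t\<bar> \<le> 1 / 2^n \<longrightarrow> norm (X s \<omega> - X t \<omega>) \<le> \<delta>)"
    by (rule whpD[OF whp_osc(1)[OF \<delta>(1)] \<delta>(1)])
  then show "\<forall>\<^sub>F n in sequentially. \<exists>A\<in>events. prob A \<le> \<epsilon> \<and>
      (\<forall>\<omega>\<in>space M - A. \<forall>k\<le>TT * 2 ^ n. norm (S n k \<omega> - I (real k / 2 ^ n) \<omega>) \<le> e)"
  proof eventually_elim
    case (elim n)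
    then obtain A where A: "A \<in> events" "prob A \<le> \<delta>"
      "\<And>\<omega> s t. \<omega> \<in> space M - A \<Longrightarrow> 0 \<le> s \<Longrightarrow> s \<le> real TT \<Longrightarrow> 0 \<le> t \<Longrightarrow> t \<le> real TT \<Longrightarrow> \<bar>s - t\<bar> \<le> 1 / 2^n \<Longrightarrow> norm (X s \<omega> - X t \<omega>) \<le> \<delta>"
      by blast
    define N where "N = TT * 2 ^ n"
    define Bk where "Bk = (\<lambda>d k. {\<omega>\<in>space M. e1 < norm (S (n + d) (k * 2 ^ d) \<omega> - I (real k / 2 ^ n) \<omega>)})"
    have BkM: "Bk d k \<in> events" for d k
      unfolding Bk_def using S_measurable ito_integral_S(2)[OF I e] by measurable
    have "\<forall>\<^sub>F d in sequentially. \<forall>k\<in>{..N}. prob (Bk d k) < \<epsilon> / (2 * real (Suc N))"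
    proof (intro eventually_ball_finite ballI)
      fix k
      have "(\<lambda>d. prob (Bk d k)) \<longlonglongrightarrow> 0" unfolding Bk_def by (rule ito_integral_S(1)[OF I e1])
      then show "\<forall>\<^sub>F d in sequentially. prob (Bk d k) < \<epsilon> / (2 * real (Suc N))"
        using eps by (intro order_tendstoD) auto
    qed simp
    then obtain d where d: "\<And>k. k \<le> N \<Longrightarrow> prob (Bk d k) < \<epsilon> / (2 * real (Suc N))"
      by (auto simp: eventually_sequentially)
    have "\<exists>A'\<in>events. prob A' \<le> real TT * (\<Lambda>\<^sup>2 * (\<delta>\<^sup>2 + \<Lambda>\<^sup>2 * \<delta>)) / e1\<^sup>2 \<and>
      (\<forall>\<omega>\<in>space M - A'. \<forall>k\<le>TT * 2 ^ n. \<bar>(S (n + d) (k * 2 ^ d) \<omega> - S n k \<omega>) $ i\<bar> \<le> e1)" for i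
      by (rule S_refine_maximal[OF A]) (use \<delta> e1 in auto)
    then obtain A' where A': "\<And>i. A' i \<in> events" "\<And>i. prob (A' i) \<le> real TT * (\<Lambda>\<^sup>2 * (\<delta>\<^sup>2 + \<Lambda>\<^sup>2 * \<delta>)) / e1\<^sup>2"
      "\<And>i \<omega> k. \<omega> \<in> space M - A' i \<Longrightarrow> k \<le> TT * 2 ^ n \<Longrightarrow> \<bar>(S (n + d) (k * 2 ^ d) \<omega> - S n k \<omega>) $ i\<bar> \<le> e1"
      by metis
    define C where "C = (\<Union>i\<in>UNIV. A' i) \<union> (\<Union>k\<in>{..N}. Bk d k)"
    have CM: "C \<in> events" unfolding C_def using A'(1) BkM by (intro sets.Un sets.finite_UN) auto
    have p1: "prob (\<Union>i\<in>UNIV. A' i) \<le> \<epsilon> / 2"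
    proof -
      have "prob (\<Union>i\<in>UNIV. A' i) \<le> (\<Sum>i\<in>UNIV. prob (A' i))"
        using A'(1) by (intro finite_measure_subadditive_finite) auto
      also have "\<dots> \<le> (\<Sum>i\<in>(UNIV::'d set). real TT * (\<Lambda>\<^sup>2 * (\<delta>\<^sup>2 + \<Lambda>\<^sup>2 * \<delta>)) / e1\<^sup>2)"
        by (intro sum_mono A')
      also have "\<dots> = dd * (real TT * (\<Lambda>\<^sup>2 * (\<delta>\<^sup>2 + \<Lambda>\<^sup>2 * \<delta>)) / e1\<^sup>2)" by (simp add: dd_def)
      also have "\<dots> \<le> dd * (real (Suc TT) * (\<Lambda>\<^sup>2 * (\<delta> + \<Lambda>\<^sup>2 * \<delta>)) / e1\<^sup>2)"
      proof -
        have "\<delta>\<^sup>2 \<le> \<delta>" using \<delta> by (simp add: power2_eq_square mult_left_le)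
        then show ?thesis using dd \<delta> by (intro mult_left_mono divide_right_mono mult_mono add_mono) auto
      qed
      also have "\<dots> = c * \<delta>" by (simp add: c_def field_simps)
      finally show ?thesis using \<delta>(3) by simp
    qed
    have p2: "prob (\<Union>k\<in>{..N}. Bk d k) \<le> \<epsilon> / 2"
    proof -
      have "prob (\<Union>k\<in>{..N}. Bk d k) \<le> (\<Sum>k\<in>{..N}. prob (Bk d k))"
        using BkM by (intro finite_measure_subadditive_finite) auto
      also have "\<dots> \<le> (\<Sum>k\<in>{..N}. \<epsilon> / (2 * real (Suc N)))" using d by (intro sum_mono less_imp_le) auto
      also have "\<dots> = \<epsilon> / 2" by (simp add: field_simps)
      finally show ?thesis .
    qed
    have "prob C \<le> \<epsilon>"
      using measure_Un_le[of "\<Union>i\<in>UNIV. A' i" M "\<Union>k\<in>{..N}. Bk d k"] p1 p2 A'(1) BkM unfolding C_def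
      by (auto intro!: sets.finite_UN)
    moreover have "norm (S n k \<omega> - I (real k / 2 ^ n) \<omega>) \<le> e" if w: "\<omega> \<in> space M - C" and k: "k \<le> TT * 2 ^ n" for \<omega> k
    proof -
      let ?S = "S (n + d) (k * 2 ^ d) \<omega>"
      have "norm (?S - S n k \<omega>) \<le> (\<Sum>i\<in>UNIV. \<bar>(?S - S n k \<omega>) $ i\<bar>)" by (rule norm_le_l1_cart)
      also have "\<dots> \<le> (\<Sum>i\<in>(UNIV::'d set). e1)"
      proof (rule sum_mono)
        fix i
        have "\<omega> \<in> space M - A' i" using w by (auto simp: C_def)
        from A'(3)[OF this k] show "\<bar>(?S - S n k \<omega>) $ i\<bar> \<le> e1" .
      qed
      also have "\<dots> = dd * e1" by (simp add: dd_def)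
      finally have 1: "norm (?S - S n k \<omega>) \<le> dd * e1" .
      have "\<omega> \<notin> Bk d k" using w k by (auto simp: C_def N_def)
      then have 2: "norm (?S - I (real k / 2 ^ n) \<omega>) \<le> e1" using w by (auto simp: Bk_def not_less)
      have "norm (S n k \<omega> - I (real k / 2 ^ n) \<omega>) \<le> norm (?S - I (real k / 2 ^ n) \<omega>) + norm (?S - S n k \<omega>)"
        using norm_triangle_ineq4[of "?S - I (real k / 2 ^ n) \<omega>" "?S - S n k \<omega>"] by simp
      also have "\<dots> \<le> (dd + 1) * e1" using 1 2 by (simp add: algebra_simps)
      also have "\<dots> = e" using dd by (simp add: e1_def)
      finally show ?thesis .
    qed
    ultimately show ?case using CM by blast
  qed
qed

end

section \<open>Tightness of the total variations\<close>

lemma norm_vector_matrix_le: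
  fixes A :: "real^'m^'d"
  shows "norm (x v* A) \<le> norm A * norm x"
proof (cases "x v* A = 0")
  case False
  let ?u = "x v* A"
  have "norm ?u * norm ?u = x \<bullet> (A *v ?u)" by (simp add: dot_lmul_matrix[symmetric] power2_norm_eq_inner[symmetric] power2_eq_square)
  also have "\<dots> \<le> norm x * norm (A *v ?u)" by (rule norm_cauchy_schwarz)
  also have "\<dots> \<le> norm x * (norm A * norm ?u)" by (intro mult_left_mono norm_matrix_vector_le) auto
  finally have "norm ?u * norm ?u \<le> (norm A * norm x) * norm ?u" by (simp add: mult_ac)
  then show ?thesis using False by simp
qed simp

lemma grid_Suc: "real k / 2 ^ n + 1 / 2 ^ n = real (Suc k) / (2::real) ^ n"
  by (simp add: add_divide_distrib)

lemma grid_le: "k \<le> TT * 2 ^ n \<Longrightarrow> real k / 2 ^ n \<le> real TT"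
proof -
  assume "k \<le> TT * 2 ^ n"
  then have "real k \<le> real (TT * 2 ^ n)" by (simp only: of_nat_le_iff)
  then show ?thesis by (simp add: divide_le_eq)
qed

context wong_zakai
begin

abbreviation "dl n k \<omega> \<equiv> Ln n (real (Suc k) / 2 ^ n) \<omega> - Ln n (real k / 2 ^ n) \<omega>"
abbreviation "dm n k \<omega> \<equiv> L (real (Suc k) / 2 ^ n) \<omega> - L (real k / 2 ^ n) \<omega>"
abbreviation "tvn n t \<omega> \<equiv> tv (\<lambda>t. Ln n t \<omega>) t"
abbreviation "tvx t \<omega> \<equiv> tv (\<lambda>t. L t \<omega>) t"
abbreviation "vln n k \<omega> \<equiv> tvn n (real (Suc k) / 2 ^ n) \<omega> - tvn n (real k / 2 ^ n) \<omega>"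
abbreviation "vlm n k \<omega> \<equiv> tvx (real (Suc k) / 2 ^ n) \<omega> - tvx (real k / 2 ^ n) \<omega>"
abbreviation "kp n k \<omega> \<equiv> norm (w' n k \<omega>) + 1 / 2 ^ n"

lemma ode_premises:
  fixes k :: nat
  assumes op: "ode_path n \<omega>"
  defines "x \<equiv> \<lambda>t. Xn n t \<omega>" and "l \<equiv> \<lambda>t. Ln n t \<omega>" and "p \<equiv> real k / 2 ^ n" and "h \<equiv> 1 / 2 ^ n"
  shows "0 < h" "continuous_on {p..p + h} x" "\<And>r. p \<le> r \<Longrightarrow> r \<le> p + h \<Longrightarrow> x r \<in> closure D"
    "\<And>s t. p \<le> s \<Longrightarrow> s \<le> t \<Longrightarrow> t \<le> p + h \<Longrightarrow> norm (l t - l s) \<le> tv l t - tv l s"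
    "\<And>s t u \<gamma>. p \<le> s \<Longrightarrow> s \<le> t \<Longrightarrow> t \<le> p + h \<Longrightarrow>
       (\<And>r w. s \<le> r \<Longrightarrow> r \<le> t \<Longrightarrow> x r \<in> frontier D \<Longrightarrow> w \<in> \<nu> (x r) \<Longrightarrow> \<gamma> \<le> u \<bullet> w) \<Longrightarrow>
       \<gamma> * (tv l t - tv l s) \<le> u \<bullet> (l t - l s)"
    "\<And>t. p \<le> t \<Longrightarrow> t \<le> p + h \<Longrightarrow>
       x t - x p = integral {p..t} (\<lambda>r. \<sigma> (x r) *v ((1 / h) *\<^sub>R w' n k \<omega>) + b (x r)) + (l t - l p)"
proof -
  have rp: "rpath x l" using op by (simp add: ode_path_def x_def l_def)
  have p0: "0 \<le> p" by (simp add: p_def)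
  show "0 < h" by (simp add: h_def)
  show "continuous_on {p..p + h} x" using rp p0 by (auto simp: rpath_def intro: continuous_on_subset)
  show "\<And>r. p \<le> r \<Longrightarrow> r \<le> p + h \<Longrightarrow> x r \<in> closure D" using rp p0 by (auto simp: rpath_def)
  show "norm (l t - l s) \<le> tv l t - tv l s" if "p \<le> s" "s \<le> t" for s t using that p0 by (intro rpath_V[OF rp]) auto
  show "\<gamma> * (tv l t - tv l s) \<le> u \<bullet> (l t - l s)" if "p \<le> s" "s \<le> t"
     "\<And>r w. s \<le> r \<Longrightarrow> r \<le> t \<Longrightarrow> x r \<in> frontier D \<Longrightarrow> w \<in> \<nu> (x r) \<Longrightarrow> \<gamma> \<le> u \<bullet> w" for s t u \<gamma>
  proof -
    have "0 \<le> s" using that(1) p0 by simp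
    then show ?thesis by (rule rpath_R[OF rp _ that(2)]) (rule that(3))
  qed
  show "x t - x p = integral {p..t} (\<lambda>r. \<sigma> (x r) *v ((1 / h) *\<^sub>R w' n k \<omega>) + b (x r)) + (l t - l p)"
    if "p \<le> t" "t \<le> p + h" for t
    unfolding x_def l_def p_def h_def by (rule ode_path_step[OF op]) (use that in \<open>auto simp: p_def h_def\<close>)
qed

lemma ode_osc:
  assumes op: "ode_path n \<omega>" and r: "real k / 2 ^ n \<le> r" "r \<le> real (Suc k) / 2 ^ n"
  shows "norm (Xn n r \<omega> - Xn n (real k / 2 ^ n) \<omega>) \<le> C2 * (\<Lambda> * kp n k \<omega>)"
  by (rule ode_step_oscillation[where x = "\<lambda>t. Xn n t \<omega>" and l = "\<lambda>t. Ln n t \<omega>" and V = "\<lambda>t. tvn n t \<omega>" and p = "real k / 2 ^ n" and h = "1 / 2 ^ n" and w = "w' n k \<omega>"])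
     ((fact ode_premises[OF op])+, use r in \<open>simp_all only: grid_Suc\<close>)

lemma ode_var:
  assumes op: "ode_path n \<omega>"
  shows "\<alpha> * vln n k \<omega> \<le> \<phi> (yk n (Suc k) \<omega>) - \<phi> (yk n k \<omega>) - g (yk n k \<omega>) \<bullet> (yk n (Suc k) \<omega> - yk n k \<omega> - dl n k \<omega>)
     + \<Lambda> * C2 * (\<Lambda> * kp n k \<omega>)\<^sup>2"
  using ode_step_variation[where x = "\<lambda>t. Xn n t \<omega>" and l = "\<lambda>t. Ln n t \<omega>" and V = "\<lambda>t. tvn n t \<omega>" and p = "real k / 2 ^ n" and h = "1 / 2 ^ n" and w = "w' n k \<omega>",
      OF ode_premises[OF op]]
  unfolding grid_Suc yk_eq[OF op] .

lemma ode_first: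
  assumes op: "ode_path n \<omega>"
  shows "norm (yk n (Suc k) \<omega> - yk n k \<omega> - dl n k \<omega> - \<sigma> (yk n k \<omega>) *v w' n k \<omega>) \<le>
    \<Lambda> * (C2 * (\<Lambda> * kp n k \<omega>)) * norm (w' n k \<omega>) + \<Lambda> * (1 / 2 ^ n)"
proof -
  have "norm (Xn n (real k / 2 ^ n + 1 / 2 ^ n) \<omega> - Xn n (real k / 2 ^ n) \<omega> - (Ln n (real k / 2 ^ n + 1 / 2 ^ n) \<omega> - Ln n (real k / 2 ^ n) \<omega>)
      - ((real k / 2 ^ n + 1 / 2 ^ n - real k / 2 ^ n) / (1 / 2 ^ n)) *\<^sub>R (\<sigma> (Xn n (real k / 2 ^ n) \<omega>) *v w' n k \<omega>)) \<le>
    \<Lambda> * (C2 * (\<Lambda> * kp n k \<omega>)) * norm (w' n k \<omega>) + \<Lambda> * (1 / 2 ^ n)"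
    by (rule ode_step_first_order[where x = "\<lambda>t. Xn n t \<omega>" and l = "\<lambda>t. Ln n t \<omega>" and V = "\<lambda>t. tvn n t \<omega>" and p = "real k / 2 ^ n" and h = "1 / 2 ^ n" and w = "w' n k \<omega>"])
       ((fact ode_premises[OF op])+, simp_all)
  moreover have "(real k / 2 ^ n + 1 / 2 ^ n - real k / 2 ^ n) / (1 / 2 ^ n) = (1::real)" by simp
  ultimately show ?thesis unfolding yk_eq[OF op] by (simp only: grid_Suc scaleR_one)
qed

lemma ode_second:
  assumes op: "ode_path n \<omega>"
  shows "norm (yk n (Suc k) \<omega> - Uhat (yk n k \<omega>) (w' n k \<omega>) - (1 / 2 ^ n) *\<^sub>R b (yk n k \<omega>) - dl n k \<omega>) \<le>
    (\<Lambda> * (C2 * (\<Lambda> * kp n k \<omega>))\<^sup>2 +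
     \<Lambda> * (\<Lambda> * (C2 * (\<Lambda> * kp n k \<omega>)) * norm (w' n k \<omega>) + \<Lambda> * (1 / 2 ^ n) + vln n k \<omega>)) * norm (w' n k \<omega>)
    + \<Lambda> * (C2 * (\<Lambda> * kp n k \<omega>)) * (1 / 2 ^ n)"
proof -
  have eq: "yk n (Suc k) \<omega> - Uhat (yk n k \<omega>) (w' n k \<omega>) - (1 / 2 ^ n) *\<^sub>R b (yk n k \<omega>) - dl n k \<omega>
    = yk n (Suc k) \<omega> - yk n k \<omega> - dl n k \<omega> - \<sigma> (yk n k \<omega>) *v w' n k \<omega> - Q (yk n k \<omega>) (w' n k \<omega>) - (1 / 2 ^ n) *\<^sub>R b (yk n k \<omega>)"
    by (simp add: Uhat_def)
  show ?thesis unfolding eq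
    using ode_step_second_order[where x = "\<lambda>t. Xn n t \<omega>" and l = "\<lambda>t. Ln n t \<omega>" and V = "\<lambda>t. tvn n t \<omega>" and p = "real k / 2 ^ n" and h = "1 / 2 ^ n" and w = "w' n k \<omega>",
      OF ode_premises[OF op]]
    unfolding grid_Suc yk_eq[OF op] .
qed

lemma sum_w'_le: "(\<Sum>k<N. (norm (w' n k \<omega>))\<^sup>2) \<le> (\<Sum>k<N. (norm (dW n k \<omega>))\<^sup>2)"
proof (cases N)
  case (Suc N')
  have "(\<Sum>k<N. (norm (w' n k \<omega>))\<^sup>2) = (\<Sum>k<N'. (norm (dW n k \<omega>))\<^sup>2)"
    unfolding Suc by (simp add: sum.lessThan_Suc_shift w'_def del: sum.lessThan_Suc)
  then show ?thesis using Suc by simp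
qed simp

lemma bounded_whp_quadratic_variation: "bounded_whp (\<lambda>n \<omega>. \<Sum>k<TT * 2 ^ n. (norm (dW n k \<omega>))\<^sup>2)"
proof (rule bounded_whp_expectation[where c = "real TT * real CARD('m)"])
  show "integrable M (\<lambda>\<omega>. \<Sum>k<TT * 2 ^ n. (norm (dW n k \<omega>))\<^sup>2)" for n
    by (intro Bochner_Integration.integrable_sum dW_norm2)
  show "expectation (\<lambda>\<omega>. \<Sum>k<TT * 2 ^ n. (norm (dW n k \<omega>))\<^sup>2) \<le> real TT * real CARD('m)" for n
    by (subst Bochner_Integration.integral_sum) (auto simp: dW_norm2)
qed (simp add: sum_nonneg)

text \<open>The noise coefficient in the expansion of \<open>\<phi>\<close> along the
  solution.\<close>

definition \<xi> :: "nat \<Rightarrow> nat \<Rightarrow> 'a \<Rightarrow> real^'m" where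
  "\<xi> n k \<omega> = g (yk n k \<omega>) v* \<sigma> (yk n k \<omega>)"

lemma \<xi>_bound: "norm (\<xi> n k \<omega>) \<le> \<Lambda> * \<Lambda>"
  unfolding \<xi>_def using \<Lambda> by (intro order_trans[OF norm_vector_matrix_le] mult_mono sigma_bound g_bound) auto

lemma \<xi>_diff: "norm (\<xi> n k \<omega> - \<xi> n j \<omega>) \<le> 2 * \<Lambda>\<^sup>2 * norm (yk n k \<omega> - yk n j \<omega>)"
proof -
  let ?y = "yk n k \<omega>" and ?z = "yk n j \<omega>"
  have eq: "\<xi> n k \<omega> - \<xi> n j \<omega> = (g ?y - g ?z) v* \<sigma> ?y + g ?z v* (\<sigma> ?y - \<sigma> ?z)"
    by (simp add: \<xi>_def vec_eq_iff vector_matrix_mult_def algebra_simps sum.distrib sum_subtractf)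
  have "norm ((g ?y - g ?z) v* \<sigma> ?y) \<le> \<Lambda> * (\<Lambda> * norm (?y - ?z))"
    using \<Lambda> by (intro order_trans[OF norm_vector_matrix_le] mult_mono sigma_bound g_lip) auto
  moreover have "norm (g ?z v* (\<sigma> ?y - \<sigma> ?z)) \<le> (\<Lambda> * norm (?y - ?z)) * \<Lambda>"
    using \<Lambda> by (intro order_trans[OF norm_vector_matrix_le] mult_mono sigma_lip g_bound) auto
  ultimately show ?thesis unfolding eq
    using norm_triangle_ineq[of "(g ?y - g ?z) v* \<sigma> ?y" "g ?z v* (\<sigma> ?y - \<sigma> ?z)"] by (simp add: power2_eq_square algebra_simps)
qed

lemma \<xi>_measurable_F: "\<xi> n k \<in> borel_measurable (F (real k / 2 ^ n))"
proof -
  let ?F = "F (real k / 2 ^ n)"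
  have 1: "(\<lambda>\<omega>. g (yk n k \<omega>)) \<in> borel_measurable ?F" "(\<lambda>\<omega>. \<sigma> (yk n k \<omega>)) \<in> borel_measurable ?F"
    unfolding yk_def
    by (rule g_measurable[OF XL_measurable_F(3) borel_measurable_const[of 0]] sigma_measurable[OF XL_measurable_F(3) borel_measurable_const[of 0]])+
  have "continuous_on UNIV (\<lambda>p::(real^'d) \<times> (real^'m^'d). fst p v* snd p)"
    unfolding vector_matrix_mult_def by (intro continuous_intros)
  from borel_measurable_continuous_Pair[OF 1 this] show ?thesis by (simp add: \<xi>_def[abs_def])
qed

definition c1 :: real where "c1 = 2 * \<Lambda>^3 * C2 + \<Lambda>\<^sup>2"

lemma c1_nonneg: "c1 \<ge> 0" using \<Lambda> consts_nonneg by (simp add: c1_def)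

text \<open>Summing the variation bounds of the steps telescopes \<open>\<phi>\<close>, which is
  bounded. What is left are squares of increments, whose sum has bounded expectation, and a noise
  sum, which the isometry will control.\<close>

lemma tvn_bound:
  assumes op: "ode_path n \<omega>" and TT: "TT \<ge> 1"
  shows "\<alpha> * tvn n (real TT) \<omega> \<le> 2 * \<Lambda> + 1 + (c1 + 2 * \<Lambda>^3 * C2) * (3 * real TT)
    + (2 * c1 + 6 * \<Lambda>^3 * C2 + 1) * ((\<Sum>k<TT * 2 ^ n. (norm (dW n k \<omega>))\<^sup>2) + (\<Sum>k<TT * 2 ^ n - 1. \<xi> n k \<omega> \<bullet> dW n k \<omega>)\<^sup>2)"
proof -
  define N where "N = TT * 2 ^ n"
  have N: "N \<ge> 1" using TT by (simp add: N_def Suc_leI)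
  define h :: real where "h = 1 / 2 ^ n"
  have h: "0 < h" "h \<le> 1" "real N * h = real TT" by (auto simp: h_def N_def)
  define Sq where "Sq = (\<Sum>k<N. (norm (dW n k \<omega>))\<^sup>2)"
  define Mt where "Mt = (\<Sum>k<N - 1. \<xi> n k \<omega> \<bullet> dW n k \<omega>)"
  have Sq0: "Sq \<ge> 0" by (simp add: Sq_def sum_nonneg)
  have kp2: "(kp n k \<omega>)\<^sup>2 \<le> 2 * (norm (w' n k \<omega>))\<^sup>2 + 2 * h" for k
  proof -
    have "(kp n k \<omega>)\<^sup>2 \<le> 2 * (norm (w' n k \<omega>))\<^sup>2 + 2 * h\<^sup>2"
      using zero_le_power2[of "norm (w' n k \<omega>) - h"] by (simp add: h_def[symmetric] power2_eq_square algebra_simps)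
    moreover have "h\<^sup>2 \<le> h" using h by (simp add: power2_eq_square)
    ultimately show ?thesis by linarith
  qed
  have step: "\<alpha> * vln n k \<omega> \<le> \<phi> (yk n (Suc k) \<omega>) - \<phi> (yk n k \<omega>) - \<xi> n k \<omega> \<bullet> w' n k \<omega> + c1 * ((kp n k \<omega>)\<^sup>2 + h)" for k
  proof -
    let ?r = "yk n (Suc k) \<omega> - yk n k \<omega> - dl n k \<omega> - \<sigma> (yk n k \<omega>) *v w' n k \<omega>"
    have kpn: "0 \<le> kp n k \<omega>" "norm (w' n k \<omega>) \<le> kp n k \<omega>" by auto
    have "norm ?r \<le> \<Lambda> * (C2 * (\<Lambda> * kp n k \<omega>)) * norm (w' n k \<omega>) + \<Lambda> * h"
      using ode_first[OF op, of k] by (simp add: h_def)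
    also have "\<dots> \<le> \<Lambda> * (C2 * (\<Lambda> * kp n k \<omega>)) * kp n k \<omega> + \<Lambda> * h"
      using \<Lambda> consts_nonneg kpn by (intro add_right_mono mult_left_mono mult_nonneg_nonneg) auto
    finally have r: "norm ?r \<le> \<Lambda>\<^sup>2 * C2 * (kp n k \<omega>)\<^sup>2 + \<Lambda> * h" by (simp add: power2_eq_square mult_ac)
    have "- (g (yk n k \<omega>) \<bullet> ?r) \<le> norm (g (yk n k \<omega>)) * norm ?r"
      using Cauchy_Schwarz_ineq2[of "g (yk n k \<omega>)" ?r] by linarith
    also have "\<dots> \<le> \<Lambda> * (\<Lambda>\<^sup>2 * C2 * (kp n k \<omega>)\<^sup>2 + \<Lambda> * h)" using r \<Lambda> by (intro mult_mono g_bound) auto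
    finally have "- (g (yk n k \<omega>) \<bullet> ?r) \<le> \<Lambda>^3 * C2 * (kp n k \<omega>)\<^sup>2 + \<Lambda>\<^sup>2 * h"
      by (simp add: power2_eq_square power3_eq_cube algebra_simps)
    moreover have "g (yk n k \<omega>) \<bullet> (yk n (Suc k) \<omega> - yk n k \<omega> - dl n k \<omega>) = g (yk n k \<omega>) \<bullet> ?r + \<xi> n k \<omega> \<bullet> w' n k \<omega>"
      by (simp add: \<xi>_def dot_lmul_matrix inner_diff_right)
    moreover have "\<Lambda> * C2 * (\<Lambda> * kp n k \<omega>)\<^sup>2 = \<Lambda>^3 * C2 * (kp n k \<omega>)\<^sup>2"
      by (simp add: power2_eq_square power3_eq_cube)
    moreover have "2 * (\<Lambda>^3 * C2 * (kp n k \<omega>)\<^sup>2) + \<Lambda>\<^sup>2 * h \<le> c1 * ((kp n k \<omega>)\<^sup>2 + h)"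
    proof -
      have "0 \<le> \<Lambda>\<^sup>2 * (kp n k \<omega>)\<^sup>2" "0 \<le> 2 * \<Lambda>^3 * C2 * h" using \<Lambda> consts_nonneg h by auto
      then show ?thesis by (simp add: c1_def algebra_simps)
    qed
    ultimately show ?thesis using ode_var[OF op, of k] by linarith
  qed
  have "(\<Sum>k<N. vln n k \<omega>) = tvn n (real N / 2 ^ n) \<omega> - tvn n (real 0 / 2 ^ n) \<omega>"
    by (rule sum_lessThan_telescope[of "\<lambda>k. tvn n (real k / 2 ^ n) \<omega>"])
  also have "\<dots> = tvn n (real TT) \<omega>"
    using op rpath_tv0 by (auto simp: N_def ode_path_def)
  finally have tel: "(\<Sum>k<N. vln n k \<omega>) = tvn n (real TT) \<omega>" .
  have "\<alpha> * tvn n (real TT) \<omega> = (\<Sum>k<N. \<alpha> * vln n k \<omega>)" unfolding tel[symmetric] by (rule sum_distrib_left)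
  also have "\<dots> \<le> (\<Sum>k<N. (\<phi> (yk n (Suc k) \<omega>) - \<phi> (yk n k \<omega>)) - \<xi> n k \<omega> \<bullet> w' n k \<omega> + c1 * ((kp n k \<omega>)\<^sup>2 + h))"
    by (rule sum_mono) (rule step)
  also have "\<dots> = (\<phi> (yk n N \<omega>) - \<phi> (yk n 0 \<omega>)) - (\<Sum>k<N. \<xi> n k \<omega> \<bullet> w' n k \<omega>) + c1 * (\<Sum>k<N. (kp n k \<omega>)\<^sup>2 + h)"
    unfolding sum.distrib[of "\<lambda>k. (\<phi> (yk n (Suc k) \<omega>) - \<phi> (yk n k \<omega>)) - \<xi> n k \<omega> \<bullet> w' n k \<omega>"]
      sum_subtractf[of "\<lambda>k. \<phi> (yk n (Suc k) \<omega>) - \<phi> (yk n k \<omega>)"] sum_lessThan_telescope[of "\<lambda>k. \<phi> (yk n k \<omega>)" N]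
      sum_distrib_left[symmetric, of c1] ..
  finally have main: "\<alpha> * tvn n (real TT) \<omega> \<le> (\<phi> (yk n N \<omega>) - \<phi> (yk n 0 \<omega>)) - (\<Sum>k<N. \<xi> n k \<omega> \<bullet> w' n k \<omega>) + c1 * (\<Sum>k<N. (kp n k \<omega>)\<^sup>2 + h)" .
  have ph: "\<phi> (yk n N \<omega>) - \<phi> (yk n 0 \<omega>) \<le> 2 * \<Lambda>"
    using phi_bound[of "yk n N \<omega>"] phi_bound[of "yk n 0 \<omega>"] by auto
  have "(\<Sum>k<N. (kp n k \<omega>)\<^sup>2 + h) \<le> (\<Sum>k<N. 2 * (norm (w' n k \<omega>))\<^sup>2 + 3 * h)"
    by (rule sum_mono) (use kp2 in \<open>auto simp: algebra_simps intro: order_trans\<close>)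
  also have "\<dots> = 2 * (\<Sum>k<N. (norm (w' n k \<omega>))\<^sup>2) + 3 * (real N * h)" by (simp add: sum.distrib sum_distrib_left)
  also have "\<dots> \<le> 2 * Sq + 3 * real TT" using sum_w'_le[of n \<omega> N] h by (simp add: Sq_def)
  finally have "c1 * (\<Sum>k<N. (kp n k \<omega>)\<^sup>2 + h) \<le> c1 * (2 * Sq + 3 * real TT)" using c1_nonneg by (rule mult_left_mono)
  note A = this
  \<comment> \<open>The coefficient at a grid time here meets the increment that has just ended, so
    this is not a martingale sum. After an index shift, which drops the zero first increment,
    \<open>\<xi>\<close> is moved back to the left end of the interval; by the oscillation bound the
    change is of second order.\<close>
  have "(\<Sum>k<N. \<xi> n k \<omega> \<bullet> w' n k \<omega>) = (\<Sum>k<N - 1. \<xi> n (Suc k) \<omega> \<bullet> dW n k \<omega>)"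
  proof (cases N)
    case (Suc N')
    show ?thesis unfolding Suc by (simp add: sum.lessThan_Suc_shift w'_def del: sum.lessThan_Suc)
  qed (use N in simp)
  also have "\<dots> = Mt + (\<Sum>k<N - 1. (\<xi> n (Suc k) \<omega> - \<xi> n k \<omega>) \<bullet> dW n k \<omega>)"
    unfolding Mt_def sum.distrib[symmetric] by (simp add: inner_diff_left)
  finally have x1: "- (\<Sum>k<N. \<xi> n k \<omega> \<bullet> w' n k \<omega>) = - Mt - (\<Sum>k<N - 1. (\<xi> n (Suc k) \<omega> - \<xi> n k \<omega>) \<bullet> dW n k \<omega>)" by simp
  have "- (\<Sum>k<N - 1. (\<xi> n (Suc k) \<omega> - \<xi> n k \<omega>) \<bullet> dW n k \<omega>) \<le> (\<Sum>k<N - 1. 2 * \<Lambda>^3 * C2 * (2 * (norm (w' n k \<omega>))\<^sup>2 + 2 * h + (norm (dW n k \<omega>))\<^sup>2))"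
    unfolding sum_negf[symmetric]
  proof (rule sum_mono)
    fix k
    have "- ((\<xi> n (Suc k) \<omega> - \<xi> n k \<omega>) \<bullet> dW n k \<omega>) \<le> norm (\<xi> n (Suc k) \<omega> - \<xi> n k \<omega>) * norm (dW n k \<omega>)"
      using Cauchy_Schwarz_ineq2[of "\<xi> n (Suc k) \<omega> - \<xi> n k \<omega>" "dW n k \<omega>"] by linarith
    also have "\<dots> \<le> (2 * \<Lambda>\<^sup>2 * (C2 * (\<Lambda> * kp n k \<omega>))) * norm (dW n k \<omega>)"
    proof (intro mult_right_mono order_trans[OF \<xi>_diff] mult_left_mono)
      show "norm (yk n (Suc k) \<omega> - yk n k \<omega>) \<le> C2 * (\<Lambda> * kp n k \<omega>)"
        unfolding yk_eq[OF op] by (rule ode_osc[OF op]) (auto simp: divide_right_mono)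
    qed auto
    also have "\<dots> = 2 * \<Lambda>^3 * C2 * (kp n k \<omega> * norm (dW n k \<omega>))" by (simp add: power2_eq_square power3_eq_cube)
    also have "\<dots> \<le> 2 * \<Lambda>^3 * C2 * (2 * (norm (w' n k \<omega>))\<^sup>2 + 2 * h + (norm (dW n k \<omega>))\<^sup>2)"
    proof (rule mult_left_mono)
      have "2 * (kp n k \<omega> * norm (dW n k \<omega>)) \<le> (kp n k \<omega>)\<^sup>2 + (norm (dW n k \<omega>))\<^sup>2"
        using zero_le_power2[of "kp n k \<omega> - norm (dW n k \<omega>)"] unfolding power2_eq_square by (simp add: algebra_simps)
      moreover have "0 \<le> kp n k \<omega> * norm (dW n k \<omega>)" by simp
      ultimately show "kp n k \<omega> * norm (dW n k \<omega>) \<le> 2 * (norm (w' n k \<omega>))\<^sup>2 + 2 * h + (norm (dW n k \<omega>))\<^sup>2"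
        using kp2[of k] by linarith
    qed (use \<Lambda> consts_nonneg in auto)
    finally show "- ((\<xi> n (Suc k) \<omega> - \<xi> n k \<omega>) \<bullet> dW n k \<omega>) \<le> 2 * \<Lambda>^3 * C2 * (2 * (norm (w' n k \<omega>))\<^sup>2 + 2 * h + (norm (dW n k \<omega>))\<^sup>2)" .
  qed
  also have "\<dots> \<le> (\<Sum>k<N. 2 * \<Lambda>^3 * C2 * (2 * (norm (w' n k \<omega>))\<^sup>2 + 2 * h + (norm (dW n k \<omega>))\<^sup>2))"
    using \<Lambda> consts_nonneg h by (intro sum_mono2) auto
  also have "\<dots> = 2 * \<Lambda>^3 * C2 * (2 * (\<Sum>k<N. (norm (w' n k \<omega>))\<^sup>2) + 2 * (real N * h) + Sq)"
    unfolding sum_distrib_left[symmetric] Sq_def by (simp add: sum.distrib sum_distrib_left)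
  also have "\<dots> \<le> 2 * \<Lambda>^3 * C2 * (3 * Sq + 3 * real TT)"
    using sum_w'_le[of n \<omega> N] h \<Lambda> consts_nonneg by (intro mult_left_mono) (auto simp: Sq_def)
  finally have x2: "- (\<Sum>k<N - 1. (\<xi> n (Suc k) \<omega> - \<xi> n k \<omega>) \<bullet> dW n k \<omega>) \<le> 2 * \<Lambda>^3 * C2 * (3 * Sq + 3 * real TT)" .
  \<comment> \<open>Passing to the square gives a nonnegative variable whose expectation is known
    from the isometry.\<close>
  have Mt: "- Mt \<le> 1 + Mt\<^sup>2" using zero_le_power2[of "Mt + 1"] zero_le_power2[of Mt] unfolding power2_eq_square
    by (simp only: algebra_simps)
  have "\<alpha> * tvn n (real TT) \<omega> \<le> 2 * \<Lambda> + 1 + (c1 + 2 * \<Lambda>^3 * C2) * (3 * real TT) + (2 * c1 + 6 * \<Lambda>^3 * C2) * Sq + Mt\<^sup>2"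
    using main ph A x1 x2 Mt by (simp add: algebra_simps)
  also have "\<dots> \<le> 2 * \<Lambda> + 1 + (c1 + 2 * \<Lambda>^3 * C2) * (3 * real TT) + (2 * c1 + 6 * \<Lambda>^3 * C2 + 1) * (Sq + Mt\<^sup>2)"
  proof -
    have "0 \<le> (2 * c1 + 6 * \<Lambda>^3 * C2) * Mt\<^sup>2" using c1_nonneg \<Lambda> consts_nonneg by simp
    then show ?thesis using Sq0 by (simp add: algebra_simps)
  qed
  finally show ?thesis by (simp add: Sq_def Mt_def N_def)
qed

lemma bounded_whp_tvn:
  assumes TT: "TT \<ge> 1"
  shows "bounded_whp (\<lambda>n \<omega>. tvn n (real TT) \<omega>)"
proof (rule bounded_whp_whp)
  define c where "c = 2 * \<Lambda> + 1 + (c1 + 2 * \<Lambda>^3 * C2) * (3 * real TT)"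
  define c' where "c' = 2 * c1 + 6 * \<Lambda>^3 * C2 + 1"
  have c': "c' \<ge> 0" using c1_nonneg \<Lambda> consts_nonneg by (simp add: c'_def)
  let ?Z = "\<lambda>n \<omega>. (\<Sum>k<TT * 2 ^ n. (norm (dW n k \<omega>))\<^sup>2) + (\<Sum>k<TT * 2 ^ n - 1. \<xi> n k \<omega> \<bullet> dW n k \<omega>)\<^sup>2"
  show "bounded_whp ?Z"
  proof (rule bounded_whp_expectation[where c = "real TT * real CARD('m) + real TT * (\<Lambda> * \<Lambda>)\<^sup>2"])
    fix n
    have i1: "integrable M (\<lambda>\<omega>. \<Sum>k<TT * 2 ^ n. (norm (dW n k \<omega>))\<^sup>2)"
      by (intro Bochner_Integration.integrable_sum dW_norm2)
    have i2: "integrable M (\<lambda>\<omega>. (\<Sum>k<TT * 2 ^ n - 1. \<xi> n k \<omega> \<bullet> dW n k \<omega>)\<^sup>2)"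
      by (rule square_integrable_sum_increments[OF \<xi>_measurable_F \<xi>_bound])
    show "integrable M (?Z n)" using i1 i2 by (rule Bochner_Integration.integrable_add)
    have "expectation (\<lambda>\<omega>. \<Sum>k<TT * 2 ^ n. (norm (dW n k \<omega>))\<^sup>2) = real TT * real CARD('m)"
      by (subst Bochner_Integration.integral_sum) (auto simp: dW_norm2)
    moreover have "expectation (\<lambda>\<omega>. (\<Sum>k<TT * 2 ^ n - 1. \<xi> n k \<omega> \<bullet> dW n k \<omega>)\<^sup>2) \<le> real TT * (\<Lambda> * \<Lambda>)\<^sup>2"
    proof -
      have b: "expectation (\<lambda>\<omega>. (norm (\<xi> n k \<omega>))\<^sup>2) \<le> (\<Lambda> * \<Lambda>)\<^sup>2" for k
      proof -
        have [measurable]: "\<xi> n k \<in> borel_measurable M" by (rule measurable_F_M[OF \<xi>_measurable_F])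
        have "expectation (\<lambda>\<omega>. (norm (\<xi> n k \<omega>))\<^sup>2) \<le> expectation (\<lambda>\<omega>. (\<Lambda> * \<Lambda>)\<^sup>2)"
          by (intro integral_mono integrable_const_bound[of _ "(\<Lambda> * \<Lambda>)\<^sup>2"]) (use power_mono[OF \<xi>_bound, of n k _ 2] in auto)
        then show ?thesis by (simp add: prob_space)
      qed
      have "expectation (\<lambda>\<omega>. (\<Sum>k<TT * 2 ^ n - 1. \<xi> n k \<omega> \<bullet> dW n k \<omega>)\<^sup>2) = (\<Sum>k<TT * 2 ^ n - 1. expectation (\<lambda>\<omega>. (norm (\<xi> n k \<omega>))\<^sup>2) / 2 ^ n)"
        by (rule isometry_sum_increments[OF \<xi>_measurable_F \<xi>_bound])
      also have "\<dots> \<le> (\<Sum>k<TT * 2 ^ n - 1. (\<Lambda> * \<Lambda>)\<^sup>2 / 2 ^ n)" by (intro sum_mono divide_right_mono b) auto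
      also have "\<dots> \<le> (\<Sum>k<TT * 2 ^ n. (\<Lambda> * \<Lambda>)\<^sup>2 / 2 ^ n)" by (intro sum_mono2) auto
      also have "\<dots> = real TT * (\<Lambda> * \<Lambda>)\<^sup>2" by simp
      finally show ?thesis .
    qed
    ultimately show "expectation (?Z n) \<le> real TT * real CARD('m) + real TT * (\<Lambda> * \<Lambda>)\<^sup>2"
      using i1 i2 by simp
  qed (simp add: sum_nonneg)
  show "whp (\<lambda>n \<omega>. tvn n (real TT) \<omega> \<le> (\<lambda>z. (c + c' * z) / \<alpha>) (?Z n \<omega>))"
  proof (rule whp_AE)
    fix n
    show "AE \<omega> in M. tvn n (real TT) \<omega> \<le> (c + c' * ?Z n \<omega>) / \<alpha>"
      using AE_ode_path[of n]
    proof eventually_elim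
      case (elim \<omega>)
      from tvn_bound[OF elim TT] show ?case using \<alpha> unfolding c_def c'_def
        by (simp add: pos_le_divide_eq mult.commute[of \<alpha>])
    qed
  qed
  show "mono (\<lambda>z. (c + c' * z) / \<alpha>)" using c' \<alpha> by (intro monoI divide_right_mono add_left_mono mult_left_mono) auto
qed

text \<open>\<open>L\<close> is a single process, so one level \<open>n\<close> suffices at which
  \<open>X\<close> oscillates little within each interval. At this level the variation of
  \<open>L\<close> is at most a constant times a finite sum of norms of increments, which is a
  finite random variable and hence bounded in probability.\<close>

lemma bounded_whp_tvx: "bounded_whp (\<lambda>n \<omega>. tvx (real TT) \<omega>)"
  unfolding bounded_whp_def
proof (intro allI impI)
  fix \<epsilon> :: real assume eps: "\<epsilon> > 0"
  define o' where "o' = \<alpha> / (2 * \<Lambda>)"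
  have o': "o' > 0" "\<Lambda> * o' = \<alpha> / 2" using \<alpha> \<Lambda> by (auto simp: o'_def)
  have "whp (\<lambda>n \<omega>. (\<forall>s t. 0 \<le> s \<longrightarrow> s \<le> real TT \<longrightarrow> 0 \<le> t \<longrightarrow> t \<le> real TT \<longrightarrow> \<bar>s - t\<bar> \<le> 1 / 2^n \<longrightarrow> norm (X s \<omega> - X t \<omega>) \<le> o') \<and> rpath (\<lambda>t. X t \<omega>) (\<lambda>t. L t \<omega>))"
    by (intro whp_conj whp_osc[OF o'(1)] whp_AE AE_rpath)
  then have "\<forall>\<^sub>F n in sequentially. \<exists>A\<in>events. prob A \<le> \<epsilon> / 2 \<and> (\<forall>\<omega>\<in>space M - A. (\<forall>s t. 0 \<le> s \<longrightarrow> s \<le> real TT \<longrightarrow> 0 \<le> t \<longrightarrow> t \<le> real TT \<longrightarrow> \<bar>s - t\<bar> \<le> 1 / 2^n \<longrightarrow> norm (X s \<omega> - X t \<omega>) \<le> o') \<and> rpath (\<lambda>t. X t \<omega>) (\<lambda>t. L t \<omega>))"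
    using eps by (intro whpD) auto
  from eventually_happens'[OF sequentially_bot this] obtain n A where A: "A \<in> events" "prob A \<le> \<epsilon> / 2"
    "\<And>\<omega> s t. \<omega> \<in> space M - A \<Longrightarrow> 0 \<le> s \<Longrightarrow> s \<le> real TT \<Longrightarrow> 0 \<le> t \<Longrightarrow> t \<le> real TT \<Longrightarrow> \<bar>s - t\<bar> \<le> 1 / 2^n \<Longrightarrow> norm (X s \<omega> - X t \<omega>) \<le> o'"
    "\<And>\<omega>. \<omega> \<in> space M - A \<Longrightarrow> rpath (\<lambda>t. X t \<omega>) (\<lambda>t. L t \<omega>)"
    by blast
  define Z where "Z = (\<lambda>\<omega>. \<Sum>k<TT * 2 ^ n. norm (dm n k \<omega>))"
  have Zm[measurable]: "Z \<in> borel_measurable M"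
    unfolding Z_def using XL_measurable(2) by (intro borel_measurable_sum borel_measurable_norm borel_measurable_diff) auto
  have "whp (\<lambda>R \<omega>. \<omega> \<in> {\<omega>\<in>space M. Z \<omega> \<le> real R})"
  proof (rule whp_incseq)
    show "{\<omega>\<in>space M. Z \<omega> \<le> real R} \<in> events" for R by measurable
    show "incseq (\<lambda>R. {\<omega>\<in>space M. Z \<omega> \<le> real R})" by (auto simp: incseq_def intro: order_trans)
    show "AE \<omega> in M. \<exists>R. \<omega> \<in> {\<omega>\<in>space M. Z \<omega> \<le> real R}"
      using AE_space by eventually_elim (auto intro: real_arch_simple)
  qed
  then have "\<forall>\<^sub>F R in sequentially. \<exists>A\<in>events. prob A \<le> \<epsilon> / 2 \<and> (\<forall>\<omega>\<in>space M - A. \<omega> \<in> {\<omega>\<in>space M. Z \<omega> \<le> real R})"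
    using eps by (intro whpD) auto
  from eventually_happens'[OF sequentially_bot this] obtain R A' where A': "A' \<in> events" "prob A' \<le> \<epsilon> / 2" "\<And>\<omega>. \<omega> \<in> space M - A' \<Longrightarrow> Z \<omega> \<le> real R"
    by blast
  have "tvx (real TT) \<omega> \<le> 2 * \<Lambda> / \<alpha> * real R" if w: "\<omega> \<in> space M - (A \<union> A')" for \<omega>
  proof -
    have rp: "rpath (\<lambda>t. X t \<omega>) (\<lambda>t. L t \<omega>)" using A(4) w by blast
    have step: "\<alpha> / 2 * vlm n k \<omega> \<le> \<Lambda> * norm (dm n k \<omega>)" if k: "k < TT * 2 ^ n" for k
    proof -
      have t: "real (Suc k) / 2 ^ n \<le> real TT" using k by (intro grid_le) simp
      have "(\<alpha> - \<Lambda> * o') * vlm n k \<omega> \<le> \<Lambda> * norm (dm n k \<omega>)"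
      proof (rule rpath_lower[OF rp])
        fix r assume r: "real k / 2 ^ n \<le> r" "r \<le> real (Suc k) / 2 ^ n"
        have k0: "0 \<le> real k / 2 ^ n" by simp
        moreover have "0 \<le> r" by (rule order_trans[OF k0 r(1)])
        moreover have "real (Suc k) / 2 ^ n = real k / 2 ^ n + 1 / 2 ^ n" by (simp add: grid_Suc)
        ultimately show "norm (X r \<omega> - X (real k / 2 ^ n) \<omega>) \<le> o'" using r t w by (intro A(3)) auto
      qed (auto simp: divide_right_mono)
      then show ?thesis using o' by simp
    qed
    have "(\<Sum>k<TT * 2 ^ n. vlm n k \<omega>) = tvx (real (TT * 2 ^ n) / 2 ^ n) \<omega> - tvx (real 0 / 2 ^ n) \<omega>"
      by (rule sum_lessThan_telescope[of "\<lambda>k. tvx (real k / 2 ^ n) \<omega>"])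
    also have "\<dots> = tvx (real TT) \<omega>" using rpath_tv0[OF rp] by simp
    finally have "\<alpha> / 2 * tvx (real TT) \<omega> = (\<Sum>k<TT * 2 ^ n. \<alpha> / 2 * vlm n k \<omega>)"
      by (simp only: sum_distrib_left[symmetric])
    also have "\<dots> \<le> (\<Sum>k<TT * 2 ^ n. \<Lambda> * norm (dm n k \<omega>))" by (intro sum_mono step) auto
    also have "\<dots> = \<Lambda> * Z \<omega>" by (simp add: Z_def sum_distrib_left)
    also have "\<dots> \<le> \<Lambda> * real R" using A'(3)[of \<omega>] w \<Lambda> by (intro mult_left_mono) auto
    finally show ?thesis using \<alpha> by (simp add: field_simps)
  qed
  moreover have "prob (A \<union> A') \<le> \<epsilon>" using measure_Un_le[of A M A'] A A' by simp
  ultimately show "\<exists>R. \<forall>\<^sub>F n in sequentially. \<exists>A\<in>events. prob A \<le> \<epsilon> \<and> (\<forall>\<omega>\<in>space M - A. tvx (real TT) \<omega> \<le> R)"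
    using A(1) A'(1) by (intro exI[of _ "2 * \<Lambda> / \<alpha> * real R"] always_eventually allI bexI[of _ "A \<union> A'"]) auto
qed

end

section \<open>Convergence\<close>

context coefficients
begin

text \<open>The squared matrix norm is the sum of the squared norms of the columns, so for an
  increment of length \<open>h\<close> the term \<open>h * (norm P)^2\<close> is the mean of the
  squared noise. Together with \<open>sigsig\<close> as a sum of diagonal coefficients, all
  subtractions amount to centering the products of coordinates.\<close>

lemma quadratic_form_expansion:
  fixes P :: "real^'m^'d" and w :: "real^'m" and z y :: "real^'d"
  assumes y: "y \<in> closure D"
  shows "2 * (z \<bullet> (P *v w + Q y w - (h / 2) *\<^sub>R sigsig \<sigma> \<sigma>' y)) + (norm (P *v w))\<^sup>2 - h * (norm P)\<^sup>2 =
    (\<Sum>i\<in>UNIV. 2 * (z \<bullet> (P *v axis i 1)) * w $ i) +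
    (\<Sum>i\<in>UNIV. \<Sum>j\<in>UNIV. (z \<bullet> ((\<sigma>' y (\<sigma> y *v axis i 1)) *v axis j 1) + (P *v axis i 1) \<bullet> (P *v axis j 1)) *
       (w $ i * w $ j - (if i = j then h else 0)))"
proof -
  have we: "w = (\<Sum>i\<in>UNIV. (w $ i) *\<^sub>R axis i 1)"
    by (simp add: vec_eq_iff axis_def if_distrib cong: if_cong)
  have mult: "A *v w = (\<Sum>i\<in>UNIV. (w $ i) *\<^sub>R (A *v axis i 1))" for A :: "real^'m^'d"
  proof -
    have "A *v w = A *v (\<Sum>i\<in>UNIV. (w $ i) *\<^sub>R axis i 1)" using we by simp
    also have "\<dots> = (\<Sum>i\<in>UNIV. A *v ((w $ i) *\<^sub>R axis i 1))" by (rule linear_sum[OF matrix_vector_mul_linear])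
    finally show ?thesis by (simp add: matrix_vector_mult_scaleR)
  qed
  have sw: "\<sigma>' y (\<sigma> y *v w) = (\<Sum>i\<in>UNIV. (w $ i) *\<^sub>R \<sigma>' y (\<sigma> y *v axis i 1))"
    unfolding mult[of "\<sigma> y"] using sigma'_linear[OF y] by (simp add: linear_sum linear_cmul)
  define T where "T = (\<lambda>i j. z \<bullet> ((\<sigma>' y (\<sigma> y *v axis i 1)) *v axis j 1))"
  define p where "p = (\<lambda>i. P *v axis i (1::real))"
  have Q1: "2 * (z \<bullet> Q y w) = (\<Sum>i\<in>UNIV. \<Sum>j\<in>UNIV. T i j * (w $ i * w $ j))"
  proof -
    have "2 * (z \<bullet> Q y w) = z \<bullet> ((\<sigma>' y (\<sigma> y *v w)) *v w)" by (simp add: Q_def)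
    also have "\<dots> = (\<Sum>j\<in>UNIV. w $ j * (z \<bullet> ((\<sigma>' y (\<sigma> y *v w)) *v axis j 1)))"
      unfolding mult[of "\<sigma>' y (\<sigma> y *v w)"] by (simp add: inner_sum_right)
    also have "\<dots> = (\<Sum>j\<in>UNIV. w $ j * (\<Sum>i\<in>UNIV. w $ i * T i j))"
    proof (rule sum.cong[OF refl])
      fix j
      have "(\<sigma>' y (\<sigma> y *v w)) *v axis j 1 = (\<Sum>i\<in>UNIV. (w $ i) *\<^sub>R (\<sigma>' y (\<sigma> y *v axis i 1) *v axis j 1))"
        unfolding sw by (simp add: vec_eq_iff matrix_vector_mult_def axis_def if_distrib sum_distrib_left cong: if_cong)
      then show "w $ j * (z \<bullet> (\<sigma>' y (\<sigma> y *v w) *v axis j 1)) = w $ j * (\<Sum>i\<in>UNIV. w $ i * T i j)"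
        by (simp add: T_def inner_sum_right)
    qed
    also have "\<dots> = (\<Sum>j\<in>UNIV. \<Sum>i\<in>UNIV. T i j * (w $ i * w $ j))"
      by (simp add: sum_distrib_left mult_ac)
    also have "\<dots> = (\<Sum>i\<in>UNIV. \<Sum>j\<in>UNIV. T i j * (w $ i * w $ j))" by (rule sum.swap)
    finally show ?thesis .
  qed
  have S1: "z \<bullet> sigsig \<sigma> \<sigma>' y = (\<Sum>i\<in>UNIV. T i i)"
    unfolding sigsig_eq[OF y] by (simp add: T_def inner_sum_right)
  have P1: "z \<bullet> (P *v w) = (\<Sum>i\<in>UNIV. (z \<bullet> p i) * w $ i)"
    unfolding mult[of P] p_def by (simp add: inner_sum_right mult.commute)
  have P2: "(norm (P *v w))\<^sup>2 = (\<Sum>i\<in>UNIV. \<Sum>j\<in>UNIV. (p i \<bullet> p j) * (w $ i * w $ j))"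
    unfolding mult[of P] p_def power2_norm_eq_inner
    by (subst inner_sum_left) (simp add: inner_sum_right sum_distrib_left mult_ac)
  have P3: "(norm P)\<^sup>2 = (\<Sum>i\<in>UNIV. p i \<bullet> p i)"
  proof -
    have "p i $ a = P $ a $ i" for a i by (simp add: p_def matrix_vector_mult_def axis_def if_distrib cong: if_cong)
    then show ?thesis unfolding power2_norm_eq_inner inner_vec_def by (simp add: sum.swap[of _ "UNIV::'d set"])
  qed
  have R: "(\<Sum>i\<in>UNIV. \<Sum>j\<in>UNIV. (T i j + p i \<bullet> p j) * (w $ i * w $ j - (if i = j then h else 0)))
    = (\<Sum>i\<in>UNIV. \<Sum>j\<in>UNIV. T i j * (w $ i * w $ j)) + (\<Sum>i\<in>UNIV. \<Sum>j\<in>UNIV. (p i \<bullet> p j) * (w $ i * w $ j))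
      - h * (\<Sum>i\<in>UNIV. T i i) - h * (\<Sum>i\<in>UNIV. p i \<bullet> p i)"
  proof -
    have "(T i j + p i \<bullet> p j) * (w $ i * w $ j - (if i = j then h else 0)) =
        T i j * (w $ i * w $ j) + (p i \<bullet> p j) * (w $ i * w $ j) - (if i = j then h * (T i i + p i \<bullet> p i) else 0)" for i j
      by (auto simp: algebra_simps)
    then have "(\<Sum>i\<in>UNIV. \<Sum>j\<in>UNIV. (T i j + p i \<bullet> p j) * (w $ i * w $ j - (if i = j then h else 0)))
      = (\<Sum>i\<in>UNIV. \<Sum>j\<in>UNIV. T i j * (w $ i * w $ j)) + (\<Sum>i\<in>UNIV. \<Sum>j\<in>UNIV. (p i \<bullet> p j) * (w $ i * w $ j))
        - (\<Sum>i\<in>UNIV. \<Sum>j\<in>UNIV. if i = j then h * (T i i + p i \<bullet> p i) else 0)"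
      by (simp only: sum.distrib sum_subtractf)
    also have "(\<Sum>i\<in>UNIV. \<Sum>j\<in>UNIV. if i = j then h * (T i i + p i \<bullet> p i) else 0) = h * (\<Sum>i\<in>UNIV. T i i) + h * (\<Sum>i\<in>UNIV. p i \<bullet> p i)"
      by (simp add: sum.distrib sum_distrib_left distrib_left)
    finally show ?thesis by simp
  qed
  show ?thesis unfolding R[unfolded T_def p_def]
    using Q1 S1 P1 P2 P3 by (simp add: T_def p_def inner_add_right inner_diff_right sum_distrib_left algebra_simps)
qed

end

context wong_zakai
begin

text \<open>An Euler path with coefficients taken along the true solution and with its exact
  reflection term. It stays close to \<open>X\<close> but has increments explicit in the new
  Brownian increment.\<close>

definition xh :: "nat \<Rightarrow> nat \<Rightarrow> 'a \<Rightarrow> real^'d" where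
  "xh n k \<omega> = x0 + S n k \<omega> + (1 / 2 ^ n) *\<^sub>R (\<Sum>j<k. B (vk n j \<omega>)) + L (real k / 2 ^ n) \<omega>"

definition z :: "nat \<Rightarrow> nat \<Rightarrow> 'a \<Rightarrow> real^'d" where
  "z n k \<omega> = Uhat (yk n k \<omega>) (w' n k \<omega>) - xh n k \<omega>"

definition P :: "nat \<Rightarrow> nat \<Rightarrow> 'a \<Rightarrow> real^'m^'d" where
  "P n k \<omega> = Shat (yk n k \<omega>) (w' n k \<omega>) - \<sigma> (vk n k \<omega>)"

lemma xh_Suc: "xh n (Suc k) \<omega> = xh n k \<omega> + \<sigma> (vk n k \<omega>) *v dW n k \<omega> + (1 / 2 ^ n) *\<^sub>R B (vk n k \<omega>) + dm n k \<omega>"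
  by (simp add: xh_def S_def scaleR_add_right)

lemma w'_Suc: "w' n (Suc k) \<omega> = dW n k \<omega>"
  by (simp add: w'_def)

lemma riemann_sum_drift:
  assumes rp: "rpath (\<lambda>t. X t \<omega>) (\<lambda>t. L t \<omega>)"
    and osc: "\<And>s t. 0 \<le> s \<Longrightarrow> s \<le> real TT \<Longrightarrow> 0 \<le> t \<Longrightarrow> t \<le> real TT \<Longrightarrow> \<bar>s - t\<bar> \<le> 1 / 2^n \<Longrightarrow> norm (X s \<omega> - X t \<omega>) \<le> \<delta>"
    and k: "k \<le> TT * 2 ^ n"
  shows "norm ((1/2) *\<^sub>R integral {0..real k / 2 ^ n} (\<lambda>s. sigsig \<sigma> \<sigma>' (X s \<omega>)) + integral {0..real k / 2 ^ n} (\<lambda>s. b (X s \<omega>))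
    - (1 / 2 ^ n) *\<^sub>R (\<Sum>j<k. B (vk n j \<omega>))) \<le> CB * \<delta> * (real k / 2 ^ n)"
proof -
  have xc: "continuous_on {0..} (\<lambda>t. X t \<omega>)" and xD: "\<And>t. 0 \<le> t \<Longrightarrow> X t \<omega> \<in> closure D" using rp by (auto simp: rpath_def)
  have Bc: "continuous_on {p..q} (\<lambda>s. B (X s \<omega>))" if "0 \<le> p" for p q
    using that xD CB_pos by (intro closure_continuous_compose[of B CB] B_lip continuous_on_subset[OF xc]) auto
  have bc: "continuous_on {p..q} (\<lambda>s. b (X s \<omega>))" if "0 \<le> p" for p q
    using that xD \<Lambda> by (intro closure_continuous_compose[of b \<Lambda>] b_lip continuous_on_subset[OF xc]) auto
  have comb: "(1/2) *\<^sub>R integral {0..t} (\<lambda>s. sigsig \<sigma> \<sigma>' (X s \<omega>)) + integral {0..t} (\<lambda>s. b (X s \<omega>)) = integral {0..t} (\<lambda>s. B (X s \<omega>))" for t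
  proof -
    have e: "(1/2) *\<^sub>R sigsig \<sigma> \<sigma>' y = B y - b y" for y by (simp add: B_def)
    have "(1/2) *\<^sub>R integral {0..t} (\<lambda>s. sigsig \<sigma> \<sigma>' (X s \<omega>)) = integral {0..t} (\<lambda>s. B (X s \<omega>) - b (X s \<omega>))"
      unfolding integral_cmul[symmetric] e ..
    also have "\<dots> = integral {0..t} (\<lambda>s. B (X s \<omega>)) - integral {0..t} (\<lambda>s. b (X s \<omega>))"
      by (intro Henstock_Kurzweil_Integration.integral_diff integrable_continuous_interval Bc bc) auto
    finally show ?thesis by simp
  qed
  show ?thesis unfolding comb using k
  proof (induction k)
    case (Suc k)
    let ?t = "real k / 2 ^ n" and ?t1 = "real (Suc k) / 2 ^ n"
    have t: "0 \<le> ?t" "?t \<le> ?t1" by (auto simp: divide_right_mono)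
    have tT: "?t1 \<le> real TT" using Suc.prems by (rule grid_le)
    have i1: "integral {0..?t1} (\<lambda>s. B (X s \<omega>)) = integral {0..?t} (\<lambda>s. B (X s \<omega>)) + integral {?t..?t1} (\<lambda>s. B (X s \<omega>))"
      by (rule Henstock_Kurzweil_Integration.integral_combine[OF t integrable_continuous_interval[OF Bc], symmetric]) simp
    have i2: "norm (integral {?t..?t1} (\<lambda>s. B (X s \<omega>)) - (1 / 2 ^ n) *\<^sub>R B (vk n k \<omega>)) \<le> CB * \<delta> * (1 / 2 ^ n)"
    proof -
      have "integral {?t..?t1} (\<lambda>s. B (X s \<omega>)) - (1 / 2 ^ n) *\<^sub>R B (vk n k \<omega>) = integral {?t..?t1} (\<lambda>s. B (X s \<omega>) - B (vk n k \<omega>))"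
        using t grid_step(3)[of k n] by (subst Henstock_Kurzweil_Integration.integral_diff)
          (auto intro!: integrable_continuous_interval Bc simp del: of_nat_Suc)
      also have "norm \<dots> \<le> (CB * \<delta>) * (?t1 - ?t)"
      proof (rule integral_bound[OF t(2)])
        show "continuous_on {?t..?t1} (\<lambda>s. B (X s \<omega>) - B (vk n k \<omega>))" by (intro continuous_intros Bc t)
        show "norm (B (X s \<omega>) - B (vk n k \<omega>)) \<le> CB * \<delta>" if s: "s \<in> {?t..?t1}" for s
        proof -
          have s0: "0 \<le> s" by (rule order_trans[OF t(1)]) (use s in simp)
          have "norm (X s \<omega> - X ?t \<omega>) \<le> \<delta>"
            by (rule osc[OF s0 _ t(1)]) (use s t tT grid_step(3)[of k n] in \<open>auto simp del: of_nat_Suc\<close>)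
          then show ?thesis unfolding vk_eq[OF rp] using CB_pos
            by (intro order_trans[OF B_lip[OF xD[OF s0] xD[OF t(1)]]] mult_left_mono) auto
        qed
      qed
      finally show ?thesis using grid_step(3)[of k n] by simp
    qed
    have i3: "norm (integral {0..?t} (\<lambda>s. B (X s \<omega>)) - (1 / 2 ^ n) *\<^sub>R (\<Sum>j<k. B (vk n j \<omega>))) \<le> CB * \<delta> * ?t"
      using Suc by simp
    have i4: "CB * \<delta> * ?t1 = CB * \<delta> * ?t + CB * \<delta> * (1 / 2 ^ n)" unfolding grid_Suc[symmetric] by (simp only: distrib_left)
    have i5: "(1 / 2 ^ n) *\<^sub>R (\<Sum>j<Suc k. B (vk n j \<omega>)) = (1 / 2 ^ n) *\<^sub>R (\<Sum>j<k. B (vk n j \<omega>)) + (1 / 2 ^ n) *\<^sub>R B (vk n k \<omega>)"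
      by (simp add: scaleR_add_right)
    have gen: "norm (I1 - s1) \<le> e1 + e2" if "I1 = I + J" "norm (J - c) \<le> e2" "norm (I - s) \<le> e1" "s1 = s + c"
      for I1 I J s s1 c :: "real^'d" and e1 e2
    proof -
      have eq: "I1 - s1 = (I - s) + (J - c)" using that by simp
      show ?thesis unfolding eq using norm_triangle_ineq[of "I - s" "J - c"] that(2,3) by linarith
    qed
    show ?case unfolding i4 by (rule gen[OF i1 i2 i3 i5])
  qed simp
qed

text \<open>The difference consists of two Riemann sum errors, one stochastic and one for the drift.
  The equation of the solution holds almost surely for each separate time; the dyadic times are
  countable, so a single null set serves them all.\<close>

lemma whp_xh_close:
  assumes e: "e > 0"
  shows "whp (\<lambda>n \<omega>. \<forall>k\<le>TT * 2 ^ n. norm (vk n k \<omega> - xh n k \<omega>) \<le> e)"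
proof -
  obtain I where I: "is_ito_integral M W (\<lambda>s \<omega>. \<sigma> (X s \<omega>)) I"
    and eq: "\<And>t. 0 \<le> t \<Longrightarrow> AE \<omega> in M. X t \<omega> = x0 + I t \<omega> + (1/2) *\<^sub>R integral {0..t} (\<lambda>s. sigsig \<sigma> \<sigma>' (X s \<omega>))
            + integral {0..t} (\<lambda>s. b (X s \<omega>)) + L t \<omega>"
    using sol unfolding reflected_sde_solution_def by blast
  have aeq: "AE \<omega> in M. \<forall>n k. X (real k / 2 ^ n) \<omega> = x0 + I (real k / 2 ^ n) \<omega> + (1/2) *\<^sub>R integral {0..real k / 2 ^ n} (\<lambda>s. sigsig \<sigma> \<sigma>' (X s \<omega>))
            + integral {0..real k / 2 ^ n} (\<lambda>s. b (X s \<omega>)) + L (real k / 2 ^ n) \<omega>"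
    unfolding AE_all_countable by (intro allI eq) simp
  define \<delta> where "\<delta> = e / (2 * CB * (real TT + 1))"
  have \<delta>: "\<delta> > 0" using e CB_pos by (simp add: \<delta>_def)
  have \<delta>2: "CB * \<delta> * real TT \<le> e / 2"
  proof -
    have "CB * \<delta> * real TT \<le> CB * \<delta> * (real TT + 1)" using CB_pos \<delta> by (intro mult_left_mono) auto
    also have "\<dots> = e / 2"
    proof -
      have "c * (e / (2 * c * a)) * a = e / 2" if "c > 0" "a > 0" for c a :: real using that by simp
      from this[of CB "real TT + 1"] show ?thesis using CB_pos by (simp add: \<delta>_def)
    qed
    finally show ?thesis .
  qed
  have e2: "e / 2 > 0" using e by simp
  have "whp (\<lambda>n \<omega>. (\<forall>k\<le>TT * 2 ^ n. norm (S n k \<omega> - I (real k / 2 ^ n) \<omega>) \<le> e / 2) \<and>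
      ((\<forall>s t. 0 \<le> s \<longrightarrow> s \<le> real TT \<longrightarrow> 0 \<le> t \<longrightarrow> t \<le> real TT \<longrightarrow> \<bar>s - t\<bar> \<le> 1 / 2^n \<longrightarrow> norm (X s \<omega> - X t \<omega>) \<le> \<delta>) \<and>
      (rpath (\<lambda>t. X t \<omega>) (\<lambda>t. L t \<omega>) \<and>
      (\<forall>n k. X (real k / 2 ^ n) \<omega> = x0 + I (real k / 2 ^ n) \<omega> + (1/2) *\<^sub>R integral {0..real k / 2 ^ n} (\<lambda>s. sigsig \<sigma> \<sigma>' (X s \<omega>))
            + integral {0..real k / 2 ^ n} (\<lambda>s. b (X s \<omega>)) + L (real k / 2 ^ n) \<omega>))))"
    by (intro whp_conj whp_ito_sums_close[OF I e2] whp_osc(1)[OF \<delta>] whp_AE[OF AE_rpath] whp_AE[OF aeq])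
  then show ?thesis
  proof (rule whp_mono, elim conjE, intro allI impI)
    fix n \<omega> k
    assume A: "\<forall>k\<le>TT * 2 ^ n. norm (S n k \<omega> - I (real k / 2 ^ n) \<omega>) \<le> e / 2"
      and osc: "\<forall>s t. 0 \<le> s \<longrightarrow> s \<le> real TT \<longrightarrow> 0 \<le> t \<longrightarrow> t \<le> real TT \<longrightarrow> \<bar>s - t\<bar> \<le> 1 / 2^n \<longrightarrow> norm (X s \<omega> - X t \<omega>) \<le> \<delta>"
      and rp: "rpath (\<lambda>t. X t \<omega>) (\<lambda>t. L t \<omega>)"
      and E: "\<forall>n k. X (real k / 2 ^ n) \<omega> = x0 + I (real k / 2 ^ n) \<omega> + (1/2) *\<^sub>R integral {0..real k / 2 ^ n} (\<lambda>s. sigsig \<sigma> \<sigma>' (X s \<omega>))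
            + integral {0..real k / 2 ^ n} (\<lambda>s. b (X s \<omega>)) + L (real k / 2 ^ n) \<omega>"
      and k: "k \<le> TT * 2 ^ n"
    let ?d = "(1/2) *\<^sub>R integral {0..real k / 2 ^ n} (\<lambda>s. sigsig \<sigma> \<sigma>' (X s \<omega>)) + integral {0..real k / 2 ^ n} (\<lambda>s. b (X s \<omega>))
       - (1 / 2 ^ n) *\<^sub>R (\<Sum>j<k. B (vk n j \<omega>))"
    have "vk n k \<omega> - xh n k \<omega> = ?d - (S n k \<omega> - I (real k / 2 ^ n) \<omega>)"
      unfolding vk_eq[OF rp, of n k] E[rule_format, of k n] by (simp add: xh_def)
    then have "norm (vk n k \<omega> - xh n k \<omega>) \<le> norm ?d + norm (S n k \<omega> - I (real k / 2 ^ n) \<omega>)"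
      using norm_triangle_ineq4 by metis
    moreover have "norm ?d \<le> CB * \<delta> * (real k / 2 ^ n)" by (rule riemann_sum_drift[OF rp _ k]) (use osc in blast)
    moreover have "CB * \<delta> * (real k / 2 ^ n) \<le> CB * \<delta> * real TT"
      using grid_le[OF k] CB_pos \<delta> by (intro mult_left_mono) auto
    moreover have "norm (S n k \<omega> - I (real k / 2 ^ n) \<omega>) \<le> e / 2" using A k by blast
    ultimately show "norm (vk n k \<omega> - xh n k \<omega>) \<le> e" using \<delta>2 by linarith
  qed
qed

section \<open>Controlled paths and the step estimate along the solutions\<close>

definition cd :: real where "cd = 2 * C2 * \<Lambda> + 2 * \<Lambda> + \<Lambda>\<^sup>2"
definition C4 :: real where "C4 = \<Lambda>^3 * C2\<^sup>2 + \<Lambda>^3 * C2 + \<Lambda>\<^sup>2 + \<Lambda> + \<Lambda>\<^sup>2 * C2"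
text \<open>A sum of everything that the constant in \<open>one_step_estimate\<close> has to
  dominate: \<open>cd\<close> measures a reflection increment of X^n in units of the modulus,
  \<open>C4\<close> collects the remainders of one step, and the factor with
  \<open>3 * \<Lambda>\<^sup>2\<close> belongs to the pairing bound.\<close>

definition Cc :: real where
  "Cc = 1 + \<Lambda> + CB + 2 * \<Lambda> / \<alpha> * (cd + 1) + C4 + (1 + 3 * \<Lambda>\<^sup>2) * (2 * C2 * \<Lambda> + 1) + C2 * \<Lambda>"
text \<open>Keeps the oscillations of both paths over a step below \<open>\<Lambda>\<close>, as the
  pairing bound requires, and below \<open>\<alpha> / (2 * \<Lambda>)\<close>, which leaves half of
  \<open>\<alpha>\<close> in the lower bound for the reflection.\<close>

definition \<delta>0 :: real where "\<delta>0 = min 1 (min \<Lambda> (\<alpha> / (2 * \<Lambda>)) / (2 * C2 * \<Lambda> + 1))"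

lemma \<delta>0_pos: "\<delta>0 > 0"
  using \<Lambda> \<alpha> consts_nonneg by (auto simp: \<delta>0_def intro!: divide_pos_pos add_nonneg_pos)

text \<open>All almost sure and high-probability facts consumed by the step estimate. For a path
  with these properties that estimate is deterministic.\<close>

definition control :: "nat \<Rightarrow> nat \<Rightarrow> real \<Rightarrow> 'a \<Rightarrow> bool" where
  "control TT n \<delta> \<omega> \<longleftrightarrow> ode_path n \<omega> \<and> rpath (\<lambda>t. X t \<omega>) (\<lambda>t. L t \<omega>) \<and> 1 / 2 ^ n \<le> \<delta> \<and>
    (\<forall>s t. 0 \<le> s \<longrightarrow> s \<le> real TT \<longrightarrow> 0 \<le> t \<longrightarrow> t \<le> real TT \<longrightarrow> \<bar>s - t\<bar> \<le> 1 / 2^n \<longrightarrow> norm (X s \<omega> - X t \<omega>) \<le> \<delta>) \<and>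
    (\<forall>s t. 0 \<le> s \<longrightarrow> s \<le> real TT \<longrightarrow> 0 \<le> t \<longrightarrow> t \<le> real TT \<longrightarrow> \<bar>s - t\<bar> \<le> 1 / 2^n \<longrightarrow> norm (L s \<omega> - L t \<omega>) \<le> \<delta>) \<and>
    (\<forall>s t. 0 \<le> s \<longrightarrow> s \<le> real TT \<longrightarrow> 0 \<le> t \<longrightarrow> t \<le> real TT \<longrightarrow> \<bar>s - t\<bar> \<le> 1 / 2^n \<longrightarrow> norm (W s \<omega> - W t \<omega>) \<le> \<delta>) \<and>
    (\<forall>k\<le>TT * 2 ^ n. norm (vk n k \<omega> - xh n k \<omega>) \<le> \<delta>)"

lemma whp_control:
  assumes "\<delta> > 0" shows "whp (\<lambda>n \<omega>. control TT n \<delta> \<omega>)"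
proof -
  have "(\<lambda>n. 1 / 2 ^ n :: real) \<longlonglongrightarrow> 0" using LIMSEQ_power_zero[of "1/2::real"] by (simp add: power_one_over)
  then have "\<forall>\<^sub>F n in sequentially. 1 / 2 ^ n < \<delta>" using assms by (rule order_tendstoD)
  then have "\<forall>\<^sub>F n in sequentially. 1 / 2 ^ n \<le> \<delta>" by eventually_elim simp
  then show ?thesis
    unfolding control_def
    by (intro whp_conj whp_osc[OF assms] whp_xh_close[OF assms] whp_AE[OF AE_ode_path] whp_AE[OF AE_rpath] whp_eventually)
qed

lemma control_dW: "control TT n \<delta> \<omega> \<Longrightarrow> k < TT * 2 ^ n \<Longrightarrow> norm (dW n k \<omega>) \<le> \<delta>"
proof -
  assume c: "control TT n \<delta> \<omega>" and k: "k < TT * 2 ^ n"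
  have "real (Suc k) / 2 ^ n \<le> real TT" "real k / 2 ^ n \<le> real TT" using k by (intro grid_le; simp)+
  then show ?thesis unfolding dW_def using c grid_step(3)[of k n] unfolding control_def by (simp del: of_nat_Suc)
qed

lemma control_w': "control TT n \<delta> \<omega> \<Longrightarrow> k \<le> TT * 2 ^ n \<Longrightarrow> norm (w' n k \<omega>) \<le> \<delta>"
proof (cases k)
  case 0
  assume "control TT n \<delta> \<omega>"
  then have "0 \<le> \<delta>" unfolding control_def by (meson order_trans zero_le_divide_1_iff zero_le_numeral zero_le_power)
  then show ?thesis using 0 by (simp add: w'_def)
qed (use control_dW in \<open>auto simp: w'_def\<close>)

abbreviation "en n k \<omega> \<equiv> (norm (w' n k \<omega>))\<^sup>2 + (norm (dW n k \<omega>))\<^sup>2 + 1 / 2 ^ n + vln n k \<omega> + vlm n k \<omega>"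

definition Mart :: "nat \<Rightarrow> nat \<Rightarrow> 'a \<Rightarrow> real" where
  "Mart n k \<omega> = 2 * (z n k \<omega> \<bullet> (P n k \<omega> *v dW n k \<omega> + Q (yk n k \<omega>) (dW n k \<omega>) - ((1 / 2 ^ n) / 2) *\<^sub>R sigsig \<sigma> \<sigma>' (yk n k \<omega>)))
     + (norm (P n k \<omega> *v dW n k \<omega>))\<^sup>2 - (1 / 2 ^ n) * (norm (P n k \<omega>))\<^sup>2"

lemma Cc_facts: "1 \<le> Cc" "\<Lambda> \<le> Cc" "CB \<le> Cc" "2 * \<Lambda> / \<alpha> * (cd + 1) \<le> Cc" "C4 \<le> Cc" "(1 + 3 * \<Lambda>\<^sup>2) * (2 * C2 * \<Lambda> + 1) \<le> Cc" "C2 * \<Lambda> \<le> Cc"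
    "0 \<le> cd" "0 \<le> C4"
proof -
  have p: "0 \<le> \<Lambda>" "0 \<le> CB" "0 \<le> cd" "0 \<le> C4" "0 \<le> C2 * \<Lambda>" using \<Lambda> CB_pos consts_nonneg by (auto simp: cd_def C4_def)
  have "0 \<le> 2 * \<Lambda> / \<alpha> * (cd + 1)" "0 \<le> (1 + 3 * \<Lambda>\<^sup>2) * (2 * C2 * \<Lambda> + 1)"
    using p \<alpha> consts_nonneg by (auto intro!: mult_nonneg_nonneg add_nonneg_nonneg)
  then show "1 \<le> Cc" "\<Lambda> \<le> Cc" "CB \<le> Cc" "2 * \<Lambda> / \<alpha> * (cd + 1) \<le> Cc" "C4 \<le> Cc" "(1 + 3 * \<Lambda>\<^sup>2) * (2 * C2 * \<Lambda> + 1) \<le> Cc" "C2 * \<Lambda> \<le> Cc"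
    "0 \<le> cd" "0 \<le> C4" using p unfolding Cc_def by linarith+
qed

lemma step_estimate:
  obtains G where "0 \<le> G" "\<And>TT n \<delta> \<omega> k. control TT n \<delta> \<omega> \<Longrightarrow> \<delta> \<le> \<delta>0 \<Longrightarrow> k < TT * 2 ^ n \<Longrightarrow>
    exp (- (2 * Cc\<^sup>2 * (norm (dl n k \<omega>) + norm (dm n k \<omega>)) + 4 * Cc\<^sup>2 * (1 / 2 ^ n))) * (norm (z n (Suc k) \<omega>))\<^sup>2
      - (norm (z n k \<omega>))\<^sup>2 - Mart n k \<omega> \<le> G * (\<delta> * en n k \<omega>)"
proof -
  obtain G where G: "0 \<le> G"
    "\<And>y v y1 w0 w1 h xh dl dm ln lm \<theta> z z1 P.
      \<lbrakk>y \<in> closure D; v \<in> closure D; y1 \<in> closure D; \<theta> \<le> 1; norm w0 \<le> \<theta>; norm w1 \<le> \<theta>; 0 \<le> h; h \<le> \<theta>;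
       norm (v - xh) \<le> \<theta>; norm dl \<le> ln; norm dm \<le> lm; ln \<le> Cc * \<theta>; lm \<le> Cc * \<theta>;
       norm (y1 - Uhat y w0 - h *\<^sub>R b y - dl) \<le> Cc * ((norm w0 + h)^3 + h * (norm w0 + h) + (norm w0 + h) * ln);
       norm (y1 - y - \<sigma> y *v w0) \<le> Cc * ((norm w0 + h)\<^sup>2 + h + ln);
       norm (y1 - y) \<le> Cc * (norm w0 + h);
       (y - v) \<bullet> dl \<le> (Cc * (norm (y - v))\<^sup>2 + Cc * \<theta>) * ln;
       (v - y) \<bullet> dm \<le> (Cc * (norm (y - v))\<^sup>2 + Cc * \<theta>) * lm;
       ln / Cc - Cc * \<theta> * ln \<le> norm dl; lm / Cc - Cc * \<theta> * lm \<le> norm dm;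
       z = Uhat y w0 - xh; z1 = Uhat y1 w1 - (xh + \<sigma> v *v w1 + h *\<^sub>R B v + dm); P = Shat y w0 - \<sigma> v\<rbrakk> \<Longrightarrow>
      exp (- (2 * Cc\<^sup>2 * (norm dl + norm dm) + 4 * Cc\<^sup>2 * h)) * (norm z1)\<^sup>2 - (norm z)\<^sup>2
        - (2 * (z \<bullet> (P *v w1 + Q y w1 - (h / 2) *\<^sub>R sigsig \<sigma> \<sigma>' y)) + (norm (P *v w1))\<^sup>2 - h * (norm P)\<^sup>2)
      \<le> G * (\<theta> * ((norm w0)\<^sup>2 + (norm w1)\<^sup>2 + h + ln + lm))"
    by (rule one_step_estimate[OF Cc_facts(1-3)]) blast
  have "exp (- (2 * Cc\<^sup>2 * (norm (dl n k \<omega>) + norm (dm n k \<omega>)) + 4 * Cc\<^sup>2 * (1 / 2 ^ n))) * (norm (z n (Suc k) \<omega>))\<^sup>2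
      - (norm (z n k \<omega>))\<^sup>2 - Mart n k \<omega> \<le> G * (\<delta> * en n k \<omega>)"
    if c: "control TT n \<delta> \<omega>" and d0: "\<delta> \<le> \<delta>0" and k: "k < TT * 2 ^ n" for TT n \<delta> \<omega> k
  proof -
    define h :: real where "h = 1 / 2 ^ n"
    define \<kappa> where "\<kappa> = norm (w' n k \<omega>) + h"
    define o1 where "o1 = C2 * (\<Lambda> * \<kappa>)"
    have op: "ode_path n \<omega>" and rp: "rpath (\<lambda>t. X t \<omega>) (\<lambda>t. L t \<omega>)" and hd: "h \<le> \<delta>"
      and oscX: "\<And>s t. 0 \<le> s \<Longrightarrow> s \<le> real TT \<Longrightarrow> 0 \<le> t \<Longrightarrow> t \<le> real TT \<Longrightarrow> \<bar>s - t\<bar> \<le> 1 / 2^n \<Longrightarrow> norm (X s \<omega> - X t \<omega>) \<le> \<delta>"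
      and oscL: "\<And>s t. 0 \<le> s \<Longrightarrow> s \<le> real TT \<Longrightarrow> 0 \<le> t \<Longrightarrow> t \<le> real TT \<Longrightarrow> \<bar>s - t\<bar> \<le> 1 / 2^n \<Longrightarrow> norm (L s \<omega> - L t \<omega>) \<le> \<delta>"
      and xhd: "norm (vk n k \<omega> - xh n k \<omega>) \<le> \<delta>"
      using c k by (auto simp: control_def h_def)
    have h0: "0 < h" by (simp add: h_def)
    have dp: "0 < \<delta>" using h0 hd by linarith
    have rpn: "rpath (\<lambda>t. Xn n t \<omega>) (\<lambda>t. Ln n t \<omega>)" using op by (simp add: ode_path_def)
    have w0: "norm (w' n k \<omega>) \<le> \<delta>" using control_w'[OF c] k by simp
    have w1: "norm (dW n k \<omega>) \<le> \<delta>" by (rule control_dW[OF c k])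
    have \<kappa>: "0 \<le> \<kappa>" "\<kappa> \<le> 2 * \<delta>" "norm (w' n k \<omega>) \<le> \<kappa>" "h \<le> \<kappa>" using w0 hd h0 by (auto simp: \<kappa>_def)
    have qd: "(2 * C2 * \<Lambda> + 1) * \<delta> \<le> min \<Lambda> (\<alpha> / (2 * \<Lambda>))" "\<delta> \<le> 1"
    proof -
      have q: "2 * C2 * \<Lambda> + 1 > 0" using consts_nonneg \<Lambda> by (intro add_nonneg_pos) auto
      have "\<delta> \<le> min \<Lambda> (\<alpha> / (2 * \<Lambda>)) / (2 * C2 * \<Lambda> + 1)" "\<delta> \<le> 1" using d0 by (auto simp: \<delta>0_def)
      then show "(2 * C2 * \<Lambda> + 1) * \<delta> \<le> min \<Lambda> (\<alpha> / (2 * \<Lambda>))" "\<delta> \<le> 1" using q by (auto simp: pos_le_divide_eq mult.commute)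
    qed
    have o1: "0 \<le> o1" "o1 \<le> 2 * C2 * \<Lambda> * \<delta>"
    proof -
      show "0 \<le> o1" using consts_nonneg \<Lambda> \<kappa> by (simp add: o1_def)
      have "C2 * \<Lambda> * \<kappa> \<le> C2 * \<Lambda> * (2 * \<delta>)" using consts_nonneg \<Lambda> \<kappa> by (intro mult_left_mono) auto
      then show "o1 \<le> 2 * C2 * \<Lambda> * \<delta>" by (simp add: o1_def mult_ac)
    qed
    have qd2: "2 * C2 * \<Lambda> * \<delta> + \<delta> \<le> \<Lambda>" "2 * C2 * \<Lambda> * \<delta> + \<delta> \<le> \<alpha> / (2 * \<Lambda>)" using qd by (auto simp: algebra_simps)
    have nn: "0 \<le> 2 * C2 * \<Lambda> * \<delta>" using consts_nonneg \<Lambda> dp by simp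
    have oL: "o1 \<le> \<Lambda>" "\<delta> \<le> \<Lambda>" "o1 \<le> \<alpha> / (2 * \<Lambda>)" "\<delta> \<le> \<alpha> / (2 * \<Lambda>)" using o1 qd2 nn dp by linarith+
    have aL: "\<alpha> / 2 \<le> \<alpha> - \<Lambda> * q" if "q \<le> \<alpha> / (2 * \<Lambda>)" for q
    proof -
      have "\<Lambda> * q \<le> \<Lambda> * (\<alpha> / (2 * \<Lambda>))" using that \<Lambda> by (intro mult_left_mono) auto
      then show ?thesis using \<Lambda> by simp
    qed
    have tk: "0 \<le> real k / 2 ^ n" "real k / 2 ^ n \<le> real (Suc k) / 2 ^ n" "real (Suc k) / 2 ^ n \<le> real TT" "real k / 2 ^ n \<le> real TT"
      using k by (auto simp: divide_right_mono intro!: grid_le simp del: of_nat_Suc)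
    have oscn: "norm (Xn n r \<omega> - Xn n (real k / 2 ^ n) \<omega>) \<le> o1" if "real k / 2 ^ n \<le> r" "r \<le> real (Suc k) / 2 ^ n" for r
      using ode_osc[OF op that] by (simp add: o1_def \<kappa>_def h_def)
    have oscx: "norm (X r \<omega> - X (real k / 2 ^ n) \<omega>) \<le> \<delta>" if "real k / 2 ^ n \<le> r" "r \<le> real (Suc k) / 2 ^ n" for r
      by (rule oscX[OF order_trans[OF tk(1) that(1)] _ tk(1)]) (use that tk grid_step(3)[of k n] in \<open>auto simp del: of_nat_Suc\<close>)
    have dln: "norm (dl n k \<omega>) \<le> vln n k \<omega>" by (rule rpath_V[OF rpn tk(1,2)])
    have dmn: "norm (dm n k \<omega>) \<le> vlm n k \<omega>" by (rule rpath_V[OF rp tk(1,2)])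
    have ln0: "0 \<le> vln n k \<omega>" "0 \<le> vlm n k \<omega>" using dln dmn norm_ge_zero order_trans by blast+
    have dmd: "norm (dm n k \<omega>) \<le> \<delta>" using tk grid_step(3)[of k n] by (intro oscL) (auto simp del: of_nat_Suc)
    have lown: "(\<alpha> - \<Lambda> * o1) * vln n k \<omega> \<le> \<Lambda> * norm (dl n k \<omega>)" by (rule rpath_lower[OF rpn tk(1,2) oscn])
    have lowx: "(\<alpha> - \<Lambda> * \<delta>) * vlm n k \<omega> \<le> \<Lambda> * norm (dm n k \<omega>)" by (rule rpath_lower[OF rp tk(1,2) oscx])
    let ?r1 = "yk n (Suc k) \<omega> - yk n k \<omega> - dl n k \<omega> - \<sigma> (yk n k \<omega>) *v w' n k \<omega>"
    have first: "norm ?r1 \<le> \<Lambda> * o1 * norm (w' n k \<omega>) + \<Lambda> * h"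
      using ode_first[OF op, of k] by (simp add: o1_def \<kappa>_def h_def)
    have y1y: "norm (yk n (Suc k) \<omega> - yk n k \<omega>) \<le> o1" unfolding yk_eq[OF op] by (rule oscn[OF tk(2) order_refl])
    \<comment> \<open>A modulus of continuity for \<open>Ln\<close> uniform in \<open>n\<close> is
      not at hand. The size of the increment is read off the equation of the step instead, whose
      other terms are of order \<open>\<delta>\<close>; the variation then follows from the lower
      bound for the reflection.\<close>
    have dld: "norm (dl n k \<omega>) \<le> cd * \<delta>"
    proof -
      have "norm (dl n k \<omega>) = norm ((yk n (Suc k) \<omega> - yk n k \<omega>) - ?r1 - \<sigma> (yk n k \<omega>) *v w' n k \<omega>)" by simp
      then have "norm (dl n k \<omega>) \<le> norm (yk n (Suc k) \<omega> - yk n k \<omega>) + norm ?r1 + norm (\<sigma> (yk n k \<omega>) *v w' n k \<omega>)"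
        using norm_triangle_ineq4[of "(yk n (Suc k) \<omega> - yk n k \<omega>) - ?r1" "\<sigma> (yk n k \<omega>) *v w' n k \<omega>"]
          norm_triangle_ineq4[of "yk n (Suc k) \<omega> - yk n k \<omega>" ?r1] by linarith
      also have "\<dots> \<le> 2 * C2 * \<Lambda> * \<delta> + (\<Lambda> * \<Lambda> * \<delta> + \<Lambda> * \<delta>) + \<Lambda> * \<delta>"
      proof (intro add_mono)
        show "norm (yk n (Suc k) \<omega> - yk n k \<omega>) \<le> 2 * C2 * \<Lambda> * \<delta>" using y1y o1 by linarith
        have "\<Lambda> * o1 * norm (w' n k \<omega>) \<le> \<Lambda> * \<Lambda> * \<delta>" using oL o1 w0 \<Lambda> by (intro mult_mono mult_left_mono) auto
        moreover have "\<Lambda> * h \<le> \<Lambda> * \<delta>" using hd \<Lambda> by (intro mult_left_mono) auto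
        ultimately show "norm ?r1 \<le> \<Lambda> * \<Lambda> * \<delta> + \<Lambda> * \<delta>" using first by linarith
        show "norm (\<sigma> (yk n k \<omega>) *v w' n k \<omega>) \<le> \<Lambda> * \<delta>"
          using w0 \<Lambda> by (intro order_trans[OF sigma_mult_bound] mult_left_mono) auto
      qed
      finally show ?thesis by (simp add: cd_def power2_eq_square algebra_simps)
    qed
    have half: "v \<le> 2 * \<Lambda> / \<alpha> * n'" if "(\<alpha> - \<Lambda> * q) * v \<le> \<Lambda> * n'" "q \<le> \<alpha> / (2 * \<Lambda>)" "0 \<le> v" for q v n' :: real
    proof -
      have "\<alpha> / 2 * v \<le> (\<alpha> - \<Lambda> * q) * v" using aL[OF that(2)] that(3) by (rule mult_right_mono)
      then have "\<alpha> / 2 * v \<le> \<Lambda> * n'" using that(1) by linarith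
      then show ?thesis using \<alpha> by (simp add: field_simps)
    qed
    have La: "0 \<le> 2 * \<Lambda> / \<alpha>" using \<Lambda> \<alpha> by simp
    have lnb: "vln n k \<omega> \<le> Cc * \<delta>" "vlm n k \<omega> \<le> Cc * \<delta>"
    proof -
      have "vln n k \<omega> \<le> 2 * \<Lambda> / \<alpha> * norm (dl n k \<omega>)" by (rule half[OF lown oL(3) ln0(1)])
      also have "\<dots> \<le> 2 * \<Lambda> / \<alpha> * ((cd + 1) * \<delta>)" using dld dp La Cc_facts(8) by (intro mult_left_mono) (auto simp: algebra_simps)
      also have "\<dots> \<le> Cc * \<delta>" using Cc_facts(4) dp by (simp only: mult.assoc[symmetric]) (intro mult_right_mono, auto)
      finally show "vln n k \<omega> \<le> Cc * \<delta>" .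
      have "vlm n k \<omega> \<le> 2 * \<Lambda> / \<alpha> * norm (dm n k \<omega>)" by (rule half[OF lowx oL(4) ln0(2)])
      also have "\<dots> \<le> 2 * \<Lambda> / \<alpha> * ((cd + 1) * \<delta>)"
      proof (rule mult_left_mono[OF _ La])
        have "1 * \<delta> \<le> (cd + 1) * \<delta>" using Cc_facts(8) dp by (intro mult_right_mono) auto
        then show "norm (dm n k \<omega>) \<le> (cd + 1) * \<delta>" using dmd by linarith
      qed
      also have "\<dots> \<le> Cc * \<delta>" using Cc_facts(4) dp by (simp only: mult.assoc[symmetric]) (intro mult_right_mono, auto)
      finally show "vlm n k \<omega> \<le> Cc * \<delta>" .
    qed
    \<comment> \<open>Division by \<open>\<Lambda>\<close> turns
      \<open>\<alpha> - \<Lambda> * q\<close> into \<open>\<alpha> / \<Lambda> - q\<close>, and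
      \<open>Cc\<close> is large enough for \<open>1 / Cc\<close> to lie below
      \<open>\<alpha> / \<Lambda>\<close>.\<close>
    have low: "v / Cc - Cc * \<delta> * v \<le> n'" if "(\<alpha> - \<Lambda> * q) * v \<le> \<Lambda> * n'" "0 \<le> v" "q \<le> Cc * \<delta>" for q v n' :: real
    proof -
      have "(\<alpha> / \<Lambda> - q) * v \<le> n'"
      proof -
        have "\<Lambda> * ((\<alpha> / \<Lambda> - q) * v) = (\<alpha> - \<Lambda> * q) * v" using \<Lambda> by (simp add: field_simps)
        then have "\<Lambda> * ((\<alpha> / \<Lambda> - q) * v) \<le> \<Lambda> * n'" using that(1) by linarith
        then show ?thesis using \<Lambda> by simp
      qed
      moreover have "1 / Cc \<le> \<alpha> / \<Lambda>"
      proof -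
        have "\<Lambda> / \<alpha> \<le> 2 * \<Lambda> / \<alpha> * (cd + 1)"
        proof -
          have "2 * \<Lambda> / \<alpha> * 1 \<le> 2 * \<Lambda> / \<alpha> * (cd + 1)" using La Cc_facts(8) by (intro mult_left_mono) auto
          moreover have "\<Lambda> / \<alpha> \<le> 2 * \<Lambda> / \<alpha>" using \<Lambda> \<alpha> by (intro divide_right_mono) auto
          ultimately show ?thesis by linarith
        qed
        then have "\<Lambda> / \<alpha> \<le> Cc" using Cc_facts(4) by linarith
        then show ?thesis using \<alpha> \<Lambda> Cc_facts(1) by (simp add: field_simps)
      qed
      then have "(1 / Cc - Cc * \<delta>) * v \<le> (\<alpha> / \<Lambda> - q) * v" using that by (intro mult_right_mono) auto
      ultimately show ?thesis by (simp add: algebra_simps)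
    qed
    have c2: "2 * C2 * \<Lambda> + 1 \<le> Cc"
    proof -
      have "1 * (2 * C2 * \<Lambda> + 1) \<le> (1 + 3 * \<Lambda>\<^sup>2) * (2 * C2 * \<Lambda> + 1)"
        using consts_nonneg \<Lambda> by (intro mult_right_mono) auto
      from order_trans[OF this Cc_facts(6)] show ?thesis by simp
    qed
    have oC: "o1 \<le> Cc * \<delta>" "\<delta> \<le> Cc * \<delta>"
    proof -
      have "(2 * C2 * \<Lambda> + 1) * \<delta> \<le> Cc * \<delta>" using c2 dp by (intro mult_right_mono) auto
      moreover have "(2 * C2 * \<Lambda> + 1) * \<delta> = 2 * C2 * \<Lambda> * \<delta> + \<delta>" by (simp add: algebra_simps)
      ultimately show "o1 \<le> Cc * \<delta>" "\<delta> \<le> Cc * \<delta>" using o1 nn dp by linarith+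
    qed
    have oC3: "(1 + 3 * \<Lambda>\<^sup>2) * q \<le> Cc * \<delta>" if "q \<le> (2 * C2 * \<Lambda> + 1) * \<delta>" for q
    proof -
      have "(1 + 3 * \<Lambda>\<^sup>2) * q \<le> (1 + 3 * \<Lambda>\<^sup>2) * ((2 * C2 * \<Lambda> + 1) * \<delta>)" using that by (intro mult_left_mono) auto
      also have "\<dots> \<le> Cc * \<delta>" using Cc_facts(6) dp by (simp only: mult.assoc[symmetric]) (intro mult_right_mono, auto)
      finally show ?thesis .
    qed
    have pair: "(\<Lambda> * s + (1 + 3 * \<Lambda>\<^sup>2) * q) * v \<le> (Cc * s + Cc * \<delta>) * v" if "0 \<le> s" "q \<le> (2 * C2 * \<Lambda> + 1) * \<delta>" "0 \<le> v" for s q v :: real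
      using that oC3[OF that(2)] Cc_facts(2) by (intro mult_right_mono add_mono) auto
    have o1q: "o1 \<le> (2 * C2 * \<Lambda> + 1) * \<delta>" "\<delta> \<le> (2 * C2 * \<Lambda> + 1) * \<delta>" using o1 nn dp by (auto simp: algebra_simps)
    have rl: "(yk n k \<omega> - vk n k \<omega>) \<bullet> dl n k \<omega> \<le> (Cc * (norm (yk n k \<omega> - vk n k \<omega>))\<^sup>2 + Cc * \<delta>) * vln n k \<omega>"
    proof -
      have "(Xn n (real k / 2 ^ n) \<omega> - vk n k \<omega>) \<bullet> dl n k \<omega> \<le> (\<Lambda> * (norm (Xn n (real k / 2 ^ n) \<omega> - vk n k \<omega>))\<^sup>2 + (1 + 3 * \<Lambda>\<^sup>2) * o1) * vln n k \<omega>"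
        by (rule rpath_pair[OF rpn tk(1,2) oscn oL(1)]) auto
      also have "\<dots> \<le> (Cc * (norm (Xn n (real k / 2 ^ n) \<omega> - vk n k \<omega>))\<^sup>2 + Cc * \<delta>) * vln n k \<omega>"
        by (rule pair[OF _ o1q(1) ln0(1)]) simp
      finally show ?thesis unfolding yk_eq[OF op] .
    qed
    have rm: "(vk n k \<omega> - yk n k \<omega>) \<bullet> dm n k \<omega> \<le> (Cc * (norm (yk n k \<omega> - vk n k \<omega>))\<^sup>2 + Cc * \<delta>) * vlm n k \<omega>"
    proof -
      have "(X (real k / 2 ^ n) \<omega> - yk n k \<omega>) \<bullet> dm n k \<omega> \<le> (\<Lambda> * (norm (X (real k / 2 ^ n) \<omega> - yk n k \<omega>))\<^sup>2 + (1 + 3 * \<Lambda>\<^sup>2) * \<delta>) * vlm n k \<omega>"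
        by (rule rpath_pair[OF rp tk(1,2) oscx oL(2)]) auto
      also have "\<dots> \<le> (Cc * (norm (X (real k / 2 ^ n) \<omega> - yk n k \<omega>))\<^sup>2 + Cc * \<delta>) * vlm n k \<omega>"
        by (rule pair[OF _ o1q(2) ln0(2)]) simp
      finally show ?thesis unfolding vk_eq[OF rp] by (simp add: norm_minus_commute)
    qed
    have e1: "norm (yk n (Suc k) \<omega> - Uhat (yk n k \<omega>) (w' n k \<omega>) - h *\<^sub>R b (yk n k \<omega>) - dl n k \<omega>) \<le> Cc * (\<kappa>^3 + h * \<kappa> + \<kappa> * vln n k \<omega>)"
    proof -
      have "norm (yk n (Suc k) \<omega> - Uhat (yk n k \<omega>) (w' n k \<omega>) - h *\<^sub>R b (yk n k \<omega>) - dl n k \<omega>) \<le>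
        (\<Lambda> * o1\<^sup>2 + \<Lambda> * (\<Lambda> * o1 * norm (w' n k \<omega>) + \<Lambda> * h + vln n k \<omega>)) * norm (w' n k \<omega>) + \<Lambda> * o1 * h"
        using ode_second[OF op, of k] by (simp add: o1_def \<kappa>_def h_def)
      also have "\<dots> \<le> (\<Lambda> * o1\<^sup>2 + \<Lambda> * (\<Lambda> * o1 * \<kappa> + \<Lambda> * h + vln n k \<omega>)) * \<kappa> + \<Lambda> * o1 * h"
        using \<Lambda> o1 \<kappa> h0 ln0 by (intro add_mono mult_mono mult_left_mono order_refl add_nonneg_nonneg mult_nonneg_nonneg) auto
      also have "\<dots> = (\<Lambda>^3 * C2\<^sup>2 + \<Lambda>^3 * C2) * \<kappa>^3 + (\<Lambda>\<^sup>2 + \<Lambda>\<^sup>2 * C2) * (h * \<kappa>) + \<Lambda> * (\<kappa> * vln n k \<omega>)"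
        by (simp add: o1_def power2_eq_square power3_eq_cube algebra_simps)
      also have "\<dots> \<le> C4 * \<kappa>^3 + C4 * (h * \<kappa>) + C4 * (\<kappa> * vln n k \<omega>)"
        using \<Lambda> \<kappa> h0 ln0 consts_nonneg by (intro add_mono mult_right_mono) (auto simp: C4_def)
      also have "\<dots> = C4 * (\<kappa>^3 + h * \<kappa> + \<kappa> * vln n k \<omega>)" by (simp add: algebra_simps)
      also have "\<dots> \<le> Cc * (\<kappa>^3 + h * \<kappa> + \<kappa> * vln n k \<omega>)"
        using Cc_facts(5) \<kappa> h0 ln0 by (intro mult_right_mono) auto
      finally show ?thesis .
    qed
    have e2: "norm (yk n (Suc k) \<omega> - yk n k \<omega> - \<sigma> (yk n k \<omega>) *v w' n k \<omega>) \<le> Cc * (\<kappa>\<^sup>2 + h + vln n k \<omega>)"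
    proof -
      have "yk n (Suc k) \<omega> - yk n k \<omega> - \<sigma> (yk n k \<omega>) *v w' n k \<omega> = ?r1 + dl n k \<omega>" by simp
      then have "norm (yk n (Suc k) \<omega> - yk n k \<omega> - \<sigma> (yk n k \<omega>) *v w' n k \<omega>) \<le> norm ?r1 + norm (dl n k \<omega>)"
        using norm_triangle_ineq by metis
      also have "\<dots> \<le> \<Lambda> * o1 * \<kappa> + \<Lambda> * h + vln n k \<omega>"
      proof -
        have "\<Lambda> * o1 * norm (w' n k \<omega>) \<le> \<Lambda> * o1 * \<kappa>" using \<Lambda> o1 \<kappa> by (intro mult_left_mono) auto
        then show ?thesis using first dln by linarith
      qed
      also have "\<dots> = (\<Lambda>\<^sup>2 * C2) * \<kappa>\<^sup>2 + \<Lambda> * h + 1 * vln n k \<omega>" by (simp add: o1_def power2_eq_square)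
      also have "\<dots> \<le> Cc * \<kappa>\<^sup>2 + Cc * h + Cc * vln n k \<omega>"
      proof (intro add_mono mult_right_mono)
        have "\<Lambda>\<^sup>2 * C2 \<le> C4" using \<Lambda> consts_nonneg by (simp add: C4_def)
        then show "\<Lambda>\<^sup>2 * C2 \<le> Cc" using Cc_facts(5) by linarith
      qed (use Cc_facts h0 ln0 in auto)
      finally show ?thesis by (simp add: algebra_simps)
    qed
    have e3: "norm (yk n (Suc k) \<omega> - yk n k \<omega>) \<le> Cc * \<kappa>"
    proof -
      have "o1 = (C2 * \<Lambda>) * \<kappa>" by (simp add: o1_def)
      also have "\<dots> \<le> Cc * \<kappa>" using Cc_facts(7) \<kappa> by (intro mult_right_mono) auto
      finally show ?thesis using y1y by linarith
    qed
    have z1: "z n (Suc k) \<omega> = Uhat (yk n (Suc k) \<omega>) (dW n k \<omega>) - (xh n k \<omega> + \<sigma> (vk n k \<omega>) *v dW n k \<omega> + h *\<^sub>R B (vk n k \<omega>) + dm n k \<omega>)"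
      by (simp only: z_def xh_Suc w'_Suc h_def)
    note low1 = low[OF lown ln0(1) oC(1)] and low2 = low[OF lowx ln0(2) oC(2)]
    have "exp (- (2 * Cc\<^sup>2 * (norm (dl n k \<omega>) + norm (dm n k \<omega>)) + 4 * Cc\<^sup>2 * h)) * (norm (z n (Suc k) \<omega>))\<^sup>2
      - (norm (z n k \<omega>))\<^sup>2
      - (2 * (z n k \<omega> \<bullet> (P n k \<omega> *v dW n k \<omega> + Q (yk n k \<omega>) (dW n k \<omega>) - (h / 2) *\<^sub>R sigsig \<sigma> \<sigma>' (yk n k \<omega>)))
         + (norm (P n k \<omega> *v dW n k \<omega>))\<^sup>2 - h * (norm (P n k \<omega>))\<^sup>2)
      \<le> G * (\<delta> * ((norm (w' n k \<omega>))\<^sup>2 + (norm (dW n k \<omega>))\<^sup>2 + h + vln n k \<omega> + vlm n k \<omega>))"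
      by (rule G(2)[OF yk_closure vk_closure yk_closure qd(2) w0 w1 less_imp_le[OF h0] hd xhd dln dmn lnb
            e1[unfolded \<kappa>_def] e2[unfolded \<kappa>_def] e3[unfolded \<kappa>_def] rl rm low1 low2 z_def z1 P_def])
    then show ?thesis by (simp add: Mart_def h_def)
  qed
  then show ?thesis using that[OF G(1)] by blast
qed

section \<open>The weighted distance and its dominating martingale\<close>

definition Rz :: real where "Rz = 2 * \<Lambda> + \<Lambda>\<^sup>2 + 1"

definition wt :: "nat \<Rightarrow> nat \<Rightarrow> 'a \<Rightarrow> real" where
  "wt n k \<omega> = exp (- (2 * Cc\<^sup>2 * (\<Sum>j<k. norm (dl n j \<omega>) + norm (dm n j \<omega>)) + 4 * Cc\<^sup>2 * (real k / 2 ^ n)))"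

definition H :: "nat \<Rightarrow> nat \<Rightarrow> 'a \<Rightarrow> real" where
  "H n k \<omega> = wt n k \<omega> * (norm (z n k \<omega>))\<^sup>2"

text \<open>A cutoff known at the left end of the step that keeps the coefficients of the martingale
  increment bounded. \<open>Rz\<close> is the diameter bound plus the gap between \<open>z\<close>
  and \<open>y - v\<close>, so the cutoff is inactive on controlled paths.\<close>

definition ind :: "nat \<Rightarrow> nat \<Rightarrow> 'a \<Rightarrow> real" where
  "ind n k \<omega> = (if norm (w' n k \<omega>) \<le> 1 \<and> norm (z n k \<omega>) \<le> Rz then 1 else 0)"

definition m :: "nat \<Rightarrow> nat \<Rightarrow> 'a \<Rightarrow> real" where
  "m n k \<omega> = wt n k \<omega> * ind n k \<omega> * Mart n k \<omega>"

text \<open>Summing positive parts makes the domination of \<open>H\<close> by \<open>Err\<close>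
  plus the martingale hold on every path and makes \<open>Err\<close> nondecreasing in
  \<open>k\<close>, as the stopping argument requires. Only the smallness of \<open>Err\<close> is a
  statement about controlled paths.\<close>

definition Err :: "nat \<Rightarrow> nat \<Rightarrow> 'a \<Rightarrow> real" where
  "Err n k \<omega> = H n 0 \<omega> + (\<Sum>j<k. max 0 (H n (Suc j) \<omega> - H n j \<omega> - m n j \<omega>))"

definition um :: "nat \<Rightarrow> nat \<Rightarrow> 'm \<Rightarrow> 'a \<Rightarrow> real" where
  "um n k i \<omega> = wt n k \<omega> * ind n k \<omega> * (2 * (z n k \<omega> \<bullet> (P n k \<omega> *v axis i 1)))"

definition Am :: "nat \<Rightarrow> nat \<Rightarrow> 'm \<Rightarrow> 'm \<Rightarrow> 'a \<Rightarrow> real" where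
  "Am n k i j \<omega> = wt n k \<omega> * ind n k \<omega> *
     (z n k \<omega> \<bullet> ((\<sigma>' (yk n k \<omega>) (\<sigma> (yk n k \<omega>) *v axis i 1)) *v axis j 1) + (P n k \<omega> *v axis i 1) \<bullet> (P n k \<omega> *v axis j 1))"

lemma m_eq: "m n k \<omega> = (\<Sum>i\<in>UNIV. um n k i \<omega> * dW n k \<omega> $ i) +
    (\<Sum>i\<in>UNIV. \<Sum>j\<in>UNIV. Am n k i j \<omega> * (dW n k \<omega> $ i * dW n k \<omega> $ j - (if i = j then 1 / 2 ^ n else 0)))"
  unfolding m_def Mart_def quadratic_form_expansion[OF yk_closure] um_def Am_def
  by (subst distrib_left) (simp add: sum_distrib_left mult.assoc)

context
  fixes n k :: nat
begin

abbreviation (input) "FF \<equiv> F (real k / 2 ^ n)"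

lemma xh_measurable_F: "xh n k \<in> borel_measurable FF"
proof -
  have s: "(\<lambda>\<omega>. \<sigma> (vk n j \<omega>)) \<in> borel_measurable FF" "(\<lambda>\<omega>. B (vk n j \<omega>)) \<in> borel_measurable FF" "dW n j \<in> borel_measurable FF" if j: "j < k" for j
  proof -
    have le: "real j / 2 ^ n \<le> real k / 2 ^ n" using j by (intro grid_step(4)) simp
    show "(\<lambda>\<omega>. \<sigma> (vk n j \<omega>)) \<in> borel_measurable FF" by (rule measurable_F_mono[OF sigma_vk_measurable_F le])
    show "(\<lambda>\<omega>. B (vk n j \<omega>)) \<in> borel_measurable FF"
      unfolding vk_def by (rule B_measurable[OF measurable_F_mono[OF XL_measurable_F(1) le] borel_measurable_const[of 0]])
    show "dW n j \<in> borel_measurable FF" by (rule dW_measurable_F'[OF j])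
  qed
  show ?thesis unfolding xh_def[abs_def] S_def
    by (intro borel_measurable_add borel_measurable_scaleR borel_measurable_const borel_measurable_sum
        matrix_vector_mult_measurable s XL_measurable_F) auto
qed

lemma z_measurable_F: "z n k \<in> borel_measurable FF"
  unfolding z_def[abs_def] yk_def
  by (intro borel_measurable_diff xh_measurable_F Uhat_measurable XL_measurable_F w'_measurable_F)

lemma P_measurable_F: "P n k \<in> borel_measurable FF"
  unfolding P_def[abs_def] yk_def
  by (intro borel_measurable_diff sigma_vk_measurable_F Shat_measurable XL_measurable_F w'_measurable_F)

lemma wt_measurable_F: "wt n k \<in> borel_measurable FF"
proof -
  have s: "L (real j / 2 ^ n) \<in> borel_measurable FF" "Ln n (real j / 2 ^ n) \<in> borel_measurable FF" if "j \<le> k" for j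
    by (rule measurable_F_mono[OF XL_measurable_F(2)] measurable_F_mono[OF XL_measurable_F(4)], rule grid_step(4)[OF that])+
  have "(\<lambda>\<omega>. \<Sum>j<k. norm (dl n j \<omega>) + norm (dm n j \<omega>)) \<in> borel_measurable FF"
    by (intro borel_measurable_sum borel_measurable_add measurable_compose[OF _ borel_measurable_norm] borel_measurable_diff s) (auto simp del: of_nat_Suc)
  then show ?thesis unfolding wt_def[abs_def] by measurable
qed

lemma H_measurable_F: "H n k \<in> borel_measurable FF"
  unfolding H_def[abs_def] using wt_measurable_F z_measurable_F by measurable

lemma ind_measurable_F: "ind n k \<in> borel_measurable FF"
  unfolding ind_def[abs_def] using w'_measurable_F[of n k] z_measurable_F by measurable

lemma um_measurable_F: "um n k i \<in> borel_measurable FF"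
  unfolding um_def[abs_def]
  by (intro borel_measurable_times borel_measurable_inner borel_measurable_const wt_measurable_F ind_measurable_F z_measurable_F
      matrix_vector_mult_measurable P_measurable_F)

lemma Am_measurable_F: "Am n k i j \<in> borel_measurable FF"
proof -
  have s: "(\<lambda>\<omega>. \<sigma> (yk n k \<omega>)) \<in> borel_measurable FF"
    unfolding yk_def by (rule sigma_measurable[OF XL_measurable_F(3) borel_measurable_const[of 0]])
  have "(\<lambda>\<omega>. \<sigma>' (yk n k \<omega>) (\<sigma> (yk n k \<omega>) *v axis i 1)) \<in> borel_measurable FF"
    using matrix_vector_mult_measurable[OF s borel_measurable_const[of "axis i 1"]] unfolding yk_def
    by (rule sigma'_measurable[OF XL_measurable_F(3) borel_measurable_const[of 0]])
  then show ?thesis unfolding Am_def[abs_def]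
    by (intro borel_measurable_times borel_measurable_add borel_measurable_inner borel_measurable_const wt_measurable_F ind_measurable_F
        z_measurable_F matrix_vector_mult_measurable P_measurable_F)
qed

lemma wt_bounds: "0 < wt n k \<omega>" "wt n k \<omega> \<le> 1"
proof -
  show "0 < wt n k \<omega>" by (simp add: wt_def)
  have "0 \<le> 2 * Cc\<^sup>2 * (\<Sum>j<k. norm (dl n j \<omega>) + norm (dm n j \<omega>)) + 4 * Cc\<^sup>2 * (real k / 2 ^ n)"
    by (intro add_nonneg_nonneg mult_nonneg_nonneg sum_nonneg) auto
  then show "wt n k \<omega> \<le> 1" by (simp add: wt_def)
qed

definition kP :: real where "kP = 2 * \<Lambda> + \<Lambda>\<^sup>2"
definition Cu :: real where "Cu = 2 * (Rz * kP) + Rz * \<Lambda>\<^sup>2 + kP * kP"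

lemma Cu_nonneg: "0 \<le> Cu" "0 \<le> Rz" "0 \<le> kP" using \<Lambda> by (auto simp: Cu_def Rz_def kP_def)

lemma coefficient_bounds: "\<bar>um n k i \<omega>\<bar> \<le> Cu" "\<bar>Am n k i j \<omega>\<bar> \<le> Cu"
proof -
  have "\<bar>um n k i \<omega>\<bar> \<le> Cu \<and> \<bar>Am n k i j \<omega>\<bar> \<le> Cu"
  proof (cases "norm (w' n k \<omega>) \<le> 1 \<and> norm (z n k \<omega>) \<le> Rz")
    case False
    then have "ind n k \<omega> = 0" by (auto simp: ind_def)
    then show ?thesis using Cu_nonneg by (simp add: um_def Am_def)
  next
    case True
    then have i1: "ind n k \<omega> = 1" by (simp add: ind_def)
    let ?y = "yk n k \<omega>"
    have "norm (\<sigma>' ?y (\<sigma> ?y *v w' n k \<omega>)) \<le> \<Lambda> * (\<Lambda> * 1)"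
      using \<Lambda> True by (intro order_trans[OF sigma'_bound] mult_left_mono order_trans[OF sigma_mult_bound]) auto
    moreover have "P n k \<omega> = \<sigma> ?y + \<sigma>' ?y (\<sigma> ?y *v w' n k \<omega>) - \<sigma> (vk n k \<omega>)" by (simp add: P_def Shat_def)
    moreover have "norm (\<sigma> ?y + \<sigma>' ?y (\<sigma> ?y *v w' n k \<omega>) - \<sigma> (vk n k \<omega>)) \<le> norm (\<sigma> ?y) + norm (\<sigma>' ?y (\<sigma> ?y *v w' n k \<omega>)) + norm (\<sigma> (vk n k \<omega>))"
      by (rule order_trans[OF norm_triangle_ineq4 add_right_mono[OF norm_triangle_ineq]])
    ultimately have Pn: "norm (P n k \<omega>) \<le> kP"
      using sigma_bound[of ?y] sigma_bound[of "vk n k \<omega>"] by (simp add: kP_def power2_eq_square)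
    have Pe: "norm (P n k \<omega> *v axis i 1) \<le> kP" for i
      using norm_matrix_vector_le[of "P n k \<omega>" "axis i 1"] Pn by simp
    have Te: "norm ((\<sigma>' ?y (\<sigma> ?y *v axis i 1)) *v axis j 1) \<le> \<Lambda>\<^sup>2"
    proof -
      have "norm ((\<sigma>' ?y (\<sigma> ?y *v axis i 1)) *v axis j (1::real)) \<le> norm (\<sigma>' ?y (\<sigma> ?y *v axis i 1))"
        using norm_matrix_vector_le[of "\<sigma>' ?y (\<sigma> ?y *v axis i 1)" "axis j 1"] by simp
      also have "\<dots> \<le> \<Lambda> * (\<Lambda> * norm (axis i (1::real) :: real^'m))"
        using \<Lambda> by (intro order_trans[OF sigma'_bound] mult_left_mono sigma_mult_bound) auto
      finally show ?thesis by (simp add: power2_eq_square)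
    qed
    have 1: "\<bar>z n k \<omega> \<bullet> (P n k \<omega> *v axis i 1)\<bar> \<le> Rz * kP"
      using True Pe Cu_nonneg by (intro order_trans[OF Cauchy_Schwarz_ineq2] mult_mono) auto
    have 2: "\<bar>z n k \<omega> \<bullet> ((\<sigma>' ?y (\<sigma> ?y *v axis i 1)) *v axis j 1)\<bar> \<le> Rz * \<Lambda>\<^sup>2"
      using True Te Cu_nonneg by (intro order_trans[OF Cauchy_Schwarz_ineq2] mult_mono) auto
    have 3: "\<bar>(P n k \<omega> *v axis i 1) \<bullet> (P n k \<omega> *v axis j 1)\<bar> \<le> kP * kP"
      using Pe Cu_nonneg by (intro order_trans[OF Cauchy_Schwarz_ineq2] mult_mono) auto
    have wle: "\<bar>wt n k \<omega> * a\<bar> \<le> Cu" if "\<bar>a\<bar> \<le> Cu" for a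
    proof -
      have "\<bar>wt n k \<omega> * a\<bar> \<le> 1 * Cu" unfolding abs_mult using wt_bounds[of \<omega>] that by (intro mult_mono) auto
      then show ?thesis by simp
    qed
    have p: "0 \<le> Rz * kP" "0 \<le> Rz * \<Lambda>\<^sup>2" "0 \<le> kP * kP" using Cu_nonneg by auto
    have "\<bar>2 * (z n k \<omega> \<bullet> (P n k \<omega> *v axis i 1))\<bar> \<le> Cu" using 1 p unfolding Cu_def by linarith
    moreover have "\<bar>z n k \<omega> \<bullet> ((\<sigma>' ?y (\<sigma> ?y *v axis i 1)) *v axis j 1) + (P n k \<omega> *v axis i 1) \<bullet> (P n k \<omega> *v axis j 1)\<bar> \<le> Cu"
      using 2 3 p unfolding Cu_def by linarith
    ultimately show ?thesis using wle by (simp add: um_def Am_def i1)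
  qed
  then show "\<bar>um n k i \<omega>\<bar> \<le> Cu" "\<bar>Am n k i j \<omega>\<bar> \<le> Cu" by auto
qed

lemma m_measurable_F: "m n k \<in> borel_measurable (F (real (Suc k) / 2 ^ n))"
proof -
  have le: "real k / 2 ^ n \<le> real (Suc k) / 2 ^ n" by (intro grid_step(4)) simp
  have d: "(\<lambda>\<omega>. dW n k \<omega> $ i) \<in> borel_measurable (F (real (Suc k) / 2 ^ n))" for i
    by (rule measurable_compose[OF dW_measurable_F vec_nth_borel])
  show ?thesis unfolding m_eq[abs_def]
    by (intro borel_measurable_add borel_measurable_sum borel_measurable_times borel_measurable_diff borel_measurable_const d
        measurable_F_mono[OF um_measurable_F le] measurable_F_mono[OF Am_measurable_F le])
qed

lemma m_mean_zero:
  assumes A: "A \<in> sets FF"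
  shows "integrable M (\<lambda>\<omega>. indicator A \<omega> * m n k \<omega>)" "expectation (\<lambda>\<omega>. indicator A \<omega> * m n k \<omega>) = 0"
proof -
  have iA: "indicator A \<in> borel_measurable FF" using A by simp
  have u: "(\<lambda>\<omega>. indicator A \<omega> * um n k i \<omega>) \<in> borel_measurable FF" "\<bar>indicator A \<omega> * um n k i \<omega>\<bar> \<le> Cu" for i \<omega>
    using iA um_measurable_F coefficient_bounds(1)[of i \<omega>] Cu_nonneg by (auto split: split_indicator intro!: borel_measurable_times)
  have a: "(\<lambda>\<omega>. indicator A \<omega> * Am n k i j \<omega>) \<in> borel_measurable FF" "\<bar>indicator A \<omega> * Am n k i j \<omega>\<bar> \<le> Cu" for i j \<omega>
    using iA Am_measurable_F coefficient_bounds(2)[of i j \<omega>] Cu_nonneg by (auto split: split_indicator intro!: borel_measurable_times)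
  have eq: "(\<lambda>\<omega>. indicator A \<omega> * m n k \<omega>) = (\<lambda>\<omega>. (\<Sum>i\<in>UNIV. (indicator A \<omega> * um n k i \<omega>) * (W (real (Suc k) / 2 ^ n) \<omega> - W (real k / 2 ^ n) \<omega>) $ i) +
    (\<Sum>i\<in>UNIV. \<Sum>j\<in>UNIV. (indicator A \<omega> * Am n k i j \<omega>) * ((W (real (Suc k) / 2 ^ n) \<omega> - W (real k / 2 ^ n) \<omega>) $ i *
       (W (real (Suc k) / 2 ^ n) \<omega> - W (real k / 2 ^ n) \<omega>) $ j - (if i = j then real (Suc k) / 2 ^ n - real k / 2 ^ n else 0))))"
    unfolding m_eq grid_step(3) dW_def[symmetric] by (simp add: distrib_left sum_distrib_left mult.assoc)
  show "integrable M (\<lambda>\<omega>. indicator A \<omega> * m n k \<omega>)" unfolding eq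
    by (rule integrable_quadratic_increment[OF grid_step(1,2) u(1) u(2) a(1) a(2)])
  show "expectation (\<lambda>\<omega>. indicator A \<omega> * m n k \<omega>) = 0" unfolding eq
    by (rule expectation_quadratic_increment[OF grid_step(1,2) u(1) u(2) a(1) a(2)])
qed

lemma m_integrable: "integrable M (m n k)"
proof -
  have "integrable M (\<lambda>\<omega>. indicator (space FF) \<omega> * m n k \<omega>)" by (rule m_mean_zero(1), rule sets.top)
  then show ?thesis by (rule Bochner_Integration.integrable_cong[THEN iffD1, rotated -1]) auto
qed

definition Cm :: real where "Cm = (real CARD('m))\<^sup>2 * Cu"

lemma Cm_nonneg: "0 \<le> Cm" using Cu_nonneg by (simp add: Cm_def)

lemma m_bound: "\<bar>m n k \<omega>\<bar> \<le> Cm * (norm (dW n k \<omega>) + (norm (dW n k \<omega>))\<^sup>2 + 1 / 2 ^ n)"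
proof -
  let ?w = "dW n k \<omega>"
  let ?c = "real CARD('m)"
  have c1: "?c \<le> ?c\<^sup>2" by (simp add: power2_eq_square Suc_leI)
  have "\<bar>\<Sum>i\<in>UNIV. um n k i \<omega> * ?w $ i\<bar> \<le> (\<Sum>i\<in>(UNIV::'m set). Cu * norm ?w)"
    by (rule order_trans[OF sum_abs sum_mono]) (auto simp: abs_mult intro!: mult_mono coefficient_bounds component_le_norm_cart Cu_nonneg)
  then have 1: "\<bar>\<Sum>i\<in>UNIV. um n k i \<omega> * ?w $ i\<bar> \<le> ?c * (Cu * norm ?w)" by simp
  have 2: "\<bar>\<Sum>i\<in>UNIV. \<Sum>j\<in>UNIV. Am n k i j \<omega> * (?w $ i * ?w $ j - (if i = j then 1 / 2 ^ n else 0))\<bar> \<le> ?c * (?c * (Cu * ((norm ?w)\<^sup>2 + 1 / 2 ^ n)))"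
  proof -
    have t: "\<bar>Am n k i j \<omega> * (?w $ i * ?w $ j - (if i = j then 1 / 2 ^ n else 0))\<bar> \<le> Cu * ((norm ?w)\<^sup>2 + 1 / 2 ^ n)" for i j
    proof -
      have "\<bar>?w $ i * ?w $ j\<bar> \<le> norm ?w * norm ?w" unfolding abs_mult by (intro mult_mono component_le_norm_cart) auto
      moreover have "\<bar>if i = j then 1 / 2 ^ n else (0::real)\<bar> \<le> 1 / 2 ^ n" by simp
      moreover have "\<bar>a - c\<bar> \<le> A + C" if "\<bar>a\<bar> \<le> A" "\<bar>c\<bar> \<le> C" for a c A C :: real using that by linarith
      ultimately have "\<bar>?w $ i * ?w $ j - (if i = j then 1 / 2 ^ n else 0)\<bar> \<le> (norm ?w)\<^sup>2 + 1 / 2 ^ n"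
        unfolding power2_eq_square by blast
      then show ?thesis unfolding abs_mult using coefficient_bounds Cu_nonneg by (intro mult_mono) auto
    qed
    have "\<bar>\<Sum>i\<in>UNIV. \<Sum>j\<in>UNIV. Am n k i j \<omega> * (?w $ i * ?w $ j - (if i = j then 1 / 2 ^ n else 0))\<bar>
      \<le> (\<Sum>i\<in>(UNIV::'m set). \<Sum>j\<in>(UNIV::'m set). Cu * ((norm ?w)\<^sup>2 + 1 / 2 ^ n))"
      by (rule order_trans[OF sum_abs sum_mono], rule order_trans[OF sum_abs sum_mono], rule t)
    then show ?thesis by simp
  qed
  have "?c * (Cu * norm ?w) \<le> ?c\<^sup>2 * (Cu * norm ?w)" using c1 Cu_nonneg by (intro mult_right_mono) auto
  then have "\<bar>m n k \<omega>\<bar> \<le> ?c\<^sup>2 * (Cu * norm ?w) + ?c * (?c * (Cu * ((norm ?w)\<^sup>2 + 1 / 2 ^ n)))"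
    unfolding m_eq using 1 2 by linarith
  then show ?thesis by (simp add: Cm_def power2_eq_square algebra_simps)
qed

end

lemma Err_measurable_F: "Err n k \<in> borel_measurable (F (real k / 2 ^ n))"
proof -
  have "H n j \<in> borel_measurable (F (real k / 2 ^ n))" if "j \<le> k" for j
    by (rule measurable_F_mono[OF H_measurable_F grid_step(4)[OF that]])
  moreover have "m n j \<in> borel_measurable (F (real k / 2 ^ n))" if "j < k" for j
    by (rule measurable_F_mono[OF m_measurable_F grid_step(4)]) (use that in simp)
  ultimately show ?thesis unfolding Err_def[abs_def]
    by (intro borel_measurable_add borel_measurable_sum borel_measurable_max borel_measurable_diff borel_measurable_const) auto
qed

lemma H_le_Err: "H n k \<omega> \<le> Err n k \<omega> + (\<Sum>j<k. m n j \<omega>)"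
proof -
  have "H n k \<omega> - H n 0 \<omega> = (\<Sum>j<k. H n (Suc j) \<omega> - H n j \<omega>)" by (rule sum_lessThan_telescope[symmetric])
  also have "\<dots> \<le> (\<Sum>j<k. max 0 (H n (Suc j) \<omega> - H n j \<omega> - m n j \<omega>) + m n j \<omega>)"
    by (rule sum_mono) (simp add: max_def)
  finally show ?thesis by (simp add: Err_def sum.distrib)
qed

text \<open>A bound for the largest martingale step that is a sum rather than a maximum. For an
  increment of norm \<open>a\<close> one has \<open>a \<le> \<delta> + a^4 / \<delta>^3\<close> and
  \<open>a^2 \<le> \<delta> + a^4 / \<delta>\<close>, and the sum of the fourth powers has
  expectation of order \<open>1 / 2^n\<close>.\<close>

definition Z :: "nat \<Rightarrow> real \<Rightarrow> nat \<Rightarrow> 'a \<Rightarrow> real" where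
  "Z TT \<delta> n \<omega> = Cm * (2 * \<delta> + 1 / 2 ^ n + (1 / \<delta>^3 + 1 / \<delta>) * (\<Sum>j<TT * 2 ^ n. (norm (dW n j \<omega>))^4))"

lemma Z_integrable: "integrable M (Z TT \<delta> n)"
  unfolding Z_def[abs_def]
  by (intro integrable_mult_right Bochner_Integration.integrable_add integrable_const Bochner_Integration.integrable_sum dW_norm4)

lemma Z_nonneg: "\<delta> > 0 \<Longrightarrow> 0 \<le> Z TT \<delta> n \<omega>"
  unfolding Z_def using Cm_nonneg by (intro mult_nonneg_nonneg add_nonneg_nonneg sum_nonneg) auto

lemma m_le_Z:
  assumes \<delta>: "\<delta> > 0" and k: "k < TT * 2 ^ n"
  shows "\<bar>m n k \<omega>\<bar> \<le> Z TT \<delta> n \<omega>"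
proof -
  define a where "a = norm (dW n k \<omega>)"
  have a0: "0 \<le> a" by (simp add: a_def)
  have s: "a^4 \<le> (\<Sum>j<TT * 2 ^ n. (norm (dW n j \<omega>))^4)" unfolding a_def using k by (intro member_le_sum) auto
  have 1: "a \<le> \<delta> + a^4 / \<delta>^3"
  proof (cases "a \<le> \<delta>")
    case False
    have "a * \<delta>^3 \<le> a * a^3" using False \<delta> a0 by (intro mult_left_mono power_mono) auto
    then have "a \<le> a^4 / \<delta>^3" using \<delta> by (simp add: pos_le_divide_eq power_eq_if)
    then show ?thesis using \<delta> by simp
  qed (use a0 \<delta> in \<open>simp add: add_increasing2\<close>)
  have 2: "a\<^sup>2 \<le> \<delta> + a^4 / \<delta>"
  proof (cases "a\<^sup>2 \<le> \<delta>")
    case False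
    have "a\<^sup>2 * \<delta> \<le> a\<^sup>2 * a\<^sup>2" using False by (intro mult_left_mono) auto
    then have "a\<^sup>2 \<le> a^4 / \<delta>" using \<delta> by (simp add: pos_le_divide_eq power_eq_if)
    then show ?thesis using \<delta> by simp
  qed (use a0 \<delta> in \<open>simp add: add_increasing2\<close>)
  have "a + a\<^sup>2 + 1 / 2 ^ n \<le> 2 * \<delta> + 1 / 2 ^ n + (1 / \<delta>^3 + 1 / \<delta>) * a^4" using 1 2 by (simp add: algebra_simps)
  also have "\<dots> \<le> 2 * \<delta> + 1 / 2 ^ n + (1 / \<delta>^3 + 1 / \<delta>) * (\<Sum>j<TT * 2 ^ n. (norm (dW n j \<omega>))^4)"
    using s \<delta> by (intro add_left_mono mult_left_mono) auto
  finally show ?thesis using m_bound[of n k \<omega>] Cm_nonneg unfolding Z_def a_def[symmetric]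
    by (meson mult_left_mono order_trans)
qed

lemma Z_expectation_small:
  assumes c: "c > 0"
  obtains \<delta> where "\<delta> > 0" "\<forall>\<^sub>F n in sequentially. expectation (Z TT \<delta> n) \<le> c"
proof -
  \<comment> \<open>The part of \<open>Z\<close> that does not vanish with growing \<open>n\<close>
    is \<open>2 * Cm * \<delta>\<close>, which this choice keeps below \<open>c / 2\<close>;
    \<open>Cm + 1\<close> avoids a zero divisor.\<close>
  define \<delta> where "\<delta> = c / (4 * (Cm + 1))"
  have \<delta>: "\<delta> > 0" using c Cm_nonneg by (simp add: \<delta>_def)
  have d2: "Cm * (2 * \<delta>) \<le> c / 2"
  proof -
    have "Cm * (2 * \<delta>) \<le> (Cm + 1) * (2 * \<delta>)" using \<delta> by (intro mult_right_mono) auto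
    also have "\<dots> = c / 2" using Cm_nonneg by (simp add: \<delta>_def field_simps)
    finally show ?thesis .
  qed
  define K where "K = Cm * (1 + (1 / \<delta>^3 + 1 / \<delta>) * (real TT * (3 * (real CARD('m))\<^sup>2)))"
  have b: "expectation (Z TT \<delta> n) \<le> c / 2 + K * (1 / 2 ^ n)" for n
  proof -
    have e: "expectation (Z TT \<delta> n) = Cm * (2 * \<delta> + 1 / 2 ^ n + (1 / \<delta>^3 + 1 / \<delta>) * (\<Sum>j<TT * 2 ^ n. expectation (\<lambda>\<omega>. (norm (dW n j \<omega>))^4)))"
    proof -
      let ?s = "\<lambda>\<omega>. \<Sum>j<TT * 2 ^ n. (norm (dW n j \<omega>))^4"
      have i: "integrable M ?s" by (intro Bochner_Integration.integrable_sum dW_norm4)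
      have "expectation (Z TT \<delta> n) = Cm * expectation (\<lambda>\<omega>. (2 * \<delta> + 1 / 2 ^ n) + (1 / \<delta>^3 + 1 / \<delta>) * ?s \<omega>)"
        unfolding Z_def[abs_def] by (rule integral_mult_right_zero)
      also have "expectation (\<lambda>\<omega>. (2 * \<delta> + 1 / 2 ^ n) + (1 / \<delta>^3 + 1 / \<delta>) * ?s \<omega>) = (2 * \<delta> + 1 / 2 ^ n) + (1 / \<delta>^3 + 1 / \<delta>) * expectation ?s"
        by (subst Bochner_Integration.integral_add) (auto simp: prob_space intro!: integrable_mult_right i)
      also have "expectation ?s = (\<Sum>j<TT * 2 ^ n. expectation (\<lambda>\<omega>. (norm (dW n j \<omega>))^4))"
        by (rule Bochner_Integration.integral_sum) (rule dW_norm4)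
      finally show ?thesis .
    qed
    have "(\<Sum>j<TT * 2 ^ n. expectation (\<lambda>\<omega>. (norm (dW n j \<omega>))^4)) \<le> (\<Sum>j<TT * 2 ^ n. 3 * (real CARD('m))\<^sup>2 * (1 / 2 ^ n)\<^sup>2)"
      by (intro sum_mono dW_norm4)
    also have "\<dots> = real TT * (3 * (real CARD('m))\<^sup>2) * (1 / 2 ^ n)" by (simp add: power2_eq_square field_simps)
    finally have s: "(\<Sum>j<TT * 2 ^ n. expectation (\<lambda>\<omega>. (norm (dW n j \<omega>))^4)) \<le> real TT * (3 * (real CARD('m))\<^sup>2) * (1 / 2 ^ n)" .
    have "expectation (Z TT \<delta> n) \<le> Cm * (2 * \<delta> + 1 / 2 ^ n + (1 / \<delta>^3 + 1 / \<delta>) * (real TT * (3 * (real CARD('m))\<^sup>2) * (1 / 2 ^ n)))"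
      unfolding e using s \<delta> Cm_nonneg by (intro mult_left_mono add_left_mono) auto
    also have "\<dots> = Cm * (2 * \<delta>) + K * (1 / 2 ^ n)" by (simp add: K_def algebra_simps add_divide_distrib)
    finally show ?thesis using d2 by linarith
  qed
  have "(\<lambda>n. K * (1 / 2 ^ n)) \<longlonglongrightarrow> K * 0"
    using LIMSEQ_power_zero[of "1/2::real"] by (intro tendsto_intros) (simp add: power_one_over)
  then have "\<forall>\<^sub>F n in sequentially. K * (1 / 2 ^ n) < c / 2" using c by (intro order_tendstoD) auto
  then have "\<forall>\<^sub>F n in sequentially. expectation (Z TT \<delta> n) \<le> c"
  proof eventually_elim
    case (elim n)
    then show ?case using b[of n] by linarith
  qed
  then show ?thesis using that \<delta> by blast
qed

lemma control_z_bound: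
  assumes c: "control TT n \<delta> \<omega>" and d: "\<delta> \<le> 1" and k: "k \<le> TT * 2 ^ n"
  shows "norm (z n k \<omega> - (yk n k \<omega> - vk n k \<omega>)) \<le> (\<Lambda> + \<Lambda>\<^sup>2 + 1) * \<delta>" "norm (z n k \<omega>) \<le> Rz"
proof -
  have w: "norm (w' n k \<omega>) \<le> \<delta>" by (rule control_w'[OF c k])
  have d0: "0 \<le> \<delta>" using w norm_ge_zero order_trans by blast
  have xd: "norm (vk n k \<omega> - xh n k \<omega>) \<le> \<delta>" using c k by (auto simp: control_def)
  have eq: "z n k \<omega> - (yk n k \<omega> - vk n k \<omega>) = \<sigma> (yk n k \<omega>) *v w' n k \<omega> + Q (yk n k \<omega>) (w' n k \<omega>) + (vk n k \<omega> - xh n k \<omega>)"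
    by (simp add: z_def Uhat_def)
  have 1: "norm (\<sigma> (yk n k \<omega>) *v w' n k \<omega>) \<le> \<Lambda> * \<delta>" using w \<Lambda> by (intro order_trans[OF sigma_mult_bound] mult_left_mono) auto
  have "(norm (w' n k \<omega>))\<^sup>2 \<le> \<delta>\<^sup>2" using w by (intro power_mono) auto
  also have "\<dots> \<le> \<delta>" using d d0 by (simp add: power2_eq_square mult_left_le)
  finally have 2: "norm (Q (yk n k \<omega>) (w' n k \<omega>)) \<le> \<Lambda>\<^sup>2 * \<delta>" by (intro order_trans[OF Q_bound] mult_left_mono) auto
  show r: "norm (z n k \<omega> - (yk n k \<omega> - vk n k \<omega>)) \<le> (\<Lambda> + \<Lambda>\<^sup>2 + 1) * \<delta>"
    unfolding eq distrib_right
    using norm_triangle_ineq[of "\<sigma> (yk n k \<omega>) *v w' n k \<omega> + Q (yk n k \<omega>) (w' n k \<omega>)" "vk n k \<omega> - xh n k \<omega>"]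
      norm_triangle_ineq[of "\<sigma> (yk n k \<omega>) *v w' n k \<omega>" "Q (yk n k \<omega>) (w' n k \<omega>)"] 1 2 xd by linarith
  have "(\<Lambda> + \<Lambda>\<^sup>2 + 1) * \<delta> \<le> (\<Lambda> + \<Lambda>\<^sup>2 + 1) * 1" using d \<Lambda> by (intro mult_left_mono) auto
  moreover have "norm (yk n k \<omega> - vk n k \<omega>) \<le> \<Lambda>" by (intro diam) auto
  ultimately show "norm (z n k \<omega>) \<le> Rz"
    using r norm_triangle_ineq[of "z n k \<omega> - (yk n k \<omega> - vk n k \<omega>)" "yk n k \<omega> - vk n k \<omega>"] by (simp add: Rz_def)
qed

text \<open>The first driving increment is 0 and both reflection terms vanish at time 0, so the
  comparison starts without any error that \<open>Err\<close> would have to carry.\<close>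

lemma control_z0:
  assumes c: "control TT n \<delta> \<omega>" shows "z n 0 \<omega> = 0"
proof -
  have op: "ode_path n \<omega>" and rp: "rpath (\<lambda>t. X t \<omega>) (\<lambda>t. L t \<omega>)" using c by (auto simp: control_def)
  have "rpath (\<lambda>t. Xn n t \<omega>) (\<lambda>t. Ln n t \<omega>)" using op by (simp only: ode_path_def)
  from rpath_l0[OF this] have l: "Ln n 0 \<omega> = 0" .
  have "Xn n 0 \<omega> = x0 + integral {0..0} (\<lambda>s. \<sigma> (Xn n s \<omega>) *v vector_derivative (\<lambda>r. interp_W W n r \<omega>) (at s))
       + integral {0..0} (\<lambda>s. b (Xn n s \<omega>)) + Ln n 0 \<omega>"
    using op unfolding ode_path_def by blast
  then have "Xn n 0 \<omega> = x0" using l by simp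
  then have "yk n 0 \<omega> = x0" using yk_eq[OF op, of 0] by simp
  then show ?thesis using rpath_l0[OF rp] by (simp add: z_def xh_def S_def Uhat_def Q_def w'_def)
qed

text \<open>On a controlled path the cutoff equals 1, so each summand of \<open>Err\<close> is the
  weight, at most 1, times the error of the step estimate. The variations over the steps
  telescope.\<close>

lemma control_Err:
  obtains G where "0 \<le> G" "\<And>TT n \<delta> \<omega>. control TT n \<delta> \<omega> \<Longrightarrow> \<delta> \<le> \<delta>0 \<Longrightarrow>
    Err n (TT * 2 ^ n) \<omega> \<le> G * (\<delta> * (2 * (\<Sum>k<TT * 2 ^ n. (norm (dW n k \<omega>))\<^sup>2) + real TT + tvn n (real TT) \<omega> + tvx (real TT) \<omega>))"
proof -
  obtain G where G: "0 \<le> G" "\<And>TT n \<delta> \<omega> k. control TT n \<delta> \<omega> \<Longrightarrow> \<delta> \<le> \<delta>0 \<Longrightarrow> k < TT * 2 ^ n \<Longrightarrow>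
    exp (- (2 * Cc\<^sup>2 * (norm (dl n k \<omega>) + norm (dm n k \<omega>)) + 4 * Cc\<^sup>2 * (1 / 2 ^ n))) * (norm (z n (Suc k) \<omega>))\<^sup>2
      - (norm (z n k \<omega>))\<^sup>2 - Mart n k \<omega> \<le> G * (\<delta> * en n k \<omega>)"
    by (rule step_estimate) blast
  have "Err n (TT * 2 ^ n) \<omega> \<le> G * (\<delta> * (2 * (\<Sum>k<TT * 2 ^ n. (norm (dW n k \<omega>))\<^sup>2) + real TT + tvn n (real TT) \<omega> + tvx (real TT) \<omega>))"
    if c: "control TT n \<delta> \<omega>" and d: "\<delta> \<le> \<delta>0" for TT n \<delta> \<omega>
  proof -
    have d1: "\<delta> \<le> 1" using d by (simp add: \<delta>0_def)
    have op: "ode_path n \<omega>" and rp: "rpath (\<lambda>t. X t \<omega>) (\<lambda>t. L t \<omega>)" and hd: "1 / 2 ^ n \<le> \<delta>" using c by (auto simp: control_def)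
    have rpn: "rpath (\<lambda>t. Xn n t \<omega>) (\<lambda>t. Ln n t \<omega>)" using op by (simp only: ode_path_def)
    have dp: "0 \<le> \<delta>" by (rule order_trans[OF _ hd]) simp
    have step: "max 0 (H n (Suc j) \<omega> - H n j \<omega> - m n j \<omega>) \<le> G * (\<delta> * en n j \<omega>)" if j: "j < TT * 2 ^ n" for j
    proof -
      have tj: "0 \<le> real j / 2 ^ n" "real j / 2 ^ n \<le> real (Suc j) / 2 ^ n" by (auto simp: divide_right_mono)
      have ln0: "0 \<le> vln n j \<omega>" "0 \<le> vlm n j \<omega>"
        using rpath_V[OF rpn tj] rpath_V[OF rp tj] norm_ge_zero order_trans by blast+
      have e0: "0 \<le> en n j \<omega>" using ln0 by (intro add_nonneg_nonneg) auto
      have rhs: "0 \<le> G * (\<delta> * en n j \<omega>)" using G(1) dp e0 by simp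
      have "norm (w' n j \<omega>) \<le> 1" using control_w'[OF c, of j] j d1 by simp
      moreover have "norm (z n j \<omega>) \<le> Rz" using j by (intro control_z_bound(2)[OF c d1]) simp
      ultimately have i1: "ind n j \<omega> = 1" by (simp add: ind_def)
      have wS: "wt n (Suc j) \<omega> = wt n j \<omega> * exp (- (2 * Cc\<^sup>2 * (norm (dl n j \<omega>) + norm (dm n j \<omega>)) + 4 * Cc\<^sup>2 * (1 / 2 ^ n)))"
        unfolding wt_def exp_add[symmetric] grid_Suc[symmetric] by (simp add: algebra_simps)
      have "H n (Suc j) \<omega> - H n j \<omega> - m n j \<omega> = wt n j \<omega> *
        (exp (- (2 * Cc\<^sup>2 * (norm (dl n j \<omega>) + norm (dm n j \<omega>)) + 4 * Cc\<^sup>2 * (1 / 2 ^ n))) * (norm (z n (Suc j) \<omega>))\<^sup>2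
      - (norm (z n j \<omega>))\<^sup>2 - Mart n j \<omega>)"
        unfolding H_def m_def wS i1 by (simp only: algebra_simps mult_1_right)
      also have "\<dots> \<le> wt n j \<omega> * (G * (\<delta> * en n j \<omega>))"
        using wt_bounds(1)[of n j \<omega>] by (intro mult_left_mono G(2)[OF c d j]) auto
      also have "\<dots> \<le> 1 * (G * (\<delta> * en n j \<omega>))" using wt_bounds(2)[of n j \<omega>] rhs by (intro mult_right_mono) auto
      finally show ?thesis using rhs by simp
    qed
    have H0: "H n 0 \<omega> = 0" by (simp add: H_def control_z0[OF c])
    have "Err n (TT * 2 ^ n) \<omega> \<le> (\<Sum>j<TT * 2 ^ n. G * (\<delta> * en n j \<omega>))"
      unfolding Err_def H0 using step by (auto intro!: sum_mono)
    also have "\<dots> = G * (\<delta> * (\<Sum>j<TT * 2 ^ n. en n j \<omega>))" by (simp only: sum_distrib_left)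
    also have "(\<Sum>j<TT * 2 ^ n. en n j \<omega>) = (\<Sum>j<TT * 2 ^ n. (norm (w' n j \<omega>))\<^sup>2) + (\<Sum>j<TT * 2 ^ n. (norm (dW n j \<omega>))\<^sup>2) + real TT
        + (\<Sum>j<TT * 2 ^ n. vln n j \<omega>) + (\<Sum>j<TT * 2 ^ n. vlm n j \<omega>)"
      by (simp only: sum.distrib) simp
    also have "(\<Sum>j<TT * 2 ^ n. vln n j \<omega>) = tvn n (real TT) \<omega>"
      unfolding sum_lessThan_telescope[of "\<lambda>k. tvn n (real k / 2 ^ n) \<omega>"] using rpath_tv0[OF rpn] by simp
    also have "(\<Sum>j<TT * 2 ^ n. vlm n j \<omega>) = tvx (real TT) \<omega>"
      unfolding sum_lessThan_telescope[of "\<lambda>k. tvx (real k / 2 ^ n) \<omega>"] using rpath_tv0[OF rp] by simp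
    also have "G * (\<delta> * ((\<Sum>j<TT * 2 ^ n. (norm (w' n j \<omega>))\<^sup>2) + (\<Sum>j<TT * 2 ^ n. (norm (dW n j \<omega>))\<^sup>2) + real TT + tvn n (real TT) \<omega> + tvx (real TT) \<omega>))
      \<le> G * (\<delta> * (2 * (\<Sum>k<TT * 2 ^ n. (norm (dW n k \<omega>))\<^sup>2) + real TT + tvn n (real TT) \<omega> + tvx (real TT) \<omega>))"
      using sum_w'_le[of n \<omega> "TT * 2 ^ n"] G(1) dp by (intro mult_left_mono) auto
    finally show ?thesis .
  qed
  then show ?thesis using that[OF G(1)] by blast
qed

lemma whp_Err:
  assumes TT: "TT \<ge> 1" and e: "e > 0"
  shows "whp (\<lambda>n \<omega>. Err n (TT * 2 ^ n) \<omega> \<le> e)"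
proof (rule whp_if_bounded[OF bounded_whp_quadratic_variation[of TT]], rule whp_if_bounded[OF bounded_whp_tvn[OF TT]], rule whp_if_bounded[OF bounded_whp_tvx[of TT]])
  fix R1 R2 R3 :: real
  obtain G where G: "0 \<le> G" "\<And>TT n \<delta> \<omega>. control TT n \<delta> \<omega> \<Longrightarrow> \<delta> \<le> \<delta>0 \<Longrightarrow>
    Err n (TT * 2 ^ n) \<omega> \<le> G * (\<delta> * (2 * (\<Sum>k<TT * 2 ^ n. (norm (dW n k \<omega>))\<^sup>2) + real TT + tvn n (real TT) \<omega> + tvx (real TT) \<omega>))"
    by (rule control_Err) blast
  define K where "K = G * (2 * \<bar>R1\<bar> + real TT + \<bar>R2\<bar> + \<bar>R3\<bar>) + 1"
  have K: "K > 0" using G(1) by (simp add: K_def add_nonneg_pos)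
  \<comment> \<open>\<open>\<delta>\<close> may depend on \<open>R1\<close>, \<open>R2\<close> and
    \<open>R3\<close>; this is why the localization precedes its choice.\<close>
  define \<delta> where "\<delta> = min \<delta>0 (e / K)"
  have \<delta>: "\<delta> > 0" "\<delta> \<le> \<delta>0" "\<delta> * K \<le> e" using \<delta>0_pos e K by (auto simp: \<delta>_def min_def field_simps)
  show "whp (\<lambda>n \<omega>. tvx (real TT) \<omega> \<le> R3 \<longrightarrow> tvn n (real TT) \<omega> \<le> R2 \<longrightarrow> (\<Sum>k<TT * 2 ^ n. (norm (dW n k \<omega>))\<^sup>2) \<le> R1 \<longrightarrow> Err n (TT * 2 ^ n) \<omega> \<le> e)"
  proof (rule whp_mono[OF whp_control[OF \<delta>(1), of TT]], intro impI)
    fix n \<omega> assume c: "control TT n \<delta> \<omega>"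
      and b: "tvx (real TT) \<omega> \<le> R3" "tvn n (real TT) \<omega> \<le> R2" "(\<Sum>k<TT * 2 ^ n. (norm (dW n k \<omega>))\<^sup>2) \<le> R1"
    have "Err n (TT * 2 ^ n) \<omega> \<le> G * (\<delta> * (2 * (\<Sum>k<TT * 2 ^ n. (norm (dW n k \<omega>))\<^sup>2) + real TT + tvn n (real TT) \<omega> + tvx (real TT) \<omega>))"
      by (rule G(2)[OF c \<delta>(2)])
    also have "\<dots> \<le> G * (\<delta> * (2 * \<bar>R1\<bar> + real TT + \<bar>R2\<bar> + \<bar>R3\<bar>))"
      using b G(1) \<delta>(1) by (intro mult_left_mono) auto
    also have "\<dots> \<le> \<delta> * K" using \<delta>(1) by (simp add: K_def algebra_simps)
    finally show "Err n (TT * 2 ^ n) \<omega> \<le> e" using \<delta>(3) by linarith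
  qed
qed

lemma whp_H:
  assumes TT: "TT \<ge> 1" and \<eta>: "\<eta> > 0"
  shows "whp (\<lambda>n \<omega>. \<forall>k\<le>TT * 2 ^ n. H n k \<omega> < \<eta>)"
  unfolding whp_def
proof (intro allI impI)
  fix \<epsilon> :: real assume eps: "\<epsilon> > 0"
  \<comment> \<open>The first bound leaves \<open>\<eta> / 2\<close> as the level for the
    martingale. By the second, and the same bound for the mean of \<open>Z\<close>, the stopping
    estimate yields probability at most \<open>\<epsilon> / 4\<close>.\<close>
  define e where "e = min (\<eta> / 2) (\<epsilon> * \<eta> / 16)"
  have e: "e > 0" "e \<le> \<eta> / 2" "e \<le> \<epsilon> * \<eta> / 16" using \<eta> eps by (auto simp: e_def)
  have "\<epsilon> * \<eta> / 16 > 0" using \<eta> eps by simp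
  then obtain \<delta> where \<delta>: "\<delta> > 0" "\<forall>\<^sub>F n in sequentially. expectation (Z TT \<delta> n) \<le> \<epsilon> * \<eta> / 16"
    by (rule Z_expectation_small)
  have "\<forall>\<^sub>F n in sequentially. \<exists>A\<in>events. prob A \<le> \<epsilon> / 2 \<and> (\<forall>\<omega>\<in>space M - A. Err n (TT * 2 ^ n) \<omega> \<le> e)"
    using eps by (intro whpD[OF whp_Err[OF TT e(1)]]) simp
  with \<delta>(2) show "\<forall>\<^sub>F n in sequentially. \<exists>A\<in>events. prob A \<le> \<epsilon> \<and> (\<forall>\<omega>\<in>space M - A. \<forall>k\<le>TT * 2 ^ n. H n k \<omega> < \<eta>)"
  proof eventually_elim
    case (elim n)
    then obtain A where A: "A \<in> events" "prob A \<le> \<epsilon> / 2" "\<forall>\<omega>\<in>space M - A. Err n (TT * 2 ^ n) \<omega> \<le> e" by blast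
    have "\<exists>A\<in>events. prob A \<le> (e + expectation (Z TT \<delta> n)) / (\<eta> / 2) \<and>
      (\<forall>\<omega>\<in>space M - A. Err n (TT * 2 ^ n) \<omega> \<le> e \<longrightarrow> (\<forall>k\<le>TT * 2 ^ n. H n k \<omega> < \<eta> / 2 + e))"
    proof (rule stopped_domination[OF Err_measurable_F m_measurable_F m_integrable m_mean_zero(2) Z_integrable Z_nonneg m_le_Z])
      show "Err n i \<omega> \<le> Err n j \<omega>" if "i \<le> j" for i j \<omega>
        unfolding Err_def using that by (intro add_left_mono sum_mono2) auto
      show "0 \<le> H n k \<omega>" for k \<omega> using wt_bounds(1)[of n k \<omega>] by (simp add: H_def)
    qed (use H_le_Err e \<eta> \<delta> in auto)
    then obtain A' where A': "A' \<in> events" "prob A' \<le> (e + expectation (Z TT \<delta> n)) / (\<eta> / 2)"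
      "\<forall>\<omega>\<in>space M - A'. Err n (TT * 2 ^ n) \<omega> \<le> e \<longrightarrow> (\<forall>k\<le>TT * 2 ^ n. H n k \<omega> < \<eta> / 2 + e)" by blast
    have "(e + expectation (Z TT \<delta> n)) / (\<eta> / 2) \<le> (\<epsilon> * \<eta> / 16 + \<epsilon> * \<eta> / 16) / (\<eta> / 2)"
      using e(3) elim(1) \<eta> by (intro divide_right_mono add_mono) auto
    also have "\<dots> = \<epsilon> / 4" using \<eta> by (simp add: field_simps)
    finally have "prob A' \<le> \<epsilon> / 2" using A'(2) eps by linarith
    then have "prob (A \<union> A') \<le> \<epsilon>" using measure_Un_le[of A M A'] A A' by simp
    moreover have "\<forall>k\<le>TT * 2 ^ n. H n k \<omega> < \<eta>" if "\<omega> \<in> space M - (A \<union> A')" for \<omega>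
    proof (intro allI impI)
      fix k assume k: "k \<le> TT * 2 ^ n"
      have "Err n (TT * 2 ^ n) \<omega> \<le> e" using A(3) that by blast
      then have "H n k \<omega> < \<eta> / 2 + e" using A'(3) that k by blast
      then show "H n k \<omega> < \<eta>" using e(2) by linarith
    qed
    ultimately show ?case using A(1) A'(1) by (intro bexI[of _ "A \<union> A'"]) auto
  qed
qed

text \<open>Where both variations are bounded the weight is bounded below, so small \<open>H\<close>
  means small \<open>z\<close> at all grid times. The passage to all times uses the oscillation
  within an interval, for X^n from its equation and for X from continuity.\<close>

lemma whp_sup_close:
  assumes TT: "TT \<ge> 1" and \<eta>: "\<eta> > 0"
  shows "whp (\<lambda>n \<omega>. \<forall>t. 0 \<le> t \<longrightarrow> t \<le> real TT \<longrightarrow> norm (Xn n t \<omega> - X t \<omega>) \<le> \<eta>)"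
proof (rule whp_if_bounded[OF bounded_whp_tvn[OF TT]], rule whp_if_bounded[OF bounded_whp_tvx[of TT]])
  fix R1 R2 :: real
  \<comment> \<open>The reciprocal of a lower bound for \<open>wt\<close>; \<open>\<eta>1\<close> is
    then the level of \<open>H\<close> that forces \<open>norm z\<close> below
    \<open>\<eta> / 4\<close>. A second quarter of \<open>\<eta>\<close> covers the gap between
    \<open>z\<close> and \<open>y - v\<close>, the other two the oscillations inside an
    interval.\<close>
  define K where "K = exp (2 * Cc\<^sup>2 * (R1 + R2) + 4 * Cc\<^sup>2 * real TT)"
  have K: "K > 0" by (simp add: K_def)
  define \<eta>1 where "\<eta>1 = (\<eta> / 4)\<^sup>2 / K"
  have \<eta>1: "\<eta>1 > 0" using \<eta> K by (simp add: \<eta>1_def)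
  define q where "q = \<Lambda> + \<Lambda>\<^sup>2 + 1 + 2 * C2 * \<Lambda>"
  have q: "q \<ge> 1" "\<Lambda> + \<Lambda>\<^sup>2 + 1 \<le> q" "2 * C2 * \<Lambda> \<le> q" using \<Lambda> consts_nonneg by (auto simp: q_def)
  define \<delta> where "\<delta> = min \<delta>0 (\<eta> / (4 * q))"
  have \<delta>: "\<delta> > 0" "\<delta> \<le> \<delta>0" "q * \<delta> \<le> \<eta> / 4" using \<delta>0_pos \<eta> q by (auto simp: \<delta>_def min_def field_simps)
  have \<delta>1: "\<delta> \<le> 1" using \<delta>(2) by (simp add: \<delta>0_def)
  have "whp (\<lambda>n \<omega>. control TT n \<delta> \<omega> \<and> (\<forall>k\<le>TT * 2 ^ n. H n k \<omega> < \<eta>1))"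
    by (intro whp_conj whp_control[OF \<delta>(1)] whp_H[OF TT \<eta>1])
  then show "whp (\<lambda>n \<omega>. tvx (real TT) \<omega> \<le> R2 \<longrightarrow> tvn n (real TT) \<omega> \<le> R1 \<longrightarrow>
      (\<forall>t. 0 \<le> t \<longrightarrow> t \<le> real TT \<longrightarrow> norm (Xn n t \<omega> - X t \<omega>) \<le> \<eta>))"
  proof (rule whp_mono, elim conjE, intro impI allI)
    fix n \<omega> t
    assume c: "control TT n \<delta> \<omega>" and Hk: "\<forall>k\<le>TT * 2 ^ n. H n k \<omega> < \<eta>1"
      and R: "tvx (real TT) \<omega> \<le> R2" "tvn n (real TT) \<omega> \<le> R1" and t: "0 \<le> t" "t \<le> real TT"
    have op: "ode_path n \<omega>" and rp: "rpath (\<lambda>t. X t \<omega>) (\<lambda>t. L t \<omega>)" and hd: "1 / 2 ^ n \<le> \<delta>"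
      and oscX: "\<And>s t. 0 \<le> s \<Longrightarrow> s \<le> real TT \<Longrightarrow> 0 \<le> t \<Longrightarrow> t \<le> real TT \<Longrightarrow> \<bar>s - t\<bar> \<le> 1 / 2^n \<Longrightarrow> norm (X s \<omega> - X t \<omega>) \<le> \<delta>"
      using c by (auto simp: control_def)
    have rpn: "rpath (\<lambda>t. Xn n t \<omega>) (\<lambda>t. Ln n t \<omega>)" using op by (simp only: ode_path_def)
    have grid: "norm (yk n k \<omega> - vk n k \<omega>) \<le> \<eta> / 2" if k: "k \<le> TT * 2 ^ n" for k
    proof -
      have tk: "0 \<le> real k / 2 ^ n" "real k / 2 ^ n \<le> real TT" using grid_le[OF k] by auto
      have "(\<Sum>j<k. norm (dl n j \<omega>) + norm (dm n j \<omega>)) \<le> (\<Sum>j<k. vln n j \<omega> + vlm n j \<omega>)"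
        by (intro sum_mono add_mono rpath_V[OF rpn] rpath_V[OF rp]) (auto simp: divide_right_mono)
      also have "\<dots> = tvn n (real k / 2 ^ n) \<omega> + tvx (real k / 2 ^ n) \<omega>"
        unfolding sum.distrib sum_lessThan_telescope[of "\<lambda>k. tvn n (real k / 2 ^ n) \<omega>"] sum_lessThan_telescope[of "\<lambda>k. tvx (real k / 2 ^ n) \<omega>"]
        using rpath_tv0[OF rp] rpath_tv0[OF rpn] by simp
      also have "\<dots> \<le> R1 + R2"
      proof -
        have "0 \<le> tvn n (real TT) \<omega> - tvn n (real k / 2 ^ n) \<omega>" "0 \<le> tvx (real TT) \<omega> - tvx (real k / 2 ^ n) \<omega>"
          using rpath_V[OF rpn tk] rpath_V[OF rp tk] norm_ge_zero order_trans by blast+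
        then show ?thesis using R by linarith
      qed
      finally have s: "(\<Sum>j<k. norm (dl n j \<omega>) + norm (dm n j \<omega>)) \<le> R1 + R2" .
      have "2 * Cc\<^sup>2 * (\<Sum>j<k. norm (dl n j \<omega>) + norm (dm n j \<omega>)) + 4 * Cc\<^sup>2 * (real k / 2 ^ n) \<le> 2 * Cc\<^sup>2 * (R1 + R2) + 4 * Cc\<^sup>2 * real TT"
        using s tk by (intro add_mono mult_left_mono) auto
      then have "inverse K \<le> wt n k \<omega>" unfolding wt_def K_def exp_minus[symmetric] by (simp only: exp_le_cancel_iff neg_le_iff_le)
      then have "1 / K \<le> wt n k \<omega>" by (simp only: inverse_eq_divide)
      then have "1 / K * (norm (z n k \<omega>))\<^sup>2 \<le> H n k \<omega>" unfolding H_def by (intro mult_right_mono) auto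
      also have "\<dots> < \<eta>1" using Hk k by blast
      finally have "(norm (z n k \<omega>))\<^sup>2 < (\<eta> / 4)\<^sup>2" using K by (simp add: \<eta>1_def divide_less_cancel)
      then have "norm (z n k \<omega>) < \<eta> / 4" by (rule power_less_imp_less_base) (use \<eta> in simp)
      moreover have "norm (z n k \<omega> - (yk n k \<omega> - vk n k \<omega>)) \<le> (\<Lambda> + \<Lambda>\<^sup>2 + 1) * \<delta>" by (rule control_z_bound(1)[OF c \<delta>1 k])
      moreover have "(\<Lambda> + \<Lambda>\<^sup>2 + 1) * \<delta> \<le> q * \<delta>" using q(2) \<delta>(1) by (intro mult_right_mono) auto
      ultimately show ?thesis
        using norm_triangle_ineq4[of "z n k \<omega>" "z n k \<omega> - (yk n k \<omega> - vk n k \<omega>)"] \<delta>(3) by simp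
    qed
    show "norm (Xn n t \<omega> - X t \<omega>) \<le> \<eta>"
    proof (cases "t = real TT")
      case True
      have "norm (yk n (TT * 2 ^ n) \<omega> - vk n (TT * 2 ^ n) \<omega>) \<le> \<eta> / 2" by (rule grid) simp
      moreover have "real (TT * 2 ^ n) / 2 ^ n = real TT" by simp
      ultimately show ?thesis using \<eta> unfolding True yk_eq[OF op] vk_eq[OF rp] by (simp del: of_nat_mult)
    next
      case False
      define k where "k = nat \<lfloor>t * 2 ^ n\<rfloor>"
      have k1: "real k \<le> t * 2 ^ n" "t * 2 ^ n < real k + 1" using t by (auto simp: k_def)
      have tk: "real k / 2 ^ n \<le> t" "t \<le> real (Suc k) / 2 ^ n" using k1 by (auto simp: field_simps)
      have "t * 2 ^ n < real TT * 2 ^ n" using False t by simp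
      then have "real k < real (TT * 2 ^ n)" using k1(1) unfolding of_nat_mult of_nat_power of_nat_numeral by linarith
      then have kN: "k < TT * 2 ^ n" by (simp only: of_nat_less_iff)
      have k0: "0 \<le> real k / 2 ^ n" "real k / 2 ^ n \<le> real TT" using kN by (auto intro!: grid_le simp: less_imp_le)
      have 1: "norm (Xn n t \<omega> - yk n k \<omega>) \<le> q * \<delta>"
      proof -
        have "norm (Xn n t \<omega> - yk n k \<omega>) \<le> C2 * (\<Lambda> * kp n k \<omega>)" unfolding yk_eq[OF op] by (rule ode_osc[OF op tk])
        also have "\<dots> \<le> C2 * (\<Lambda> * (\<delta> + \<delta>))"
          using consts_nonneg \<Lambda> control_w'[OF c, of k] kN hd by (intro mult_left_mono add_mono) auto
        also have "\<dots> = 2 * C2 * \<Lambda> * \<delta>" by simp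
        also have "\<dots> \<le> q * \<delta>" using q(3) \<delta>(1) by (intro mult_right_mono) auto
        finally show ?thesis .
      qed
      have 2: "norm (vk n k \<omega> - X t \<omega>) \<le> q * \<delta>"
      proof -
        have "t - real k / 2 ^ n \<le> 1 / 2 ^ n" using tk grid_step(3)[of k n] by linarith
        then have "norm (vk n k \<omega> - X t \<omega>) \<le> \<delta>" unfolding vk_eq[OF rp] using t k0 tk by (intro oscX; linarith)
        moreover have "1 * \<delta> \<le> q * \<delta>" using q(1) \<delta>(1) by (intro mult_right_mono) auto
        ultimately show ?thesis by simp
      qed
      have 3: "norm (yk n k \<omega> - vk n k \<omega>) \<le> \<eta> / 2" using kN by (intro grid) simp
      have "Xn n t \<omega> - X t \<omega> = (Xn n t \<omega> - yk n k \<omega>) + ((yk n k \<omega> - vk n k \<omega>) + (vk n k \<omega> - X t \<omega>))" by simp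
      then have "norm (Xn n t \<omega> - X t \<omega>) \<le> norm (Xn n t \<omega> - yk n k \<omega>) + (norm (yk n k \<omega> - vk n k \<omega>) + norm (vk n k \<omega> - X t \<omega>))"
        by (metis norm_triangle_le add_left_mono norm_triangle_ineq)
      then show ?thesis using 1 2 3 \<delta>(3) by linarith
    qed
  qed
qed

text \<open>Both paths stay in the closure of \<open>D\<close>, so the supremum is bounded by the
  diameter and closeness with high probability suffices. \<open>T\<close> is rounded up to an
  integer, at which every dyadic grid has a point.\<close>

theorem strong_convergence:
  assumes p: "p > 0" and T: "T > 0"
  shows "(\<lambda>n. \<integral>\<^sup>+ \<omega>. ennreal ((SUP t\<in>{0..T}. norm (Xn n t \<omega> - X t \<omega>)) powr p) \<partial>M) \<longlonglongrightarrow> 0"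
proof (rule expectation_tends_to_zero_if_whp[OF _ _ p, where B = \<Lambda>])
  define TT where "TT = nat \<lceil>T\<rceil>"
  have TT: "TT \<ge> 1" "T \<le> real TT" using T by (auto simp: TT_def Suc_leI)
  have ne: "{0..T} \<noteq> {}" using T by simp
  fix \<eta> :: real assume \<eta>: "\<eta> > 0"
  show "whp (\<lambda>n \<omega>. (SUP t\<in>{0..T}. norm (Xn n t \<omega> - X t \<omega>)) \<le> \<eta>)"
  proof (rule whp_mono[OF whp_sup_close[OF TT(1) \<eta>]])
    fix n \<omega> assume A: "\<forall>t. 0 \<le> t \<longrightarrow> t \<le> real TT \<longrightarrow> norm (Xn n t \<omega> - X t \<omega>) \<le> \<eta>"
    show "(SUP t\<in>{0..T}. norm (Xn n t \<omega> - X t \<omega>)) \<le> \<eta>"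
      by (rule cSUP_least[OF ne]) (use A TT in auto)
  qed
next
  have ne: "{0..T} \<noteq> {}" using T by simp
  fix n
  show "AE \<omega> in M. 0 \<le> (SUP t\<in>{0..T}. norm (Xn n t \<omega> - X t \<omega>)) \<and> (SUP t\<in>{0..T}. norm (Xn n t \<omega> - X t \<omega>)) \<le> \<Lambda>"
    using AE_ode_path[of n] AE_rpath
  proof eventually_elim
    case (elim \<omega>)
    then have rpn: "rpath (\<lambda>t. Xn n t \<omega>) (\<lambda>t. Ln n t \<omega>)" by (simp only: ode_path_def)
    have d: "norm (Xn n t \<omega> - X t \<omega>) \<le> \<Lambda>" if "t \<in> {0..T}" for t
      using rpn elim(2) that by (intro diam) (auto simp: rpath_def)
    have "bdd_above ((\<lambda>t. norm (Xn n t \<omega> - X t \<omega>)) ` {0..T})" by (intro bdd_aboveI2[of _ _ \<Lambda>] d)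
    then have "0 \<le> (SUP t\<in>{0..T}. norm (Xn n t \<omega> - X t \<omega>))"
      by (rule cSUP_upper2[of _ _ 0]) (use T in auto)
    moreover have "(SUP t\<in>{0..T}. norm (Xn n t \<omega> - X t \<omega>)) \<le> \<Lambda>" by (rule cSUP_least[OF ne d])
    ultimately show ?case by blast
  qed
qed

end

section \<open>Constants for the given coefficients\<close>

lemma compact_norm_bound:
  fixes f :: "'a::topological_space \<Rightarrow> 'b::real_normed_vector"
  assumes "compact S" "continuous_on S f"
  obtains C where "0 \<le> C" "\<And>x. x \<in> S \<Longrightarrow> norm (f x) \<le> C"
proof -
  have "bounded (f ` S)" using assms by (intro compact_imp_bounded compact_continuous_image)
  then obtain C where "\<forall>x\<in>S. norm (f x) \<le> C" by (auto simp: bounded_iff)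
  then show ?thesis using that[of "max 0 C"] by fastforce
qed

text \<open>\<open>\<phi>\<close> and its gradient live on the whole space, so their Lipschitz
  constants come from the mean value inequality on a ball containing the closure of
  \<open>D\<close>, which is convex. \<open>\<sigma>\<close> is differentiable only relative to the
  closure; its Lipschitz property is deduced from Taylor's formula along chains.\<close>

lemma coefficients_exist:
  fixes D :: "(real^'d) set" and \<sigma> :: "real^'d \<Rightarrow> real^'m^'d"
  assumes domain: "open D" "bounded D"
    and nu_dirs: "\<forall>x\<in>frontier D. \<nu> x \<noteq> {} \<and> (\<forall>v\<in>\<nu> x. norm v = 1)"
    and D1: "\<exists>C0\<ge>0. \<forall>x'\<in>D. \<forall>x\<in>frontier D. \<forall>v\<in>\<nu> x. (x' - x) \<bullet> v + C0 * (norm (x - x'))^2 \<ge> 0"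
    and D2: "\<exists>(\<phi>::real^'d \<Rightarrow> real) (g::real^'d \<Rightarrow> real^'d) (H::real^'d \<Rightarrow> real^'d^'d) \<alpha>.
               (\<forall>x. (\<phi> has_derivative (\<lambda>h. g x \<bullet> h)) (at x)) \<and>
               (\<forall>x. (g has_derivative (\<lambda>h. H x *v h)) (at x)) \<and> continuous_on UNIV H \<and>
               \<alpha> > 0 \<and> (\<forall>x\<in>frontier D. \<forall>v\<in>\<nu> x. g x \<bullet> v \<ge> \<alpha>)"
    and D3: "\<exists>N::nat. \<exists>lam>0. \<exists>K>0. \<exists>(a::nat \<Rightarrow> real^'d) (xs::nat \<Rightarrow> real^'d). N \<ge> 1 \<and>
               (\<forall>i<N. norm (a i) = 1 \<and> xs i \<in> frontier D) \<and>
               frontier D \<subseteq> (\<Union>i<N. ball (xs i) K) \<and>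
               (\<forall>i<N. \<forall>x\<in>frontier D \<inter> ball (xs i) (2 * K). \<forall>v\<in>\<nu> x. v \<bullet> a i \<ge> lam)"
    and sigma_C1: "\<forall>x\<in>closure D. (\<sigma> has_derivative \<sigma>' x) (at x within closure D)"
    and sigma'_lip: "\<exists>C. \<forall>x\<in>closure D. \<forall>y\<in>closure D. onorm (\<lambda>h. \<sigma>' x h - \<sigma>' y h) \<le> C * dist x y"
    and b_lip: "\<exists>C. C-lipschitz_on (closure D) b"
    and x0: "x0 \<in> closure D"
  obtains \<phi> g \<alpha> \<Lambda> where "coefficients D \<nu> \<phi> g \<alpha> \<Lambda> \<sigma> \<sigma>' b"
proof -
  have comp: "compact (closure D)" using domain by simp
  obtain R where R: "0 \<le> R" "closure D \<subseteq> cball 0 R"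
  proof -
    obtain R where "\<forall>x\<in>closure D. norm x \<le> R" using compact_imp_bounded[OF comp] by (auto simp: bounded_iff)
    then show ?thesis using that[of "max 0 R"] by fastforce
  qed
  have diam: "norm (x - y) \<le> 2 * R" if "x \<in> closure D" "y \<in> closure D" for x y
  proof -
    have "x \<in> cball 0 R" "y \<in> cball 0 R" using R(2) that by blast+
    then show ?thesis using norm_triangle_ineq4[of x y] by simp
  qed
  obtain C0 where C0: "0 \<le> C0" "\<forall>x'\<in>D. \<forall>x\<in>frontier D. \<forall>v\<in>\<nu> x. (x' - x) \<bullet> v + C0 * (norm (x - x'))^2 \<ge> 0"
    using D1 by blast
  \<comment> \<open>For fixed \<open>x\<close> and \<open>v\<close> the inequality is a closed
    condition on \<open>x'\<close>, so it extends from \<open>D\<close> to its closure.\<close>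
  have C0c: "(x - x') \<bullet> v \<le> C0 * (norm (x - x'))\<^sup>2" if "x' \<in> closure D" "x \<in> frontier D" "v \<in> \<nu> x" for x x' v
  proof -
    have "closed {x'. 0 \<le> (x' - x) \<bullet> v + C0 * (norm (x - x'))\<^sup>2}"
      by (intro closed_Collect_le continuous_intros)
    moreover have "D \<subseteq> {x'. 0 \<le> (x' - x) \<bullet> v + C0 * (norm (x - x'))\<^sup>2}" using C0(2) that by blast
    ultimately have "x' \<in> {x'. 0 \<le> (x' - x) \<bullet> v + C0 * (norm (x - x'))\<^sup>2}" using closure_minimal that(1) by blast
    then show ?thesis by (simp add: inner_diff_left)
  qed
  obtain \<phi> g H \<alpha> where phi: "\<And>x. (\<phi> has_derivative (\<lambda>h. g x \<bullet> h)) (at x)"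
    and g: "\<And>x. (g has_derivative (\<lambda>h. H x *v h)) (at x)" and H: "continuous_on UNIV H"
    and \<alpha>: "\<alpha> > 0" "\<And>x v. x \<in> frontier D \<Longrightarrow> v \<in> \<nu> x \<Longrightarrow> \<alpha> \<le> g x \<bullet> v"
    using D2 by blast
  have g_cont: "continuous_on UNIV g" by (rule has_derivative_continuous_on[where f' = "\<lambda>x h. H x *v h"]) (rule g)
  have phi_cont: "continuous_on UNIV \<phi>" by (rule has_derivative_continuous_on[where f' = "\<lambda>x h. g x \<bullet> h"]) (rule phi)
  obtain CH where CH: "0 \<le> CH" "\<And>x. x \<in> cball 0 R \<Longrightarrow> norm (H x) \<le> CH"
    by (rule compact_norm_bound[OF compact_cball continuous_on_subset[OF H subset_UNIV]]) blast
  obtain Cg where Cg: "0 \<le> Cg" "\<And>x. x \<in> cball 0 R \<Longrightarrow> norm (g x) \<le> Cg"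
    by (rule compact_norm_bound[OF compact_cball continuous_on_subset[OF g_cont subset_UNIV]]) blast
  obtain Cp where Cp: "0 \<le> Cp" "\<And>x. x \<in> cball 0 R \<Longrightarrow> norm (\<phi> x) \<le> Cp"
    by (rule compact_norm_bound[OF compact_cball continuous_on_subset[OF phi_cont subset_UNIV]]) blast
  have phi_lip: "norm (\<phi> x - \<phi> y) \<le> Cg * norm (x - y)" if "x \<in> closure D" "y \<in> closure D" for x y
  proof (rule differentiable_bound[of "cball 0 R" \<phi> "\<lambda>x h. g x \<bullet> h"])
    show "(\<phi> has_derivative (\<lambda>h. g x \<bullet> h)) (at x within cball 0 R)" for x
      by (rule has_derivative_at_withinI[OF phi])
    show "onorm (\<lambda>h. g x \<bullet> h) \<le> Cg" if "x \<in> cball 0 R" for x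
    proof (rule onorm_bound[OF Cg(1)])
      fix h
      show "norm (g x \<bullet> h) \<le> Cg * norm h"
        using Cauchy_Schwarz_ineq2[of "g x" h] mult_right_mono[OF Cg(2)[OF that], of "norm h"] by simp
    qed
  qed (use R(2) that in auto)
  have g_lip: "norm (g x - g y) \<le> CH * norm (x - y)" if "x \<in> closure D" "y \<in> closure D" for x y
  proof (rule differentiable_bound[of "cball 0 R" g "\<lambda>x h. H x *v h"])
    show "(g has_derivative (\<lambda>h. H x *v h)) (at x within cball 0 R)" for x
      by (rule has_derivative_at_withinI[OF g])
    show "onorm (\<lambda>h. H x *v h) \<le> CH" if "x \<in> cball 0 R" for x
    proof (rule onorm_bound[OF CH(1)])
      fix h
      show "norm (H x *v h) \<le> CH * norm h"
        using norm_matrix_vector_le[of "H x" h] mult_right_mono[OF CH(2)[OF that], of "norm h"] by simp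
    qed
  qed (use R(2) that in auto)
  obtain C1 where C1: "\<And>x y. x \<in> closure D \<Longrightarrow> y \<in> closure D \<Longrightarrow> onorm (\<lambda>h. \<sigma>' x h - \<sigma>' y h) \<le> C1 * dist x y"
    using sigma'_lip by blast
  define C' where "C' = max 0 C1"
  have C'0: "0 \<le> C'" by (simp add: C'_def)
  have C': "onorm (\<lambda>h. \<sigma>' x h - \<sigma>' y h) \<le> C' * dist x y" if "x \<in> closure D" "y \<in> closure D" for x y
    by (rule order_trans[OF C1[OF that] mult_right_mono]) (auto simp: C'_def)
  obtain E where E: "0 \<le> E" "\<And>x y. x \<in> closure D \<Longrightarrow> y \<in> closure D \<Longrightarrow> norm (\<sigma> y - \<sigma> x - \<sigma>' x (y - x)) \<le> E * (norm (y - x))\<^sup>2"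
  proof -
    obtain N lam K and a xs :: "nat \<Rightarrow> real^'d" where d3: "lam > 0" "K > 0" "\<forall>i<(N::nat). norm (a i) = 1 \<and> xs i \<in> frontier D"
      "frontier D \<subseteq> (\<Union>i<N. ball (xs i) K)"
      "\<forall>i<N. \<forall>x\<in>frontier D \<inter> ball (xs i) (2 * K). \<forall>v\<in>\<nu> x. v \<bullet> a i \<ge> lam"
      using D3 by (elim exE conjE, intro that) assumption+
    have d3': "\<forall>i<N. norm (a i) = 1" using d3(3) by blast
    obtain \<rho> C where ch: "\<rho> > 0" "C \<ge> 1" "\<And>y z. y \<in> D \<Longrightarrow> z \<in> D \<Longrightarrow> dist y z < \<rho> \<Longrightarrow>
       \<exists>y' z'. closed_segment y y' \<subseteq> D \<and> closed_segment y' z' \<subseteq> D \<and> closed_segment z' z \<subseteq> D \<and>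
             dist y y' \<le> C * dist y z \<and> dist y' z' \<le> C * dist y z \<and> dist z' z \<le> C * dist y z"
      by (rule short_chain_in_domain[OF domain(1) C0 nu_dirs d3(1,2) d3' d3(4,5)]) blast
    show ?thesis
      using C1_taylor_on_closure[OF domain ch sigma_C1 C'0 C'] that by blast
  qed
  have bl: "bounded_linear (\<sigma>' x)" if "x \<in> closure D" for x
    using sigma_C1 that has_derivative_bounded_linear by blast
  have s_lip': "norm (\<sigma>' x h - \<sigma>' y h) \<le> C' * norm (x - y) * norm h" if "x \<in> closure D" "y \<in> closure D" for x y h
  proof -
    have "norm (\<sigma>' x h - \<sigma>' y h) \<le> onorm (\<lambda>h. \<sigma>' x h - \<sigma>' y h) * norm h"
      using bl that by (intro onorm bounded_linear_sub) auto
    also have "\<dots> \<le> C' * dist x y * norm h" using C'[OF that] by (intro mult_right_mono) auto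
    finally show ?thesis by (simp add: dist_norm)
  qed
  \<comment> \<open>The operator norm at the one point \<open>x0\<close> plus the Lipschitz constant
    times the diameter bounds \<open>\<sigma>'\<close> throughout the closure.\<close>
  define S1 where "S1 = onorm (\<sigma>' x0) + C' * (2 * R)"
  have S1_0: "0 \<le> S1" using onorm_pos_le[OF bl[OF x0]] C'0 R(1) by (simp add: S1_def)
  have s_bound': "norm (\<sigma>' x h) \<le> S1 * norm h" if x: "x \<in> closure D" for x h
  proof -
    have "norm (\<sigma>' x h) \<le> norm (\<sigma>' x0 h) + norm (\<sigma>' x h - \<sigma>' x0 h)" using norm_triangle_sub by blast
    also have "\<dots> \<le> onorm (\<sigma>' x0) * norm h + C' * (2 * R) * norm h"
    proof (intro add_mono onorm[OF bl[OF x0]] order_trans[OF s_lip'[OF x x0]])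
      show "C' * norm (x - x0) * norm h \<le> C' * (2 * R) * norm h"
        using diam[OF x x0] C'0 by (intro mult_right_mono mult_left_mono) auto
    qed
    finally show ?thesis by (simp add: S1_def algebra_simps)
  qed
  have s_lip: "norm (\<sigma> x - \<sigma> y) \<le> (S1 + E * (2 * R)) * norm (x - y)" if "x \<in> closure D" "y \<in> closure D" for x y
  proof -
    have "norm (\<sigma> x - \<sigma> y) \<le> norm (\<sigma>' y (x - y)) + norm (\<sigma> x - \<sigma> y - \<sigma>' y (x - y))" by (rule norm_triangle_sub)
    also have "\<dots> \<le> S1 * norm (x - y) + E * (norm (x - y) * norm (x - y))"
      using s_bound'[OF that(2)] E(2)[OF that(2,1)] by (intro add_mono) (auto simp: power2_eq_square)
    also have "\<dots> \<le> S1 * norm (x - y) + E * (2 * R * norm (x - y))"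
      using diam[OF that] E(1) by (intro add_left_mono mult_left_mono mult_right_mono) auto
    finally show ?thesis by (simp add: algebra_simps)
  qed
  have "continuous_on (closure D) \<sigma>" using sigma_C1 by (intro has_derivative_continuous_on) blast
  then obtain S0 where S0: "0 \<le> S0" "\<And>x. x \<in> closure D \<Longrightarrow> norm (\<sigma> x) \<le> S0"
    by (rule compact_norm_bound[OF comp]) blast
  obtain Lb where Lb: "Lb-lipschitz_on (closure D) b" using b_lip by blast
  then obtain Cb where Cb: "0 \<le> Cb" "\<And>x. x \<in> closure D \<Longrightarrow> norm (b x) \<le> Cb"
    by (rule compact_norm_bound[OF comp lipschitz_on_continuous_on]) blast
  have Lb0: "0 \<le> Lb" by (rule lipschitz_on_nonneg[OF Lb])
  have Lb1: "norm (b x - b y) \<le> Lb * norm (x - y)" if "x \<in> closure D" "y \<in> closure D" for x y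
    using lipschitz_onD[OF Lb that] by (simp add: dist_norm)
  define \<Lambda> where "\<Lambda> = 1 + 2 * R + C0 + CH + Cg + Cp + C' + E + S1 + E * (2 * R) + S0 + Cb + Lb"
  have "0 \<le> E * (2 * R)" using E(1) R(1) by simp
  then have \<Lambda>: "1 \<le> \<Lambda>" "2 * R \<le> \<Lambda>" "C0 \<le> \<Lambda>" "CH \<le> \<Lambda>" "Cg \<le> \<Lambda>" "Cp \<le> \<Lambda>" "C' \<le> \<Lambda>" "E \<le> \<Lambda>" "S1 \<le> \<Lambda>"
    "S1 + E * (2 * R) \<le> \<Lambda>" "S0 \<le> \<Lambda>" "Cb \<le> \<Lambda>" "Lb \<le> \<Lambda>"
    using R(1) C0(1) CH(1) Cg(1) Cp(1) C'0 E(1) S1_0 S0(1) Cb(1) Lb0 unfolding \<Lambda>_def by linarith+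
  have up: "u \<le> \<Lambda> * v" if "u \<le> c * v" "c \<le> \<Lambda>" "0 \<le> v" for u c v :: real
    by (rule order_trans[OF that(1) mult_right_mono[OF that(2,3)]])
  have "coefficients D \<nu> \<phi> g \<alpha> \<Lambda> \<sigma> \<sigma>' b"
  proof (rule coefficients.intro)
    show "norm (\<sigma>' x h - \<sigma>' y h) \<le> \<Lambda> * norm (x - y) * norm h" if "x \<in> closure D" "y \<in> closure D" for x y h
      using up[OF _ \<Lambda>(7), of "norm (\<sigma>' x h - \<sigma>' y h)" "norm (x - y) * norm h"] s_lip'[OF that, of h] by (simp add: mult.assoc)
    show "\<bar>\<phi> x - \<phi> y\<bar> \<le> \<Lambda> * norm (x - y)" if "x \<in> closure D" "y \<in> closure D" for x y
      using up[OF phi_lip[OF that] \<Lambda>(5)] by simp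
    show "\<bar>\<phi> x\<bar> \<le> \<Lambda>" if "x \<in> closure D" for x using Cp(2)[of x] R(2) that \<Lambda>(6) by fastforce
    show "norm (g x) \<le> \<Lambda>" if "x \<in> closure D" for x using Cg(2)[of x] R(2) that \<Lambda>(5) by fastforce
    show "norm (x - y) \<le> \<Lambda>" if "x \<in> closure D" "y \<in> closure D" for x y using diam[OF that] \<Lambda>(2) by linarith
    show "norm (\<sigma> x) \<le> \<Lambda>" if "x \<in> closure D" for x using S0(2)[OF that] \<Lambda>(11) by linarith
    show "norm (b x) \<le> \<Lambda>" if "x \<in> closure D" for x using Cb(2)[OF that] \<Lambda>(12) by linarith
    show "linear (\<sigma>' x)" if "x \<in> closure D" for x using bl[OF that] by (rule bounded_linear.linear)
    show "(x - x') \<bullet> v \<le> \<Lambda> * (norm (x - x'))\<^sup>2" if "x' \<in> closure D" "x \<in> frontier D" "v \<in> \<nu> x" for x x' v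
      by (rule up[OF C0c[OF that] \<Lambda>(3)]) simp
    show "norm (g x - g y) \<le> \<Lambda> * norm (x - y)" if "x \<in> closure D" "y \<in> closure D" for x y
      by (rule up[OF g_lip[OF that] \<Lambda>(4)]) simp
    show "norm (\<sigma> x - \<sigma> y) \<le> \<Lambda> * norm (x - y)" if "x \<in> closure D" "y \<in> closure D" for x y
      by (rule up[OF s_lip[OF that] \<Lambda>(10)]) simp
    show "norm (\<sigma> y - \<sigma> x - \<sigma>' x (y - x)) \<le> \<Lambda> * (norm (y - x))\<^sup>2" if "x \<in> closure D" "y \<in> closure D" for x y
      by (rule up[OF E(2)[OF that] \<Lambda>(8)]) simp
    show "norm (\<sigma>' x h) \<le> \<Lambda> * norm h" if "x \<in> closure D" for x h
      by (rule up[OF s_bound'[OF that] \<Lambda>(9)]) simp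
    show "norm (b x - b y) \<le> \<Lambda> * norm (x - y)" if "x \<in> closure D" "y \<in> closure D" for x y
      by (rule up[OF Lb1[OF that] \<Lambda>(13)]) simp
  qed (fact \<Lambda>(1) \<alpha> nu_dirs phi g_cont)+
  then show ?thesis by (rule that)
qed

theorem theorem2p2:
  fixes D :: "(real^'d) set"
    and \<nu> :: "real^'d \<Rightarrow> (real^'d) set"
    and \<sigma> :: "real^'d \<Rightarrow> real^'m^'d"
    and \<sigma>' :: "real^'d \<Rightarrow> real^'d \<Rightarrow> real^'m^'d"
    and b :: "real^'d \<Rightarrow> real^'d"
    and M :: "'a measure" and F :: "real \<Rightarrow> 'a measure"
    and W :: "real \<Rightarrow> 'a \<Rightarrow> real^'m"
    and x0 :: "real^'d"
    and X L :: "real \<Rightarrow> 'a \<Rightarrow> real^'d"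
    and Xpn Lpn :: "nat \<Rightarrow> real \<Rightarrow> 'a \<Rightarrow> real^'d"
    and p T :: real
  assumes domain: "open D" "connected D" "D \<noteq> {}" "bounded D"
    and nu_dirs: "\<forall>x\<in>frontier D. \<nu> x \<noteq> {} \<and> (\<forall>v\<in>\<nu> x. norm v = 1)"
    and D1: "\<exists>C0\<ge>0. \<forall>x'\<in>D. \<forall>x\<in>frontier D. \<forall>v\<in>\<nu> x. (x' - x) \<bullet> v + C0 * (norm (x - x'))^2 \<ge> 0"
    and D2: "\<exists>(\<phi>::real^'d \<Rightarrow> real) (g::real^'d \<Rightarrow> real^'d) (H::real^'d \<Rightarrow> real^'d^'d) \<alpha>.
               (\<forall>x. (\<phi> has_derivative (\<lambda>h. g x \<bullet> h)) (at x)) \<and>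
               (\<forall>x. (g has_derivative (\<lambda>h. H x *v h)) (at x)) \<and> continuous_on UNIV H \<and>
               \<alpha> > 0 \<and> (\<forall>x\<in>frontier D. \<forall>v\<in>\<nu> x. g x \<bullet> v \<ge> \<alpha>)"
    and D3: "\<exists>N::nat. \<exists>lam>0. \<exists>K>0. \<exists>(a::nat \<Rightarrow> real^'d) (xs::nat \<Rightarrow> real^'d). N \<ge> 1 \<and>
               (\<forall>i<N. norm (a i) = 1 \<and> xs i \<in> frontier D) \<and>
               frontier D \<subseteq> (\<Union>i<N. ball (xs i) K) \<and>
               (\<forall>i<N. \<forall>x\<in>frontier D \<inter> ball (xs i) (2 * K). \<forall>v\<in>\<nu> x. v \<bullet> a i \<ge> lam)"
    and sigma_C1: "\<forall>x\<in>closure D. (\<sigma> has_derivative \<sigma>' x) (at x within closure D)"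
    and sigma'_lip: "\<exists>C. \<forall>x\<in>closure D. \<forall>y\<in>closure D. onorm (\<lambda>h. \<sigma>' x h - \<sigma>' y h) \<le> C * dist x y"
    and b_lip: "\<exists>C. C-lipschitz_on (closure D) b"
    and space: "complete_filtered_prob_space M F"
    and BM: "brownian_motion M F W"
    and x0: "x0 \<in> closure D"
    and sol: "reflected_sde_solution M F W D \<nu> \<sigma> \<sigma>' b x0 X L"
    and sol_n: "\<forall>n. reflected_ode_solution M F W n D \<nu> \<sigma> b x0 (Xpn n) (Lpn n)"
    and p: "p > 0" and T: "T > 0"
  shows "(\<lambda>n. \<integral>\<^sup>+ \<omega>. ennreal ((SUP t\<in>{0..T}. norm (Xpn n t \<omega> - X t \<omega>)) powr p) \<partial>M) \<longlonglongrightarrow> 0"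
proof -
  obtain \<phi> g \<alpha> \<Lambda> where "coefficients D \<nu> \<phi> g \<alpha> \<Lambda> \<sigma> \<sigma>' b"
    using coefficients_exist[OF domain(1,4) nu_dirs D1 D2 D3 sigma_C1 sigma'_lip b_lip x0] by blast
  then interpret coefficients D \<nu> \<phi> g \<alpha> \<Lambda> \<sigma> \<sigma>' b .
  interpret wong_zakai M F W D \<nu> \<phi> g \<alpha> \<Lambda> \<sigma> \<sigma>' b x0 X L Xpn Lpn
    by unfold_locales (use space BM x0 sol sol_n in auto)
  show ?thesis by (rule strong_convergence[OF p T])
qed

end
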